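(* Let $\mathcal{F}$ be either the pair $\{C_4^3, C_5^3\}$ or the single-member family $\{C_\ell^3\}$ for some integer $\ell\ge 7$ with $\ell\not\equiv 0 \pmod 3$. Then $\pi(\mathcal{F}) \le 2\sqrt{3}-3$.
   Context: A $3$-graph is a set of $3$-element subsets (edges) of a vertex set. For $\ell\ge 4$, the tight $\ell$-cycle $C_\ell^3$ is the $3$-graph on $\{1,\dots,\ell\}$ whose edges are the $\ell$ cyclically consecutive triples $\{1,2,3\},\{2,3,4\},\dots,\{\ell-2,\ell-1,\ell\},\{\ell-1,\ell,1\},\{\ell,1,2\}$. A $3$-graph is $\mathcal{F}$-free if it contains no member of $\mathcal{F}$ as a (not necessarily induced) subgraph. $\mathrm{ex}(n,\mathcal{F})$ is the maximum number of edges in an $\mathcal{F}$-free $3$-graph on $n$ vertices, and the Turán density is $\pi(\mathcal{F})=\lim_{n\to\infty}\mathrm{ex}(n,\mathcal{F})/\binom{n}{3}$ (this limit exists). *)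

theory Defs
  imports "HOL-Analysis.Analysis"
begin

type_synonym 'a hypergraph = "'a set \<times> 'a set set"

abbreviation verts :: "'a hypergraph \<Rightarrow> 'a set" where "verts \<equiv> fst"
abbreviation edges :: "'a hypergraph \<Rightarrow> 'a set set" where "edges \<equiv> snd"

definition three_graph :: "'a hypergraph \<Rightarrow> bool" where
  "three_graph G \<longleftrightarrow> finite (verts G) \<and> (\<forall>e\<in>edges G. e \<subseteq> verts G \<and> card e = 3)"

definition tight_cycle :: "nat \<Rightarrow> nat hypergraph" where
  "tight_cycle l = ({1..l}, {{i, i + 1, i + 2} | i. 1 \<le> i \<and> i + 2 \<le> l} \<union> {{l - 1, l, 1}, {l, 1, 2}})"

definition contains_subgraph :: "'a hypergraph \<Rightarrow> 'b hypergraph \<Rightarrow> bool" where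
  "contains_subgraph G H \<longleftrightarrow>
     (\<exists>f. inj_on f (verts H) \<and> f ` verts H \<subseteq> verts G \<and> (\<forall>e\<in>edges H. f ` e \<in> edges G))"

definition family_free :: "'b hypergraph set \<Rightarrow> 'a hypergraph \<Rightarrow> bool" where
  "family_free \<F> G \<longleftrightarrow> (\<forall>H\<in>\<F>. \<not> contains_subgraph G H)"

text \<open>Up to isomorphism every finite hypergraph has its vertices in \<^typ>\<open>nat\<close>.\<close>

definition ex_number :: "nat \<Rightarrow> 'b hypergraph set \<Rightarrow> nat" where
  "ex_number n \<F> = Max {card (edges G) | G :: nat hypergraph.
     three_graph G \<and> card (verts G) = n \<and> family_free \<F> G}"

text \<open>
  The maximum and the limit are meaningful as soon as every member of the family has an edge; see
  \<open>ex_number_set\<close> and \<open>turan_density_limit\<close> below.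
\<close>

definition turan_density :: "'b hypergraph set \<Rightarrow> real" where
  "turan_density \<F> = lim (\<lambda>n. real (ex_number n \<F>) / real (n choose 3))"

lemma three_graph_tight_cycle:
  assumes "l \<ge> 4" shows "three_graph (tight_cycle l)"
  using assms by (auto simp: three_graph_def tight_cycle_def card_insert_if)

lemma edges_tight_cycle_nonempty: "edges (tight_cycle l) \<noteq> {}"
  by (simp add: tight_cycle_def)

lemma ex_number_set:
  fixes \<F> :: "'b hypergraph set"
  assumes "\<And>H. H \<in> \<F> \<Longrightarrow> edges H \<noteq> {}"
  defines "S n \<equiv> {card (edges G) | G :: nat hypergraph.
     three_graph G \<and> card (verts G) = n \<and> family_free \<F> G}"
  shows "finite (S n)" "S n \<noteq> {}"
proof -
  have "card (edges G) \<le> 2 ^ n" if "three_graph G" "card (verts G) = n" for G :: "nat hypergraph"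
  proof -
    have "edges G \<subseteq> Pow (verts G)" "finite (verts G)" using that by (auto simp: three_graph_def)
    thus ?thesis using that(2) card_mono[of "Pow (verts G)" "edges G"] by (simp add: card_Pow)
  qed
  hence "S n \<subseteq> {..2 ^ n}" by (auto simp: S_def)
  thus "finite (S n)" by (rule finite_subset) simp
  have "family_free \<F> ({..<n}, {} :: nat set set)"
    using assms(1) by (auto simp: family_free_def contains_subgraph_def)
  moreover have "three_graph ({..<n}, {} :: nat set set)" by (simp add: three_graph_def)
  ultimately show "S n \<noteq> {}" unfolding S_def
    by (auto intro!: exI[of _ "{..<n}"] exI[of _ "{} :: nat set set"])
qed

lemma ex_number_Suc:
  fixes \<F> :: "'b hypergraph set"
  assumes F: "\<And>H. H \<in> \<F> \<Longrightarrow> edges H \<noteq> {}"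
  shows "(n - 2) * ex_number (Suc n) \<F> \<le> Suc n * ex_number n \<F>"
proof -
  define S where "S n = {card (edges G) | G :: nat hypergraph.
     three_graph G \<and> card (verts G) = n \<and> family_free \<F> G}" for n
  have fin: "finite (S m)" "S m \<noteq> {}" for m
    unfolding S_def using ex_number_set[of \<F>] F by blast+
  have "ex_number (Suc n) \<F> \<in> S (Suc n)"
    using Max_in[OF fin] by (simp add: S_def ex_number_def)
  then obtain V E where G: "three_graph (V, E :: nat set set)" "card V = Suc n"
      "family_free \<F> (V, E)" and ex: "ex_number (Suc n) \<F> = card E"
    by (auto simp: S_def)
  have finV: "finite V" and E: "\<And>e. e \<in> E \<Longrightarrow> e \<subseteq> V \<and> card e = 3"
    using G(1) by (auto simp: three_graph_def)
  have finE: "finite E" using finV E by (auto intro: finite_subset[of _ "Pow V"])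
  have le: "card {e\<in>E. v \<notin> e} \<le> ex_number n \<F>" if v: "v \<in> V" for v
  proof -
    have "three_graph (V - {v}, {e\<in>E. v \<notin> e})" using finV E by (auto simp: three_graph_def)
    moreover have "card (V - {v}) = n" using v G(2) finV by simp
    moreover have "family_free \<F> (V - {v}, {e\<in>E. v \<notin> e})"
    proof -
      have "contains_subgraph (V, E) H"
        if "contains_subgraph (V - {v}, {e\<in>E. v \<notin> e}) H" for H :: "'b hypergraph"
        using that unfolding contains_subgraph_def by (elim exE) (rule exI, auto)
      thus ?thesis using G(3) unfolding family_free_def by blast
    qed
    ultimately have "card {e\<in>E. v \<notin> e} \<in> S n" unfolding S_def by force
    thus ?thesis using Max_ge[OF fin(1)] by (simp add: ex_number_def S_def)
  qed
  have "(n - 2) * card E = (\<Sum>e\<in>E. card {v\<in>V. v \<notin> e})"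
  proof -
    have "card {v\<in>V. v \<notin> e} = n - 2" if "e \<in> E" for e
    proof -
      have "{v\<in>V. v \<notin> e} = V - e" by auto
      moreover have "finite e" using E[OF that] finV finite_subset by blast
      ultimately show ?thesis using E[OF that] G(2) by (simp add: card_Diff_subset)
    qed
    thus ?thesis by simp
  qed
  also have "\<dots> = (\<Sum>e\<in>E. \<Sum>v\<in>V. if v \<notin> e then 1 else 0)"
    using finV by (simp add: sum.If_cases Int_def)
  also have "\<dots> = (\<Sum>v\<in>V. \<Sum>e\<in>E. if v \<notin> e then 1 else 0)" by (rule sum.swap)
  also have "\<dots> = (\<Sum>v\<in>V. card {e\<in>E. v \<notin> e})"
    using finE by (simp add: sum.If_cases Int_def)
  also have "\<dots> \<le> Suc n * ex_number n \<F>" using sum_mono[of V, OF le] G(2) by simp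
  finally show ?thesis using ex by simp
qed

lemma turan_density_limit:
  fixes \<F> :: "'b hypergraph set"
  assumes "\<And>H. H \<in> \<F> \<Longrightarrow> edges H \<noteq> {}"
  shows "(\<lambda>n. real (ex_number n \<F>) / real (n choose 3)) \<longlonglongrightarrow> turan_density \<F>"
proof -
  define f where "f n = real (ex_number n \<F>) / real (n choose 3)" for n
  have "f (Suc n) \<le> f n" if n: "n \<ge> 3" for n
  proof -
    have "Suc n * (n choose 3) = (n - 2) * (Suc n choose 3)"
      using binomial_absorb_comp[of "Suc n" 3]
      by (metis diff_Suc_1 diff_Suc_Suc numeral_3_eq_3 numeral_2_eq_2)
    hence *: "real (Suc n) * real (n choose 3) = real (n - 2) * real (Suc n choose 3)"
      by (metis of_nat_mult)
    have **: "real (n - 2) * real (ex_number (Suc n) \<F>) \<le> real (Suc n) * real (ex_number n \<F>)"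
      using ex_number_Suc[OF assms, of \<F> n] by (metis of_nat_le_iff of_nat_mult)
    have pos: "real (n choose 3) > 0" "real (Suc n choose 3) > 0" "real (n - 2) > 0"
      using n by (simp_all add: zero_less_binomial)
    have "real (n - 2) * (real (ex_number (Suc n) \<F>) * real (n choose 3))
        \<le> real (Suc n) * real (ex_number n \<F>) * real (n choose 3)"
      using mult_right_mono[OF **, of "real (n choose 3)"] by (simp add: mult_ac)
    also have "\<dots> = real (n - 2) * (real (ex_number n \<F>) * real (Suc n choose 3))"
      using * by (metis mult.commute mult.assoc)
    finally have "real (ex_number (Suc n) \<F>) * real (n choose 3)
        \<le> real (ex_number n \<F>) * real (Suc n choose 3)"
      using pos(3) mult_le_cancel_left_pos by blast
    thus ?thesis using pos by (simp add: f_def divide_simps mult_ac)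
  qed
  hence "f (Suc (n + 3)) \<le> f (n + 3)" for n using le_add2 by blast
  hence "decseq (\<lambda>n. f (n + 3))" unfolding decseq_Suc_iff add_Suc by blast
  moreover have "0 \<le> f (n + 3)" for n by (simp add: f_def)
  ultimately obtain L where "(\<lambda>n. f (n + 3)) \<longlonglongrightarrow> L"
    using decseq_convergent[of "\<lambda>n. f (n + 3)" 0] by blast
  hence "f \<longlonglongrightarrow> L" by (rule LIMSEQ_offset)
  thus ?thesis unfolding turan_density_def f_def[symmetric] by (simp add: limI)
qed

end

(*
  Let lam = 2 sqrt 3 - 3.  Call a 3-graph good if it contains neither K4 nor a tight 5-cycle with a
  chord.  A tight cycle of length l >= 7, with l not divisible by 3, maps homomorphically to both
  excluded graphs, so by sampling and blowing up it suffices to show that every weighted good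
  3-graph has density at most lam; for {C4, C5} the reduction is immediate.

  In a counterexample with the fewest vertices and optimal weights all degrees equal some mu > lam,
  and every proper vertex set B of weight b spans density at most lam b^3.  For a vertex set A let
  Phi(A) be the density of edges with exactly two vertices in A, minus 19 times that of edges with
  one and minus 38 times that of edges with three vertices in A.  A flag algebra computation on six
  vertices shows that Phi is positive for some set {w : xzw and yzw are edges}, where xyz is an edge.
  Take A maximising Phi.  Moving single vertices in and out of A gives inequalities on the links,
  which two rooted five-vertex computations turn into bounds on the number of wrongly placed edges
  at each vertex.  A last five-vertex computation then shows that at most 3 a^2 b of the density
  meets A, where a and b are the weights of A and its complement B.  So the density is at most
  lam b^3 + 3 a^2 b, which is at most lam.

  The integer vectors below are rounded solutions of the semidefinite programs that belong to these
  computations: a sum of squares is their dot product dotl summed over pairs of flags.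
*)
theory Submission
  imports Defs
begin

text \<open>The bound is approached by a nested construction: give B weight r = (sqrt 3 - 1) / 2 and
  A the rest, take all triples with exactly two vertices in A, and repeat inside B. Samples of
  bounded size cannot follow this nesting, so the computations also use an inequality from
  minimality: outside a vertex set of weight b the density is at least 0.4641 (1 - b^3). Here 0.4641
  lies just below \<open>lam\<close>, so all certificates are rational; sqrt 3 itself matters only
  in the closing identity, whose square vanishes at b = r. The penalties 19 and 38 make Phi > 0
  imply that edges meeting A have on average more than 39/20 vertices there. With equal degrees this
  gives A weight at least 0.6119, against about 0.634 in the construction. The last computation is
  sharp for the construction, so its multipliers live on wrongly placed edges and on missing triples
  only; the bounds on wrong edges at each vertex serve as its side constraints. The length 7 is the
  point from which both excluded graphs receive every cycle of length not divisible by 3: in K4 no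
  tight walk closes after 5 steps, and in a 5-cycle with one chord none closes after 4.\<close>

fun dotl :: "real list \<Rightarrow> real list \<Rightarrow> real" where
  "dotl (x # xs) (y # ys) = x * y + dotl xs ys"
| "dotl _ _ = 0"

lemma dotl_comm: "dotl xs ys = dotl ys xs"
  by (induction xs ys rule: dotl.induct) (simp_all add: mult.commute)

text \<open>The default 0 at the empty list, together with \<open>tl [] = []\<close>, treats lists
  as vectors padded with zeros, in agreement with \<open>dotl\<close> stopping at the shorter
  argument.\<close>

definition hd0 :: "real list \<Rightarrow> real" where
  "hd0 xs = (case xs of [] \<Rightarrow> 0 | x # _ \<Rightarrow> x)"

lemma dotl_hd_tl: "dotl xs ys = hd0 xs * hd0 ys + dotl (tl xs) (tl ys)"
  by (cases xs; cases ys) (simp_all add: hd0_def)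

lemma all_bool: "(\<forall>b. P b) = (P True \<and> P False)"
  by (metis (full_types))

section \<open>Averages over a weighted vertex set\<close>

locale weighted =
  fixes V :: "'a set" and w :: "'a \<Rightarrow> real"
  assumes finV: "finite V" and w_nonneg: "v \<in> V \<Longrightarrow> 0 \<le> w v" and w_sum: "sum w V = 1"
begin

text \<open>The expectation of f at a random vertex with law w. Densities are nested expectations
  over ordered tuples with repetition allowed, so no correction terms for coinciding vertices
  arise.\<close>

definition I :: "('a \<Rightarrow> real) \<Rightarrow> real" where
  "I f = (\<Sum>v\<in>V. w v * f v)"

lemma I_add: "I (\<lambda>v. f v + g v) = I f + I g"
  unfolding I_def by (simp add: distrib_left sum.distrib)

lemma I_diff: "I (\<lambda>v. f v - g v) = I f - I g"
  unfolding I_def by (simp add: right_diff_distrib sum_subtractf)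

lemma I_cmult: "I (\<lambda>v. k * f v) = k * I f"
  unfolding I_def by (simp add: sum_distrib_left mult_ac)

lemma I_multc: "I (\<lambda>v. f v * k) = I f * k"
  using I_cmult[of k f] by (simp add: mult.commute)

lemma I_const: "I (\<lambda>v. k) = k"
  unfolding I_def by (simp add: sum_distrib_right[symmetric] w_sum)

lemma I_nonneg: "(\<And>v. v \<in> V \<Longrightarrow> 0 \<le> f v) \<Longrightarrow> 0 \<le> I f"
  unfolding I_def by (intro sum_nonneg mult_nonneg_nonneg w_nonneg)

lemma I_mono: "(\<And>v. v \<in> V \<Longrightarrow> f v \<le> g v) \<Longrightarrow> I f \<le> I g"
  unfolding I_def by (intro sum_mono mult_left_mono w_nonneg)

lemma I_cong: "(\<And>v. f v = g v) \<Longrightarrow> I f = I g"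
  by presburger

lemma I_swap: "I (\<lambda>a. I (\<lambda>b. f b a)) = I (\<lambda>a. I (\<lambda>b. f a b))"
proof -
  have "(\<Sum>a\<in>V. \<Sum>b\<in>V. w a * (w b * f b a)) = (\<Sum>b\<in>V. \<Sum>a\<in>V. w a * (w b * f b a))"
    by (rule sum.swap)
  then show ?thesis
    unfolding I_def by (simp add: sum_distrib_left mult_ac)
qed

lemma I_square_nonneg: "0 \<le> I (\<lambda>a. I (\<lambda>b. f a * f b))"
  by (simp add: I_cmult I_multc)

lemma I_square_nonneg2: "0 \<le> I (\<lambda>a. I (\<lambda>b. I (\<lambda>c. I (\<lambda>d. f a b * f c d))))"
  by (simp add: I_cmult I_multc)

text \<open>For independent a and b the average of each coordinate product factors into the square
  of an average; this is the semidefinite part of every flag computation below. The length bound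
  only drives the induction, which splits off one coordinate at a time.\<close>

lemma sos_nonneg:
  assumes "\<And>a. length (g a) \<le> n"
  shows "0 \<le> I (\<lambda>a. I (\<lambda>b. dotl (g a) (g b)))"
  using assms
proof (induction n arbitrary: g)
  case 0
  then have "g = (\<lambda>_. [])" by auto
  then show ?case by (simp add: I_const)
next
  case (Suc n)
  have "dotl (g a) (g b) = hd0 (g a) * hd0 (g b) + dotl (tl (g a)) (tl (g b))" for a b
    by (rule dotl_hd_tl)
  moreover have "length (tl (g a)) \<le> n" for a using Suc.prems[of a] by simp
  ultimately show ?case
    using Suc.IH[of "\<lambda>a. tl (g a)"] I_square_nonneg[of "\<lambda>a. hd0 (g a)"] by (simp add: I_add)
qed

text \<open>The same for flags with two free vertices: the pairs (a, b) and (c, d) are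
  independent.\<close>

lemma sos_nonneg2:
  assumes "\<And>a b. length (g a b) \<le> n"
  shows "0 \<le> I (\<lambda>a. I (\<lambda>b. I (\<lambda>c. I (\<lambda>d. dotl (g a b) (g c d)))))"
  using assms
proof (induction n arbitrary: g)
  case 0
  then have "g = (\<lambda>_ _. [])" by auto
  then show ?case by (simp add: I_const)
next
  case (Suc n)
  have "dotl (g a b) (g c d) = hd0 (g a b) * hd0 (g c d) + dotl (tl (g a b)) (tl (g c d))" for a b c d
    by (rule dotl_hd_tl)
  moreover have "length (tl (g a b)) \<le> n" for a b using Suc.prems[of a b] by simp
  ultimately show ?case
    using Suc.IH[of "\<lambda>a b. tl (g a b)"] I_square_nonneg2[of "\<lambda>a b. hd0 (g a b)"] by (simp add: I_add)
qed


section \<open>Averages over four, five and six points, and their symmetrisation\<close>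

definition Z4 :: "('a \<Rightarrow> 'a \<Rightarrow> 'a \<Rightarrow> 'a \<Rightarrow> real) \<Rightarrow> real" where
  "Z4 H = I (\<lambda>a. I (\<lambda>b. I (\<lambda>c. I (\<lambda>d. H a b c d))))"

lemma Z4_swap1: "Z4 (\<lambda>a b c d. H b a c d) = Z4 (\<lambda>a b c d. H a b c d)"
  unfolding Z4_def by (rule I_swap)

lemma Z4_swap2: "Z4 (\<lambda>a b c d. H a c b d) = Z4 (\<lambda>a b c d. H a b c d)"
  unfolding Z4_def by (rule I_cong, rule I_swap)

lemma Z4_swap3: "Z4 (\<lambda>a b c d. H a b d c) = Z4 (\<lambda>a b c d. H a b c d)"
  unfolding Z4_def by (rule I_cong, rule I_cong, rule I_swap)

lemma Z4_add: "Z4 (\<lambda>a b c d. G a b c d + H a b c d) = Z4 G + Z4 H"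
  unfolding Z4_def by (simp only: I_add)

lemma Z4_diff: "Z4 (\<lambda>a b c d. G a b c d - H a b c d) = Z4 G - Z4 H"
  unfolding Z4_def by (simp only: I_diff)

lemma Z4_cmult: "Z4 (\<lambda>a b c d. k * H a b c d) = k * Z4 H"
  unfolding Z4_def by (simp only: I_cmult)

lemma Z4_const: "Z4 (\<lambda>a b c d. k) = k"
  unfolding Z4_def by (simp only: I_const)

lemma Z4_mono: "(\<And>a b c d. G a b c d \<le> H a b c d) \<Longrightarrow> Z4 G \<le> Z4 H"
  unfolding Z4_def by (intro I_mono) simp

definition Z5 :: "('a \<Rightarrow> 'a \<Rightarrow> 'a \<Rightarrow> 'a \<Rightarrow> 'a \<Rightarrow> real) \<Rightarrow> real" where
  "Z5 H = I (\<lambda>a. I (\<lambda>b. I (\<lambda>c. I (\<lambda>d. I (\<lambda>e. H a b c d e)))))"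

lemma Z5_swap1: "Z5 (\<lambda>a b c d e. H b a c d e) = Z5 (\<lambda>a b c d e. H a b c d e)"
  unfolding Z5_def by (rule I_swap)

lemma Z5_swap2: "Z5 (\<lambda>a b c d e. H a c b d e) = Z5 (\<lambda>a b c d e. H a b c d e)"
  unfolding Z5_def by (rule I_cong, rule I_swap)

lemma Z5_swap3: "Z5 (\<lambda>a b c d e. H a b d c e) = Z5 (\<lambda>a b c d e. H a b c d e)"
  unfolding Z5_def by (rule I_cong, rule I_cong, rule I_swap)

lemma Z5_swap4: "Z5 (\<lambda>a b c d e. H a b c e d) = Z5 (\<lambda>a b c d e. H a b c d e)"
  unfolding Z5_def by (rule I_cong, rule I_cong, rule I_cong, rule I_swap)

lemma Z5_add: "Z5 (\<lambda>a b c d e. G a b c d e + H a b c d e) = Z5 G + Z5 H"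
  unfolding Z5_def by (simp only: I_add)

lemma Z5_diff: "Z5 (\<lambda>a b c d e. G a b c d e - H a b c d e) = Z5 G - Z5 H"
  unfolding Z5_def by (simp only: I_diff)

lemma Z5_cmult: "Z5 (\<lambda>a b c d e. k * H a b c d e) = k * Z5 H"
  unfolding Z5_def by (simp only: I_cmult)

lemma Z5_const: "Z5 (\<lambda>a b c d e. k) = k"
  unfolding Z5_def by (simp only: I_const)

lemma Z5_mono: "(\<And>a b c d e. G a b c d e \<le> H a b c d e) \<Longrightarrow> Z5 G \<le> Z5 H"
  unfolding Z5_def by (intro I_mono) simp

definition Z6 :: "('a \<Rightarrow> 'a \<Rightarrow> 'a \<Rightarrow> 'a \<Rightarrow> 'a \<Rightarrow> 'a \<Rightarrow> real) \<Rightarrow> real" where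
  "Z6 H = I (\<lambda>a. I (\<lambda>b. I (\<lambda>c. I (\<lambda>d. I (\<lambda>e. I (\<lambda>f. H a b c d e f))))))"

lemma Z6_swap1: "Z6 (\<lambda>a b c d e f. H b a c d e f) = Z6 (\<lambda>a b c d e f. H a b c d e f)"
  unfolding Z6_def by (rule I_swap)

lemma Z6_swap2: "Z6 (\<lambda>a b c d e f. H a c b d e f) = Z6 (\<lambda>a b c d e f. H a b c d e f)"
  unfolding Z6_def by (rule I_cong, rule I_swap)

lemma Z6_swap3: "Z6 (\<lambda>a b c d e f. H a b d c e f) = Z6 (\<lambda>a b c d e f. H a b c d e f)"
  unfolding Z6_def by (rule I_cong, rule I_cong, rule I_swap)

lemma Z6_swap4: "Z6 (\<lambda>a b c d e f. H a b c e d f) = Z6 (\<lambda>a b c d e f. H a b c d e f)"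
  unfolding Z6_def by (rule I_cong, rule I_cong, rule I_cong, rule I_swap)

lemma Z6_swap5: "Z6 (\<lambda>a b c d e f. H a b c d f e) = Z6 (\<lambda>a b c d e f. H a b c d e f)"
  unfolding Z6_def by (rule I_cong, rule I_cong, rule I_cong, rule I_cong, rule I_swap)

lemma Z6_add: "Z6 (\<lambda>a b c d e f. G a b c d e f + H a b c d e f) = Z6 G + Z6 H"
  unfolding Z6_def by (simp only: I_add)

lemma Z6_diff: "Z6 (\<lambda>a b c d e f. G a b c d e f - H a b c d e f) = Z6 G - Z6 H"
  unfolding Z6_def by (simp only: I_diff)

lemma Z6_cmult: "Z6 (\<lambda>a b c d e f. k * H a b c d e f) = k * Z6 H"
  unfolding Z6_def by (simp only: I_cmult)

lemma Z6_const: "Z6 (\<lambda>a b c d e f. k) = k"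
  unfolding Z6_def by (simp only: I_const)

lemma Z6_mono: "(\<And>a b c d e f. G a b c d e f \<le> H a b c d e f) \<Longrightarrow> Z6 G \<le> Z6 H"
  unfolding Z6_def by (intro I_mono) simp

text \<open>The terms are the orderings of the four points up to exchanging the last two. Each is
  reduced to an earlier one by a single adjacent transposition, which leaves the average unchanged.
  Certificates are verified pointwise on such symmetrised sums.\<close>

lemma Z4_12: "Z4 (\<lambda>a b c d. H a b c d
    + H a c b d
    + H a d b c
    + H b a c d
    + H b c a d
    + H b d a c
    + H c a b d
    + H c b a d
    + H c d a b
    + H d a b c
    + H d b a c
    + H d c a b) = 12 * Z4 H"
  by (simp only: Z4_add
    Z4_swap2[of "\<lambda>a b c d. H a b c d"]
    Z4_swap3[of "\<lambda>a b c d. H a c b d"]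
    Z4_swap1[of "\<lambda>a b c d. H a b c d"]
    Z4_swap1[of "\<lambda>a b c d. H a c b d"]
    Z4_swap1[of "\<lambda>a b c d. H a d b c"]
    Z4_swap2[of "\<lambda>a b c d. H b a c d"]
    Z4_swap1[of "\<lambda>a b c d. H c a b d"]
    Z4_swap2[of "\<lambda>a b c d. H b d a c"]
    Z4_swap3[of "\<lambda>a b c d. H c a b d"]
    Z4_swap1[of "\<lambda>a b c d. H d a b c"]
    Z4_swap2[of "\<lambda>a b c d. H d b a c"])

text \<open>Again all orderings up to exchanging the last two points.\<close>

lemma Z5_60: "Z5 (\<lambda>a b c d e. H a b c d e
    + H a b d c e
    + H a b e c d
    + H a c b d e
    + H a c d b e
    + H a c e b d
    + H a d b c e
    + H a d c b e
    + H a d e b c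
    + H a e b c d
    + H a e c b d
    + H a e d b c
    + H b a c d e
    + H b a d c e
    + H b a e c d
    + H b c a d e
    + H b c d a e
    + H b c e a d
    + H b d a c e
    + H b d c a e
    + H b d e a c
    + H b e a c d
    + H b e c a d
    + H b e d a c
    + H c a b d e
    + H c a d b e
    + H c a e b d
    + H c b a d e
    + H c b d a e
    + H c b e a d
    + H c d a b e
    + H c d b a e
    + H c d e a b
    + H c e a b d
    + H c e b a d
    + H c e d a b
    + H d a b c e
    + H d a c b e
    + H d a e b c
    + H d b a c e
    + H d b c a e
    + H d b e a c
    + H d c a b e
    + H d c b a e
    + H d c e a b
    + H d e a b c
    + H d e b a c
    + H d e c a b
    + H e a b c d
    + H e a c b d
    + H e a d b c
    + H e b a c d
    + H e b c a d
    + H e b d a c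
    + H e c a b d
    + H e c b a d
    + H e c d a b
    + H e d a b c
    + H e d b a c
    + H e d c a b) = 60 * Z5 H"
  by (simp only: Z5_add
    Z5_swap3[of "\<lambda>a b c d e. H a b c d e"]
    Z5_swap4[of "\<lambda>a b c d e. H a b d c e"]
    Z5_swap2[of "\<lambda>a b c d e. H a b c d e"]
    Z5_swap2[of "\<lambda>a b c d e. H a b d c e"]
    Z5_swap2[of "\<lambda>a b c d e. H a b e c d"]
    Z5_swap3[of "\<lambda>a b c d e. H a c b d e"]
    Z5_swap2[of "\<lambda>a b c d e. H a d b c e"]
    Z5_swap3[of "\<lambda>a b c d e. H a c e b d"]
    Z5_swap4[of "\<lambda>a b c d e. H a d b c e"]
    Z5_swap2[of "\<lambda>a b c d e. H a e b c d"]
    Z5_swap3[of "\<lambda>a b c d e. H a e c b d"]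
    Z5_swap1[of "\<lambda>a b c d e. H a b c d e"]
    Z5_swap1[of "\<lambda>a b c d e. H a b d c e"]
    Z5_swap1[of "\<lambda>a b c d e. H a b e c d"]
    Z5_swap1[of "\<lambda>a b c d e. H a c b d e"]
    Z5_swap1[of "\<lambda>a b c d e. H a c d b e"]
    Z5_swap1[of "\<lambda>a b c d e. H a c e b d"]
    Z5_swap1[of "\<lambda>a b c d e. H a d b c e"]
    Z5_swap1[of "\<lambda>a b c d e. H a d c b e"]
    Z5_swap1[of "\<lambda>a b c d e. H a d e b c"]
    Z5_swap1[of "\<lambda>a b c d e. H a e b c d"]
    Z5_swap1[of "\<lambda>a b c d e. H a e c b d"]
    Z5_swap1[of "\<lambda>a b c d e. H a e d b c"]
    Z5_swap2[of "\<lambda>a b c d e. H b a c d e"]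
    Z5_swap2[of "\<lambda>a b c d e. H b a d c e"]
    Z5_swap2[of "\<lambda>a b c d e. H b a e c d"]
    Z5_swap1[of "\<lambda>a b c d e. H c a b d e"]
    Z5_swap1[of "\<lambda>a b c d e. H c a d b e"]
    Z5_swap1[of "\<lambda>a b c d e. H c a e b d"]
    Z5_swap2[of "\<lambda>a b c d e. H b d a c e"]
    Z5_swap1[of "\<lambda>a b c d e. H c d a b e"]
    Z5_swap2[of "\<lambda>a b c d e. H b d e a c"]
    Z5_swap2[of "\<lambda>a b c d e. H b e a c d"]
    Z5_swap1[of "\<lambda>a b c d e. H c e a b d"]
    Z5_swap2[of "\<lambda>a b c d e. H b e d a c"]
    Z5_swap3[of "\<lambda>a b c d e. H c a b d e"]
    Z5_swap2[of "\<lambda>a b c d e. H d a b c e"]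
    Z5_swap3[of "\<lambda>a b c d e. H c a e b d"]
    Z5_swap1[of "\<lambda>a b c d e. H d a b c e"]
    Z5_swap1[of "\<lambda>a b c d e. H d a c b e"]
    Z5_swap1[of "\<lambda>a b c d e. H d a e b c"]
    Z5_swap2[of "\<lambda>a b c d e. H d b a c e"]
    Z5_swap1[of "\<lambda>a b c d e. H d c a b e"]
    Z5_swap2[of "\<lambda>a b c d e. H d b e a c"]
    Z5_swap3[of "\<lambda>a b c d e. H c e a b d"]
    Z5_swap1[of "\<lambda>a b c d e. H d e a b c"]
    Z5_swap2[of "\<lambda>a b c d e. H d e b a c"]
    Z5_swap4[of "\<lambda>a b c d e. H d a b c e"]
    Z5_swap2[of "\<lambda>a b c d e. H e a b c d"]
    Z5_swap3[of "\<lambda>a b c d e. H e a c b d"]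
    Z5_swap1[of "\<lambda>a b c d e. H e a b c d"]
    Z5_swap1[of "\<lambda>a b c d e. H e a c b d"]
    Z5_swap1[of "\<lambda>a b c d e. H e a d b c"]
    Z5_swap2[of "\<lambda>a b c d e. H e b a c d"]
    Z5_swap1[of "\<lambda>a b c d e. H e c a b d"]
    Z5_swap2[of "\<lambda>a b c d e. H e b d a c"]
    Z5_swap3[of "\<lambda>a b c d e. H e c a b d"]
    Z5_swap1[of "\<lambda>a b c d e. H e d a b c"]
    Z5_swap2[of "\<lambda>a b c d e. H e d b a c"])

lemma Z6_2: "Z6 (\<lambda>a b c d e f. H a b c d e f
    + H b a c d e f) = 2 * Z6 H"
  by (simp only: Z6_add
    Z6_swap1[of "\<lambda>a b c d e f. H a b c d e f"])

lemma Z6_3: "Z6 (\<lambda>a b c d e f. H b c a d e f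
    + H a c b d e f
    + H a b c d e f) = 3 * Z6 H"
  by (simp only: Z6_add
    Z6_swap1[of "\<lambda>a b c d e f. H a c b d e f"]
    Z6_swap2[of "\<lambda>a b c d e f. H a b c d e f"])

lemma Z6_24: "Z6 (\<lambda>a b c d e f. H a b c d e f
    + H a b d c e f
    + H a c b d e f
    + H a c d b e f
    + H a d b c e f
    + H a d c b e f
    + H b a c d e f
    + H b a d c e f
    + H b c a d e f
    + H b c d a e f
    + H b d a c e f
    + H b d c a e f
    + H c a b d e f
    + H c a d b e f
    + H c b a d e f
    + H c b d a e f
    + H c d a b e f
    + H c d b a e f
    + H d a b c e f
    + H d a c b e f
    + H d b a c e f
    + H d b c a e f
    + H d c a b e f
    + H d c b a e f) = 24 * Z6 H"
  by (simp only: Z6_add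
    Z6_swap3[of "\<lambda>a b c d e f. H a b c d e f"]
    Z6_swap2[of "\<lambda>a b c d e f. H a b c d e f"]
    Z6_swap2[of "\<lambda>a b c d e f. H a b d c e f"]
    Z6_swap3[of "\<lambda>a b c d e f. H a c b d e f"]
    Z6_swap2[of "\<lambda>a b c d e f. H a d b c e f"]
    Z6_swap1[of "\<lambda>a b c d e f. H a b c d e f"]
    Z6_swap1[of "\<lambda>a b c d e f. H a b d c e f"]
    Z6_swap1[of "\<lambda>a b c d e f. H a c b d e f"]
    Z6_swap1[of "\<lambda>a b c d e f. H a c d b e f"]
    Z6_swap1[of "\<lambda>a b c d e f. H a d b c e f"]
    Z6_swap1[of "\<lambda>a b c d e f. H a d c b e f"]
    Z6_swap2[of "\<lambda>a b c d e f. H b a c d e f"]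
    Z6_swap2[of "\<lambda>a b c d e f. H b a d c e f"]
    Z6_swap1[of "\<lambda>a b c d e f. H c a b d e f"]
    Z6_swap1[of "\<lambda>a b c d e f. H c a d b e f"]
    Z6_swap2[of "\<lambda>a b c d e f. H b d a c e f"]
    Z6_swap1[of "\<lambda>a b c d e f. H c d a b e f"]
    Z6_swap3[of "\<lambda>a b c d e f. H c a b d e f"]
    Z6_swap2[of "\<lambda>a b c d e f. H d a b c e f"]
    Z6_swap1[of "\<lambda>a b c d e f. H d a b c e f"]
    Z6_swap1[of "\<lambda>a b c d e f. H d a c b e f"]
    Z6_swap2[of "\<lambda>a b c d e f. H d b a c e f"]
    Z6_swap1[of "\<lambda>a b c d e f. H d c a b e f"])

text \<open>One term for each choice of the pair in the last two places, the places of the two flag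
  vertices over a four-vertex type.\<close>

lemma Z6_15: "Z6 (\<lambda>a b c d e f. H c d e f a b
    + H b d e f a c
    + H b c e f a d
    + H b c d f a e
    + H b c d e a f
    + H a d e f b c
    + H a c e f b d
    + H a c d f b e
    + H a c d e b f
    + H a b e f c d
    + H a b d f c e
    + H a b d e c f
    + H a b c f d e
    + H a b c e d f
    + H a b c d e f) = 15 * Z6 H"
  by (simp only: Z6_add
    Z6_swap2[of "\<lambda>a b c d e f. H b d e f a c"]
    Z6_swap1[of "\<lambda>a b c d e f. H a d e f b c"]
    Z6_swap3[of "\<lambda>a b c d e f. H a c e f b d"]
    Z6_swap2[of "\<lambda>a b c d e f. H a b e f c d"]
    Z6_swap4[of "\<lambda>a b c d e f. H a b d f c e"]
    Z6_swap3[of "\<lambda>a b c d e f. H a b c f d e"]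
    Z6_swap5[of "\<lambda>a b c d e f. H a b c e d f"]
    Z6_swap4[of "\<lambda>a b c d e f. H a b c d e f"]
    Z6_swap1[of "\<lambda>a b c d e f. H a c e f b d"]
    Z6_swap1[of "\<lambda>a b c d e f. H a c d f b e"]
    Z6_swap2[of "\<lambda>a b c d e f. H a b d f c e"]
    Z6_swap1[of "\<lambda>a b c d e f. H a c d e b f"]
    Z6_swap2[of "\<lambda>a b c d e f. H a b d e c f"]
    Z6_swap3[of "\<lambda>a b c d e f. H a b c e d f"])

text \<open>One term for each choice of the root triple in the first three places.\<close>

lemma Z6_20: "Z6 (\<lambda>a b c d e f. H a b c d e f
    + H a b d c e f
    + H a b e c d f
    + H a b f c d e
    + H a c d b e f
    + H a c e b d f
    + H a c f b d e
    + H a d e b c f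
    + H a d f b c e
    + H a e f b c d
    + H b c d a e f
    + H b c e a d f
    + H b c f a d e
    + H b d e a c f
    + H b d f a c e
    + H b e f a c d
    + H c d e a b f
    + H c d f a b e
    + H c e f a b d
    + H d e f a b c) = 20 * Z6 H"
  by (simp only: Z6_add
    Z6_swap3[of "\<lambda>a b c d e f. H a b c d e f"]
    Z6_swap4[of "\<lambda>a b c d e f. H a b d c e f"]
    Z6_swap5[of "\<lambda>a b c d e f. H a b e c d f"]
    Z6_swap2[of "\<lambda>a b c d e f. H a b d c e f"]
    Z6_swap2[of "\<lambda>a b c d e f. H a b e c d f"]
    Z6_swap2[of "\<lambda>a b c d e f. H a b f c d e"]
    Z6_swap3[of "\<lambda>a b c d e f. H a c e b d f"]
    Z6_swap3[of "\<lambda>a b c d e f. H a c f b d e"]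
    Z6_swap4[of "\<lambda>a b c d e f. H a d f b c e"]
    Z6_swap1[of "\<lambda>a b c d e f. H a c d b e f"]
    Z6_swap1[of "\<lambda>a b c d e f. H a c e b d f"]
    Z6_swap1[of "\<lambda>a b c d e f. H a c f b d e"]
    Z6_swap1[of "\<lambda>a b c d e f. H a d e b c f"]
    Z6_swap1[of "\<lambda>a b c d e f. H a d f b c e"]
    Z6_swap1[of "\<lambda>a b c d e f. H a e f b c d"]
    Z6_swap2[of "\<lambda>a b c d e f. H b d e a c f"]
    Z6_swap2[of "\<lambda>a b c d e f. H b d f a c e"]
    Z6_swap2[of "\<lambda>a b c d e f. H b e f a c d"]
    Z6_swap3[of "\<lambda>a b c d e f. H c e f a b d"])

text \<open>Fifteen choices of a root pair times three ways to split the other four points into two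
  pairs.\<close>

lemma Z6_45: "Z6 (\<lambda>a b c d e f. H a b c d e f
    + H a b c e d f
    + H a b c f d e
    + H a c b d e f
    + H a c b e d f
    + H a c b f d e
    + H a d b c e f
    + H a d b e c f
    + H a d b f c e
    + H a e b c d f
    + H a e b d c f
    + H a e b f c d
    + H a f b c d e
    + H a f b d c e
    + H a f b e c d
    + H b c a d e f
    + H b c a e d f
    + H b c a f d e
    + H b d a c e f
    + H b d a e c f
    + H b d a f c e
    + H b e a c d f
    + H b e a d c f
    + H b e a f c d
    + H b f a c d e
    + H b f a d c e
    + H b f a e c d
    + H c d a b e f
    + H c d a e b f
    + H c d a f b e
    + H c e a b d f
    + H c e a d b f
    + H c e a f b d
    + H c f a b d e
    + H c f a d b e
    + H c f a e b d
    + H d e a b c f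
    + H d e a c b f
    + H d e a f b c
    + H d f a b c e
    + H d f a c b e
    + H d f a e b c
    + H e f a b c d
    + H e f a c b d
    + H e f a d b c) = 45 * Z6 H"
  by (simp only: Z6_add
    Z6_swap4[of "\<lambda>a b c d e f. H a b c d e f"]
    Z6_swap5[of "\<lambda>a b c d e f. H a b c e d f"]
    Z6_swap2[of "\<lambda>a b c d e f. H a b c d e f"]
    Z6_swap2[of "\<lambda>a b c d e f. H a b c e d f"]
    Z6_swap2[of "\<lambda>a b c d e f. H a b c f d e"]
    Z6_swap3[of "\<lambda>a b c d e f. H a c b d e f"]
    Z6_swap3[of "\<lambda>a b c d e f. H a c b e d f"]
    Z6_swap3[of "\<lambda>a b c d e f. H a c b f d e"]
    Z6_swap4[of "\<lambda>a b c d e f. H a d b c e f"]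
    Z6_swap3[of "\<lambda>a b c d e f. H a e b c d f"]
    Z6_swap4[of "\<lambda>a b c d e f. H a d b f c e"]
    Z6_swap5[of "\<lambda>a b c d e f. H a e b c d f"]
    Z6_swap3[of "\<lambda>a b c d e f. H a f b c d e"]
    Z6_swap4[of "\<lambda>a b c d e f. H a f b d c e"]
    Z6_swap1[of "\<lambda>a b c d e f. H a c b d e f"]
    Z6_swap1[of "\<lambda>a b c d e f. H a c b e d f"]
    Z6_swap1[of "\<lambda>a b c d e f. H a c b f d e"]
    Z6_swap1[of "\<lambda>a b c d e f. H a d b c e f"]
    Z6_swap1[of "\<lambda>a b c d e f. H a d b e c f"]
    Z6_swap1[of "\<lambda>a b c d e f. H a d b f c e"]
    Z6_swap1[of "\<lambda>a b c d e f. H a e b c d f"]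
    Z6_swap1[of "\<lambda>a b c d e f. H a e b d c f"]
    Z6_swap1[of "\<lambda>a b c d e f. H a e b f c d"]
    Z6_swap1[of "\<lambda>a b c d e f. H a f b c d e"]
    Z6_swap1[of "\<lambda>a b c d e f. H a f b d c e"]
    Z6_swap1[of "\<lambda>a b c d e f. H a f b e c d"]
    Z6_swap2[of "\<lambda>a b c d e f. H b d a c e f"]
    Z6_swap2[of "\<lambda>a b c d e f. H b d a e c f"]
    Z6_swap2[of "\<lambda>a b c d e f. H b d a f c e"]
    Z6_swap2[of "\<lambda>a b c d e f. H b e a c d f"]
    Z6_swap2[of "\<lambda>a b c d e f. H b e a d c f"]
    Z6_swap2[of "\<lambda>a b c d e f. H b e a f c d"]
    Z6_swap2[of "\<lambda>a b c d e f. H b f a c d e"]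
    Z6_swap2[of "\<lambda>a b c d e f. H b f a d c e"]
    Z6_swap2[of "\<lambda>a b c d e f. H b f a e c d"]
    Z6_swap3[of "\<lambda>a b c d e f. H c e a b d f"]
    Z6_swap2[of "\<lambda>a b c d e f. H d e a b c f"]
    Z6_swap3[of "\<lambda>a b c d e f. H c e a f b d"]
    Z6_swap3[of "\<lambda>a b c d e f. H c f a b d e"]
    Z6_swap2[of "\<lambda>a b c d e f. H d f a b c e"]
    Z6_swap3[of "\<lambda>a b c d e f. H c f a e b d"]
    Z6_swap4[of "\<lambda>a b c d e f. H d f a b c e"]
    Z6_swap2[of "\<lambda>a b c d e f. H e f a b c d"]
    Z6_swap3[of "\<lambda>a b c d e f. H e f a c b d"])

end

section \<open>Codes of good 3-graphs and the six-vertex certificate\<close>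

context
begin

private abbreviation (input) T :: bool where "T \<equiv> True"
private abbreviation (input) F :: bool where "F \<equiv> False"

lemma all_boolI: "P True \<Longrightarrow> P False \<Longrightarrow> \<forall>b. P b"
  by (simp add: all_bool)

text \<open>The bits list the ten triples of {0,...,4} in colexicographic order. The first five
  clauses exclude K4 on each four points; the other twelve exclude a tight 5-cycle with a chord, one
  for each cyclic ordering of five points.\<close>

definition ok5 :: "bool \<Rightarrow> bool \<Rightarrow> bool \<Rightarrow> bool \<Rightarrow> bool \<Rightarrow> bool \<Rightarrow> bool \<Rightarrow> bool \<Rightarrow> bool \<Rightarrow> bool \<Rightarrow> bool" where
  "ok5 b012 b013 b023 b123 b014 b024 b034 b124 b134 b234 \<longleftrightarrow>
   \<not> (b012 \<and> b013 \<and> b023 \<and> b123) \<and>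
   \<not> (b012 \<and> b014 \<and> b024 \<and> b124) \<and>
   \<not> (b013 \<and> b014 \<and> b034 \<and> b134) \<and>
   \<not> (b023 \<and> b024 \<and> b034 \<and> b234) \<and>
   \<not> (b123 \<and> b124 \<and> b134 \<and> b234) \<and>
   \<not> (b012 \<and> b123 \<and> b234 \<and> b034 \<and> b014 \<and> (b013 \<or> b023 \<or> b024 \<or> b124 \<or> b134)) \<and>
   \<not> (b012 \<and> b124 \<and> b234 \<and> b034 \<and> b013 \<and> (b023 \<or> b123 \<or> b014 \<or> b024 \<or> b134)) \<and>
   \<not> (b013 \<and> b123 \<and> b234 \<and> b024 \<and> b014 \<and> (b012 \<or> b023 \<or> b034 \<or> b124 \<or> b134)) \<and>
   \<not> (b013 \<and> b134 \<and> b234 \<and> b024 \<and> b012 \<and> (b023 \<or> b123 \<or> b014 \<or> b034 \<or> b124)) \<and>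
   \<not> (b014 \<and> b124 \<and> b234 \<and> b023 \<and> b013 \<and> (b012 \<or> b123 \<or> b024 \<or> b034 \<or> b134)) \<and>
   \<not> (b014 \<and> b134 \<and> b234 \<and> b023 \<and> b012 \<and> (b013 \<or> b123 \<or> b024 \<or> b034 \<or> b124)) \<and>
   \<not> (b012 \<and> b123 \<and> b134 \<and> b034 \<and> b024 \<and> (b013 \<or> b023 \<or> b014 \<or> b124 \<or> b234)) \<and>
   \<not> (b012 \<and> b124 \<and> b134 \<and> b034 \<and> b023 \<and> (b013 \<or> b123 \<or> b014 \<or> b024 \<or> b234)) \<and>
   \<not> (b023 \<and> b123 \<and> b134 \<and> b014 \<and> b024 \<and> (b012 \<or> b013 \<or> b034 \<or> b124 \<or> b234)) \<and>
   \<not> (b024 \<and> b124 \<and> b134 \<and> b013 \<and> b023 \<and> (b012 \<or> b123 \<or> b014 \<or> b034 \<or> b234)) \<and>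
   \<not> (b013 \<and> b123 \<and> b124 \<and> b024 \<and> b034 \<and> (b012 \<or> b023 \<or> b014 \<or> b134 \<or> b234)) \<and>
   \<not> (b023 \<and> b123 \<and> b124 \<and> b014 \<and> b034 \<and> (b012 \<or> b013 \<or> b024 \<or> b134 \<or> b234))"

text \<open>Representatives of the five-vertex good 3-graphs up to isomorphism; \<open>rep5\<close>
  shows that every code obeying \<open>ok5\<close> can be permuted into this list.\<close>

inductive isrep :: "bool \<Rightarrow> bool \<Rightarrow> bool \<Rightarrow> bool \<Rightarrow> bool \<Rightarrow> bool \<Rightarrow> bool \<Rightarrow> bool \<Rightarrow> bool \<Rightarrow> bool \<Rightarrow> bool" where
  "isrep F F F F F F F F F F"
| "isrep F F F F F F F F F T"
| "isrep F F F F F F F F T T"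
| "isrep F F F F F F F T T T"
| "isrep F F F F F F T F T T"
| "isrep F F F F F F T T F F"
| "isrep F F F F F F T T F T"
| "isrep F F F F F F T T T T"
| "isrep F F F F F T T T T F"
| "isrep F F F F F T T T T T"
| "isrep F F F F T T T T T T"
| "isrep F F F T F F T T F F"
| "isrep F F F T F F T T F T"
| "isrep F F F T F T T F T F"
| "isrep F F F T F T T F T T"
| "isrep F F F T F T T T T F"
| "isrep F F F T T T T F F F"
| "isrep F F F T T T T F F T"
| "isrep F F F T T T T F T T"
| "isrep F F T T F T T T T F"
| "isrep F F T T T F T T F F"

text \<open>The hypotheses \<open>sw0\<close> to \<open>sw3\<close> express closure under the four
  adjacent transpositions of the vertices, which generate all permutations. It remains to connect
  each of the finitely many codes with a representative.\<close>

lemma rep5: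
  assumes sw0: "\<And>b0 b1 b2 b3 b4 b5 b6 b7 b8 b9. R b0 b1 b3 b2 b4 b7 b8 b5 b6 b9 \<Longrightarrow> R b0 b1 b2 b3 b4 b5 b6 b7 b8 b9"
    and sw1: "\<And>b0 b1 b2 b3 b4 b5 b6 b7 b8 b9. R b0 b2 b1 b3 b5 b4 b6 b7 b9 b8 \<Longrightarrow> R b0 b1 b2 b3 b4 b5 b6 b7 b8 b9"
    and sw2: "\<And>b0 b1 b2 b3 b4 b5 b6 b7 b8 b9. R b1 b0 b2 b3 b4 b6 b5 b8 b7 b9 \<Longrightarrow> R b0 b1 b2 b3 b4 b5 b6 b7 b8 b9"
    and sw3: "\<And>b0 b1 b2 b3 b4 b5 b6 b7 b8 b9. R b0 b4 b5 b7 b1 b2 b6 b3 b8 b9 \<Longrightarrow> R b0 b1 b2 b3 b4 b5 b6 b7 b8 b9"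
    and rep: "\<And>b0 b1 b2 b3 b4 b5 b6 b7 b8 b9. isrep b0 b1 b2 b3 b4 b5 b6 b7 b8 b9 \<Longrightarrow> R b0 b1 b2 b3 b4 b5 b6 b7 b8 b9"
  shows "ok5 b0 b1 b2 b3 b4 b5 b6 b7 b8 b9 \<Longrightarrow> R b0 b1 b2 b3 b4 b5 b6 b7 b8 b9"
proof -
  note reps = isrep.intros[THEN rep]
  have eq0: "R b0 b1 b2 b3 b4 b5 b6 b7 b8 b9 = R b0 b1 b3 b2 b4 b7 b8 b5 b6 b9" for b0 b1 b2 b3 b4 b5 b6 b7 b8 b9 using sw0 by metis
  have eq1: "R b0 b1 b2 b3 b4 b5 b6 b7 b8 b9 = R b0 b2 b1 b3 b5 b4 b6 b7 b9 b8" for b0 b1 b2 b3 b4 b5 b6 b7 b8 b9 using sw1 by metis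
  have eq2: "R b0 b1 b2 b3 b4 b5 b6 b7 b8 b9 = R b1 b0 b2 b3 b4 b6 b5 b8 b7 b9" for b0 b1 b2 b3 b4 b5 b6 b7 b8 b9 using sw2 by metis
  have eq3: "R b0 b1 b2 b3 b4 b5 b6 b7 b8 b9 = R b0 b4 b5 b7 b1 b2 b6 b3 b8 b9" for b0 b1 b2 b3 b4 b5 b6 b7 b8 b9 using sw3 by metis
  \<comment> \<open>The equations \<open>eq0\<close> to \<open>eq3\<close> are permutative and are
    applied only downwards in the term order, so rewriting can halt at a code that no single
    transposition lowers although it is not a representative. Such codes get explicit chains of
    transpositions here.\<close>
  have ex0: "R F F F T F T T F F F"
    by (rule sw3, rule sw2, rule sw0, rule reps)
  have ex1: "R F F F T F T T F F T"
    by (rule sw3, rule sw2, rule sw0, rule reps)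
  have ex2: "R F F T T T F F F F F"
    by (rule sw1, rule sw2, rule sw3, rule sw0, rule sw1, rule sw2, rule sw1, rule sw0, rule reps)
  have ex3: "R F F T T T F F F F T"
    by (rule sw3, rule sw1, rule sw0, rule reps)
  have ex4: "R F F T T T F F F T F"
    by (rule sw3, rule sw1, rule sw2, rule sw0, rule sw1, rule reps)
  have ex5: "R F F T T T F F F T T"
    by (rule sw3, rule sw1, rule sw0, rule reps)
  have ex6: "R F F T T T F F T T F"
    by (rule sw1, rule sw2, rule sw3, rule sw2, rule sw1, rule sw0, rule reps)
  have ex7: "R F F T T T F T F T F"
    by (rule sw3, rule sw1, rule sw2, rule sw0, rule sw1, rule reps)
  have ex8: "R F F T T T F T F T T"
    by (rule sw3, rule sw1, rule sw0, rule reps)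
  have ex9: "R F T T T T T F T F F"
    by (rule sw2, rule sw3, rule sw1, rule sw2, rule sw0, rule sw1, rule reps)
  have "\<forall>b0 b1 b2 b3 b4 b5 b6 b7 b8 b9. ok5 b0 b1 b2 b3 b4 b5 b6 b7 b8 b9 \<longrightarrow> R b0 b1 b2 b3 b4 b5 b6 b7 b8 b9"
    apply (intro all_boolI)
    apply (simp_all only: ok5_def simp_thms)
    apply (simp_all only: eq0 eq1 eq2 eq3 reps ex0 ex1 ex2 ex3 ex4 ex5 ex6 ex7 ex8 ex9)
    done
  then show "ok5 b0 b1 b2 b3 b4 b5 b6 b7 b8 b9 \<Longrightarrow> R b0 b1 b2 b3 b4 b5 b6 b7 b8 b9" by blast
qed

text \<open>Flag vectors over the type of four labelled vertices without edges; the six bits tell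
  which of the pairs 01, 02, 03, 12, 13, 23 form an edge with a fifth vertex. \<open>u1\<close>,
  \<open>u2\<close> and \<open>u3\<close> belong to the types with one, two and three edges.\<close>

definition u0 :: "bool \<Rightarrow> bool \<Rightarrow> bool \<Rightarrow> bool \<Rightarrow> bool \<Rightarrow> bool \<Rightarrow> real list" where
  "u0 a b c d e f = (if a then (if b then (if c then (if d then (if e then (if f then [1199, -122, 0] else [3871, -13685, 0]) else (if f then [1953, -5637, 0] else [708, 3973, 0])) else (if e then (if f then [-5108, -5303, 0] else [-1959, 3719, 0]) else (if f then [-3413, 1214, 0] else [-566, -495, 0]))) else (if d then (if e then (if f then [5838, -10418, 0] else [8009, 2475, 0]) else (if f then [2864, 6311, 0] else [28449, -1563, 0])) else (if e then (if f then [1643, 9946, 0] else [12607, 5735, -1817]) else (if f then [-10751, 10552, 1817] else [13065, 491, 0])))) else (if c then (if d then (if e then (if f then [-1183, -9896, 0] else [5346, 2474, 0]) else (if f then [1632, 12584, 0] else [2689, 16632, 1817])) else (if e then (if f then [-13782, 6487, 0] else [581, -1053, 0]) else (if f then [-15775, 2321, -1817] else [-153, 1684, 0]))) else (if d then (if e then (if f then [5154, 2065, 0] else [2548, -1088, 0]) else (if f then [1005, 8495, -1817] else [14491, -289, 0])) else (if e then (if f then [-15405, 14497, 1817] else [1281, -1101, 0]) else (if f then [-4753, 8706, 0] else [-1004, 1766, 0]))))) else (if b then (if c then (if d then (if e then (if f then [-3075, -2700, 0] else [4163, 189, 0]) else (if f then [-1053, 2628, 0] else [9356, -10618, -1817]))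 else (if e then (if f then [-15037, 2796, 0] else [-4969, -4557, 1817]) else (if f then [-9646, 3926, 0] else [-4190, -1826, 0]))) else (if d then (if e then (if f then [187, 4732, 0] else [11811, 1616, 1817]) else (if f then [401, 316, 0] else [14738, -2144, 0])) else (if e then (if f then [39, -14581, -1817] else [-949, -10349, 0]) else (if f then [-4383, 3015, 0] else [-292, -2402, 0])))) else (if c then (if d then (if e then (if f then [-13771, 5153, 0] else [4702, -6673, -1817]) else (if f then [-9879, -3684, 1817] else [-951, -6286, 0])) else (if e then (if f then [-5557, 446, 0] else [-1057, -1788, 0]) else (if f then [-6969, 4176, 0] else [-5876, 297, 0]))) else (if d then (if e then (if f then [4850, 2234, 0] else [4087, -3650, 0]) else (if f then [2460, 3966, 0] else [2857, -4267, 0])) else (if e then (if f then [-140, 3130, 0] else [-2733, -6213, 0]) else (if f then [-6357, 11450, 0] else [-693, 74, 0]))))))"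

definition u1 :: "bool \<Rightarrow> bool \<Rightarrow> bool \<Rightarrow> bool \<Rightarrow> bool \<Rightarrow> bool \<Rightarrow> real list" where
  "u1 a b c d e f = (if a then (if b then (if c then (if d then (if e then (if f then [0, 0, 0] else [-21488, 2437, -1598]) else (if f then [-21223, -118, 249] else [8114, -1000, 4463])) else (if e then (if f then [-19346, -1773, 1294] else [3714, 2889, 721]) else (if f then [2671, 8212, -6194] else [392, 453, -45]))) else (if d then (if e then (if f then [0, 0, 0] else [-25442, 1452, 9763]) else (if f then [-25034, 3675, 16632] else [11015, -428, 12])) else (if e then (if f then [9956, 4403, -3977] else [-10910, 9447, 4174]) else (if f then [6149, 12087, 6978] else [13316, 317, 3452])))) else (if c then (if d then (if e then (if f then [0, 0, 0] else [-20594, -2314, -1749]) else (if f then [8014, 4764, -791] else [-10966, 8606, -977])) else (if e then (if f then [-20914, 577, 8500] else [11104, -1087, 357]) else (if f then [17502, 2080, 3957] else [8911, 3364, 821]))) else (if d then (if e then (if f then [0, 0, 0] else [4074, 11650, -2730]) else (if f then [7718, 15396, 3709] else [6979, 1567, 11045])) else (if e then (if f then [12081, 12070, 4088] else [4523, 3571, 8594]) else (if f then [25865, 13607, -966] else [18889, 15264, 3018]))))) else (if b then (if c then (if d then (if e then (if f then [0, 0, 0] else [-14485, -19132, 5784]) else (if f then [-10620, 1853, -18652] else [-7904, -6680, -8635])) else (if e then (if f then [-11347, 2519, -15290] else [3503, -15845, -6485]) else (if f then [1851, -12513, 1033] else [-5226, -7217, -3919]))) else (if d then (if e then (if f then [0,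 0, 0] else [-11300, -10816, -765]) else (if f then [-11957, -6242, 603] else [5915, -616, 1413])) else (if e then (if f then [2841, -9240, -182] else [10909, -2661, -125]) else (if f then [292, 1150, -5621] else [-831, -3724, -920])))) else (if c then (if d then (if e then (if f then [0, 0, 0] else [-5370, -16717, -2469]) else (if f then [4379, -11849, -2265] else [9677, -2489, 244])) else (if e then (if f then [-12904, -6402, 2226] else [3506, 1272, -5804]) else (if f then [352, 1024, -10404] else [-4251, -1921, -3060]))) else (if d then (if e then (if f then [0, 0, 0] else [-4865, -9331, 6834]) else (if f then [-4686, -1002, -965] else [14801, -8760, 9219])) else (if e then (if f then [-10055, 3828, -5218] else [5529, -434, 1886]) else (if f then [5676, 13722, -11556] else [4695, 299, -30]))))))"

definition u2 :: "bool \<Rightarrow> bool \<Rightarrow> bool \<Rightarrow> bool \<Rightarrow> bool \<Rightarrow> bool \<Rightarrow> real list" where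
  "u2 a b c d e f = (if a then (if b then (if c then (if d then [0, 0, 0, 0, 0, 0, 0, 0, 0, 0, 0] else (if e then [0, 0, 0, 0, 0, 0, 0, 0, 0, 0, 0] else (if f then [0, 0, 0, 0, 0, 0, 0, 0, 0, 0, 0] else [-8908, 0, 11130, 0, -1547, 0, 0, -1207, 1924, 0, -144]))) else (if d then (if e then [0, 0, 0, 0, 0, 0, 0, 0, 0, 0, 0] else (if f then [-15105, 0, 0, 4756, -3238, -1487, 0, 0, 0, 0, -237] else [-3727, 0, 0, 17856, -822, -3015, 0, 0, 0, 0, -10])) else (if e then (if f then [0, 0, 0, 0, 0, 0, 0, 0, 0, 0, 0] else [-24203, 27619, 0, 0, -2217, 0, 4410, 0, 0, -1373, -400]) else (if f then [7622, 2297, 7498, 5443, -1570, -568, 2678, 5886, -337, -374, 188] else [-2837, -4157, 7215, 11670, 8575, 13508, -1690, -1141, -2763, 5427, 1723])))) else (if c then (if d then (if e then [0, 0, 0, 0, 0, 0, 0, 0, 0, 0, 0] else (if f then [0, 0, 0, 0, 0, 0, 0, 0, 0, 0, 0] else [-24203, -27619, 0, 0, -2217, 0, -4410, 0, 0, 1373, -400])) else (if e then (if f then [-15105, 0, 0, -4756, -3238, 1487, 0, 0, 0, 0, -237] else [-3727, 0, 0, -17856, -822, 3015, 0, 0, 0, 0, -10]) else (if f then [7622, -2297, 7498, -5443, -1570, 568, -2678, 5886, -337, 374, 188] else [-2837, 4157, 7215, -11670, 8575, -13508, 1690, -1141, -2763, -5427, 1723]))) else (if d then (if e then (if f then [0,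 0, 0, 0, 0, 0, 0, 0, 0, 0, 0] else [-8908, 0, -11130, 0, -1547, 0, 0, 1207, -1924, 0, -144]) else (if f then [7622, -2297, -7498, 5443, -1570, -568, -2678, -5886, 337, 374, 188] else [-2837, 4157, -7215, 11670, 8575, 13508, 1690, 1141, 2763, -5427, 1723])) else (if e then (if f then [7622, 2297, -7498, -5443, -1570, 568, 2678, -5886, 337, -374, 188] else [-2837, -4157, -7215, -11670, 8575, -13508, -1690, 1141, 2763, 5427, 1723]) else (if f then [14209, 0, 0, 0, 2440, 0, 0, 0, 0, 0, 216] else [-1283, 0, 0, 0, -320, 0, 0, 0, 0, 0, -21]))))) else (if b then (if c then (if d then (if e then (if f then [0, 0, 0, 0, 0, 0, 0, 0, 0, 0, 0] else [-8641, 0, 0, 0, -1507, 0, 0, 0, 0, 0, -132]) else (if f then [0, 0, 0, 0, 0, 0, 0, 0, 0, 0, 0] else [-917, -6691, 9680, 8590, 3090, -608, -5316, 7564, -448, 782, -107])) else (if e then (if f then [0, 0, 0, 0, 0, 0, 0, 0, 0, 0, 0] else [-917, 6691, 9680, -8590, 3090, 608, 5316, 7564, -448, -782, -107]) else (if f then [0, 0, 0, 0, 0, 0, 0, 0, 0, 0, 0] else [8326, 0, 17668, 0, 412, 0, 0, -4611, 3699, 0, 165]))) else (if d then (if e then (if f then [0, 0, 0, 0, 0, 0, 0, 0, 0, 0, 0] else [-917, 6691, -9680, 8590, 3090, -608, 5316, -7564, 448, -782, -107]) else (if f then [-3996, 0, 0, 6248, -1502, -1907, 0, 0, 0, 0,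 -68] else [7191, 0, 0, 6744, 2096, -2096, 0, 0, 0, 0, 120])) else (if e then (if f then [15262, -7038, 0, 0, -12226, 0, 13268, 0, 0, -1509, 738] else [1776, 26646, 0, 0, 21979, 0, -9437, 0, 0, 1482, -996]) else (if f then [14399, 8427, 4433, 2196, 677, 446, 3245, 2680, 11, -613, 231] else [7271, 4882, 15117, 6695, 1243, -13522, 7141, -4495, -858, 5303, -2061])))) else (if c then (if d then (if e then (if f then [0, 0, 0, 0, 0, 0, 0, 0, 0, 0, 0] else [-917, -6691, -9680, -8590, 3090, 608, -5316, -7564, 448, 782, -107]) else (if f then [15262, 7038, 0, 0, -12226, 0, -13268, 0, 0, 1509, 738] else [1776, -26646, 0, 0, 21979, 0, 9437, 0, 0, -1482, -996])) else (if e then (if f then [-3996, 0, 0, -6248, -1502, 1907, 0, 0, 0, 0, -68] else [7191, 0, 0, -6744, 2096, 2096, 0, 0, 0, 0, 120]) else (if f then [14399, -8427, 4433, -2196, 677, -446, -3245, 2680, 11, 613, 231] else [7271, -4882, 15117, -6695, 1243, 13522, -7141, -4495, -858, -5303, -2061]))) else (if d then (if e then (if f then [0, 0, 0, 0, 0, 0, 0, 0, 0, 0, 0] else [8326, 0, -17668, 0, 412, 0, 0, 4611, -3699, 0, 165]) else (if f then [14399, -8427, -4433, 2196, 677, 446, -3245, -2680, -11, 613, 231] else [7271, -4882, -15117, 6695, 1243, -13522, -7141, 4495, 858, -5303, -2061])) else (if e then (if f then [14399, 8427, -4433, -2196, 677, -446, 3245, -2680, -11, -613, 231] else [7271, 4882,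 -15117, -6695, 1243, 13522, 7141, 4495, 858, 5303, -2061]) else (if f then [15419, 0, 0, 0, 2717, 0, 0, 0, 0, 0, 235] else [1719, 0, 0, 0, 275, 0, 0, 0, 0, 0, 29]))))))"

definition u3 :: "bool \<Rightarrow> bool \<Rightarrow> bool \<Rightarrow> bool \<Rightarrow> bool \<Rightarrow> bool \<Rightarrow> real list" where
  "u3 a b c d e f = (if a then (if b then (if c then (if d then [0, 0] else (if e then [0, 0] else (if f then [0, 0] else [-18373, -9183]))) else (if d then (if e then [0, 0] else (if f then [0, 0] else [-7724, 5983])) else (if e then [0, 0] else (if f then [0, 0] else [7030, -7774])))) else (if c then (if d then [0, 0] else (if e then [0, 0] else (if f then [6447, -12901] else [-4754, -3402]))) else (if d then (if e then (if f then [0, 0] else [-2845, 1327]) else (if f then [0, 0] else [-4589, 7234])) else (if e then (if f then [-4783, -3106] else [6166, -8625]) else (if f then [-10280, -3849] else [-1713, -6973]))))) else (if b then (if c then (if d then [0, 0] else (if e then (if f then [0, 0] else [7648, -13122]) else (if f then [0, 0] else [-7586, -2037]))) else (if d then (if e then [0, 0] else (if f then [-6119, 2723] else [356, 5554])) else (if e then (if f then [674, -4842] else [-162, -7446]) else (if f then [-358, -5930] else [1370, -7709])))) else (if c then (if d then (if e then (if f then [0, 0] else [-1649, 12751]) else (if f then [2614, 11256] else [-28543, 11385])) else (if e then (if f then [4486, -3482] else [11143, -5836]) else (if f then [6562, -3918] else [-4407, -11673]))) else (if d then (if e then (if f then [0, 0] else [20839, 12317]) else (if f then [17171, 13660] else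 [2831, 24345])) else (if e then (if f then [27631, 8999] else [2629, -918]) else (if f then [1792, -458] else [377, 138]))))))"

text \<open>Flags over a type of two labelled vertices x, y with two free vertices p, q. The first
  two bits are the conjunction and the disjunction of xyp and xyq, so that only their number is
  seen; the others are xpq and ypq.\<close>

definition u4 :: "bool \<Rightarrow> bool \<Rightarrow> bool \<Rightarrow> bool \<Rightarrow> real list" where
  "u4 a b c d = (if a then (if b then (if c then (if d then [0, 0, 0] else [87, -3471, -1259]) else (if d then [87, 3471, 1259] else [1027, 0, 0])) else [0, 0, 0]) else (if b then (if c then (if d then [-6203, 0, 0] else [-1241, -2668, -1622]) else (if d then [-1241, 2668, 1622] else [6804, 0, 0])) else (if c then (if d then [-7903, 0, 0] else [861, 2265, -3862]) else (if d then [861, -2265, 3862] else [6851, 0, 0]))))"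

text \<open>A four-vertex 3-graph with at most three edges can be relabelled so that its edge bits
  are one of FFFF, FFFT, FFTT, FTTT. All other patterns get the empty vector and so contribute
  nothing to the sum over the 24 labellings.\<close>

definition uu :: "bool \<Rightarrow> bool \<Rightarrow> bool \<Rightarrow> bool \<Rightarrow> bool \<Rightarrow> bool \<Rightarrow> bool \<Rightarrow> bool \<Rightarrow> bool \<Rightarrow> bool \<Rightarrow> real list" where
  "uu k l m n a b c d e f = (if k then [] else if l then (if m \<and> n then u3 a b c d e f else [])
     else if m then (if n then u2 a b c d e f else []) else if n then u1 a b c d e f else u0 a b c d e f)"

definition qq :: "bool \<Rightarrow> bool \<Rightarrow> bool \<Rightarrow> bool \<Rightarrow> bool \<Rightarrow> bool \<Rightarrow> bool \<Rightarrow> bool \<Rightarrow> bool \<Rightarrow> bool \<Rightarrow> bool \<Rightarrow> bool \<Rightarrow> bool \<Rightarrow> bool \<Rightarrow> bool \<Rightarrow> bool \<Rightarrow> real" where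
  "qq k l m n a b c d e f a' b' c' d' e' f' = dotl (uu k l m n a b c d e f) (uu k l m n a' b' c' d' e' f')"

definition s16 :: "bool \<Rightarrow> bool \<Rightarrow> bool \<Rightarrow> bool \<Rightarrow> bool \<Rightarrow> bool \<Rightarrow> bool \<Rightarrow> bool \<Rightarrow> bool \<Rightarrow> bool \<Rightarrow> bool \<Rightarrow> bool \<Rightarrow> bool \<Rightarrow> bool \<Rightarrow> bool \<Rightarrow> bool \<Rightarrow> real" where
  "s16 m012 m013 m023 m123 p01 p02 p03 p12 p13 p23 q01 q02 q03 q12 q13 q23 =
    qq m012 m013 m023 m123 p01 p02 p03 p12 p13 p23 q01 q02 q03 q12 q13 q23 +
    qq m013 m012 m023 m123 p01 p03 p02 p13 p12 p23 q01 q03 q02 q13 q12 q23 +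
    qq m012 m023 m013 m123 p02 p01 p03 p12 p23 p13 q02 q01 q03 q12 q23 q13 +
    qq m023 m012 m013 m123 p02 p03 p01 p23 p12 p13 q02 q03 q01 q23 q12 q13 +
    qq m013 m023 m012 m123 p03 p01 p02 p13 p23 p12 q03 q01 q02 q13 q23 q12 +
    qq m023 m013 m012 m123 p03 p02 p01 p23 p13 p12 q03 q02 q01 q23 q13 q12 +
    qq m012 m013 m123 m023 p01 p12 p13 p02 p03 p23 q01 q12 q13 q02 q03 q23 +
    qq m013 m012 m123 m023 p01 p13 p12 p03 p02 p23 q01 q13 q12 q03 q02 q23 +
    qq m012 m123 m013 m023 p12 p01 p13 p02 p23 p03 q12 q01 q13 q02 q23 q03 +
    qq m123 m012 m013 m023 p12 p13 p01 p23 p02 p03 q12 q13 q01 q23 q02 q03 +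
    qq m013 m123 m012 m023 p13 p01 p12 p03 p23 p02 q13 q01 q12 q03 q23 q02 +
    qq m123 m013 m012 m023 p13 p12 p01 p23 p03 p02 q13 q12 q01 q23 q03 q02 +
    qq m012 m023 m123 m013 p02 p12 p23 p01 p03 p13 q02 q12 q23 q01 q03 q13 +
    qq m023 m012 m123 m013 p02 p23 p12 p03 p01 p13 q02 q23 q12 q03 q01 q13 +
    qq m012 m123 m023 m013 p12 p02 p23 p01 p13 p03 q12 q02 q23 q01 q13 q03 +
    qq m123 m012 m023 m013 p12 p23 p02 p13 p01 p03 q12 q23 q02 q13 q01 q03 +
    qq m023 m123 m012 m013 p23 p02 p12 p03 p13 p01 q23 q02 q12 q03 q13 q01 +
    qq m123 m023 m012 m013 p23 p12 p02 p13 p03 p01 q23 q12 q02 q13 q03 q01 +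
    qq m013 m023 m123 m012 p03 p13 p23 p01 p02 p12 q03 q13 q23 q01 q02 q12 +
    qq m023 m013 m123 m012 p03 p23 p13 p02 p01 p12 q03 q23 q13 q02 q01 q12 +
    qq m013 m123 m023 m012 p13 p03 p23 p01 p12 p02 q13 q03 q23 q01 q12 q02 +
    qq m123 m013 m023 m012 p13 p23 p03 p12 p01 p02 q13 q23 q03 q12 q01 q02 +
    qq m023 m123 m013 m012 p23 p03 p13 p02 p12 p01 q23 q03 q13 q02 q12 q01 +
    qq m123 m023 m013 m012 p23 p13 p03 p12 p02 p01 q23 q13 q03 q12 q02 q01"

definition rr :: "bool \<Rightarrow> bool \<Rightarrow> bool \<Rightarrow> bool \<Rightarrow> bool \<Rightarrow> bool \<Rightarrow> bool \<Rightarrow> bool \<Rightarrow> real" where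
  "rr x y z w x' y' z' w' = dotl (u4 (x \<and> y) (x \<or> y) z w) (u4 (x' \<and> y') (x' \<or> y') z' w')"

text \<open>The summand of Phi at an edge, as a function of which of its three vertices lie in
  A.\<close>

definition hh :: "bool \<Rightarrow> bool \<Rightarrow> bool \<Rightarrow> real" where
  "hh a b c = (if a then (if b then (if c then - 38 else 1) else if c then 1 else - 19)
     else if b then (if c then 1 else - 19) else if c then - 19 else 0)"

text \<open>The root triple abc has bit e and three further vertices form a triple with bit d; the
  bits xi, yi, zi tell whether the i-th of them forms an edge with ab, ac, bc. For an edge abc the
  three \<open>hh\<close> terms are contributions to Phi of the three sets of vertices joined to two
  of these pairs. The subtracted numbers are 67500 and 183978 times 5359 or -4641, that is,
  multiples of the surplus of an edge indicator over 0.4641.\<close>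

definition rt :: "bool \<Rightarrow> bool \<Rightarrow> bool \<Rightarrow> bool \<Rightarrow> bool \<Rightarrow> bool \<Rightarrow> bool \<Rightarrow> bool \<Rightarrow> bool \<Rightarrow> bool \<Rightarrow> bool \<Rightarrow> real" where
  "rt e x1 y1 z1 x2 y2 z2 x3 y3 z3 d = (if e then
      (if d then 6000000 * (hh (y1 \<and> z1) (y2 \<and> z2) (y3 \<and> z3) + hh (x1 \<and> z1) (x2 \<and> z2) (x3 \<and> z3) + hh (x1 \<and> y1) (x2 \<and> y2) (x3 \<and> y3)) else 0)
      - (if (x1 = (y1 = z1)) \<and> (x2 = (y2 = z2)) \<and> (x3 = (y3 = z3)) then 0 else if d then 361732500 else - 313267500)
    else - (if x1 \<and> y1 \<and> z1 \<and> x2 \<and> y2 \<and> z2 \<and> x3 \<and> y3 \<and> z3 then 0 else if d then 985938102 else - 853841898))"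

definition r2 :: "bool \<Rightarrow> bool \<Rightarrow> bool \<Rightarrow> bool \<Rightarrow> bool \<Rightarrow> bool \<Rightarrow> bool \<Rightarrow> bool \<Rightarrow> real" where
  "r2 x y z w x' y' z' w' = rr x y z w x' y' z' w' + rr x y w z x' y' w' z'"

text \<open>The objective summed over all root triples, minus symmetrised squares. The squares have
  nonnegative averages, so a positive lower bound on all good 3-graphs forces the objective to have
  a positive average.\<close>

definition S6 :: "bool \<Rightarrow> bool \<Rightarrow> bool \<Rightarrow> bool \<Rightarrow> bool \<Rightarrow> bool \<Rightarrow> bool \<Rightarrow> bool \<Rightarrow> bool \<Rightarrow> bool \<Rightarrow> bool \<Rightarrow> bool \<Rightarrow> bool \<Rightarrow> bool \<Rightarrow> bool \<Rightarrow> bool \<Rightarrow> bool \<Rightarrow> bool \<Rightarrow> bool \<Rightarrow> bool \<Rightarrow> real" where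
  "S6 b012 b013 b023 b123 b014 b024 b034 b124 b134 b234 b015 b025 b035 b125 b135 b235 b045 b145 b245 b345 =
   rt b012 b013 b023 b123 b014 b024 b124 b015 b025 b125 b345
   + rt b013 b012 b023 b123 b014 b034 b134 b015 b035 b135 b245
   + rt b014 b012 b024 b124 b013 b034 b134 b015 b045 b145 b235
   + rt b015 b012 b025 b125 b013 b035 b135 b014 b045 b145 b234
   + rt b023 b012 b013 b123 b024 b034 b234 b025 b035 b235 b145
   + rt b024 b012 b014 b124 b023 b034 b234 b025 b045 b245 b135
   + rt b025 b012 b015 b125 b023 b035 b235 b024 b045 b245 b134
   + rt b034 b013 b014 b134 b023 b024 b234 b035 b045 b345 b125
   + rt b035 b013 b015 b135 b023 b025 b235 b034 b045 b345 b124
   + rt b045 b014 b015 b145 b024 b025 b245 b034 b035 b345 b123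
   + rt b123 b012 b013 b023 b124 b134 b234 b125 b135 b235 b045
   + rt b124 b012 b014 b024 b123 b134 b234 b125 b145 b245 b035
   + rt b125 b012 b015 b025 b123 b135 b235 b124 b145 b245 b034
   + rt b134 b013 b014 b034 b123 b124 b234 b135 b145 b345 b025
   + rt b135 b013 b015 b035 b123 b125 b235 b134 b145 b345 b024
   + rt b145 b014 b015 b045 b124 b125 b245 b134 b135 b345 b023
   + rt b234 b023 b024 b034 b123 b124 b134 b235 b245 b345 b015
   + rt b235 b023 b025 b035 b123 b125 b135 b234 b245 b345 b014
   + rt b245 b024 b025 b045 b124 b125 b145 b234 b235 b345 b013
   + rt b345 b034 b035 b045 b134 b135 b145 b234 b235 b245 b012
   - (s16 b234 b235 b245 b345 b023 b024 b025 b034 b035 b045 b123 b124 b125 b134 b135 b145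
   + s16 b134 b135 b145 b345 b013 b014 b015 b034 b035 b045 b123 b124 b125 b234 b235 b245
   + s16 b124 b125 b145 b245 b012 b014 b015 b024 b025 b045 b123 b134 b135 b234 b235 b345
   + s16 b123 b125 b135 b235 b012 b013 b015 b023 b025 b035 b124 b134 b145 b234 b245 b345
   + s16 b123 b124 b134 b234 b012 b013 b014 b023 b024 b034 b125 b135 b145 b235 b245 b345
   + s16 b034 b035 b045 b345 b013 b014 b015 b134 b135 b145 b023 b024 b025 b234 b235 b245
   + s16 b024 b025 b045 b245 b012 b014 b015 b124 b125 b145 b023 b034 b035 b234 b235 b345
   + s16 b023 b025 b035 b235 b012 b013 b015 b123 b125 b135 b024 b034 b045 b234 b245 b345
   + s16 b023 b024 b034 b234 b012 b013 b014 b123 b124 b134 b025 b035 b045 b235 b245 b345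
   + s16 b014 b015 b045 b145 b012 b024 b025 b124 b125 b245 b013 b034 b035 b134 b135 b345
   + s16 b013 b015 b035 b135 b012 b023 b025 b123 b125 b235 b014 b034 b045 b134 b145 b345
   + s16 b013 b014 b034 b134 b012 b023 b024 b123 b124 b234 b015 b035 b045 b135 b145 b345
   + s16 b012 b015 b025 b125 b013 b023 b035 b123 b135 b235 b014 b024 b045 b124 b145 b245
   + s16 b012 b014 b024 b124 b013 b023 b034 b123 b134 b234 b015 b025 b045 b125 b145 b245
   + s16 b012 b013 b023 b123 b014 b024 b034 b124 b134 b234 b015 b025 b035 b125 b135 b235)
   - 4 * (r2 b012 b013 b023 b123 b014 b015 b045 b145
   + r2 b012 b014 b024 b124 b013 b015 b035 b135
   + r2 b012 b015 b025 b125 b013 b014 b034 b134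
   + r2 b012 b023 b013 b123 b024 b025 b045 b245
   + r2 b012 b024 b014 b124 b023 b025 b035 b235
   + r2 b012 b025 b015 b125 b023 b024 b034 b234
   + r2 b013 b023 b012 b123 b034 b035 b045 b345
   + r2 b013 b034 b014 b134 b023 b035 b025 b235
   + r2 b013 b035 b015 b135 b023 b034 b024 b234
   + r2 b014 b024 b012 b124 b034 b045 b035 b345
   + r2 b014 b034 b013 b134 b024 b045 b025 b245
   + r2 b014 b045 b015 b145 b024 b034 b023 b234
   + r2 b015 b025 b012 b125 b035 b045 b034 b345
   + r2 b015 b035 b013 b135 b025 b045 b024 b245
   + r2 b015 b045 b014 b145 b025 b035 b023 b235
   + r2 b012 b123 b013 b023 b124 b125 b145 b245
   + r2 b012 b124 b014 b024 b123 b125 b135 b235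
   + r2 b012 b125 b015 b025 b123 b124 b134 b234
   + r2 b013 b123 b012 b023 b134 b135 b145 b345
   + r2 b013 b134 b014 b034 b123 b135 b125 b235
   + r2 b013 b135 b015 b035 b123 b134 b124 b234
   + r2 b014 b124 b012 b024 b134 b145 b135 b345
   + r2 b014 b134 b013 b034 b124 b145 b125 b245
   + r2 b014 b145 b015 b045 b124 b134 b123 b234
   + r2 b015 b125 b012 b025 b135 b145 b134 b345
   + r2 b015 b135 b013 b035 b125 b145 b124 b245
   + r2 b015 b145 b014 b045 b125 b135 b123 b235
   + r2 b023 b123 b012 b013 b234 b235 b245 b345
   + r2 b023 b234 b024 b034 b123 b235 b125 b135
   + r2 b023 b235 b025 b035 b123 b234 b124 b134
   + r2 b024 b124 b012 b014 b234 b245 b235 b345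
   + r2 b024 b234 b023 b034 b124 b245 b125 b145
   + r2 b024 b245 b025 b045 b124 b234 b123 b134
   + r2 b025 b125 b012 b015 b235 b245 b234 b345
   + r2 b025 b235 b023 b035 b125 b245 b124 b145
   + r2 b025 b245 b024 b045 b125 b235 b123 b135
   + r2 b034 b134 b013 b014 b234 b345 b235 b245
   + r2 b034 b234 b023 b024 b134 b345 b135 b145
   + r2 b034 b345 b035 b045 b134 b234 b123 b124
   + r2 b035 b135 b013 b015 b235 b345 b234 b245
   + r2 b035 b235 b023 b025 b135 b345 b134 b145
   + r2 b035 b345 b034 b045 b135 b235 b123 b125
   + r2 b045 b145 b014 b015 b245 b345 b234 b235
   + r2 b045 b245 b024 b025 b145 b345 b134 b135
   + r2 b045 b345 b034 b035 b145 b245 b124 b125)"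

text \<open>Used to compare the degrees of two vertices among six, after cancelling the four triples
  that contain both.\<close>

definition le6 :: "bool \<Rightarrow> bool \<Rightarrow> bool \<Rightarrow> bool \<Rightarrow> bool \<Rightarrow> bool \<Rightarrow> bool \<Rightarrow> bool \<Rightarrow> bool \<Rightarrow> bool \<Rightarrow> bool \<Rightarrow> bool \<Rightarrow> bool" where
  "le6 a b c d e f a' b' c' d' e' f' \<longleftrightarrow> (of_bool a + of_bool b + of_bool c + of_bool d + of_bool e + of_bool f :: nat)
     \<le> of_bool a' + of_bool b' + of_bool c' + of_bool d' + of_bool e' + of_bool f'"

text \<open>The last five clauses say that vertex 5 has least degree. This breaks the symmetry and
  cuts down the one-vertex extensions of a representative. Four of the five-vertex conditions appear
  here; the one on 0, 1, 2, 3, 5 is tested on its own before the remaining bits are split.\<close>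

definition okx :: "bool \<Rightarrow> bool \<Rightarrow> bool \<Rightarrow> bool \<Rightarrow> bool \<Rightarrow> bool \<Rightarrow> bool \<Rightarrow> bool \<Rightarrow> bool \<Rightarrow> bool \<Rightarrow> bool \<Rightarrow> bool \<Rightarrow> bool \<Rightarrow> bool \<Rightarrow> bool \<Rightarrow> bool \<Rightarrow> bool \<Rightarrow> bool \<Rightarrow> bool \<Rightarrow> bool \<Rightarrow> bool" where
  "okx b012 b013 b023 b123 b014 b024 b034 b124 b134 b234 b015 b025 b035 b125 b135 b235 b045 b145 b245 b345 \<longleftrightarrow>
    ok5 b123 b124 b134 b234 b125 b135 b145 b235 b245 b345 \<and>
    ok5 b023 b024 b034 b234 b025 b035 b045 b235 b245 b345 \<and>
    ok5 b013 b014 b034 b134 b015 b035 b045 b135 b145 b345 \<and>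
    ok5 b012 b014 b024 b124 b015 b025 b045 b125 b145 b245 \<and>
    le6 b125 b135 b235 b145 b245 b345 b012 b013 b023 b014 b024 b034 \<and>
    le6 b025 b035 b235 b045 b245 b345 b012 b013 b123 b014 b124 b134 \<and>
    le6 b015 b035 b135 b045 b145 b345 b012 b023 b123 b024 b124 b234 \<and>
    le6 b015 b025 b125 b045 b145 b245 b013 b023 b123 b034 b134 b234 \<and>
    le6 b015 b025 b035 b125 b135 b235 b014 b024 b034 b124 b134 b234"

lemmas u0_eqs = u0_def[abs_def, THEN meta_eq_to_obj_eq, simplified fun_eq_iff all_bool if_True if_False]
lemmas u1_eqs = u1_def[abs_def, THEN meta_eq_to_obj_eq, simplified fun_eq_iff all_bool if_True if_False]
lemmas u2_eqs = u2_def[abs_def, THEN meta_eq_to_obj_eq, simplified fun_eq_iff all_bool if_True if_False]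
lemmas u3_eqs = u3_def[abs_def, THEN meta_eq_to_obj_eq, simplified fun_eq_iff all_bool if_True if_False]
lemmas u4_eqs = u4_def[abs_def, THEN meta_eq_to_obj_eq, simplified fun_eq_iff all_bool if_True if_False]
text \<open>With the type fixed, labellings whose edge pattern is not canonical drop out before any
  number is inserted.\<close>

lemmas s16_0000 = s16_def[of F F F F, simplified qq_def uu_def if_True if_False simp_thms dotl.simps add_0 add_0_right]
lemmas s16_0001 = s16_def[of F F F T, simplified qq_def uu_def if_True if_False simp_thms dotl.simps add_0 add_0_right]
lemmas s16_0011 = s16_def[of F F T T, simplified qq_def uu_def if_True if_False simp_thms dotl.simps add_0 add_0_right]
lemmas s16_0111 = s16_def[of F T T T, simplified qq_def uu_def if_True if_False simp_thms dotl.simps add_0 add_0_right]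
lemmas hh_eqs = hh_def[abs_def, THEN meta_eq_to_obj_eq, simplified fun_eq_iff all_bool if_True if_False]
text \<open>Relabelling the type and exchanging the two flags leave the symmetrised square
  unchanged. Used as ordered rewrite rules, these four invariances bring every argument into the
  normal form listed in the tables below.\<close>

lemma s16_swap0: "s16 k l m n a b c d e f a' b' c' d' e' f' = s16 k l n m a d e b c f a' d' e' b' c' f'"
  unfolding s16_def qq_def by (simp add: dotl_comm ac_simps)
lemma s16_swap1: "s16 k l m n a b c d e f a' b' c' d' e' f' = s16 k m l n b a c d f e b' a' c' d' f' e'"
  unfolding s16_def qq_def by (simp add: dotl_comm ac_simps)
lemma s16_swap2: "s16 k l m n a b c d e f a' b' c' d' e' f' = s16 l k m n a c b e d f a' c' b' e' d' f'"
  unfolding s16_def qq_def by (simp add: dotl_comm ac_simps)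
lemma s16_swap3: "s16 k l m n a b c d e f a' b' c' d' e' f' = s16 k l m n a' b' c' d' e' f' a b c d e f"
  unfolding s16_def qq_def by (simp add: dotl_comm ac_simps)
lemmas r2_eqs = r2_def[abs_def, THEN meta_eq_to_obj_eq, unfolded rr_def, simplified fun_eq_iff all_bool simp_thms u4_eqs dotl.simps arith_simps rel_simps arith_special simp_thms if_True if_False order_refl mult_zero_left mult_zero_right mult_1_left mult_1_right add_0 add_0_right minus_zero minus_minus]
text \<open>Values of the symmetrised square over the type without edges, for pairs of flags in
  normal form; the tables beginning with \<open>tab1\<close>, \<open>tab2\<close> and
  \<open>tab3\<close> do the same for one, two and three edges. Every six-vertex case looks its
  squares up here.\<close>

lemma tab0_0:
  "s16 F F F F F F F F F F F F F F F F = 11657400"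
  "s16 F F F F F F F F F F F F F F F T = 37345436"
  "s16 F F F F F F F F F F F F F F T T = - 45218508"
  "s16 F F F F F F F F F F F F F T T T = - 99191436"
  "s16 F F F F F F F F F F F F T F T T = 12832968"
  "s16 F F F F F F F F F F F F T T F F = 32190264"
  "s16 F F F F F F F F F F F F T T F T = 23114800"
  "s16 F F F F F F F F F F F F T T T T = 43587338"
  "s16 F F F F F F F F F F F T T T T F = - 27786624"
  "s16 F F F F F F F F F F F T T T T T = - 20465656"
  "s16 F F F F F F F F F F T T T T T T = - 20158440"
  "s16 F F F F F F F F F T F F F F F T = 1154206280"
  "s16 F F F F F F F F F T F F F F T F = - 156998902"
  "s16 F F F F F F F F F T F F F F T T = 383462867"
  "s16 F F F F F F F F F T F F F T T F = - 190789632"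
  "s16 F F F F F F F F F T F F F T T T = 360597250"
  "s16 F F F F F F F F F T F F T F T F = - 584825074"
  "s16 F F F F F F F F F T F F T F T T = 194180358"
  "s16 F F F F F F F F F T F F T T F F = - 371437824"
  "s16 F F F F F F F F F T F F T T F T = - 53064892"
  "s16 F F F F F F F F F T F F T T T F = - 583068092"
  "s16 F F F F F F F F F T F F T T T T = 471472581"
  "s16 F F F F F F F F F T F T T T T F = - 743759264"
  "s16 F F F F F F F F F T F T T T T T = 511351020"
  "s16 F F F F F F F F F T T F F F F F = 194158072"
  "s16 F F F F F F F F F T T F F F F T = 1079596712"
  "s16 F F F F F F F F F T T F F F T F = - 437529680"
  "s16 F F F F F F F F F T T F F F T T = 814349149"
  "s16 F F F F F F F F F T T F F T T F = - 110121520"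
  "s16 F F F F F F F F F T T F F T T T = - 196408014"
  "s16 F F F F F F F F F T T F T F T F = - 1005838262"
  "s16 F F F F F F F F F T T F T F T T = 513251952"
  "s16 F F F F F F F F F T T F T T F F = 6030048"
  "s16 F F F F F F F F F T T F T T F T = 201138230"
  "s16 F F F F F F F F F T T F T T T F = - 243569978"
  "s16 F F F F F F F F F T T F T T T T = - 30130618"
  "s16 F F F F F F F F F T T T T T T F = - 634180904"
  "s16 F F F F F F F F F T T T T T T T = - 64598308"
  "s16 F F F F F F F F T T F F F F T T = 1579320920"
  "s16 F F F F F F F F T T F F F T F F = - 190789632"
  by (simp_all only: s16_0000 u0_eqs dotl.simps arith_simps rel_simps arith_special simp_thms if_True if_False order_refl mult_zero_left mult_zero_right mult_1_left mult_1_right add_0 add_0_right minus_zero minus_minus)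
lemma tab0_1:
  "s16 F F F F F F F F T T F F F T F T = 1327611960"
  "s16 F F F F F F F F T T F F F T T T = 2834641808"
  "s16 F F F F F F F F T T F F T F F F = - 584825074"
  "s16 F F F F F F F F T T F F T F F T = - 8931220"
  "s16 F F F F F F F F T T F F T F T T = 210963284"
  "s16 F F F F F F F F T T F F T T F F = - 597206198"
  "s16 F F F F F F F F T T F F T T F T = 134281191"
  "s16 F F F F F F F F T T F F T T T T = 721561864"
  "s16 F F F F F F F F T T F T F F F F = - 437529680"
  "s16 F F F F F F F F T T F T F F F T = 52549074"
  "s16 F F F F F F F F T T F T F F T F = 32614053"
  "s16 F F F F F F F F T T F T F F T T = 740501447"
  "s16 F F F F F F F F T T F T F T F F = - 384965328"
  "s16 F F F F F F F F T T F T F T F T = 71412661"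
  "s16 F F F F F F F F T T F T F T T F = 493441154"
  "s16 F F F F F F F F T T F T F T T T = 414127645"
  "s16 F F F F F F F F T T F T T F F F = - 384965328"
  "s16 F F F F F F F F T T F T T F F T = - 185099266"
  "s16 F F F F F F F F T T F T T F T F = - 537163017"
  "s16 F F F F F F F F T T F T T F T T = 453046310"
  "s16 F F F F F F F F T T F T T T F F = - 904831547"
  "s16 F F F F F F F F T T F T T T F T = 107005863"
  "s16 F F F F F F F F T T F T T T T F = 113853219"
  "s16 F F F F F F F F T T F T T T T T = 440649976"
  "s16 F F F F F F F F T T T T F F F F = - 509291644"
  "s16 F F F F F F F F T T T T F F F T = - 298611288"
  "s16 F F F F F F F F T T T T F F T T = 523983874"
  "s16 F F F F F F F F T T T T F T F F = - 813705204"
  "s16 F F F F F F F F T T T T F T F T = 120502177"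
  "s16 F F F F F F F F T T T T F T T T = 198872016"
  "s16 F F F F F F F F T T T T T F F F = - 574032934"
  "s16 F F F F F F F F T T T T T F F T = - 1388228076"
  "s16 F F F F F F F F T T T T T F T T = - 309785352"
  "s16 F F F F F F F F T T T T T T F F = - 1413337466"
  "s16 F F F F F F F F T T T T T T F T = - 578724524"
  "s16 F F F F F F F F T T T T T T T T = 78303524"
  "s16 F F F F F F F T T T F F F T T T = 5701241928"
  "s16 F F F F F F F T T T F F T F F F = - 1005838262"
  "s16 F F F F F F F T T T F F T F F T = - 185099266"
  "s16 F F F F F F F T T T F F T F T T = 223520088"
  by (simp_all only: s16_0000 u0_eqs dotl.simps arith_simps rel_simps arith_special simp_thms if_True if_False order_refl mult_zero_left mult_zero_right mult_1_left mult_1_right add_0 add_0_right minus_zero minus_minus)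
lemma tab0_2:
  "s16 F F F F F F F T T T F F T T F F = - 378658356"
  "s16 F F F F F F F T T T F F T T F T = 860101853"
  "s16 F F F F F F F T T T F F T T T T = 980263086"
  "s16 F F F F F F F T T T F T T F F F = - 813705204"
  "s16 F F F F F F F T T T F T T F F T = - 700720592"
  "s16 F F F F F F F T T T F T T F T F = - 1143250393"
  "s16 F F F F F F F T T T F T T F T T = 418879696"
  "s16 F F F F F F F T T T F T T T T F = 521537256"
  "s16 F F F F F F F T T T F T T T T T = 740116708"
  "s16 F F F F F F F T T T T T T F F F = - 1149530304"
  "s16 F F F F F F F T T T T T T F F T = - 2802332698"
  "s16 F F F F F F F T T T T T T F T T = - 966499412"
  "s16 F F F F F F F T T T T T T T T T = 171745188"
  "s16 F F F F F F T F T T F F T F T T = 237487506"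
  "s16 F F F F F F T F T T F F T T F F = 55252662"
  "s16 F F F F F F T F T T F F T T F T = 216264897"
  "s16 F F F F F F T F T T F F T T T T = 571986748"
  "s16 F F F F F F T F T T F T F T F F = - 574032934"
  "s16 F F F F F F T F T T F T F T F T = - 57665868"
  "s16 F F F F F F T F T T F T F T T F = - 186222152"
  "s16 F F F F F F T F T T F T F T T T = - 120358287"
  "s16 F F F F F F T F T T F T T T T F = - 84521022"
  "s16 F F F F F F T F T T F T T T T T = 221055446"
  "s16 F F F F F F T F T T T T F T F F = - 1149530304"
  "s16 F F F F F F T F T T T T F T F T = - 233772552"
  "s16 F F F F F F T F T T T T F T T T = - 157407216"
  "s16 F F F F F F T F T T T T T T T T = - 22232784"
  "s16 F F F F F F T T F F F F T T F F = 1974448352"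
  "s16 F F F F F F T T F F F F T T F T = 1262040298"
  "s16 F F F F F F T T F F F F T T T T = - 62340146"
  "s16 F F F F F F T T F F F T F F F F = - 371437824"
  "s16 F F F F F F T T F F F T F F F T = - 597206198"
  "s16 F F F F F F T T F F F T F F T F = - 558698376"
  "s16 F F F F F F T T F F F T F F T T = - 1179150272"
  "s16 F F F F F F T T F F F T F T F F = 32614053"
  "s16 F F F F F F T T F F F T F T F T = 55252662"
  "s16 F F F F F F T T F F F T F T T F = - 201979236"
  "s16 F F F F F F T T F F F T F T T T = - 139972219"
  "s16 F F F F F F T T F F F T T F F F = 32614053"
  "s16 F F F F F F T T F F F T T F F T = - 378658356"
  by (simp_all only: s16_0000 u0_eqs dotl.simps arith_simps rel_simps arith_special simp_thms if_True if_False order_refl mult_zero_left mult_zero_right mult_1_left mult_1_right add_0 add_0_right minus_zero minus_minus)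
lemma tab0_3:
  "s16 F F F F F F T T F F F T T F T F = - 201979236"
  "s16 F F F F F F T T F F F T T F T T = - 139972219"
  "s16 F F F F F F T T F F F T T T F F = 1262040298"
  "s16 F F F F F F T T F F F T T T F T = - 62340146"
  "s16 F F F F F F T T F F F T T T T F = - 62476108"
  "s16 F F F F F F T T F F F T T T T T = 501474556"
  "s16 F F F F F F T T F F T T F F F F = - 597206198"
  "s16 F F F F F F T T F F T T F F F T = - 1179150272"
  "s16 F F F F F F T T F F T T F F T T = - 1712039504"
  "s16 F F F F F F T T F F T T F T F F = - 378658356"
  "s16 F F F F F F T T F F T T F T F T = - 139972219"
  "s16 F F F F F F T T F F T T F T T T = 446868260"
  "s16 F F F F F F T T F F T T T F F F = 55252662"
  "s16 F F F F F F T T F F T T T F F T = - 139972219"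
  "s16 F F F F F F T T F F T T T F T T = 446868260"
  "s16 F F F F F F T T F F T T T T F F = - 62340146"
  "s16 F F F F F F T T F F T T T T F T = 501474556"
  "s16 F F F F F F T T F F T T T T T T = - 56076872"
  "s16 F F F F F F T T F T F F T T F T = 4590747002"
  "s16 F F F F F F T T F T F F T T T F = 810430732"
  "s16 F F F F F F T T F T F F T T T T = 952660141"
  "s16 F F F F F F T T F T F T F F F F = - 583068092"
  "s16 F F F F F F T T F T F T F F F T = 134281191"
  "s16 F F F F F F T T F T F T F F T F = - 1179150272"
  "s16 F F F F F F T T F T F T F F T T = - 502344792"
  "s16 F F F F F F T T F T F T F T F F = - 537163017"
  "s16 F F F F F F T T F T F T F T F T = 216264897"
  "s16 F F F F F F T T F T F T F T T F = - 94652899"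
  "s16 F F F F F F T T F T F T F T T T = 879844199"
  "s16 F F F F F F T T F T F T T F F F = 493441154"
  "s16 F F F F F F T T F T F T T F F T = 860101853"
  "s16 F F F F F F T T F T F T T F T F = - 94652899"
  "s16 F F F F F F T T F T F T T F T T = 879844199"
  "s16 F F F F F F T T F T F T T T F F = 810430732"
  "s16 F F F F F F T T F T F T T T F T = 952660141"
  "s16 F F F F F F T T F T F T T T T F = 333340776"
  "s16 F F F F F F T T F T F T T T T T = - 294247714"
  "s16 F F F F F F T T F T T F F F F F = 6030048"
  "s16 F F F F F F T T F T T F F F F T = - 201979236"
  "s16 F F F F F F T T F T T F F F T F = - 904831547"
  by (simp_all only: s16_0000 u0_eqs dotl.simps arith_simps rel_simps arith_special simp_thms if_True if_False order_refl mult_zero_left mult_zero_right mult_1_left mult_1_right add_0 add_0_right minus_zero minus_minus)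
lemma tab0_4:
  "s16 F F F F F F T T F T T F F F T T = - 94652899"
  "s16 F F F F F F T T F T T F F T F F = - 298611288"
  "s16 F F F F F F T T F T T F F T F T = - 397381126"
  "s16 F F F F F F T T F T T F F T T F = - 186222152"
  "s16 F F F F F F T T F T T F F T T T = - 38833209"
  "s16 F F F F F F T T F T T F T F F F = - 298611288"
  "s16 F F F F F F T T F T T F T F F T = - 397381126"
  "s16 F F F F F F T T F T T F T F T F = - 1143250393"
  "s16 F F F F F F T T F T T F T F T T = 449203087"
  "s16 F F F F F F T T F T T F T T F F = 880356108"
  "s16 F F F F F F T T F T T F T T F T = 970696832"
  "s16 F F F F F F T T F T T F T T T F = - 455740812"
  "s16 F F F F F F T T F T T F T T T T = - 302487355"
  "s16 F F F F F F T T F T T T F F F F = - 904831547"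
  "s16 F F F F F F T T F T T T F F F T = - 94652899"
  "s16 F F F F F F T T F T T T F F T F = - 4212735684"
  "s16 F F F F F F T T F T T T F F T T = - 624061998"
  "s16 F F F F F F T T F T T T F T F F = - 1143250393"
  "s16 F F F F F F T T F T T T F T F T = 449203087"
  "s16 F F F F F F T T F T T T F T T F = - 528556771"
  "s16 F F F F F F T T F T T T F T T T = - 348841947"
  "s16 F F F F F F T T F T T T T F F F = - 186222152"
  "s16 F F F F F F T T F T T T T F F T = - 38833209"
  "s16 F F F F F F T T F T T T T F T F = - 528556771"
  "s16 F F F F F F T T F T T T T F T T = - 348841947"
  "s16 F F F F F F T T F T T T T T F F = - 455740812"
  "s16 F F F F F F T T F T T T T T F T = - 302487355"
  "s16 F F F F F F T T F T T T T T T F = - 350310452"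
  "s16 F F F F F F T T F T T T T T T T = - 39754200"
  "s16 F F F F F F T T T T F F T T T T = 1886991540"
  "s16 F F F F F F T T T T F T F F F F = - 243569978"
  "s16 F F F F F F T T T T F T F F F T = 107005863"
  "s16 F F F F F F T T T T F T F F T F = - 139972219"
  "s16 F F F F F F T T T T F T F F T T = 879844199"
  "s16 F F F F F F T T T T F T F T F F = - 1388228076"
  "s16 F F F F F F T T T T F T F T F T = - 120358287"
  "s16 F F F F F F T T T T F T F T T F = - 38833209"
  "s16 F F F F F F T T T T F T F T T T = 260551750"
  "s16 F F F F F F T T T T F T T F F F = 120502177"
  "s16 F F F F F F T T T T F T T F F T = 418879696"
  by (simp_all only: s16_0000 u0_eqs dotl.simps arith_simps rel_simps arith_special simp_thms if_True if_False order_refl mult_zero_left mult_zero_right mult_1_left mult_1_right add_0 add_0_right minus_zero minus_minus)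
lemma tab0_5:
  "s16 F F F F F F T T T T F T T F T F = 449203087"
  "s16 F F F F F F T T T T F T T F T T = 1762547680"
  "s16 F F F F F F T T T T F T T T F F = - 455740812"
  "s16 F F F F F F T T T T F T T T F T = 140873268"
  "s16 F F F F F F T T T T F T T T T F = 551051899"
  "s16 F F F F F F T T T T F T T T T T = - 265958362"
  "s16 F F F F F F T T T T T T F F F F = - 1413337466"
  "s16 F F F F F F T T T T T T F F F T = - 528556771"
  "s16 F F F F F F T T T T T T F F T T = 500506656"
  "s16 F F F F F F T T T T T T F T F F = - 2802332698"
  "s16 F F F F F F T T T T T T F T F T = - 128545059"
  "s16 F F F F F F T T T T T T F T T T = - 1153810452"
  "s16 F F F F F F T T T T T T T F F F = - 233772552"
  "s16 F F F F F F T T T T T T T F F T = - 128545059"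
  "s16 F F F F F F T T T T T T T F T T = - 287643250"
  "s16 F F F F F F T T T T T T T T F F = - 393199224"
  "s16 F F F F F F T T T T T T T T F T = - 1172128152"
  "s16 F F F F F F T T T T T T T T T T = - 74881894"
  "s16 F F F F F T T T T F F T T T T F = 2240073080"
  "s16 F F F F F T T T T F F T T T T T = - 1396621300"
  "s16 F F F F F T T T T F T F F F F F = - 743759264"
  "s16 F F F F F T T T T F T F F F F T = - 1712039504"
  "s16 F F F F F T T T T F T F F F T F = 113853219"
  "s16 F F F F F T T T T F T F F F T T = - 624061998"
  "s16 F F F F F T T T T F T F F T T F = - 84521022"
  "s16 F F F F F T T T T F T F F T T T = 500506656"
  "s16 F F F F F T T T T F T F T F T F = 521537256"
  "s16 F F F F F T T T T F T F T F T T = 500506656"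
  "s16 F F F F F T T T T F T F T T F F = 333340776"
  "s16 F F F F F T T T T F T F T T F T = 1165870680"
  "s16 F F F F F T T T T F T F T T T F = 551051899"
  "s16 F F F F F T T T T F T F T T T T = - 1432154936"
  "s16 F F F F F T T T T F T T T T T F = - 1396621300"
  "s16 F F F F F T T T T F T T T T T T = 49171552"
  "s16 F F F F F T T T T T F T T T T T = 2203040860"
  "s16 F F F F F T T T T T T F F F F F = - 634180904"
  "s16 F F F F F T T T T T T F F F F T = 446868260"
  "s16 F F F F F T T T T T T F F F T F = - 578724524"
  "s16 F F F F F T T T T T T F F F T T = - 348841947"
  "s16 F F F F F T T T T T T F F T T F = - 157407216"
  by (simp_all only: s16_0000 u0_eqs dotl.simps arith_simps rel_simps arith_special simp_thms if_True if_False order_refl mult_zero_left mult_zero_right mult_1_left mult_1_right add_0 add_0_right minus_zero minus_minus)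
lemma tab0_6:
  "s16 F F F F F T T T T T T F F T T T = - 1153810452"
  "s16 F F F F F T T T T T T F T F T F = - 966499412"
  "s16 F F F F F T T T T T T F T F T T = - 287643250"
  "s16 F F F F F T T T T T T F T T F F = - 350310452"
  "s16 F F F F F T T T T T T F T T F T = - 1432154936"
  "s16 F F F F F T T T T T T F T T T F = - 1172128152"
  "s16 F F F F F T T T T T T F T T T T = 1516094366"
  "s16 F F F F F T T T T T T T T T T F = 831565424"
  "s16 F F F F F T T T T T T T T T T T = 34259448"
  "s16 F F F F T T T T T T T T T T T T = 34859640"
  by (simp_all only: s16_0000 u0_eqs dotl.simps arith_simps rel_simps arith_special simp_thms if_True if_False order_refl mult_zero_left mult_zero_right mult_1_left mult_1_right add_0 add_0_right minus_zero minus_minus)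
lemma tab1_0:
  "s16 F F F T F F F F F F F F F F F F = 132799956"
  "s16 F F F T F F F F F F F F F F F T = 246931144"
  "s16 F F F T F F F F F F F F F F T T = - 188029390"
  "s16 F F F T F F F F F F F F T F F F = 135457612"
  "s16 F F F T F F F F F F F F T F F T = 103662807"
  "s16 F F F T F F F F F F F F T F T T = - 195790282"
  "s16 F F F T F F F F F F F F T T F F = 441282996"
  "s16 F F F T F F F F F F F F T T F T = 42199431"
  "s16 F F F T F F F F F F F T T F F F = 157503622"
  "s16 F F F T F F F F F F F T T F F T = 216605436"
  "s16 F F F T F F F F F F F T T F T F = - 9400625"
  "s16 F F F T F F F F F F F T T F T T = - 532655227"
  "s16 F F F T F F F F F F F T T T T F = 26704120"
  "s16 F F F T F F F F F F T T T F F F = 11863422"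
  "s16 F F F T F F F F F F T T T F F T = 142246608"
  "s16 F F F T F F F F F F T T T F T T = - 582385422"
  "s16 F F F T F F F F F T F F F F F T = 1538327502"
  "s16 F F F T F F F F F T F F F F T F = - 72145530"
  "s16 F F F T F F F F F T F F F F T T = - 47238358"
  "s16 F F F T F F F F F T F F F T T F = - 984767038"
  "s16 F F F T F F F F F T F F T F F F = 200277706"
  "s16 F F F T F F F F F T F F T F F T = 563587927"
  "s16 F F F T F F F F F T F F T F T F = 211154097"
  "s16 F F F T F F F F F T F F T F T T = - 583012350"
  "s16 F F F T F F F F F T F F T T F F = 673474571"
  "s16 F F F T F F F F F T F F T T F T = - 243946901"
  "s16 F F F T F F F F F T F F T T T F = - 134907207"
  "s16 F F F T F F F F F T F T T F F F = 384176094"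
  "s16 F F F T F F F F F T F T T F F T = 112595082"
  "s16 F F F T F F F F F T F T T F T F = - 278516419"
  "s16 F F F T F F F F F T F T T F T T = - 437142135"
  "s16 F F F T F F F F F T F T T T T F = - 597423102"
  "s16 F F F T F F F F F T T F F F F F = 405551660"
  "s16 F F F T F F F F F T T F F F F T = 1146410856"
  "s16 F F F T F F F F F T T F F F T F = - 177441091"
  "s16 F F F T F F F F F T T F F F T T = 551241518"
  "s16 F F F T F F F F F T T F F T T F = 75760294"
  "s16 F F F T F F F F F T T F T F F F = 233869297"
  "s16 F F F T F F F F F T T F T F F T = - 225036985"
  "s16 F F F T F F F F F T T F T F T F = 502915193"
  by (simp_all only: s16_0001 u1_eqs dotl.simps arith_simps rel_simps arith_special simp_thms if_True if_False order_refl mult_zero_left mult_zero_right mult_1_left mult_1_right add_0 add_0_right minus_zero minus_minus)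
lemma tab1_1:
  "s16 F F F T F F F F F T T F T F T T = - 1354470886"
  "s16 F F F T F F F F F T T F T T F F = 479606196"
  "s16 F F F T F F F F F T T F T T F T = 343762725"
  "s16 F F F T F F F F F T T F T T T F = - 1136291353"
  "s16 F F F T F F F F F T T T T F F F = 24531662"
  "s16 F F F T F F F F F T T T T F F T = 780127842"
  "s16 F F F T F F F F F T T T T F T F = 33189911"
  "s16 F F F T F F F F F T T T T F T T = - 1165597942"
  "s16 F F F T F F F F F T T T T T T F = - 891518614"
  "s16 F F F T F F F F T T F F F F T T = 648634600"
  "s16 F F F T F F F F T T F F F T F F = - 984767038"
  "s16 F F F T F F F F T T F F F T F T = 102816762"
  "s16 F F F T F F F F T T F F T F F F = - 307655492"
  "s16 F F F T F F F F T T F F T F F T = 59322910"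
  "s16 F F F T F F F F T T F F T F T T = 16295414"
  "s16 F F F T F F F F T T F F T T F F = - 831675464"
  "s16 F F F T F F F F T T F F T T F T = - 313357973"
  "s16 F F F T F F F F T T F T F F F F = - 180070153"
  "s16 F F F T F F F F T T F T F F F T = - 165386159"
  "s16 F F F T F F F F T T F T F F T F = - 550444756"
  "s16 F F F T F F F F T T F T F F T T = 94685743"
  "s16 F F F T F F F F T T F T F T F F = - 369117020"
  "s16 F F F T F F F F T T F T F T F T = 405932634"
  "s16 F F F T F F F F T T F T F T T F = 154767032"
  "s16 F F F T F F F F T T F T T F F F = - 179461964"
  "s16 F F F T F F F F T T F T T F F T = - 328858688"
  "s16 F F F T F F F F T T F T T F T F = - 286478975"
  "s16 F F F T F F F F T T F T T F T T = 821927089"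
  "s16 F F F T F F F F T T F T T T F F = 118091505"
  "s16 F F F T F F F F T T F T T T F T = 947906043"
  "s16 F F F T F F F F T T F T T T T F = - 187296515"
  "s16 F F F T F F F F T T T T F F F F = - 261255016"
  "s16 F F F T F F F F T T T T F F F T = 156163663"
  "s16 F F F T F F F F T T T T F F T T = 368906692"
  "s16 F F F T F F F F T T T T F T F F = - 97864580"
  "s16 F F F T F F F F T T T T F T F T = 413280168"
  "s16 F F F T F F F F T T T T T F F F = - 21323224"
  "s16 F F F T F F F F T T T T T F F T = - 88984975"
  "s16 F F F T F F F F T T T T T F T T = 702385128"
  "s16 F F F T F F F F T T T T T T F F = - 523293868"
  by (simp_all only: s16_0001 u1_eqs dotl.simps arith_simps rel_simps arith_special simp_thms if_True if_False order_refl mult_zero_left mult_zero_right mult_1_left mult_1_right add_0 add_0_right minus_zero minus_minus)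
lemma tab1_2:
  "s16 F F F T F F F F T T T T T T F T = 861909443"
  "s16 F F F T F F T F F F F F T F F F = 1290844640"
  "s16 F F F T F F T F F F F F T F F T = 380468445"
  "s16 F F F T F F T F F F F F T F T T = 679017094"
  "s16 F F F T F F T F F F F F T T F F = 1314405664"
  "s16 F F F T F F T F F F F F T T F T = 972918961"
  "s16 F F F T F F T F F F F T F F F F = - 361338466"
  "s16 F F F T F F T F F F F T F F F T = 119748764"
  "s16 F F F T F F T F F F F T F F T F = 66308822"
  "s16 F F F T F F T F F F F T F F T T = - 850315881"
  "s16 F F F T F F T F F F F T F T F F = - 125049974"
  "s16 F F F T F F T F F F F T F T F T = - 636171180"
  "s16 F F F T F F T F F F F T F T T F = - 185249593"
  "s16 F F F T F F T F F F F T T F F F = 509547509"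
  "s16 F F F T F F T F F F F T T F F T = 399134206"
  "s16 F F F T F F T F F F F T T F T F = - 200273059"
  "s16 F F F T F F T F F F F T T F T T = - 695673223"
  "s16 F F F T F F T F F F F T T T F F = 834027390"
  "s16 F F F T F F T F F F F T T T F T = - 510289018"
  "s16 F F F T F F T F F F F T T T T F = 561753118"
  "s16 F F F T F F T F F F T T F F F F = - 618336068"
  "s16 F F F T F F T F F F T T F F F T = - 575804852"
  "s16 F F F T F F T F F F T T F F T T = - 1220932900"
  "s16 F F F T F F T F F F T T F T F F = - 408928944"
  "s16 F F F T F F T F F F T T F T F T = - 291930786"
  "s16 F F F T F F T F F F T T T F F F = 19626082"
  "s16 F F F T F F T F F F T T T F F T = 201950521"
  "s16 F F F T F F T F F F T T T F T T = - 547956848"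
  "s16 F F F T F F T F F F T T T T F F = 192740622"
  "s16 F F F T F F T F F F T T T T F T = - 577537691"
  "s16 F F F T F F T F F T F F T F F T = 507599148"
  "s16 F F F T F F T F F T F F T F T F = 376160534"
  "s16 F F F T F F T F F T F F T F T T = - 127547005"
  "s16 F F F T F F T F F T F F T T F F = 442922281"
  "s16 F F F T F F T F F T F F T T F T = 169012693"
  "s16 F F F T F F T F F T F F T T T F = 301048913"
  "s16 F F F T F F T F F T F T F F F F = 119748764"
  "s16 F F F T F F T F F T F T F F F T = 172407480"
  "s16 F F F T F F T F F T F T F F T F = 365410764"
  "s16 F F F T F F T F F T F T F F T T = - 140257492"
  by (simp_all only: s16_0001 u1_eqs dotl.simps arith_simps rel_simps arith_special simp_thms if_True if_False order_refl mult_zero_left mult_zero_right mult_1_left mult_1_right add_0 add_0_right minus_zero minus_minus)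
lemma tab1_3:
  "s16 F F F T F F T F F T F T F T F F = - 121492374"
  "s16 F F F T F F T F F T F T F T F T = - 131170986"
  "s16 F F F T F F T F F T F T F T T F = 42273955"
  "s16 F F F T F F T F F T F T T F F F = 348878521"
  "s16 F F F T F F T F F T F T T F F T = 184090540"
  "s16 F F F T F F T F F T F T T F T F = 128352943"
  "s16 F F F T F F T F F T F T T F T T = - 171121121"
  "s16 F F F T F F T F F T F T T T F F = 272707621"
  "s16 F F F T F F T F F T F T T T F T = 70422061"
  "s16 F F F T F F T F F T F T T T T F = 24614111"
  "s16 F F F T F F T F F T T F F F F F = - 125049974"
  "s16 F F F T F F T F F T T F F F F T = 261519167"
  "s16 F F F T F F T F F T T F F F T F = - 121492374"
  "s16 F F F T F F T F F T T F F F T T = - 184795795"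
  "s16 F F F T F F T F F T T F F T F F = - 283954172"
  "s16 F F F T F F T F F T T F F T F T = - 134300531"
  "s16 F F F T F F T F F T T F F T T F = - 197592353"
  "s16 F F F T F F T F F T T F T F F F = 113684650"
  "s16 F F F T F F T F F T T F T F F T = - 135055115"
  "s16 F F F T F F T F F T T F T F T F = 134561997"
  "s16 F F F T F F T F F T T F T F T T = - 422581429"
  "s16 F F F T F F T F F T T F T T F F = 334614531"
  "s16 F F F T F F T F F T T F T T F T = - 46923112"
  "s16 F F F T F F T F F T T F T T T F = - 77295686"
  "s16 F F F T F F T F F T T T F F F F = - 124352510"
  "s16 F F F T F F T F F T T T F F F T = - 452276415"
  "s16 F F F T F F T F F T T T F F T F = - 126961071"
  "s16 F F F T F F T F F T T T F F T T = 17279444"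
  "s16 F F F T F F T F F T T T F T F F = 85443995"
  "s16 F F F T F F T F F T T T F T F T = - 949140578"
  "s16 F F F T F F T F F T T T F T T F = - 845398356"
  "s16 F F F T F F T F F T T T T F F F = 12098733"
  "s16 F F F T F F T F F T T T T F F T = 323925555"
  "s16 F F F T F F T F F T T T T F T F = 140539720"
  "s16 F F F T F F T F F T T T T F T T = - 498539585"
  "s16 F F F T F F T F F T T T T T F F = - 70495804"
  "s16 F F F T F F T F F T T T T T F T = - 447229161"
  "s16 F F F T F F T F F T T T T T T F = - 388221310"
  "s16 F F F T F F T F T T F F T F T T = 1109045588"
  "s16 F F F T F F T F T T F F T T F F = 88468256"
  by (simp_all only: s16_0001 u1_eqs dotl.simps arith_simps rel_simps arith_special simp_thms if_True if_False order_refl mult_zero_left mult_zero_right mult_1_left mult_1_right add_0 add_0_right minus_zero minus_minus)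
lemma tab1_4:
  "s16 F F F T F F T F T T F F T T F T = 790246502"
  "s16 F F F T F F T F T T F T F F F F = - 636171180"
  "s16 F F F T F F T F T T F T F F F T = - 131170986"
  "s16 F F F T F F T F T T F T F F T F = - 1018301176"
  "s16 F F F T F F T F T T F T F F T T = - 747734073"
  "s16 F F F T F F T F T T F T F T F F = - 197592353"
  "s16 F F F T F F T F T T F T F T F T = - 121425588"
  "s16 F F F T F F T F T T F T F T T F = - 236398544"
  "s16 F F F T F F T F T T F T T F F F = 38046745"
  "s16 F F F T F F T F T T F T T F F T = - 77985199"
  "s16 F F F T F F T F T T F T T F T F = - 89850632"
  "s16 F F F T F F T F T T F T T F T T = 552480670"
  "s16 F F F T F F T F T T F T T T F F = 568427372"
  "s16 F F F T F F T F T T F T T T F T = 565823750"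
  "s16 F F F T F F T F T T F T T T T F = 526803400"
  "s16 F F F T F F T F T T T T F F F F = - 775793404"
  "s16 F F F T F F T F T T T T F F F T = - 433724720"
  "s16 F F F T F F T F T T T T F F T T = - 1178480602"
  "s16 F F F T F F T F T T T T F T F F = - 812393122"
  "s16 F F F T F F T F T T T T F T F T = 1242600785"
  "s16 F F F T F F T F T T T T T F F F = - 17206482"
  "s16 F F F T F F T F T T T T T F F T = - 284619080"
  "s16 F F F T F F T F T T T T T F T T = 927467132"
  "s16 F F F T F F T F T T T T T T F F = - 53824034"
  "s16 F F F T F F T F T T T T T T F T = 825697124"
  "s16 F F F T F F T T F F F F T T F F = 2162167286"
  "s16 F F F T F F T T F F F F T T F T = 899863026"
  "s16 F F F T F F T T F F F T F F F F = 66308822"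
  "s16 F F F T F F T T F F F T F F F T = 365410764"
  "s16 F F F T F F T T F F F T F F T F = 1148850016"
  "s16 F F F T F F T T F F F T F F T T = - 542030543"
  "s16 F F F T F F T T F F F T F T F F = 261519167"
  "s16 F F F T F F T T F F F T F T F T = - 1018301176"
  "s16 F F F T F F T T F F F T F T T F = - 57819628"
  "s16 F F F T F F T T F F F T T F F F = 772028039"
  "s16 F F F T F F T T F F F T T F F T = 885352541"
  "s16 F F F T F F T T F F F T T F T F = - 119680430"
  "s16 F F F T F F T T F F F T T F T T = - 1935151293"
  "s16 F F F T F F T T F F F T T T F F = 540707132"
  "s16 F F F T F F T T F F F T T T F T = - 1871961018"
  by (simp_all only: s16_0001 u1_eqs dotl.simps arith_simps rel_simps arith_special simp_thms if_True if_False order_refl mult_zero_left mult_zero_right mult_1_left mult_1_right add_0 add_0_right minus_zero minus_minus)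
lemma tab1_5:
  "s16 F F F T F F T T F F F T T T T F = 558056817"
  "s16 F F F T F F T T F F T T F F F F = - 25036756"
  "s16 F F F T F F T T F F T T F F F T = - 460179577"
  "s16 F F F T F F T T F F T T F F T T = - 962619278"
  "s16 F F F T F F T T F F T T F T F F = 216511278"
  "s16 F F F T F F T T F F T T F T F T = - 1419708144"
  "s16 F F F T F F T T F F T T T F F F = 44155856"
  "s16 F F F T F F T T F F T T T F F T = 458127751"
  "s16 F F F T F F T T F F T T T F T T = - 1869609072"
  "s16 F F F T F F T T F F T T T T F F = 603289850"
  "s16 F F F T F F T T F F T T T T F T = - 1943141064"
  "s16 F F F T F F T T F T F F T T F T = 1436546929"
  "s16 F F F T F F T T F T F F T T T F = 1084731656"
  "s16 F F F T F F T T F T F T F F F F = - 850315881"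
  "s16 F F F T F F T T F T F T F F F T = - 140257492"
  "s16 F F F T F F T T F T F T F F T F = - 542030543"
  "s16 F F F T F F T T F T F T F F T T = - 821957248"
  "s16 F F F T F F T T F T F T F T F F = - 184795795"
  "s16 F F F T F F T T F T F T F T F T = - 747734073"
  "s16 F F F T F F T T F T F T F T T F = - 578484067"
  "s16 F F F T F F T T F T F T T F F F = 133472434"
  "s16 F F F T F F T T F T F T T F F T = 313490700"
  "s16 F F F T F F T T F T F T T F T F = - 41342526"
  "s16 F F F T F F T T F T F T T F T T = - 198386282"
  "s16 F F F T F F T T F T F T T T F F = 669136655"
  "s16 F F F T F F T T F T F T T T F T = 53074600"
  "s16 F F F T F F T T F T F T T T T F = 287897677"
  "s16 F F F T F F T T F T T F F F F F = - 185249593"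
  "s16 F F F T F F T T F T T F F F F T = - 57819628"
  "s16 F F F T F F T T F T T F F F T F = 42273955"
  "s16 F F F T F F T T F T T F F F T T = - 578484067"
  "s16 F F F T F F T T F T T F F T F F = - 134300531"
  "s16 F F F T F F T T F T T F F T F T = 16802390"
  "s16 F F F T F F T T F T T F F T T F = - 236398544"
  "s16 F F F T F F T T F T T F T F F F = 632493100"
  "s16 F F F T F F T T F T T F T F F T = 421324828"
  "s16 F F F T F F T T F T T F T F T F = 604510006"
  "s16 F F F T F F T T F T T F T F T T = - 505956283"
  "s16 F F F T F F T T F T T F T T F F = 475848391"
  "s16 F F F T F F T T F T T F T T F T = 1007711672"
  by (simp_all only: s16_0001 u1_eqs dotl.simps arith_simps rel_simps arith_special simp_thms if_True if_False order_refl mult_zero_left mult_zero_right mult_1_left mult_1_right add_0 add_0_right minus_zero minus_minus)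
lemma tab1_6:
  "s16 F F F T F F T T F T T F T T T F = - 272589238"
  "s16 F F F T F F T T F T T T F F F F = - 514465505"
  "s16 F F F T F F T T F T T T F F F T = - 551693104"
  "s16 F F F T F F T T F T T T F F T F = - 1207648746"
  "s16 F F F T F F T T F T T T F F T T = - 1046573688"
  "s16 F F F T F F T T F T T T F T F F = - 370192176"
  "s16 F F F T F F T T F T T T F T F T = - 201612514"
  "s16 F F F T F F T T F T T T F T T F = - 219706390"
  "s16 F F F T F F T T F T T T T F F F = - 5622080"
  "s16 F F F T F F T T F T T T T F F T = - 146580036"
  "s16 F F F T F F T T F T T T T F T F = - 58698919"
  "s16 F F F T F F T T F T T T T F T T = - 125616106"
  "s16 F F F T F F T T F T T T T T F F = 139495190"
  "s16 F F F T F F T T F T T T T T F T = - 249162888"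
  "s16 F F F T F F T T F T T T T T T F = - 279116455"
  "s16 F F F T F T T F F F F T T F F F = 750967666"
  "s16 F F F T F T T F F F F T T F F T = 637500658"
  "s16 F F F T F T T F F F F T T F T F = 323379917"
  "s16 F F F T F T T F F F F T T F T T = - 733310586"
  "s16 F F F T F T T F F F F T T T T F = 796274880"
  "s16 F F F T F T T F F F T F F F F F = - 618336068"
  "s16 F F F T F T T F F F T F F F F T = - 25036756"
  "s16 F F F T F T T F F F T F F F T F = - 124352510"
  "s16 F F F T F T T F F F T F F F T T = - 514465505"
  "s16 F F F T F T T F F F T F F T T F = - 775793404"
  "s16 F F F T F T T F F F T F T F F F = - 73821220"
  "s16 F F F T F T T F F F T F T F F T = - 641964612"
  "s16 F F F T F T T F F F T F T F T F = 138862957"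
  "s16 F F F T F T T F F F T F T F T T = - 694276759"
  "s16 F F F T F T T F F F T F T T F F = 239308797"
  "s16 F F F T F T T F F F T F T T F T = - 303293051"
  "s16 F F F T F T T F F F T F T T T F = - 537421822"
  "s16 F F F T F T T F F F T T T F F F = 10093308"
  "s16 F F F T F T T F F F T T T F F T = 235181854"
  "s16 F F F T F T T F F F T T T F T F = 92831896"
  "s16 F F F T F T T F F F T T T F T T = - 714935039"
  "s16 F F F T F T T F F F T T T T T F = - 684092288"
  "s16 F F F T F T T F F T F T T F F T = 814379692"
  "s16 F F F T F T T F F T F T T F T F = 258588893"
  "s16 F F F T F T T F F T F T T F T T = - 1144907201"
  by (simp_all only: s16_0001 u1_eqs dotl.simps arith_simps rel_simps arith_special simp_thms if_True if_False order_refl mult_zero_left mult_zero_right mult_1_left mult_1_right add_0 add_0_right minus_zero minus_minus)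
lemma tab1_7:
  "s16 F F F T F T T F F T F T T T T F = 819643172"
  "s16 F F F T F T T F F T T F F F F F = - 408928944"
  "s16 F F F T F T T F F T T F F F F T = 216511278"
  "s16 F F F T F T T F F T T F F F T F = 85443995"
  "s16 F F F T F T T F F T T F F F T T = - 370192176"
  "s16 F F F T F T T F F T T F F T T F = - 812393122"
  "s16 F F F T F T T F F T T F T F F F = 138862957"
  "s16 F F F T F T T F F T T F T F F T = - 407108266"
  "s16 F F F T F T T F F T T F T F T F = 366121442"
  "s16 F F F T F T T F F T T F T F T T = - 870958054"
  "s16 F F F T F T T F F T T F T T F F = - 51812483"
  "s16 F F F T F T T F F T T F T T F T = - 185072684"
  "s16 F F F T F T T F F T T F T T T F = - 825541543"
  "s16 F F F T F T T F F T T T T F F F = 5956932"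
  "s16 F F F T F T T F F T T T T F F T = 48006878"
  "s16 F F F T F T T F F T T T T F T F = 180424743"
  "s16 F F F T F T T F F T T T T F T T = - 975558634"
  "s16 F F F T F T T F F T T T T T T F = - 1039368108"
  "s16 F F F T F T T F T F F T T F T F = 1466918713"
  "s16 F F F T F T T F T F F T T F T T = 467125920"
  "s16 F F F T F T T F T F F T T T F F = 64977786"
  "s16 F F F T F T T F T F F T T T F T = 419612791"
  "s16 F F F T F T T F T F F T T T T F = 511235315"
  "s16 F F F T F T T F T F T F F F F F = - 575804852"
  "s16 F F F T F T T F T F T F F F F T = - 460179577"
  "s16 F F F T F T T F T F T F F F T F = - 452276415"
  "s16 F F F T F T T F T F T F F F T T = - 551693104"
  "s16 F F F T F T T F T F T F F T F F = - 126961071"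
  "s16 F F F T F T T F T F T F F T F T = - 1207648746"
  "s16 F F F T F T T F T F T F F T T F = - 433724720"
  "s16 F F F T F T T F T F T F T F F F = - 641964612"
  "s16 F F F T F T T F T F T F T F F T = 19909638"
  "s16 F F F T F T T F T F T F T F T F = - 407108266"
  "s16 F F F T F T T F T F T F T F T T = - 57267131"
  "s16 F F F T F T T F T F T F T T F F = - 707992994"
  "s16 F F F T F T T F T F T F T T F T = - 779554126"
  "s16 F F F T F T T F T F T F T T T F = 240117471"
  "s16 F F F T F T T F T F T T F F F F = 239308797"
  "s16 F F F T F T T F T F T T F F F T = - 707992994"
  "s16 F F F T F T T F T F T T F F T F = - 33955104"
  by (simp_all only: s16_0001 u1_eqs dotl.simps arith_simps rel_simps arith_special simp_thms if_True if_False order_refl mult_zero_left mult_zero_right mult_1_left mult_1_right add_0 add_0_right minus_zero minus_minus)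
lemma tab1_8:
  "s16 F F F T F T T F T F T T F F T T = 161552718"
  "s16 F F F T F T T F T F T T F T F F = - 51812483"
  "s16 F F F T F T T F T F T T F T F T = - 519606391"
  "s16 F F F T F T T F T F T T F T T F = - 174708296"
  "s16 F F F T F T T F T F T T T F F F = 3406903"
  "s16 F F F T F T T F T F T T T F F T = - 56175331"
  "s16 F F F T F T T F T F T T T F T F = - 133815352"
  "s16 F F F T F T T F T F T T T F T T = 159924972"
  "s16 F F F T F T T F T F T T T T F F = 250843384"
  "s16 F F F T F T T F T F T T T T F T = 15422741"
  "s16 F F F T F T T F T F T T T T T F = - 7038221"
  "s16 F F F T F T T F T T F T T F T T = 3437053783"
  "s16 F F F T F T T F T T F T T T F F = 419612791"
  "s16 F F F T F T T F T T F T T T F T = 3258985018"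
  "s16 F F F T F T T F T T F T T T T F = - 892971648"
  "s16 F F F T F T T F T T T F F F F F = - 291930786"
  "s16 F F F T F T T F T T T F F F F T = - 1419708144"
  "s16 F F F T F T T F T T T F F F T F = - 949140578"
  "s16 F F F T F T T F T T T F F F T T = - 201612514"
  "s16 F F F T F T T F T T T F F T F F = - 845398356"
  "s16 F F F T F T T F T T T F F T F T = - 219706390"
  "s16 F F F T F T T F T T T F F T T F = 1242600785"
  "s16 F F F T F T T F T T T F T F F F = - 694276759"
  "s16 F F F T F T T F T T T F T F F T = - 57267131"
  "s16 F F F T F T T F T T T F T F T F = - 870958054"
  "s16 F F F T F T T F T T T F T F T T = 1149535090"
  "s16 F F F T F T T F T T T F T T F F = - 519606391"
  "s16 F F F T F T T F T T T F T T F T = 226372069"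
  "s16 F F F T F T T F T T T F T T T F = 1542901356"
  "s16 F F F T F T T F T T T T F F F F = - 537421822"
  "s16 F F F T F T T F T T T T F F F T = 240117471"
  "s16 F F F T F T T F T T T T F F T F = - 174708296"
  "s16 F F F T F T T F T T T T F F T T = 191323278"
  "s16 F F F T F T T F T T T T F T F F = - 825541543"
  "s16 F F F T F T T F T T T T F T F T = 1542901356"
  "s16 F F F T F T T F T T T T F T T F = 2114336058"
  "s16 F F F T F T T F T T T T T F F F = - 41116786"
  "s16 F F F T F T T F T T T T T F F T = - 263734058"
  "s16 F F F T F T T F T T T T T F T F = - 716483445"
  "s16 F F F T F T T F T T T T T F T T = 2339689898"
  by (simp_all only: s16_0001 u1_eqs dotl.simps arith_simps rel_simps arith_special simp_thms if_True if_False order_refl mult_zero_left mult_zero_right mult_1_left mult_1_right add_0 add_0_right minus_zero minus_minus)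
lemma tab1_9:
  "s16 F F F T F T T F T T T T T T F F = - 592750124"
  "s16 F F F T F T T F T T T T T T F T = 2314744461"
  "s16 F F F T F T T F T T T T T T T F = 2421304680"
  "s16 F F F T F T T T T F F T T T T F = 1662347504"
  "s16 F F F T F T T T T F T F F F F F = - 1220932900"
  "s16 F F F T F T T T T F T F F F F T = - 962619278"
  "s16 F F F T F T T T T F T F F F T F = 17279444"
  "s16 F F F T F T T T T F T F F F T T = - 1046573688"
  "s16 F F F T F T T T T F T F F T T F = - 1178480602"
  "s16 F F F T F T T T T F T F T F F F = - 303293051"
  "s16 F F F T F T T T T F T F T F F T = - 779554126"
  "s16 F F F T F T T T T F T F T F T F = - 185072684"
  "s16 F F F T F T T T T F T F T F T T = 226372069"
  "s16 F F F T F T T T T F T F T T F F = 161552718"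
  "s16 F F F T F T T T T F T F T T F T = - 718695046"
  "s16 F F F T F T T T T F T F T T T F = 191323278"
  "s16 F F F T F T T T T F T T T F F F = - 6387490"
  "s16 F F F T F T T T T F T T T F F T = - 260080002"
  "s16 F F F T F T T T T F T T T F T F = 78886391"
  "s16 F F F T F T T T T F T T T F T T = - 100749813"
  "s16 F F F T F T T T T F T T T T T F = - 242031204"
  "s16 F F F T T T T F F F T T T F F F = 2165388"
  "s16 F F F T T T T F F F T T T F F T = 20609622"
  "s16 F F F T T T T F F F T T T F T T = - 48153062"
  "s16 F F F T T T T F F T T T T F F T = 444704288"
  "s16 F F F T T T T F F T T T T F T F = 90919158"
  "s16 F F F T T T T F F T T T T F T T = - 638301038"
  "s16 F F F T T T T F F T T T T T T F = - 511785418"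
  "s16 F F F T T T T F T T T T T F T T = 2599608104"
  "s16 F F F T T T T F T T T T T T F F = - 511785418"
  "s16 F F F T T T T F T T T T T T F T = 2551568338"
  by (simp_all only: s16_0001 u1_eqs dotl.simps arith_simps rel_simps arith_special simp_thms if_True if_False order_refl mult_zero_left mult_zero_right mult_1_left mult_1_right add_0 add_0_right minus_zero minus_minus)
lemma tab2_0:
  "s16 F F T T F F F F F F F F F F F F = 12125708"
  "s16 F F T T F F F F F F F F F F F T = 109037004"
  "s16 F F T T F F F F F F F F F F T F = 51123620"
  "s16 F F T T F F F F F F F F F F T T = 99779020"
  "s16 F F T T F F F F F F F F F T T F = 57721916"
  "s16 F F T T F F F F F F F F T F T F = 51764836"
  "s16 F F T T F F F F F F F F T F T T = - 29136584"
  "s16 F F T T F F F F F F F F T T F F = 36273140"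
  "s16 F F T T F F F F F F F F T T F T = 91578520"
  "s16 F F T T F F F F F F F F T T T F = - 2918704"
  "s16 F F T T F F F F F F F T T T T F = - 61088528"
  "s16 F F T T F F F F F F T F F F F F = - 9176344"
  "s16 F F T T F F F F F F T F F F F T = 100410140"
  "s16 F F T T F F F F F F T F F F T F = - 9874844"
  "s16 F F T T F F F F F F T F F F T T = 50703680"
  "s16 F F T T F F F F F F T F F T T F = - 62969812"
  "s16 F F T T F F F F F F T F T F T F = - 26532212"
  "s16 F F T T F F F F F F T F T F T T = - 107451272"
  "s16 F F T T F F F F F F T F T T F F = - 168904928"
  "s16 F F T T F F F F F T F F F F F T = 980731500"
  "s16 F F T T F F F F F T F F F F T F = 460017780"
  "s16 F F T T F F F F F T F F F F T T = 895647500"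
  "s16 F F T T F F F F F T F F F T T F = 518147092"
  "s16 F F T T F F F F F T F F T F T F = 466404244"
  "s16 F F T T F F F F F T F F T F T T = - 262844952"
  "s16 F F T T F F F F F T F F T T F F = 347468108"
  "s16 F F T T F F F F F T F F T T F T = 809120664"
  "s16 F F T T F F F F F T F F T T T F = - 23075352"
  "s16 F F T T F F F F F T F T T T T F = - 549444472"
  "s16 F F T T F F F F F T T F F F F F = - 82627808"
  "s16 F F T T F F F F F T T F F F F T = 903075244"
  "s16 F F T T F F F F F T T F F F T F = - 80162092"
  "s16 F F T T F F F F F T T F F F T T = 453208432"
  "s16 F F T T F F F F F T T F F T T F = - 566357964"
  "s16 F F T T F F F F F T T F T F T F = - 238809348"
  "s16 F F T T F F F F F T T F T F T T = - 967029344"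
  "s16 F F T T F F F F F T T F T T F F = - 1517214584"
  "s16 F F T T F F F F T F F F F F T F = 2554968848"
  "s16 F F T T F F F F T F F F F F T T = 919008000"
  "s16 F F T T F F F F T F F F F T F F = - 89968136"
  by (simp_all only: s16_0011 u2_eqs dotl.simps arith_simps rel_simps arith_special simp_thms if_True if_False order_refl mult_zero_left mult_zero_right mult_1_left mult_1_right add_0 add_0_right minus_zero minus_minus)
lemma tab2_1:
  "s16 F F T T F F F F T F F F F T F T = 361137376"
  "s16 F F T T F F F F T F F F F T T F = 1381401024"
  "s16 F F T T F F F F T F F F T F F F = - 264347088"
  "s16 F F T T F F F F T F F F T F F T = - 9152344"
  "s16 F F T T F F F F T F F F T F T F = 512547844"
  "s16 F F T T F F F F T F F F T F T T = 147340240"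
  "s16 F F T T F F F F T F F F T T F F = - 113077008"
  "s16 F F T T F F F F T F F F T T F T = 167468084"
  "s16 F F T T F F F F T F F F T T T F = 437448032"
  "s16 F F T T F F F F T F F T F F F F = - 1262090248"
  "s16 F F T T F F F F T F F T F F F T = 409975752"
  "s16 F F T T F F F F T F F T F F T F = 451364600"
  "s16 F F T T F F F F T F F T F F T T = 586548444"
  "s16 F F T T F F F F T F F T F T F F = - 75397692"
  "s16 F F T T F F F F T F F T F T F T = - 393594272"
  "s16 F F T T F F F F T F F T F T T F = 443437200"
  "s16 F F T T F F F F T F F T T F F F = - 895717848"
  "s16 F F T T F F F F T F F T T F T F = 67554496"
  "s16 F F T T F F F F T F F T T T F F = - 990137488"
  "s16 F F T T F F F F T F F T T T T F = - 257719440"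
  "s16 F F T T F F F F T F T F F F F F = - 38732688"
  "s16 F F T T F F F F T F T F F F F T = 423605532"
  "s16 F F T T F F F F T F T F F F T F = - 20238040"
  "s16 F F T T F F F F T F T F F F T T = 850940148"
  "s16 F F T T F F F F T F T F F T F F = 844625232"
  "s16 F F T T F F F F T F T F F T F T = 271135260"
  "s16 F F T T F F F F T F T F F T T F = 422522712"
  "s16 F F T T F F F F T F T F T F F F = - 924119808"
  "s16 F F T T F F F F T F T F T F F T = - 73324428"
  "s16 F F T T F F F F T F T F T F T F = 528858388"
  "s16 F F T T F F F F T F T F T F T T = - 245664792"
  "s16 F F T T F F F F T F T F T T F F = - 1347832372"
  "s16 F F T T F F F F T F T T F F F F = - 116590664"
  "s16 F F T T F F F F T F T T F F F T = - 199461636"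
  "s16 F F T T F F F F T F T T F F T F = - 75458380"
  "s16 F F T T F F F F T F T T F T F F = - 753659612"
  "s16 F F T T F F F F T F T T F T F T = - 661253864"
  "s16 F F T T F F F F T F T T T F F F = - 953692352"
  "s16 F F T T F F F F T T F F F F T T = 1286473424"
  "s16 F F T T F F F F T T F F F T F F = 361137376"
  by (simp_all only: s16_0011 u2_eqs dotl.simps arith_simps rel_simps arith_special simp_thms if_True if_False order_refl mult_zero_left mult_zero_right mult_1_left mult_1_right add_0 add_0_right minus_zero minus_minus)
lemma tab2_2:
  "s16 F F T T F F F F T T F F F T F T = 590941784"
  "s16 F F T T F F F F T T F F F T T F = 744834264"
  "s16 F F T T F F F F T T F F T F F F = - 9152344"
  "s16 F F T T F F F F T T F F T F F T = 416440360"
  "s16 F F T T F F F F T T F F T F T F = 475459716"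
  "s16 F F T T F F F F T T F F T F T T = - 182803520"
  "s16 F F T T F F F F T T F F T T F F = - 611167920"
  "s16 F F T T F F F F T T F F T T F T = 907922252"
  "s16 F F T T F F F F T T F F T T T F = - 13924036"
  "s16 F F T T F F F F T T F T F F F F = 409975752"
  "s16 F F T T F F F F T T F T F F F T = 1031630688"
  "s16 F F T T F F F F T T F T F F T F = 932946568"
  "s16 F F T T F F F F T T F T F F T T = 785285860"
  "s16 F F T T F F F F T T F T F T F F = 364459652"
  "s16 F F T T F F F F T T F T F T F T = - 285764208"
  "s16 F F T T F F F F T T F T F T T F = 430254932"
  "s16 F F T T F F F F T T F T T F F F = 216790640"
  "s16 F F T T F F F F T T F T T F T F = 73570452"
  "s16 F F T T F F F F T T F T T T F F = - 668088068"
  "s16 F F T T F F F F T T F T T T T F = - 501889960"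
  "s16 F F T T F F F F T T T F F F F F = - 74781632"
  "s16 F F T T F F F F T T T F F F F T = 825188668"
  "s16 F F T T F F F F T T T F F F T F = - 71763220"
  "s16 F F T T F F F F T T T F F F T T = 790859256"
  "s16 F F T T F F F F T T T F F T F F = 25756396"
  "s16 F F T T F F F F T T T F F T F T = 471053728"
  "s16 F F T T F F F F T T T F F T T F = - 332884724"
  "s16 F F T T F F F F T T T F T F F F = 47804924"
  "s16 F F T T F F F F T T T F T F F T = 172574472"
  "s16 F F T T F F F F T T T F T F T F = - 65427164"
  "s16 F F T T F F F F T T T F T F T T = - 839851176"
  "s16 F F T T F F F F T T T F T T F F = - 2391958872"
  "s16 F F T T F F F F T T T T F F F F = - 556144900"
  "s16 F F T T F F F F T T T T F F F T = 305188000"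
  "s16 F F T T F F F F T T T T F F T F = - 408779576"
  "s16 F F T T F F F F T T T T F T F F = - 368363852"
  "s16 F F T T F F F F T T T T F T F T = - 918098968"
  "s16 F F T T F F F F T T T T T F F F = - 701890276"
  "s16 F F T T F F F T T F F F F T T F = 1666485564"
  "s16 F F T T F F F T T F F F T F F F = - 895717848"
  by (simp_all only: s16_0011 u2_eqs dotl.simps arith_simps rel_simps arith_special simp_thms if_True if_False order_refl mult_zero_left mult_zero_right mult_1_left mult_1_right add_0 add_0_right minus_zero minus_minus)
lemma tab2_3:
  "s16 F F T T F F F T T F F F T F F T = 216790640"
  "s16 F F T T F F F T T F F F T F T F = 243022472"
  "s16 F F T T F F F T T F F F T F T T = - 135602960"
  "s16 F F T T F F F T T F F F T T F F = 94711936"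
  "s16 F F T T F F F T T F F F T T F T = 488624280"
  "s16 F F T T F F F T T F F F T T T F = 512447868"
  "s16 F F T T F F F T T F F T T F F F = - 1110331604"
  "s16 F F T T F F F T T F F T T F T F = - 563484004"
  "s16 F F T T F F F T T F F T T T T F = - 290350520"
  "s16 F F T T F F F T T F T F F F F F = - 43270252"
  "s16 F F T T F F F T T F T F F F F T = 477380216"
  "s16 F F T T F F F T T F T F F F T F = 410847068"
  "s16 F F T T F F F T T F T F F F T T = 667730828"
  "s16 F F T T F F F T T F T F F T T F = 537992244"
  "s16 F F T T F F F T T F T F T F F F = - 569276404"
  "s16 F F T T F F F T T F T F T F F T = - 164971212"
  "s16 F F T T F F F T T F T F T F T F = - 125485264"
  "s16 F F T T F F F T T F T F T F T T = - 508549564"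
  "s16 F F T T F F F T T F T F T T F F = - 809974328"
  "s16 F F T T F F F T T F T T T F F F = - 1136625300"
  "s16 F F T T F F T F T F F F T F T F = 423971396"
  "s16 F F T T F F T F T F F F T F T T = 56967984"
  "s16 F F T T F F T F T F F F T T F F = 234878720"
  "s16 F F T T F F T F T F F F T T F T = 336847624"
  "s16 F F T T F F T F T F F F T T T F = 236299924"
  "s16 F F T T F F T F T F F T F T F F = 24973380"
  "s16 F F T T F F T F T F F T F T F T = - 312100688"
  "s16 F F T T F F T F T F F T F T T F = - 237342700"
  "s16 F F T T F F T F T F F T T T T F = - 261247772"
  "s16 F F T T F F T F T F T F F F F F = - 39597172"
  "s16 F F T T F F T F T F T F F F F T = 429268316"
  "s16 F F T T F F T F T F T F F F T F = 192675220"
  "s16 F F T T F F T F T F T F F F T T = 357759048"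
  "s16 F F T T F F T F T F T F F T F F = - 210442476"
  "s16 F F T T F F T F T F T F F T F T = 54574088"
  "s16 F F T T F F T F T F T F F T T F = - 269268880"
  "s16 F F T T F F T F T F T F T F T F = 392861340"
  "s16 F F T T F F T F T F T F T F T T = - 320976508"
  "s16 F F T T F F T F T F T F T T F F = - 714954420"
  "s16 F F T T F F T F T F T T F T F F = - 621061092"
  by (simp_all only: s16_0011 u2_eqs dotl.simps arith_simps rel_simps arith_special simp_thms if_True if_False order_refl mult_zero_left mult_zero_right mult_1_left mult_1_right add_0 add_0_right minus_zero minus_minus)
lemma tab2_4:
  "s16 F F T T F F T F T F T T F T F T = - 602506236"
  "s16 F F T T F F T F T T F F T F T T = 243611188"
  "s16 F F T T F F T F T T F F T T F F = - 160166504"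
  "s16 F F T T F F T F T T F F T T F T = - 170694736"
  "s16 F F T T F F T F T T F F T T T F = 215440816"
  "s16 F F T T F F T F T T F T F T F F = - 312100688"
  "s16 F F T T F F T F T T F T F T F T = - 97782036"
  "s16 F F T T F F T F T T F T F T T F = - 223197392"
  "s16 F F T T F F T F T T F T T T T F = 147207704"
  "s16 F F T T F F T F T T T F F F F F = 22435744"
  "s16 F F T T F F T F T T T F F F F T = - 241834928"
  "s16 F F T T F F T F T T T F F F T F = 181976968"
  "s16 F F T T F F T F T T T F F F T T = 27915536"
  "s16 F F T T F F T F T T T F F T F F = - 195258264"
  "s16 F F T T F F T F T T T F F T F T = - 252812784"
  "s16 F F T T F F T F T T T F F T T F = 151719016"
  "s16 F F T T F F T F T T T F T F T F = 533769236"
  "s16 F F T T F F T F T T T F T F T T = 391161476"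
  "s16 F F T T F F T F T T T F T T F F = 400289288"
  "s16 F F T T F F T F T T T T F T F F = - 404741908"
  "s16 F F T T F F T F T T T T F T F T = 130751900"
  "s16 F F T T F F T T F F F F T T F F = 5153940968"
  "s16 F F T T F F T T F F F F T T F T = - 2229303968"
  "s16 F F T T F F T T F F F F T T T F = 773421840"
  "s16 F F T T F F T T F F F T F F F F = - 113077008"
  "s16 F F T T F F T T F F F T F F F T = - 611167920"
  "s16 F F T T F F T T F F F T F F T F = - 1256159904"
  "s16 F F T T F F T T F F F T F F T T = 290544048"
  "s16 F F T T F F T T F F F T F T F F = 234878720"
  "s16 F F T T F F T T F F F T F T F T = - 160166504"
  "s16 F F T T F F T T F F F T F T T F = - 242277120"
  "s16 F F T T F F T T F F F T T F F F = 94711936"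
  "s16 F F T T F F T T F F F T T F T F = - 242277120"
  "s16 F F T T F F T T F F F T T T F F = 773421840"
  "s16 F F T T F F T T F F F T T T T F = - 193349188"
  "s16 F F T T F F T T F F T F F F F F = - 37163888"
  "s16 F F T T F F T T F F T F F F F T = 314595232"
  "s16 F F T T F F T T F F T F F F T F = 1073965532"
  "s16 F F T T F F T T F F T F F F T T = - 226147656"
  "s16 F F T T F F T T F F T F F T F F = 379756908"
  by (simp_all only: s16_0011 u2_eqs dotl.simps arith_simps rel_simps arith_special simp_thms if_True if_False order_refl mult_zero_left mult_zero_right mult_1_left mult_1_right add_0 add_0_right minus_zero minus_minus)
lemma tab2_5:
  "s16 F F T T F F T T F F T F F T F T = 56886808"
  "s16 F F T T F F T T F F T F F T T F = - 198714788"
  "s16 F F T T F F T T F F T F T F F F = 379756908"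
  "s16 F F T T F F T T F F T F T F F T = 56886808"
  "s16 F F T T F F T T F F T F T F T F = - 98703720"
  "s16 F F T T F F T T F F T F T F T T = - 391033720"
  "s16 F F T T F F T T F F T F T T F F = 2403881388"
  "s16 F F T T F F T T F F T T F F F F = 1073965532"
  "s16 F F T T F F T T F F T T F F F T = - 226147656"
  "s16 F F T T F F T T F F T T F F T F = - 3134389956"
  "s16 F F T T F F T T F F T T F T F F = - 98703720"
  "s16 F F T T F F T T F F T T F T F T = - 391033720"
  "s16 F F T T F F T T F F T T T F F F = - 198714788"
  "s16 F F T T F F T T F T F F T T F T = 2443194852"
  "s16 F F T T F F T T F T F F T T T F = - 108924368"
  "s16 F F T T F F T T F T F T F F F F = 167468084"
  "s16 F F T T F F T T F T F T F F F T = 907922252"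
  "s16 F F T T F F T T F T F T F F T F = 290544048"
  "s16 F F T T F F T T F T F T F F T T = 620392060"
  "s16 F F T T F F T T F T F T F T F F = 336847624"
  "s16 F F T T F F T T F T F T F T F T = - 170694736"
  "s16 F F T T F F T T F T F T F T T F = - 305896112"
  "s16 F F T T F F T T F T F T T F F F = 488624280"
  "s16 F F T T F F T T F T F T T F T F = - 305896112"
  "s16 F F T T F F T T F T F T T T F F = - 108924368"
  "s16 F F T T F F T T F T F T T T T F = - 454207104"
  "s16 F F T T F F T T F T T F F F F F = - 62737296"
  "s16 F F T T F F T T F T T F F F F T = 748742904"
  "s16 F F T T F F T T F T T F F F T F = - 582037492"
  "s16 F F T T F F T T F T T F F F T T = 462922976"
  "s16 F F T T F F T T F T T F F T F F = - 592879868"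
  "s16 F F T T F F T T F T T F F T F T = 622361248"
  "s16 F F T T F F T T F T T F F T T F = - 468586184"
  "s16 F F T T F F T T F T T F T F F F = - 592879868"
  "s16 F F T T F F T T F T T F T F F T = 622361248"
  "s16 F F T T F F T T F T T F T F T F = - 187356328"
  "s16 F F T T F F T T F T T F T F T T = - 764478512"
  "s16 F F T T F F T T F T T F T T F F = - 1905500516"
  "s16 F F T T F F T T F T T T F F F F = - 582037492"
  "s16 F F T T F F T T F T T T F F F T = 462922976"
  by (simp_all only: s16_0011 u2_eqs dotl.simps arith_simps rel_simps arith_special simp_thms if_True if_False order_refl mult_zero_left mult_zero_right mult_1_left mult_1_right add_0 add_0_right minus_zero minus_minus)
lemma tab2_6:
  "s16 F F T T F F T T F T T T F F T F = - 835110236"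
  "s16 F F T T F F T T F T T T F T F F = - 187356328"
  "s16 F F T T F F T T F T T T F T F T = - 764478512"
  "s16 F F T T F F T T F T T T T F F F = - 468586184"
  "s16 F F T T F F T T T F F F T T T F = 1237265052"
  "s16 F F T T F F T T T F F T F F F F = - 990137488"
  "s16 F F T T F F T T T F F T F F F T = - 668088068"
  "s16 F F T T F F T T T F F T F F T F = - 242277120"
  "s16 F F T T F F T T T F F T F F T T = - 305896112"
  "s16 F F T T F F T T T F F T F T F F = - 237342700"
  "s16 F F T T F F T T T F F T F T F T = - 223197392"
  "s16 F F T T F F T T T F F T F T T F = 54876052"
  "s16 F F T T F F T T T F F T T F F F = - 563484004"
  "s16 F F T T F F T T T F F T T F T F = - 560799436"
  "s16 F F T T F F T T T F F T T T F F = - 564934660"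
  "s16 F F T T F F T T T F F T T T T F = 13125164"
  "s16 F F T T F F T T T F T F F F F F = 759832"
  "s16 F F T T F F T T T F T F F F F T = - 22052660"
  "s16 F F T T F F T T T F T F F F T F = 897749180"
  "s16 F F T T F F T T T F T F F F T T = 490381204"
  "s16 F F T T F F T T T F T F F T F F = - 166849836"
  "s16 F F T T F F T T T F T F F T F T = 352759036"
  "s16 F F T T F F T T T F T F F T T F = 404602056"
  "s16 F F T T F F T T T F T F T F F F = 69821652"
  "s16 F F T T F F T T T F T F T F F T = - 208461812"
  "s16 F F T T F F T T T F T F T F T F = 624379636"
  "s16 F F T T F F T T T F T F T F T T = 182517440"
  "s16 F F T T F F T T T F T F T T F F = 898809584"
  "s16 F F T T F F T T T F T T F F F F = - 338098308"
  "s16 F F T T F F T T T F T T F F F T = - 824451068"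
  "s16 F F T T F F T T T F T T F F T F = - 775718216"
  "s16 F F T T F F T T T F T T F T F F = - 617349644"
  "s16 F F T T F F T T T F T T F T F T = - 151547648"
  "s16 F F T T F F T T T F T T T F F F = - 377371544"
  "s16 F F T T F T T T T F F T T T T F = 307821416"
  "s16 F F T T F T T T T F T F F F F F = 46285660"
  "s16 F F T T F T T T T F T F F F F T = - 505942244"
  "s16 F F T T F T T T T F T F F F T F = 45458224"
  "s16 F F T T F T T T T F T F F F T T = - 254082112"
  "s16 F F T T F T T T T F T F F T T F = 317297460"
  by (simp_all only: s16_0011 u2_eqs dotl.simps arith_simps rel_simps arith_special simp_thms if_True if_False order_refl mult_zero_left mult_zero_right mult_1_left mult_1_right add_0 add_0_right minus_zero minus_minus)
lemma tab2_7:
  "s16 F F T T F T T T T F T F T F T F = 133780324"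
  "s16 F F T T F T T T T F T F T F T T = 541733020"
  "s16 F F T T F T T T T F T F T T F F = 850127768"
  "s16 F F T T T F F F F F T F F F F F = 6995720"
  "s16 F F T T T F F F F F T F F F F T = - 76061932"
  "s16 F F T T T F F F F F T F F F T F = 3438752"
  "s16 F F T T T F F F F F T F F F T T = - 37122296"
  "s16 F F T T T F F F F F T F F T T F = 47708112"
  "s16 F F T T T F F F F F T F T F T F = 20179964"
  "s16 F F T T T F F F F F T F T F T T = 81683408"
  "s16 F F T T T F F F F F T F T T F F = 127081156"
  "s16 F F T T T F F F F T T F F F F T = 831583748"
  "s16 F F T T T F F F F T T F F F T F = - 76063060"
  "s16 F F T T T F F F F T T F F F T T = 418043224"
  "s16 F F T T T F F F F T T F F T T F = - 521518224"
  "s16 F F T T T F F F F T T F T F T F = - 219859132"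
  "s16 F F T T T F F F F T T F T F T T = - 890315428"
  "s16 F F T T T F F F F T T F T T F F = - 1397585228"
  "s16 F F T T T F F F T F T F F F T F = 2055136960"
  "s16 F F T T T F F F T F T F F F T T = 213175816"
  "s16 F F T T T F F F T F T F F T F F = - 890815376"
  "s16 F F T T T F F F T F T F F T F T = - 104769136"
  "s16 F F T T T F F F T F T F F T T F = 352489936"
  "s16 F F T T T F F F T F T F T F F F = 1170486136"
  "s16 F F T T T F F F T F T F T F F T = - 44497208"
  "s16 F F T T T F F F T F T F T F T F = 684642076"
  "s16 F F T T T F F F T F T F T F T T = 200379232"
  "s16 F F T T T F F F T F T F T T F F = 714721160"
  "s16 F F T T T F F F T F T T F F F F = - 982040952"
  "s16 F F T T T F F F T F T T F F F T = - 620108512"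
  "s16 F F T T T F F F T F T T F F T F = - 323009672"
  "s16 F F T T T F F F T F T T F T F F = - 656581124"
  "s16 F F T T T F F F T F T T F T F T = - 82949760"
  "s16 F F T T T F F F T F T T T F F F = - 258423064"
  "s16 F F T T T F F F T T T F F F T T = 776441356"
  "s16 F F T T T F F F T T T F F T F F = - 104769136"
  "s16 F F T T T F F F T T T F F T F T = 436148220"
  "s16 F F T T T F F F T T T F F T T F = 40819568"
  "s16 F F T T T F F F T T T F T F F F = - 44497208"
  "s16 F F T T T F F F T T T F T F F T = - 52089348"
  by (simp_all only: s16_0011 u2_eqs dotl.simps arith_simps rel_simps arith_special simp_thms if_True if_False order_refl mult_zero_left mult_zero_right mult_1_left mult_1_right add_0 add_0_right minus_zero minus_minus)
lemma tab2_8: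
  "s16 F F T T T F F F T T T F T F T F = 287136776"
  "s16 F F T T T F F F T T T F T F T T = - 333438728"
  "s16 F F T T T F F F T T T F T T F F = - 1027336404"
  "s16 F F T T T F F F T T T T F F F F = - 620108512"
  "s16 F F T T T F F F T T T T F F F T = - 190978180"
  "s16 F F T T T F F F T T T T F F T F = - 421221804"
  "s16 F F T T T F F F T T T T F T F F = - 504085048"
  "s16 F F T T T F F F T T T T F T F T = - 547290920"
  "s16 F F T T T F F F T T T T T F F F = - 564780032"
  "s16 F F T T T F F T T F T F F T T F = 843207736"
  "s16 F F T T T F F T T F T F T F F F = - 258423064"
  "s16 F F T T T F F T T F T F T F F T = - 564780032"
  "s16 F F T T T F F T T F T F T F T F = 137892760"
  "s16 F F T T T F F T T F T F T F T T = 558394616"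
  "s16 F F T T T F F T T F T F T T F F = 876350492"
  "s16 F F T T T F F T T F T T T F F F = - 189076464"
  "s16 F F T T T F T F T F T F T F T F = 1369973096"
  "s16 F F T T T F T F T F T F T F T T = 593467128"
  "s16 F F T T T F T F T F T F T T F F = 368123820"
  "s16 F F T T T F T F T F T T F T F F = - 1253442592"
  "s16 F F T T T F T F T F T T F T F T = - 121784400"
  "s16 F F T T T F T F T T T F T F T T = 1054130172"
  "s16 F F T T T F T F T T T F T T F F = 1491439044"
  "s16 F F T T T F T F T T T T F T F F = - 121784400"
  "s16 F F T T T F T F T T T T F T F T = 855484532"
  "s16 F F T T T F T T F F T F T T F F = 5500010752"
  "s16 F F T T T F T T F F T T F F F F = 714721160"
  "s16 F F T T T F T T F F T T F F F T = - 1027336404"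
  "s16 F F T T T F T T F F T T F F T F = - 773128368"
  "s16 F F T T T F T T F F T T F T F F = 368123820"
  "s16 F F T T T F T T F F T T F T F T = 1491439044"
  "s16 F F T T T F T T F F T T T F F F = 876350492"
  by (simp_all only: s16_0011 u2_eqs dotl.simps arith_simps rel_simps arith_special simp_thms if_True if_False order_refl mult_zero_left mult_zero_right mult_1_left mult_1_right add_0 add_0_right minus_zero minus_minus)
lemma tab3_0:
  "s16 F T T T F F F F F F F F F F F F = 967038"
  "s16 F T T T F F F F F F F F F F F T = - 3590968"
  "s16 F T T T F F F F F F F F F F T T = 33974964"
  "s16 F T T T F F F F F F F F F T F F = 4542940"
  "s16 F T T T F F F F F F F F F T F T = 12692860"
  "s16 F T T T F F F F F F F F T F T T = 7264236"
  "s16 F T T T F F F F F F F F T T F F = - 29369850"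
  "s16 F T T T F F F F F F F F T T F T = 2753495"
  "s16 F T T T F F F F F F F T F T F F = 3492802"
  "s16 F T T T F F F F F F F T F T F T = - 22028806"
  "s16 F T T T F F F F F F T T F T F F = - 12517764"
  "s16 F T T T F F F F F T F F F F F T = 333711942"
  "s16 F T T T F F F F F T F F F F T F = 3420626"
  "s16 F T T T F F F F F T F F F F T T = 193812477"
  "s16 F T T T F F F F F T F F F T F F = 159795217"
  "s16 F T T T F F F F F T F F F T F T = 212067272"
  "s16 F T T T F F F F F T F F F T T F = 186573244"
  "s16 F T T T F F F F F T F F T F T F = - 366651556"
  "s16 F T T T F F F F F T F F T F T T = 90998844"
  "s16 F T T T F F F F F T F F T T F F = 15637292"
  "s16 F T T T F F F F F T F F T T F T = 218840460"
  "s16 F T T T F F F F F T F F T T T F = 147136972"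
  "s16 F T T T F F F F F T F T F T F F = 78307238"
  "s16 F T T T F F F F F T F T F T F T = 334505794"
  "s16 F T T T F F F F F T T F F F F F = - 571705744"
  "s16 F T T T F F F F F T T F F F F T = - 34714984"
  "s16 F T T T F F F F F T T F F F T F = - 476271991"
  "s16 F T T T F F F F F T T F F F T T = - 235803882"
  "s16 F T T T F F F F F T T F F T F F = - 104542147"
  "s16 F T T T F F F F F T T F F T T F = - 100655098"
  "s16 F T T T F F F F F T T T F T F F = - 156360606"
  "s16 F T T T F F F F T T F F F F T T = 2122180150"
  "s16 F T T T F F F F T T F F F T F F = 716208574"
  "s16 F T T T F F F F T T F F F T F T = 1349030999"
  "s16 F T T T F F F F T T F F T F F F = - 366651556"
  "s16 F T T T F F F F T T F F T F F T = 994832846"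
  "s16 F T T T F F F F T T F F T F T T = 412012412"
  "s16 F T T T F F F F T T F F T T F F = - 1500389820"
  "s16 F T T T F F F F T T F F T T F T = 479653628"
  "s16 F T T T F F F F T T F T F F F F = - 252603884"
  by (simp_all only: s16_0111 u3_eqs dotl.simps arith_simps rel_simps arith_special simp_thms if_True if_False order_refl mult_zero_left mult_zero_right mult_1_left mult_1_right add_0 add_0_right minus_zero minus_minus)
lemma tab3_1:
  "s16 F T T T F F F F T T F T F F F T = 158474012"
  "s16 F T T T F F F F T T F T F F T F = - 1017297000"
  "s16 F T T T F F F F T T F T F F T T = - 50144426"
  "s16 F T T T F F F F T T F T F T F F = 85633584"
  "s16 F T T T F F F F T T F T F T F T = - 537229116"
  "s16 F T T T F F F F T T F T T F F F = - 84935568"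
  "s16 F T T T F F F F T T F T T F T F = 74488154"
  "s16 F T T T F F F F T T T T F F F F = 74771276"
  "s16 F T T T F F F F T T T T F T F F = - 709384858"
  "s16 F T T T F F F F T T T T T F F F = - 1396491402"
  "s16 F T T T F F F T F F F F F T F F = 1427112530"
  "s16 F T T T F F F T F F F F F T F T = 871996213"
  "s16 F T T T F F F T F F F F T F F F = - 571705744"
  "s16 F T T T F F F T F F F F T F F T = - 252603884"
  "s16 F T T T F F F T F F F F T F T T = - 44970796"
  "s16 F T T T F F F T F F F F T T F F = 595981166"
  "s16 F T T T F F F T F F F F T T F T = 845834325"
  "s16 F T T T F F F T F F F T F F F F = - 613992552"
  "s16 F T T T F F F T F F F T F F F T = - 494351488"
  "s16 F T T T F F F T F F F T F F T F = - 394115593"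
  "s16 F T T T F F F T F F F T F F T T = - 187721068"
  "s16 F T T T F F F T F F F T F T F F = 326157024"
  "s16 F T T T F F F T F F F T F T F T = 180592588"
  "s16 F T T T F F F T F F F T T F F F = - 241513732"
  "s16 F T T T F F F T F F F T T F T F = - 727149301"
  "s16 F T T T F F F T F F T T F F F F = - 541495612"
  "s16 F T T T F F F T F F T T F T F F = 77192834"
  "s16 F T T T F F F T F F T T T F F F = - 596414446"
  "s16 F T T T F F F T F T F F F T F T = 1310985381"
  "s16 F T T T F F F T F T F F F T T F = 1081801946"
  "s16 F T T T F F F T F T F F T F F F = - 476271991"
  "s16 F T T T F F F T F T F F T F F T = 158474012"
  "s16 F T T T F F F T F T F F T F T F = - 84935568"
  "s16 F T T T F F F T F T F F T F T T = 120377502"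
  "s16 F T T T F F F T F T F F T T F F = - 696785512"
  "s16 F T T T F F F T F T F F T T F T = 329053500"
  "s16 F T T T F F F T F T F F T T T F = 603130966"
  "s16 F T T T F F F T F T F T F F F F = - 494351488"
  "s16 F T T T F F F T F T F T F F F T = - 43796302"
  "s16 F T T T F F F T F T F T F F T F = - 585687601"
  by (simp_all only: s16_0111 u3_eqs dotl.simps arith_simps rel_simps arith_special simp_thms if_True if_False order_refl mult_zero_left mult_zero_right mult_1_left mult_1_right add_0 add_0_right minus_zero minus_minus)
lemma tab3_2:
  "s16 F T T T F F F T F T F T F F T T = - 394672159"
  "s16 F T T T F F F T F T F T F T F F = - 92767583"
  "s16 F T T T F F F T F T F T F T F T = 122909259"
  "s16 F T T T F F F T F T F T T F F F = - 398827311"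
  "s16 F T T T F F F T F T F T T F T F = - 172584412"
  "s16 F T T T F F F T F T T F F F F F = - 241513732"
  "s16 F T T T F F F T F T T F F F F T = 55841753"
  "s16 F T T T F F F T F T T F F F T F = - 398827311"
  "s16 F T T T F F F T F T T F F F T T = - 13918391"
  "s16 F T T T F F F T F T T F F T F F = 233018757"
  "s16 F T T T F F F T F T T F F T T F = - 47868485"
  "s16 F T T T F F F T F T T F T F F F = - 524675630"
  "s16 F T T T F F F T F T T F T F F T = - 65908538"
  "s16 F T T T F F F T F T T T F F F F = - 22208446"
  "s16 F T T T F F F T F T T T F T F F = - 207339783"
  "s16 F T T T F F F T F T T T T F F F = - 966265599"
  "s16 F T T T F F T F T T F F T F T T = 193491120"
  "s16 F T T T F F T F T T F F T T F F = - 350400180"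
  "s16 F T T T F F T F T T F F T T F T = 83820834"
  "s16 F T T T F F T F T T F T F T F F = - 9822812"
  "s16 F T T T F F T F T T F T F T F T = - 209521352"
  "s16 F T T T F F T F T T T T F T F F = - 332896020"
  "s16 F T T T F F T T F F F F T T F F = 2240566870"
  "s16 F T T T F F T T F F F F T T F T = 422692503"
  "s16 F T T T F F T T F F F T F F F F = - 394115593"
  "s16 F T T T F F T T F F F T F F F T = - 585687601"
  "s16 F T T T F F T T F F F T F F T F = 399554890"
  "s16 F T T T F F T T F F F T F F T T = - 22665746"
  "s16 F T T T F F T T F F F T F T F F = 258732467"
  "s16 F T T T F F T T F F F T F T F T = 602396350"
  "s16 F T T T F F T T F F F T T F F F = 55841753"
  "s16 F T T T F F T T F F F T T F T F = - 827848252"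
  "s16 F T T T F F T T F F T T F F F F = - 734644504"
  "s16 F T T T F F T T F F T T F T F F = 603317220"
  "s16 F T T T F F T T F F T T T F F F = 925749250"
  "s16 F T T T F F T T F T F F T T F T = 793939697"
  "s16 F T T T F F T T F T F F T T T F = 434281502"
  "s16 F T T T F F T T F T F T F F F F = - 187721068"
  "s16 F T T T F F T T F T F T F F F T = - 394672159"
  "s16 F T T T F F T T F T F T F F T F = - 22665746"
  by (simp_all only: s16_0111 u3_eqs dotl.simps arith_simps rel_simps arith_special simp_thms if_True if_False order_refl mult_zero_left mult_zero_right mult_1_left mult_1_right add_0 add_0_right minus_zero minus_minus)
lemma tab3_3:
  "s16 F T T T F F T T F T F T F F T T = 268272846"
  "s16 F T T T F F T T F T F T F T F F = 437472914"
  "s16 F T T T F F T T F T F T F T F T = 8445779"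
  "s16 F T T T F F T T F T F T T F F F = - 13918391"
  "s16 F T T T F F T T F T F T T F T F = - 342168312"
  "s16 F T T T F F T T F T T F F F F F = - 727149301"
  "s16 F T T T F F T T F T T F F F F T = - 827848252"
  "s16 F T T T F F T T F T T F F F T F = - 172584412"
  "s16 F T T T F F T T F T T F F F T T = - 342168312"
  "s16 F T T T F F T T F T T F F T F F = - 20504267"
  "s16 F T T T F F T T F T T F F T T F = 82801567"
  "s16 F T T T F F T T F T T F T F F F = - 65908538"
  "s16 F T T T F F T T F T T F T F F T = - 592951724"
  "s16 F T T T F F T T F T T T F F F F = - 436298196"
  "s16 F T T T F F T T F T T T F T F F = - 144200136"
  "s16 F T T T F F T T F T T T T F F F = - 339469621"
  "s16 F T T T F T F T F F F T F T F F = 428438610"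
  "s16 F T T T F T F T F F F T F T F T = - 44346294"
  "s16 F T T T F T F T F F T F F F F F = - 541495612"
  "s16 F T T T F T F T F F T F F F F T = - 734644504"
  "s16 F T T T F T F T F F T F F F T F = - 22208446"
  "s16 F T T T F T F T F F T F F F T T = - 436298196"
  "s16 F T T T F T F T F F T F F T F F = - 181255900"
  "s16 F T T T F T F T F F T F F T T F = - 80025304"
  "s16 F T T T F T F T F F T T F T F F = 16789468"
  "s16 F T T T F T F T F T F T F T F T = 953212924"
  "s16 F T T T F T F T F T T F F F F F = - 596414446"
  "s16 F T T T F T F T F T T F F F F T = 925749250"
  "s16 F T T T F T F T F T T F F F T F = - 966265599"
  "s16 F T T T F T F T F T T F F F T T = - 339469621"
  "s16 F T T T F T F T F T T F F T F F = - 80025304"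
  "s16 F T T T F T F T F T T F F T T F = 297052796"
  "s16 F T T T F T F T F T T T F T F F = 360880498"
  "s16 F T T T T T F T F F T T F T F F = 572738790"
  by (simp_all only: s16_0111 u3_eqs dotl.simps arith_simps rel_simps arith_special simp_thms if_True if_False order_refl mult_zero_left mult_zero_right mult_1_left mult_1_right add_0 add_0_right minus_zero minus_minus)
lemmas s16_tab = tab0_0 tab0_1 tab0_2 tab0_3 tab0_4 tab0_5 tab0_6 tab1_0 tab1_1 tab1_2 tab1_3 tab1_4 tab1_5 tab1_6 tab1_7 tab1_8 tab1_9 tab2_0 tab2_1 tab2_2 tab2_3 tab2_4 tab2_5 tab2_6 tab2_7 tab2_8 tab3_0 tab3_1 tab3_2 tab3_3

lemmas okx_eval = okx_def ok5_def le6_def of_bool_eq one_add_one add_0 add_0_right arith_simps arith_special rel_simps order_refl simp_thms le_numeral_extra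
lemmas S6_eval = S6_def rt_def hh_eqs r2_eqs s16_swap0 s16_swap1 s16_swap2 s16_swap3 s16_tab arith_simps rel_simps arith_special simp_thms if_True if_False order_refl mult_zero_left mult_zero_right mult_1_left mult_1_right add_0 add_0_right minus_zero minus_minus
text \<open>One statement per representative on 0,...,4. The six triples of vertex 5 with pairs from
  0, 1, 2, 3 are split first, so that codes violating \<open>ok5\<close> disappear before the last
  four bits are split. All values are integers, whence strict positivity has the form of the bound
  1.\<close>

lemma S6_rep0: "\<forall>b015 b025 b035 b125 b135 b235. ok5 F F F F b015 b025 b035 b125 b135 b235 \<longrightarrow>
    (\<forall>b045 b145 b245 b345. okx F F F F F F F F F F b015 b025 b035 b125 b135 b235 b045 b145 b245 b345 \<longrightarrow> 1 \<le> S6 F F F F F F F F F F b015 b025 b035 b125 b135 b235 b045 b145 b245 b345)"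
  by (intro all_boolI; simp only: ok5_def simp_thms; intro all_boolI; simp only: okx_eval; simp only: S6_eval)

lemma S6_rep1: "\<forall>b015 b025 b035 b125 b135 b235. ok5 F F F F b015 b025 b035 b125 b135 b235 \<longrightarrow>
    (\<forall>b045 b145 b245 b345. okx F F F F F F F F F T b015 b025 b035 b125 b135 b235 b045 b145 b245 b345 \<longrightarrow> 1 \<le> S6 F F F F F F F F F T b015 b025 b035 b125 b135 b235 b045 b145 b245 b345)"
  by (intro all_boolI; simp only: ok5_def simp_thms; intro all_boolI; simp only: okx_eval; simp only: S6_eval)

lemma S6_rep2: "\<forall>b015 b025 b035 b125 b135 b235. ok5 F F F F b015 b025 b035 b125 b135 b235 \<longrightarrow>
    (\<forall>b045 b145 b245 b345. okx F F F F F F F F T T b015 b025 b035 b125 b135 b235 b045 b145 b245 b345 \<longrightarrow> 1 \<le> S6 F F F F F F F F T T b015 b025 b035 b125 b135 b235 b045 b145 b245 b345)"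
  by (intro all_boolI; simp only: ok5_def simp_thms; intro all_boolI; simp only: okx_eval; simp only: S6_eval)

lemma S6_rep3: "\<forall>b015 b025 b035 b125 b135 b235. ok5 F F F F b015 b025 b035 b125 b135 b235 \<longrightarrow>
    (\<forall>b045 b145 b245 b345. okx F F F F F F F T T T b015 b025 b035 b125 b135 b235 b045 b145 b245 b345 \<longrightarrow> 1 \<le> S6 F F F F F F F T T T b015 b025 b035 b125 b135 b235 b045 b145 b245 b345)"
  by (intro all_boolI; simp only: ok5_def simp_thms; intro all_boolI; simp only: okx_eval; simp only: S6_eval)

lemma S6_rep4: "\<forall>b015 b025 b035 b125 b135 b235. ok5 F F F F b015 b025 b035 b125 b135 b235 \<longrightarrow>
    (\<forall>b045 b145 b245 b345. okx F F F F F F T F T T b015 b025 b035 b125 b135 b235 b045 b145 b245 b345 \<longrightarrow> 1 \<le> S6 F F F F F F T F T T b015 b025 b035 b125 b135 b235 b045 b145 b245 b345)"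
  by (intro all_boolI; simp only: ok5_def simp_thms; intro all_boolI; simp only: okx_eval; simp only: S6_eval)

lemma S6_rep5: "\<forall>b015 b025 b035 b125 b135 b235. ok5 F F F F b015 b025 b035 b125 b135 b235 \<longrightarrow>
    (\<forall>b045 b145 b245 b345. okx F F F F F F T T F F b015 b025 b035 b125 b135 b235 b045 b145 b245 b345 \<longrightarrow> 1 \<le> S6 F F F F F F T T F F b015 b025 b035 b125 b135 b235 b045 b145 b245 b345)"
  by (intro all_boolI; simp only: ok5_def simp_thms; intro all_boolI; simp only: okx_eval; simp only: S6_eval)

lemma S6_rep6: "\<forall>b015 b025 b035 b125 b135 b235. ok5 F F F F b015 b025 b035 b125 b135 b235 \<longrightarrow>
    (\<forall>b045 b145 b245 b345. okx F F F F F F T T F T b015 b025 b035 b125 b135 b235 b045 b145 b245 b345 \<longrightarrow> 1 \<le> S6 F F F F F F T T F T b015 b025 b035 b125 b135 b235 b045 b145 b245 b345)"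
  by (intro all_boolI; simp only: ok5_def simp_thms; intro all_boolI; simp only: okx_eval; simp only: S6_eval)

lemma S6_rep7: "\<forall>b015 b025 b035 b125 b135 b235. ok5 F F F F b015 b025 b035 b125 b135 b235 \<longrightarrow>
    (\<forall>b045 b145 b245 b345. okx F F F F F F T T T T b015 b025 b035 b125 b135 b235 b045 b145 b245 b345 \<longrightarrow> 1 \<le> S6 F F F F F F T T T T b015 b025 b035 b125 b135 b235 b045 b145 b245 b345)"
  by (intro all_boolI; simp only: ok5_def simp_thms; intro all_boolI; simp only: okx_eval; simp only: S6_eval)

lemma S6_rep8: "\<forall>b015 b025 b035 b125 b135 b235. ok5 F F F F b015 b025 b035 b125 b135 b235 \<longrightarrow>
    (\<forall>b045 b145 b245 b345. okx F F F F F T T T T F b015 b025 b035 b125 b135 b235 b045 b145 b245 b345 \<longrightarrow> 1 \<le> S6 F F F F F T T T T F b015 b025 b035 b125 b135 b235 b045 b145 b245 b345)"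
  by (intro all_boolI; simp only: ok5_def simp_thms; intro all_boolI; simp only: okx_eval; simp only: S6_eval)

lemma S6_rep9: "\<forall>b015 b025 b035 b125 b135 b235. ok5 F F F F b015 b025 b035 b125 b135 b235 \<longrightarrow>
    (\<forall>b045 b145 b245 b345. okx F F F F F T T T T T b015 b025 b035 b125 b135 b235 b045 b145 b245 b345 \<longrightarrow> 1 \<le> S6 F F F F F T T T T T b015 b025 b035 b125 b135 b235 b045 b145 b245 b345)"
  by (intro all_boolI; simp only: ok5_def simp_thms; intro all_boolI; simp only: okx_eval; simp only: S6_eval)

lemma S6_rep10: "\<forall>b015 b025 b035 b125 b135 b235. ok5 F F F F b015 b025 b035 b125 b135 b235 \<longrightarrow>
    (\<forall>b045 b145 b245 b345. okx F F F F T T T T T T b015 b025 b035 b125 b135 b235 b045 b145 b245 b345 \<longrightarrow> 1 \<le> S6 F F F F T T T T T T b015 b025 b035 b125 b135 b235 b045 b145 b245 b345)"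
  by (intro all_boolI; simp only: ok5_def simp_thms; intro all_boolI; simp only: okx_eval; simp only: S6_eval)

lemma S6_rep11: "\<forall>b015 b025 b035 b125 b135 b235. ok5 F F F T b015 b025 b035 b125 b135 b235 \<longrightarrow>
    (\<forall>b045 b145 b245 b345. okx F F F T F F T T F F b015 b025 b035 b125 b135 b235 b045 b145 b245 b345 \<longrightarrow> 1 \<le> S6 F F F T F F T T F F b015 b025 b035 b125 b135 b235 b045 b145 b245 b345)"
  by (intro all_boolI; simp only: ok5_def simp_thms; intro all_boolI; simp only: okx_eval; simp only: S6_eval)

lemma S6_rep12: "\<forall>b015 b025 b035 b125 b135 b235. ok5 F F F T b015 b025 b035 b125 b135 b235 \<longrightarrow>
    (\<forall>b045 b145 b245 b345. okx F F F T F F T T F T b015 b025 b035 b125 b135 b235 b045 b145 b245 b345 \<longrightarrow> 1 \<le> S6 F F F T F F T T F T b015 b025 b035 b125 b135 b235 b045 b145 b245 b345)"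
  by (intro all_boolI; simp only: ok5_def simp_thms; intro all_boolI; simp only: okx_eval; simp only: S6_eval)

lemma S6_rep13: "\<forall>b015 b025 b035 b125 b135 b235. ok5 F F F T b015 b025 b035 b125 b135 b235 \<longrightarrow>
    (\<forall>b045 b145 b245 b345. okx F F F T F T T F T F b015 b025 b035 b125 b135 b235 b045 b145 b245 b345 \<longrightarrow> 1 \<le> S6 F F F T F T T F T F b015 b025 b035 b125 b135 b235 b045 b145 b245 b345)"
  by (intro all_boolI; simp only: ok5_def simp_thms; intro all_boolI; simp only: okx_eval; simp only: S6_eval)

lemma S6_rep14: "\<forall>b015 b025 b035 b125 b135 b235. ok5 F F F T b015 b025 b035 b125 b135 b235 \<longrightarrow>
    (\<forall>b045 b145 b245 b345. okx F F F T F T T F T T b015 b025 b035 b125 b135 b235 b045 b145 b245 b345 \<longrightarrow> 1 \<le> S6 F F F T F T T F T T b015 b025 b035 b125 b135 b235 b045 b145 b245 b345)"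
  by (intro all_boolI; simp only: ok5_def simp_thms; intro all_boolI; simp only: okx_eval; simp only: S6_eval)

lemma S6_rep15: "\<forall>b015 b025 b035 b125 b135 b235. ok5 F F F T b015 b025 b035 b125 b135 b235 \<longrightarrow>
    (\<forall>b045 b145 b245 b345. okx F F F T F T T T T F b015 b025 b035 b125 b135 b235 b045 b145 b245 b345 \<longrightarrow> 1 \<le> S6 F F F T F T T T T F b015 b025 b035 b125 b135 b235 b045 b145 b245 b345)"
  by (intro all_boolI; simp only: ok5_def simp_thms; intro all_boolI; simp only: okx_eval; simp only: S6_eval)

lemma S6_rep16: "\<forall>b015 b025 b035 b125 b135 b235. ok5 F F F T b015 b025 b035 b125 b135 b235 \<longrightarrow>
    (\<forall>b045 b145 b245 b345. okx F F F T T T T F F F b015 b025 b035 b125 b135 b235 b045 b145 b245 b345 \<longrightarrow> 1 \<le> S6 F F F T T T T F F F b015 b025 b035 b125 b135 b235 b045 b145 b245 b345)"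
  by (intro all_boolI; simp only: ok5_def simp_thms; intro all_boolI; simp only: okx_eval; simp only: S6_eval)

lemma S6_rep17: "\<forall>b015 b025 b035 b125 b135 b235. ok5 F F F T b015 b025 b035 b125 b135 b235 \<longrightarrow>
    (\<forall>b045 b145 b245 b345. okx F F F T T T T F F T b015 b025 b035 b125 b135 b235 b045 b145 b245 b345 \<longrightarrow> 1 \<le> S6 F F F T T T T F F T b015 b025 b035 b125 b135 b235 b045 b145 b245 b345)"
  by (intro all_boolI; simp only: ok5_def simp_thms; intro all_boolI; simp only: okx_eval; simp only: S6_eval)

lemma S6_rep18: "\<forall>b015 b025 b035 b125 b135 b235. ok5 F F F T b015 b025 b035 b125 b135 b235 \<longrightarrow>
    (\<forall>b045 b145 b245 b345. okx F F F T T T T F T T b015 b025 b035 b125 b135 b235 b045 b145 b245 b345 \<longrightarrow> 1 \<le> S6 F F F T T T T F T T b015 b025 b035 b125 b135 b235 b045 b145 b245 b345)"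
  by (intro all_boolI; simp only: ok5_def simp_thms; intro all_boolI; simp only: okx_eval; simp only: S6_eval)

lemma S6_rep19: "\<forall>b015 b025 b035 b125 b135 b235. ok5 F F T T b015 b025 b035 b125 b135 b235 \<longrightarrow>
    (\<forall>b045 b145 b245 b345. okx F F T T F T T T T F b015 b025 b035 b125 b135 b235 b045 b145 b245 b345 \<longrightarrow> 1 \<le> S6 F F T T F T T T T F b015 b025 b035 b125 b135 b235 b045 b145 b245 b345)"
  by (intro all_boolI; simp only: ok5_def simp_thms; intro all_boolI; simp only: okx_eval; simp only: S6_eval)

lemma S6_rep20: "\<forall>b015 b025 b035 b125 b135 b235. ok5 F F T T b015 b025 b035 b125 b135 b235 \<longrightarrow>
    (\<forall>b045 b145 b245 b345. okx F F T T T F T T F F b015 b025 b035 b125 b135 b235 b045 b145 b245 b345 \<longrightarrow> 1 \<le> S6 F F T T T F T T F F b015 b025 b035 b125 b135 b235 b045 b145 b245 b345)"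
  by (intro all_boolI; simp only: ok5_def simp_thms; intro all_boolI; simp only: okx_eval; simp only: S6_eval)

section \<open>Certificates for five-vertex 3-graphs coloured by membership in A\<close>

definition dg :: "bool \<Rightarrow> real" where
  "dg e = (if e then 5359 else - 4641)"

text \<open>\<open>dg\<close> and \<open>cl\<close> are ten thousand times the surplus of an
  indicator over 0.4641, a rational just below \<open>lam\<close>, and over 0.6119, the lower bound
  proved later for the weight of A.\<close>

definition cl :: "bool \<Rightarrow> real" where
  "cl c = (if c then 3881 else - 6119)"

text \<open>The type consists of the root v and two vertices x, y with their colours and the bit
  vxy; a flag adds a vertex z with its colour and the bits vxz, vyz, xyz. The colour pattern True,
  False of x, y gets the empty vector, since exchanging x and y turns it into False, True.\<close>

definition vA :: "bool \<Rightarrow> bool \<Rightarrow> bool \<Rightarrow> bool \<Rightarrow> bool \<Rightarrow> bool \<Rightarrow> bool \<Rightarrow> real list" where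
  "vA a b c d e f g = (if a then (if b then (if c then (if d then (if e then (if f then (if g then [] else [- 2406, - 4579, 0]) else (if g then [- 2376, - 2155, 2527] else [- 4449, 847, 2038])) else (if f then (if g then [- 2376, - 2155, - 2527] else [- 4449, 847, - 2038]) else (if g then [- 3602, 3585, 0] else [- 4495, 1339, 0]))) else (if e then (if f then (if g then [] else [7314, - 2381, 0]) else (if g then [6896, - 1075, 451] else [5408, 1810, 802])) else (if f then (if g then [6896, - 1075, - 451] else [5408, 1810, - 802]) else (if g then [4849, 4640, 0] else [3218, - 872, 0])))) else (if d then (if e then (if f then (if g then [- 3080, - 5183, 1067, 7264, 0] else [3117, - 4754, - 768, - 2288, 0]) else (if g then [- 4368, 122, 597, 1264, - 862] else [- 2802, - 504, - 649, 549, 0])) else (if f then (if g then [- 4368, 122, 597, 1264, 862] else [- 2802, - 504, - 649, 549, 0]) else (if g then [- 5154, - 240, 4606, - 1017, 0] else [- 3924, 385, - 940, - 955, 0]))) else (if e then (if f then (if g then [6307, - 689, 1422, 1297, 0] else [- 563, 4962, - 1077, 2964, 0]) else (if g then [5088, 282, 1195, 39, 0] else [2780, 5069, - 75, - 2335, - 4797])) else (if f then (if g then [5088, 282, 1195, 39, 0] else [2780, 5069, - 75, - 2335, 4797]) else (if g then [1311, 2648, 2358, 2530, 0] else [5957, - 2437, - 1981, - 520, 0]))))) else []) else (if b then (if c then (if d then (if e then (if f then (if g then [] else [3622, - 2380, - 1140, 263]) else (if g then [2373, 3847, 461, 994] else [684, - 1734, - 3851, 1262])) else (if f then (if g then [6507,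 4181, 2298, - 1590] else [4681, - 8063, 2810, - 564]) else (if g then [2795, 1726, - 2389, - 53] else [2205, 6615, - 7843, - 4361]))) else (if e then (if f then (if g then [] else [- 4179, - 2340, 4176, - 12]) else (if g then [- 4089, 4377, - 366, - 1420] else [- 3693, 328, - 1162, - 2590])) else (if f then (if g then [- 6551, - 2335, - 238, 534] else [- 3921, - 6078, - 465, - 1355]) else (if g then [- 6558, 3872, 176, - 351] else [- 5107, - 684, - 268, - 1044])))) else (if d then (if e then (if f then (if g then [- 740, - 11085, - 1079, - 700, 50] else [3359, 51, - 6378, 1652, 2398]) else (if g then [6120, 3763, - 137, 2796, 291] else [2997, - 1544, - 946, - 9125, 1206])) else (if f then (if g then [1447, - 3783, - 1457, - 756, - 217] else [1619, 5203, - 6293, - 3038, - 1509]) else (if g then [4943, 1283, 1686, 211, 414] else [9283, 3833, 1724, 2151, - 2263]))) else (if e then (if f then (if g then [- 7278, - 1842, - 2114, 789, - 877] else [- 7331, - 359, - 2947, - 258, - 687]) else (if g then [- 4374, 570, 3749, - 439, 306] else [- 4992, 1589, 1183, - 511, - 5])) else (if f then (if g then [- 3413, 4306, - 116, 1956, 316] else [- 5100, 2115, - 3316, - 3496, 2810]) else (if g then [- 5120, 2613, 3120, - 1199, - 955] else [- 5138, 2264, 1231, - 1507, - 8]))))) else (if c then (if d then (if e then (if f then (if g then [] else [- 3728, 5443, - 754, 91]) else (if g then [- 2817, 3134, 1132, 300] else [- 1811, - 1542, - 217, 753])) else (if f then (if g then [- 2817, 3134, 1132, 300] else [- 1811, -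 1542, - 217, 753]) else (if g then [- 2438, - 2065, 5951, - 536] else [- 1698, - 3007, - 1526, 935]))) else (if e then (if f then (if g then [] else [3743, 20, - 221, - 1071]) else (if g then [3300, 1069, 553, - 1062] else [3136, 545, 18, - 962])) else (if f then (if g then [3300, 1069, 553, - 1062] else [3136, 545, 18, - 962]) else (if g then [5495, 1372, 1573, 2723] else [4599, 831, 678, 1534])))) else (if d then (if e then (if f then (if g then [- 5095, 1898, 618, 146] else [- 2722, - 650, 607, 310]) else (if g then [- 2275, - 435, 98, - 175] else [- 361, - 1251, - 336, 76])) else (if f then (if g then [- 2275, - 435, 98, - 175] else [- 361, - 1251, - 336, 76]) else (if g then [- 2688, 3532, - 164, 473] else [- 1290, - 1990, 120, - 245]))) else (if e then (if f then (if g then [3324, 577, 3254, - 812] else [4276, - 496, 788, 1752]) else (if g then [2517, 248, 109, - 41] else [3463, 434, - 152, 234])) else (if f then (if g then [2517, 248, 109, - 41] else [3463, 434, - 152, 234]) else (if g then [4086, 1065, - 1289, - 736] else [4286, 827, - 845, - 350])))))))"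

text \<open>Coefficients of a further square: the square of an average over the pair x, y, with the
  root alone as type.\<close>

definition zzA :: "bool \<Rightarrow> bool \<Rightarrow> bool \<Rightarrow> real" where
  "zzA a b c = (if a then (if b then (if c then - 2861 else - 1144) else (if c then 591 else 2327)) else (if b then (if c then 591 else 2327) else (if c then - 906 else 858)))"

text \<open>A nonnegative average says that pairs inside A forming an edge with the root have
  density at most 0.0525. For a root in A these are edges inside A, which are wrongly
  placed.\<close>

definition obA :: "bool \<Rightarrow> bool \<Rightarrow> bool \<Rightarrow> real" where
  "obA a b c = (if a then (if b then (if c then - 9475 else 525) else 525) else 525)"

text \<open>The loss of Phi, read off at a link pair, when a root in A is moved out of A: the
  summand rises from -38 to 1, falls from 1 to -19, or rises from -19 to 0.\<close>

definition kcA :: "bool \<Rightarrow> bool \<Rightarrow> bool \<Rightarrow> real" where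
  "kcA a b c = (if a then (if b then (if c then - 39 else 0) else (if c then 20 else 0)) else (if b then (if c then 20 else 0) else (if c then - 19 else 0)))"

text \<open>Nonnegative multiplier of the cut inequality. Likewise \<open>mdA\<close> multiplies the
  degree of the root, \<open>mDA\<close> the degree of x, \<open>mlA\<close> the weight of A,
  \<open>mkA\<close> the inequality Phi >= 0, and \<open>mgA\<close> the density of edges meeting A.
  Each depends only on vertices over which the multiplied inequality is not averaged, so the product
  keeps a nonnegative average.\<close>

definition mcA :: "bool \<Rightarrow> bool \<Rightarrow> bool \<Rightarrow> real" where
  "mcA a b c = (if a then (if b then (if c then 813000 else 0) else 0) else (if b then 0 else (if c then 488000 else 0)))"

definition mdA :: "bool \<Rightarrow> bool \<Rightarrow> bool \<Rightarrow> real" where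
  "mdA a b c = (if a then (if b then (if c then 1893 else 2077) else (if c then 0 else 969)) else (if b then (if c then 0 else 969) else (if c then 0 else 123)))"

definition mlA :: "bool \<Rightarrow> bool \<Rightarrow> bool \<Rightarrow> real" where
  "mlA a b c = (if a then 0 else (if b then 0 else (if c then 360 else 1596)))"

definition mkA :: "bool \<Rightarrow> real" where
  "mkA a = (if a then 518000 else 242000)"

definition mgA :: "bool \<Rightarrow> real" where
  "mgA a = (if a then 916 else 344)"

definition mDA :: "bool \<Rightarrow> bool \<Rightarrow> bool \<Rightarrow> real" where
  "mDA a b c = (if a then (if b then (if c then 3096 else 0) else (if c then 2865 else 0)) else (if b then 0 else (if c then 395 else 0)))"

definition ppA :: "bool \<Rightarrow> bool \<Rightarrow> bool \<Rightarrow> bool \<Rightarrow> bool \<Rightarrow> bool \<Rightarrow> real" where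
  "ppA a b c d e f = 1000 * obA a b c - mcA d e f * kcA a b c - mdA d e f * dg c - zzA a b c * zzA d e f"

definition llA :: "bool \<Rightarrow> bool \<Rightarrow> bool \<Rightarrow> bool \<Rightarrow> real" where
  "llA a b c d = mlA a b c * cl d"

definition kgA :: "bool \<Rightarrow> bool \<Rightarrow> bool \<Rightarrow> bool \<Rightarrow> bool \<Rightarrow> real" where
  "kgA a b c d e = mkA e * (if d then hh a b c else 0) + mgA e * (if a \<or> b \<or> c then dg d else 0)"

definition ddA :: "bool \<Rightarrow> bool \<Rightarrow> bool \<Rightarrow> bool \<Rightarrow> real" where
  "ddA a b c d = mDA a b c * dg d"

text \<open>The scaled objective minus multiples of valid inequalities minus squares. If its
  symmetrisation \<open>S4A\<close> is nonnegative at every coloured good 3-graph, averaging leaves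
  a nonnegative objective.\<close>

definition lfA :: "bool \<Rightarrow> bool \<Rightarrow> bool \<Rightarrow> bool \<Rightarrow> bool \<Rightarrow> bool \<Rightarrow> bool \<Rightarrow> bool \<Rightarrow> bool \<Rightarrow> bool \<Rightarrow> bool \<Rightarrow> bool \<Rightarrow> bool \<Rightarrow> bool \<Rightarrow> real" where
  "lfA cx cy cz ct vxy vxz vyz xyz vxt vyt vzt xyt xzt yzt =
    ppA cx cy vxy cz ct vzt - llA cx cy vxy cz - llA cx cy vxy ct - kgA cx cy cz xyz ct - kgA cx cy ct xyt cz
    - ddA cx cy vxy xzt - dotl (vA cx cy vxy cz vxz vyz xyz) (vA cx cy vxy ct vxt vyt xyt)"

definition S4A :: "bool \<Rightarrow> bool \<Rightarrow> bool \<Rightarrow> bool \<Rightarrow> bool \<Rightarrow> bool \<Rightarrow> bool \<Rightarrow> bool \<Rightarrow> bool \<Rightarrow> bool \<Rightarrow> bool \<Rightarrow> bool \<Rightarrow> bool \<Rightarrow> bool \<Rightarrow> real" where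
  "S4A c1 c2 c3 c4 b012 b013 b023 b123 b014 b024 b034 b124 b134 b234 =
    lfA c1 c2 c3 c4 b012 b013 b023 b123 b014 b024 b034 b124 b134 b234 +
    lfA c1 c3 c2 c4 b013 b012 b023 b123 b014 b034 b024 b134 b124 b234 +
    lfA c1 c4 c2 c3 b014 b012 b024 b124 b013 b034 b023 b134 b123 b234 +
    lfA c2 c1 c3 c4 b012 b023 b013 b123 b024 b014 b034 b124 b234 b134 +
    lfA c2 c3 c1 c4 b023 b012 b013 b123 b024 b034 b014 b234 b124 b134 +
    lfA c2 c4 c1 c3 b024 b012 b014 b124 b023 b034 b013 b234 b123 b134 +
    lfA c3 c1 c2 c4 b013 b023 b012 b123 b034 b014 b024 b134 b234 b124 +
    lfA c3 c2 c1 c4 b023 b013 b012 b123 b034 b024 b014 b234 b134 b124 +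
    lfA c3 c4 c1 c2 b034 b013 b014 b134 b023 b024 b012 b234 b123 b124 +
    lfA c4 c1 c2 c3 b014 b024 b012 b124 b034 b013 b023 b134 b234 b123 +
    lfA c4 c2 c1 c3 b024 b014 b012 b124 b034 b023 b013 b234 b134 b123 +
    lfA c4 c3 c1 c2 b034 b014 b013 b134 b024 b023 b012 b234 b124 b123"

lemmas vA_eqs = vA_def[abs_def, THEN meta_eq_to_obj_eq, simplified fun_eq_iff all_bool if_True if_False simp_thms ]
lemmas ppA_eqs = ppA_def[abs_def, THEN meta_eq_to_obj_eq, simplified fun_eq_iff all_bool if_True if_False simp_thms  obA_def mcA_def kcA_def mdA_def dg_def zzA_def arith_simps rel_simps arith_special simp_thms if_True if_False order_refl mult_zero_left mult_zero_right mult_1_left mult_1_right add_0 add_0_right minus_zero minus_minus]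
lemmas llA_eqs = llA_def[abs_def, THEN meta_eq_to_obj_eq, simplified fun_eq_iff all_bool if_True if_False simp_thms  mlA_def cl_def arith_simps rel_simps arith_special simp_thms if_True if_False order_refl mult_zero_left mult_zero_right mult_1_left mult_1_right add_0 add_0_right minus_zero minus_minus]
lemmas kgA_eqs = kgA_def[abs_def, THEN meta_eq_to_obj_eq, simplified fun_eq_iff all_bool if_True if_False simp_thms  mkA_def hh_def mgA_def dg_def arith_simps rel_simps arith_special simp_thms if_True if_False order_refl mult_zero_left mult_zero_right mult_1_left mult_1_right add_0 add_0_right minus_zero minus_minus]
lemmas ddA_eqs = ddA_def[abs_def, THEN meta_eq_to_obj_eq, simplified fun_eq_iff all_bool if_True if_False simp_thms  mDA_def dg_def arith_simps rel_simps arith_special simp_thms if_True if_False order_refl mult_zero_left mult_zero_right mult_1_left mult_1_right add_0 add_0_right minus_zero minus_minus]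
lemmas S4A_eval = S4A_def lfA_def ppA_eqs llA_eqs kgA_eqs ddA_eqs vA_eqs dotl.simps arith_simps rel_simps arith_special simp_thms if_True if_False order_refl mult_zero_left mult_zero_right mult_1_left mult_1_right add_0 add_0_right minus_zero minus_minus
text \<open>A root breaks the symmetry by which representatives were chosen, so the five conjuncts
  take each vertex of the representative as root in turn. The colours of the other four vertices
  range freely.\<close>

lemma S4A_rep0: "\<forall>c1 c2 c3 c4. 0 \<le> S4A c1 c2 c3 c4 F F F F F F F F F F \<and>
    0 \<le> S4A c1 c2 c3 c4 F F F F F F F F F F \<and>
    0 \<le> S4A c1 c2 c3 c4 F F F F F F F F F F \<and>
    0 \<le> S4A c1 c2 c3 c4 F F F F F F F F F F \<and>
    0 \<le> S4A c1 c2 c3 c4 F F F F F F F F F F"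
  by (intro all_boolI; simp only: S4A_eval)

lemma S4A_rep1: "\<forall>c1 c2 c3 c4. 0 \<le> S4A c1 c2 c3 c4 F F F F F F F F F T \<and>
    0 \<le> S4A c1 c2 c3 c4 F F F F F F F F F T \<and>
    0 \<le> S4A c1 c2 c3 c4 F F F F F F T F F F \<and>
    0 \<le> S4A c1 c2 c3 c4 F F F F F F T F F F \<and>
    0 \<le> S4A c1 c2 c3 c4 F F F F F F T F F F"
  by (intro all_boolI; simp only: S4A_eval)

lemma S4A_rep2: "\<forall>c1 c2 c3 c4. 0 \<le> S4A c1 c2 c3 c4 F F F F F F F F T T \<and>
    0 \<le> S4A c1 c2 c3 c4 F F F F F F T F F T \<and>
    0 \<le> S4A c1 c2 c3 c4 F F F F F F T F F T \<and>
    0 \<le> S4A c1 c2 c3 c4 F F F F F T T F F F \<and>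
    0 \<le> S4A c1 c2 c3 c4 F F F F F T T F F F"
  by (intro all_boolI; simp only: S4A_eval)

lemma S4A_rep3: "\<forall>c1 c2 c3 c4. 0 \<le> S4A c1 c2 c3 c4 F F F F F F F T T T \<and>
    0 \<le> S4A c1 c2 c3 c4 F F F F F T T F F T \<and>
    0 \<le> S4A c1 c2 c3 c4 F F F F F T T F F T \<and>
    0 \<le> S4A c1 c2 c3 c4 F F F F F T T F F T \<and>
    0 \<le> S4A c1 c2 c3 c4 F F T F F T T F F F"
  by (intro all_boolI; simp only: S4A_eval)

lemma S4A_rep4: "\<forall>c1 c2 c3 c4. 0 \<le> S4A c1 c2 c3 c4 F F F F F F T F T T \<and>
    0 \<le> S4A c1 c2 c3 c4 F F F F F F T F T T \<and>
    0 \<le> S4A c1 c2 c3 c4 F F F F F F T F T T \<and>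
    0 \<le> S4A c1 c2 c3 c4 F F F F T T T F F F \<and>
    0 \<le> S4A c1 c2 c3 c4 F F F F T T T F F F"
  by (intro all_boolI; simp only: S4A_eval)

lemma S4A_rep5: "\<forall>c1 c2 c3 c4. 0 \<le> S4A c1 c2 c3 c4 F F F F F F T T F F \<and>
    0 \<le> S4A c1 c2 c3 c4 F F F F F T F F T F \<and>
    0 \<le> S4A c1 c2 c3 c4 F F F F F T F F T F \<and>
    0 \<le> S4A c1 c2 c3 c4 F F F F T F F F F T \<and>
    0 \<le> S4A c1 c2 c3 c4 F F T F T F F F F F"
  by (intro all_boolI; simp only: S4A_eval)

lemma S4A_rep6: "\<forall>c1 c2 c3 c4. 0 \<le> S4A c1 c2 c3 c4 F F F F F F T T F T \<and>
    0 \<le> S4A c1 c2 c3 c4 F F F F F T F F T T \<and>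
    0 \<le> S4A c1 c2 c3 c4 F F F F F T T F T F \<and>
    0 \<le> S4A c1 c2 c3 c4 F F F F T F T F F T \<and>
    0 \<le> S4A c1 c2 c3 c4 F F T F T F T F F F"
  by (intro all_boolI; simp only: S4A_eval)

lemma S4A_rep7: "\<forall>c1 c2 c3 c4. 0 \<le> S4A c1 c2 c3 c4 F F F F F F T T T T \<and>
    0 \<le> S4A c1 c2 c3 c4 F F F F F T T F T T \<and>
    0 \<le> S4A c1 c2 c3 c4 F F F F F T T F T T \<and>
    0 \<le> S4A c1 c2 c3 c4 F F F F T T T F F T \<and>
    0 \<le> S4A c1 c2 c3 c4 F F T F T T T F F F"
  by (intro all_boolI; simp only: S4A_eval)

lemma S4A_rep8: "\<forall>c1 c2 c3 c4. 0 \<le> S4A c1 c2 c3 c4 F F F F F T T T T F \<and>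
    0 \<le> S4A c1 c2 c3 c4 F F F F F T T T T F \<and>
    0 \<le> S4A c1 c2 c3 c4 F F F F T T F F T T \<and>
    0 \<le> S4A c1 c2 c3 c4 F F F F T T F F T T \<and>
    0 \<le> S4A c1 c2 c3 c4 F T T F T T F F F F"
  by (intro all_boolI; simp only: S4A_eval)

lemma S4A_rep9: "\<forall>c1 c2 c3 c4. 0 \<le> S4A c1 c2 c3 c4 F F F F F T T T T T \<and>
    0 \<le> S4A c1 c2 c3 c4 F F F F F T T T T T \<and>
    0 \<le> S4A c1 c2 c3 c4 F F F F T T T F T T \<and>
    0 \<le> S4A c1 c2 c3 c4 F F F F T T T F T T \<and>
    0 \<le> S4A c1 c2 c3 c4 F T T F T T T F F F"
  by (intro all_boolI; simp only: S4A_eval)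

lemma S4A_rep10: "\<forall>c1 c2 c3 c4. 0 \<le> S4A c1 c2 c3 c4 F F F F T T T T T T \<and>
    0 \<le> S4A c1 c2 c3 c4 F F F F T T T T T T \<and>
    0 \<le> S4A c1 c2 c3 c4 F F F F T T T T T T \<and>
    0 \<le> S4A c1 c2 c3 c4 F F F F T T T T T T \<and>
    0 \<le> S4A c1 c2 c3 c4 T T T F T T T F F F"
  by (intro all_boolI; simp only: S4A_eval)

lemma S4A_rep11: "\<forall>c1 c2 c3 c4. 0 \<le> S4A c1 c2 c3 c4 F F F T F F T T F F \<and>
    0 \<le> S4A c1 c2 c3 c4 F F T F F T F F T F \<and>
    0 \<le> S4A c1 c2 c3 c4 F F T F F T F F T F \<and>
    0 \<le> S4A c1 c2 c3 c4 F F T F T F F F F T \<and>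
    0 \<le> S4A c1 c2 c3 c4 F F T F T F F F F T"
  by (intro all_boolI; simp only: S4A_eval)

lemma S4A_rep12: "\<forall>c1 c2 c3 c4. 0 \<le> S4A c1 c2 c3 c4 F F F T F F T T F T \<and>
    0 \<le> S4A c1 c2 c3 c4 F F T F F T F F T T \<and>
    0 \<le> S4A c1 c2 c3 c4 F F T F F T T F T F \<and>
    0 \<le> S4A c1 c2 c3 c4 F F T F T F T F F T \<and>
    0 \<le> S4A c1 c2 c3 c4 F F T F T F T F F T"
  by (intro all_boolI; simp only: S4A_eval)

lemma S4A_rep13: "\<forall>c1 c2 c3 c4. 0 \<le> S4A c1 c2 c3 c4 F F F T F T T F T F \<and>
    0 \<le> S4A c1 c2 c3 c4 F F T F F F T T T F \<and>
    0 \<le> S4A c1 c2 c3 c4 F F T F T F F F T T \<and>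
    0 \<le> S4A c1 c2 c3 c4 F F T F T T F F T F \<and>
    0 \<le> S4A c1 c2 c3 c4 F T F F T T F F F T"
  by (intro all_boolI; simp only: S4A_eval)

lemma S4A_rep14: "\<forall>c1 c2 c3 c4. 0 \<le> S4A c1 c2 c3 c4 F F F T F T T F T T \<and>
    0 \<le> S4A c1 c2 c3 c4 F F T F F F T T T T \<and>
    0 \<le> S4A c1 c2 c3 c4 F F T F T F T F T T \<and>
    0 \<le> S4A c1 c2 c3 c4 F F T F T T T F T F \<and>
    0 \<le> S4A c1 c2 c3 c4 F T F F T T T F F T"
  by (intro all_boolI; simp only: S4A_eval)

lemma S4A_rep15: "\<forall>c1 c2 c3 c4. 0 \<le> S4A c1 c2 c3 c4 F F F T F T T T T F \<and>
    0 \<le> S4A c1 c2 c3 c4 F F T F F T T T T F \<and>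
    0 \<le> S4A c1 c2 c3 c4 F F T F T T F F T T \<and>
    0 \<le> S4A c1 c2 c3 c4 F F T F T T F F T T \<and>
    0 \<le> S4A c1 c2 c3 c4 F T T F T T F F F T"
  by (intro all_boolI; simp only: S4A_eval)

lemma S4A_rep16: "\<forall>c1 c2 c3 c4. 0 \<le> S4A c1 c2 c3 c4 F F F T T T T F F F \<and>
    0 \<le> S4A c1 c2 c3 c4 F F T F T F F T T F \<and>
    0 \<le> S4A c1 c2 c3 c4 F F T F T F F T T F \<and>
    0 \<le> S4A c1 c2 c3 c4 F F T F T F F T T F \<and>
    0 \<le> S4A c1 c2 c3 c4 T T F F T F F F F T"
  by (intro all_boolI; simp only: S4A_eval)

lemma S4A_rep17: "\<forall>c1 c2 c3 c4. 0 \<le> S4A c1 c2 c3 c4 F F F T T T T F F T \<and>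
    0 \<le> S4A c1 c2 c3 c4 F F T F T F F T T T \<and>
    0 \<le> S4A c1 c2 c3 c4 F F T F T F T T T F \<and>
    0 \<le> S4A c1 c2 c3 c4 F F T F T F T T T F \<and>
    0 \<le> S4A c1 c2 c3 c4 T T F F T F T F F T"
  by (intro all_boolI; simp only: S4A_eval)

lemma S4A_rep18: "\<forall>c1 c2 c3 c4. 0 \<le> S4A c1 c2 c3 c4 F F F T T T T F T T \<and>
    0 \<le> S4A c1 c2 c3 c4 F F T F T F T T T T \<and>
    0 \<le> S4A c1 c2 c3 c4 F F T F T F T T T T \<and>
    0 \<le> S4A c1 c2 c3 c4 F F T F T T T T T F \<and>
    0 \<le> S4A c1 c2 c3 c4 T T F F T T T F F T"
  by (intro all_boolI; simp only: S4A_eval)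

lemma S4A_rep19: "\<forall>c1 c2 c3 c4. 0 \<le> S4A c1 c2 c3 c4 F F T T F T T T T F \<and>
    0 \<le> S4A c1 c2 c3 c4 F F T T F T T T T F \<and>
    0 \<le> S4A c1 c2 c3 c4 F T T F T T F F T T \<and>
    0 \<le> S4A c1 c2 c3 c4 F T T F T T F F T T \<and>
    0 \<le> S4A c1 c2 c3 c4 F T T F T T F F T T"
  by (intro all_boolI; simp only: S4A_eval)

lemma S4A_rep20: "\<forall>c1 c2 c3 c4. 0 \<le> S4A c1 c2 c3 c4 F F T T T F T T F F \<and>
    0 \<le> S4A c1 c2 c3 c4 F F T T T T F F T F \<and>
    0 \<le> S4A c1 c2 c3 c4 F T T F F T F T T F \<and>
    0 \<le> S4A c1 c2 c3 c4 F T T F T F F T F T \<and>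
    0 \<le> S4A c1 c2 c3 c4 T F T F T F F F T T"
  by (intro all_boolI; simp only: S4A_eval)

text \<open>The counterpart for a root outside A, with multipliers of its own; the cut inequality
  now comes from moving the root into A.\<close>

definition vB :: "bool \<Rightarrow> bool \<Rightarrow> bool \<Rightarrow> bool \<Rightarrow> bool \<Rightarrow> bool \<Rightarrow> bool \<Rightarrow> real list" where
  "vB a b c d e f g = (if a then (if b then (if c then (if d then (if e then (if f then (if g then [] else [3108, - 4735, 0, 1987]) else (if g then [457, - 2109, - 640, 2105] else [4252, 1086, - 2549, - 308])) else (if f then (if g then [457, - 2109, 640, 2105] else [4252, 1086, 2549, - 308]) else (if g then [4393, 5850, 0, 5210] else [7384, 1426, 0, - 2078]))) else (if e then (if f then (if g then [] else [- 3968, - 2717, 0, - 1858]) else (if g then [- 8094, - 1254, - 1005, 1591] else [- 3499, - 744, - 6079, - 928])) else (if f then (if g then [- 8094, - 1254, 1005, 1591] else [- 3499, - 744, 6079, - 928]) else (if g then [- 6833, 6261, 0, - 1967] else [197, 705, 0, 547])))) else (if d then (if e then (if f then (if g then [1567, 351, 525, 3861, 1302] else [- 8323, 2845, - 405, - 1394, 245]) else (if g then [809, - 505, 2426, - 1932, - 865] else [- 1291, - 3616, 1394, - 541, - 707])) else (if f then (if g then [809, - 505, 2426, - 1932, - 865] else [- 1291, - 3616, 1394, - 541, - 707]) else (if g then [- 1059, - 2942, - 1545, 3637, - 1100] else [- 2200, - 4873, - 1403, 1147, 1154]))) else (if e then (if f then (if g then [2659, 8665, 2321, - 2109, - 1953]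 else [12260, - 3383, 1825, - 1076, 880]) else (if g then [2457, 6389, - 1423, 354, 601] else [- 814, - 2213, - 639, 1097, - 60])) else (if f then (if g then [2457, 6389, - 1423, 354, 601] else [- 814, - 2213, - 639, 1097, - 60]) else (if g then [6353, - 147, - 51, 1899, - 857] else [1862, 3840, - 721, - 3978, - 238]))))) else []) else (if b then (if c then (if d then (if e then (if f then (if g then [] else [4726, 3491, 742, 1319]) else (if g then [5432, - 3431, - 3114, 837] else [11659, 2614, 2634, - 557])) else (if f then (if g then [3803, - 3827, - 1292, 4531] else [2886, - 4956, 3030, - 7683]) else (if g then [6941, - 1299, 258, 2376] else [340, 2157, 3881, - 6282]))) else (if e then (if f then (if g then [] else [- 12764, 1228, - 1058, - 3731]) else (if g then [- 11933, - 230, 2883, 4863] else [- 7206, - 3454, 7142, 286])) else (if f then (if g then [- 9519, 4754, - 4000, - 1689] else [- 8356, 5979, 4353, - 1620]) else (if g then [- 7696, - 6173, - 1951, - 2116] else [- 7804, - 3039, 501, - 2102])))) else (if d then (if e then (if f then (if g then [5154, - 12275, - 1574, - 322] else [4997, 1985, - 4703, 9106]) else (if g then [5154, 5448, - 1125, 1652] else [12252, 8438, 3241, - 4620])) else (if f then (if g then [4293, - 2650, - 1211, - 229] else [4021, 7023, - 3783, - 854]) else (if g then [5353, 3107, 2657, 683] else [9054, 2758, - 2740, - 9615]))) else (if e then (if f then (if g then [- 5504, - 5264, - 4326, 280] else [- 8288, - 4642, - 4395, - 1245]) else (if g then [- 7221, 311, 4065, 337] else [- 7456, 1305, 2330, -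 208])) else (if f then (if g then [- 6920, 6259, - 2640, 50] else [- 9378, 3698, - 7093, - 3813]) else (if g then [- 6326, 2974, 4446, - 1086] else [- 7578, 2833, 1822, - 176]))))) else (if c then (if d then (if e then (if f then (if g then [] else [13957, - 666, - 1346, - 1055, 0, - 1478]) else (if g then [5178, 4324, 1246, - 373, 153, 177] else [2554, - 303, - 1170, 646, - 2216, 330])) else (if f then (if g then [5178, 4324, 1246, - 373, - 153, 177] else [2554, - 303, - 1170, 646, 2216, 330]) else (if g then [- 917, 9050, - 145, 7891, 0, - 399] else [- 513, 879, 191, 68, 0, 1153]))) else (if e then (if f then (if g then [] else [- 3918, - 4081, 1272, - 184, 0, - 803]) else (if g then [- 4587, 2544, 4939, - 2192, - 3298, - 429] else [- 4755, - 2634, - 4043, 1401, - 3820, - 296])) else (if f then (if g then [- 4587, 2544, 4939, - 2192, 3298, - 429] else [- 4755, - 2634, - 4043, 1401, 3820, - 296]) else (if g then [- 6600, 8502, - 5404, - 4920, 0, - 527] else [- 5040, - 2668, 2420, 3492, 0, - 784])))) else (if d then (if e then (if f then (if g then [5056, 636, 5626, - 645, 374] else [- 1321, - 3384, 1452, 25, - 344]) else (if g then [- 1342, 45, 226, - 232, - 366] else [- 1674, 233, - 848, 145, - 451])) else (if f then (if g then [- 1342, 45, 226, - 232, - 366] else [- 1674, 233, - 848, 145, - 451]) else (if g then [1742, 7625, 1075, 1483, - 1110] else [- 699, 636, - 274, - 156, - 340]))) else (if e then (if f then (if g then [8360, - 6818, - 1697, 1426, - 215] else [- 5320, - 3042,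 - 1415, 2337, 303]) else (if g then [2376, 134, - 12, 184, 640] else [- 4906, - 799, 1297, - 1262, 326])) else (if f then (if g then [2376, 134, - 12, 184, 640] else [- 4906, - 799, 1297, - 1262, 326]) else (if g then [3037, 6365, - 3633, - 2507, 499] else [- 1222, 5178, 456, 3841, 806])))))))"

definition zzB :: "bool \<Rightarrow> bool \<Rightarrow> bool \<Rightarrow> real" where
  "zzB a b c = (if a then (if b then (if c then 1409 else 5351) else (if c then - 5047 else - 1712)) else (if b then (if c then - 5047 else - 1712) else (if c then - 410 else 2764)))"

text \<open>For a root outside A the wrongly placed link pairs counted here have exactly one vertex
  in A; a nonnegative average bounds their density by 0.195.\<close>

definition obB :: "bool \<Rightarrow> bool \<Rightarrow> bool \<Rightarrow> real" where
  "obB a b c = (if a then (if b then 1950 else (if c then - 8050 else 1950)) else (if b then (if c then - 8050 else 1950) else 1950))"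

definition kcB :: "bool \<Rightarrow> bool \<Rightarrow> bool \<Rightarrow> real" where
  "kcB a b c = (if a then (if b then (if c then 39 else 0) else (if c then - 20 else 0)) else (if b then (if c then - 20 else 0) else (if c then 19 else 0)))"

definition mcB :: "bool \<Rightarrow> bool \<Rightarrow> bool \<Rightarrow> real" where
  "mcB a b c = (if a then (if b then 0 else (if c then 977000 else 0)) else (if b then (if c then 977000 else 0) else 0))"

definition mdB :: "bool \<Rightarrow> bool \<Rightarrow> bool \<Rightarrow> real" where
  "mdB a b c = (if a then (if b then (if c then 0 else 5522) else (if c then 0 else 1101)) else (if b then (if c then 0 else 1101) else (if c then 0 else 2646)))"

definition mlB :: "bool \<Rightarrow> bool \<Rightarrow> bool \<Rightarrow> real" where
  "mlB a b c = (if a then (if b then 0 else (if c then 1227 else 0)) else (if b then (if c then 1227 else 0) else (if c then 0 else 3052)))"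

definition mkB :: "bool \<Rightarrow> real" where
  "mkB a = (if a then 814000 else 716000)"

definition mgB :: "bool \<Rightarrow> real" where
  "mgB a = 0"

definition mDB :: "bool \<Rightarrow> bool \<Rightarrow> bool \<Rightarrow> real" where
  "mDB a b c = (if a then (if b then (if c then 7773 else 7384) else (if c then 4934 else 0)) else (if b then (if c then 3127 else 0) else (if c then 7014 else 0)))"

definition ppB :: "bool \<Rightarrow> bool \<Rightarrow> bool \<Rightarrow> bool \<Rightarrow> bool \<Rightarrow> bool \<Rightarrow> real" where
  "ppB a b c d e f = 1000 * obB a b c - mcB d e f * kcB a b c - mdB d e f * dg c - zzB a b c * zzB d e f"

definition llB :: "bool \<Rightarrow> bool \<Rightarrow> bool \<Rightarrow> bool \<Rightarrow> real" where
  "llB a b c d = mlB a b c * cl d"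

definition kgB :: "bool \<Rightarrow> bool \<Rightarrow> bool \<Rightarrow> bool \<Rightarrow> bool \<Rightarrow> real" where
  "kgB a b c d e = mkB e * (if d then hh a b c else 0) + mgB e * (if a \<or> b \<or> c then dg d else 0)"

definition ddB :: "bool \<Rightarrow> bool \<Rightarrow> bool \<Rightarrow> bool \<Rightarrow> real" where
  "ddB a b c d = mDB a b c * dg d"

definition lfB :: "bool \<Rightarrow> bool \<Rightarrow> bool \<Rightarrow> bool \<Rightarrow> bool \<Rightarrow> bool \<Rightarrow> bool \<Rightarrow> bool \<Rightarrow> bool \<Rightarrow> bool \<Rightarrow> bool \<Rightarrow> bool \<Rightarrow> bool \<Rightarrow> bool \<Rightarrow> real" where
  "lfB cx cy cz ct vxy vxz vyz xyz vxt vyt vzt xyt xzt yzt =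
    ppB cx cy vxy cz ct vzt - llB cx cy vxy cz - llB cx cy vxy ct - kgB cx cy cz xyz ct - kgB cx cy ct xyt cz
    - ddB cx cy vxy xzt - dotl (vB cx cy vxy cz vxz vyz xyz) (vB cx cy vxy ct vxt vyt xyt)"

definition S4B :: "bool \<Rightarrow> bool \<Rightarrow> bool \<Rightarrow> bool \<Rightarrow> bool \<Rightarrow> bool \<Rightarrow> bool \<Rightarrow> bool \<Rightarrow> bool \<Rightarrow> bool \<Rightarrow> bool \<Rightarrow> bool \<Rightarrow> bool \<Rightarrow> bool \<Rightarrow> real" where
  "S4B c1 c2 c3 c4 b012 b013 b023 b123 b014 b024 b034 b124 b134 b234 =
    lfB c1 c2 c3 c4 b012 b013 b023 b123 b014 b024 b034 b124 b134 b234 +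
    lfB c1 c3 c2 c4 b013 b012 b023 b123 b014 b034 b024 b134 b124 b234 +
    lfB c1 c4 c2 c3 b014 b012 b024 b124 b013 b034 b023 b134 b123 b234 +
    lfB c2 c1 c3 c4 b012 b023 b013 b123 b024 b014 b034 b124 b234 b134 +
    lfB c2 c3 c1 c4 b023 b012 b013 b123 b024 b034 b014 b234 b124 b134 +
    lfB c2 c4 c1 c3 b024 b012 b014 b124 b023 b034 b013 b234 b123 b134 +
    lfB c3 c1 c2 c4 b013 b023 b012 b123 b034 b014 b024 b134 b234 b124 +
    lfB c3 c2 c1 c4 b023 b013 b012 b123 b034 b024 b014 b234 b134 b124 +
    lfB c3 c4 c1 c2 b034 b013 b014 b134 b023 b024 b012 b234 b123 b124 +
    lfB c4 c1 c2 c3 b014 b024 b012 b124 b034 b013 b023 b134 b234 b123 +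
    lfB c4 c2 c1 c3 b024 b014 b012 b124 b034 b023 b013 b234 b134 b123 +
    lfB c4 c3 c1 c2 b034 b014 b013 b134 b024 b023 b012 b234 b124 b123"

lemmas vB_eqs = vB_def[abs_def, THEN meta_eq_to_obj_eq, simplified fun_eq_iff all_bool if_True if_False simp_thms ]
lemmas ppB_eqs = ppB_def[abs_def, THEN meta_eq_to_obj_eq, simplified fun_eq_iff all_bool if_True if_False simp_thms  obB_def mcB_def kcB_def mdB_def dg_def zzB_def arith_simps rel_simps arith_special simp_thms if_True if_False order_refl mult_zero_left mult_zero_right mult_1_left mult_1_right add_0 add_0_right minus_zero minus_minus]
lemmas llB_eqs = llB_def[abs_def, THEN meta_eq_to_obj_eq, simplified fun_eq_iff all_bool if_True if_False simp_thms  mlB_def cl_def arith_simps rel_simps arith_special simp_thms if_True if_False order_refl mult_zero_left mult_zero_right mult_1_left mult_1_right add_0 add_0_right minus_zero minus_minus]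
lemmas kgB_eqs = kgB_def[abs_def, THEN meta_eq_to_obj_eq, simplified fun_eq_iff all_bool if_True if_False simp_thms  mkB_def hh_def mgB_def dg_def arith_simps rel_simps arith_special simp_thms if_True if_False order_refl mult_zero_left mult_zero_right mult_1_left mult_1_right add_0 add_0_right minus_zero minus_minus]
lemmas ddB_eqs = ddB_def[abs_def, THEN meta_eq_to_obj_eq, simplified fun_eq_iff all_bool if_True if_False simp_thms  mDB_def dg_def arith_simps rel_simps arith_special simp_thms if_True if_False order_refl mult_zero_left mult_zero_right mult_1_left mult_1_right add_0 add_0_right minus_zero minus_minus]
lemmas S4B_eval = S4B_def lfB_def ppB_eqs llB_eqs kgB_eqs ddB_eqs vB_eqs dotl.simps arith_simps rel_simps arith_special simp_thms if_True if_False order_refl mult_zero_left mult_zero_right mult_1_left mult_1_right add_0 add_0_right minus_zero minus_minus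
lemma S4B_rep0: "\<forall>c1 c2 c3 c4. 0 \<le> S4B c1 c2 c3 c4 F F F F F F F F F F \<and>
    0 \<le> S4B c1 c2 c3 c4 F F F F F F F F F F \<and>
    0 \<le> S4B c1 c2 c3 c4 F F F F F F F F F F \<and>
    0 \<le> S4B c1 c2 c3 c4 F F F F F F F F F F \<and>
    0 \<le> S4B c1 c2 c3 c4 F F F F F F F F F F"
  by (intro all_boolI; simp only: S4B_eval)

lemma S4B_rep1: "\<forall>c1 c2 c3 c4. 0 \<le> S4B c1 c2 c3 c4 F F F F F F F F F T \<and>
    0 \<le> S4B c1 c2 c3 c4 F F F F F F F F F T \<and>
    0 \<le> S4B c1 c2 c3 c4 F F F F F F T F F F \<and>
    0 \<le> S4B c1 c2 c3 c4 F F F F F F T F F F \<and>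
    0 \<le> S4B c1 c2 c3 c4 F F F F F F T F F F"
  by (intro all_boolI; simp only: S4B_eval)

lemma S4B_rep2: "\<forall>c1 c2 c3 c4. 0 \<le> S4B c1 c2 c3 c4 F F F F F F F F T T \<and>
    0 \<le> S4B c1 c2 c3 c4 F F F F F F T F F T \<and>
    0 \<le> S4B c1 c2 c3 c4 F F F F F F T F F T \<and>
    0 \<le> S4B c1 c2 c3 c4 F F F F F T T F F F \<and>
    0 \<le> S4B c1 c2 c3 c4 F F F F F T T F F F"
  by (intro all_boolI; simp only: S4B_eval)

lemma S4B_rep3: "\<forall>c1 c2 c3 c4. 0 \<le> S4B c1 c2 c3 c4 F F F F F F F T T T \<and>
    0 \<le> S4B c1 c2 c3 c4 F F F F F T T F F T \<and>
    0 \<le> S4B c1 c2 c3 c4 F F F F F T T F F T \<and>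
    0 \<le> S4B c1 c2 c3 c4 F F F F F T T F F T \<and>
    0 \<le> S4B c1 c2 c3 c4 F F T F F T T F F F"
  by (intro all_boolI; simp only: S4B_eval)

lemma S4B_rep4: "\<forall>c1 c2 c3 c4. 0 \<le> S4B c1 c2 c3 c4 F F F F F F T F T T \<and>
    0 \<le> S4B c1 c2 c3 c4 F F F F F F T F T T \<and>
    0 \<le> S4B c1 c2 c3 c4 F F F F F F T F T T \<and>
    0 \<le> S4B c1 c2 c3 c4 F F F F T T T F F F \<and>
    0 \<le> S4B c1 c2 c3 c4 F F F F T T T F F F"
  by (intro all_boolI; simp only: S4B_eval)

lemma S4B_rep5: "\<forall>c1 c2 c3 c4. 0 \<le> S4B c1 c2 c3 c4 F F F F F F T T F F \<and>
    0 \<le> S4B c1 c2 c3 c4 F F F F F T F F T F \<and>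
    0 \<le> S4B c1 c2 c3 c4 F F F F F T F F T F \<and>
    0 \<le> S4B c1 c2 c3 c4 F F F F T F F F F T \<and>
    0 \<le> S4B c1 c2 c3 c4 F F T F T F F F F F"
  by (intro all_boolI; simp only: S4B_eval)

lemma S4B_rep6: "\<forall>c1 c2 c3 c4. 0 \<le> S4B c1 c2 c3 c4 F F F F F F T T F T \<and>
    0 \<le> S4B c1 c2 c3 c4 F F F F F T F F T T \<and>
    0 \<le> S4B c1 c2 c3 c4 F F F F F T T F T F \<and>
    0 \<le> S4B c1 c2 c3 c4 F F F F T F T F F T \<and>
    0 \<le> S4B c1 c2 c3 c4 F F T F T F T F F F"
  by (intro all_boolI; simp only: S4B_eval)

lemma S4B_rep7: "\<forall>c1 c2 c3 c4. 0 \<le> S4B c1 c2 c3 c4 F F F F F F T T T T \<and>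
    0 \<le> S4B c1 c2 c3 c4 F F F F F T T F T T \<and>
    0 \<le> S4B c1 c2 c3 c4 F F F F F T T F T T \<and>
    0 \<le> S4B c1 c2 c3 c4 F F F F T T T F F T \<and>
    0 \<le> S4B c1 c2 c3 c4 F F T F T T T F F F"
  by (intro all_boolI; simp only: S4B_eval)

lemma S4B_rep8: "\<forall>c1 c2 c3 c4. 0 \<le> S4B c1 c2 c3 c4 F F F F F T T T T F \<and>
    0 \<le> S4B c1 c2 c3 c4 F F F F F T T T T F \<and>
    0 \<le> S4B c1 c2 c3 c4 F F F F T T F F T T \<and>
    0 \<le> S4B c1 c2 c3 c4 F F F F T T F F T T \<and>
    0 \<le> S4B c1 c2 c3 c4 F T T F T T F F F F"
  by (intro all_boolI; simp only: S4B_eval)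

lemma S4B_rep9: "\<forall>c1 c2 c3 c4. 0 \<le> S4B c1 c2 c3 c4 F F F F F T T T T T \<and>
    0 \<le> S4B c1 c2 c3 c4 F F F F F T T T T T \<and>
    0 \<le> S4B c1 c2 c3 c4 F F F F T T T F T T \<and>
    0 \<le> S4B c1 c2 c3 c4 F F F F T T T F T T \<and>
    0 \<le> S4B c1 c2 c3 c4 F T T F T T T F F F"
  by (intro all_boolI; simp only: S4B_eval)

lemma S4B_rep10: "\<forall>c1 c2 c3 c4. 0 \<le> S4B c1 c2 c3 c4 F F F F T T T T T T \<and>
    0 \<le> S4B c1 c2 c3 c4 F F F F T T T T T T \<and>
    0 \<le> S4B c1 c2 c3 c4 F F F F T T T T T T \<and>
    0 \<le> S4B c1 c2 c3 c4 F F F F T T T T T T \<and>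
    0 \<le> S4B c1 c2 c3 c4 T T T F T T T F F F"
  by (intro all_boolI; simp only: S4B_eval)

lemma S4B_rep11: "\<forall>c1 c2 c3 c4. 0 \<le> S4B c1 c2 c3 c4 F F F T F F T T F F \<and>
    0 \<le> S4B c1 c2 c3 c4 F F T F F T F F T F \<and>
    0 \<le> S4B c1 c2 c3 c4 F F T F F T F F T F \<and>
    0 \<le> S4B c1 c2 c3 c4 F F T F T F F F F T \<and>
    0 \<le> S4B c1 c2 c3 c4 F F T F T F F F F T"
  by (intro all_boolI; simp only: S4B_eval)

lemma S4B_rep12: "\<forall>c1 c2 c3 c4. 0 \<le> S4B c1 c2 c3 c4 F F F T F F T T F T \<and>
    0 \<le> S4B c1 c2 c3 c4 F F T F F T F F T T \<and>
    0 \<le> S4B c1 c2 c3 c4 F F T F F T T F T F \<and>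
    0 \<le> S4B c1 c2 c3 c4 F F T F T F T F F T \<and>
    0 \<le> S4B c1 c2 c3 c4 F F T F T F T F F T"
  by (intro all_boolI; simp only: S4B_eval)

lemma S4B_rep13: "\<forall>c1 c2 c3 c4. 0 \<le> S4B c1 c2 c3 c4 F F F T F T T F T F \<and>
    0 \<le> S4B c1 c2 c3 c4 F F T F F F T T T F \<and>
    0 \<le> S4B c1 c2 c3 c4 F F T F T F F F T T \<and>
    0 \<le> S4B c1 c2 c3 c4 F F T F T T F F T F \<and>
    0 \<le> S4B c1 c2 c3 c4 F T F F T T F F F T"
  by (intro all_boolI; simp only: S4B_eval)

lemma S4B_rep14: "\<forall>c1 c2 c3 c4. 0 \<le> S4B c1 c2 c3 c4 F F F T F T T F T T \<and>
    0 \<le> S4B c1 c2 c3 c4 F F T F F F T T T T \<and>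
    0 \<le> S4B c1 c2 c3 c4 F F T F T F T F T T \<and>
    0 \<le> S4B c1 c2 c3 c4 F F T F T T T F T F \<and>
    0 \<le> S4B c1 c2 c3 c4 F T F F T T T F F T"
  by (intro all_boolI; simp only: S4B_eval)

lemma S4B_rep15: "\<forall>c1 c2 c3 c4. 0 \<le> S4B c1 c2 c3 c4 F F F T F T T T T F \<and>
    0 \<le> S4B c1 c2 c3 c4 F F T F F T T T T F \<and>
    0 \<le> S4B c1 c2 c3 c4 F F T F T T F F T T \<and>
    0 \<le> S4B c1 c2 c3 c4 F F T F T T F F T T \<and>
    0 \<le> S4B c1 c2 c3 c4 F T T F T T F F F T"
  by (intro all_boolI; simp only: S4B_eval)

lemma S4B_rep16: "\<forall>c1 c2 c3 c4. 0 \<le> S4B c1 c2 c3 c4 F F F T T T T F F F \<and>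
    0 \<le> S4B c1 c2 c3 c4 F F T F T F F T T F \<and>
    0 \<le> S4B c1 c2 c3 c4 F F T F T F F T T F \<and>
    0 \<le> S4B c1 c2 c3 c4 F F T F T F F T T F \<and>
    0 \<le> S4B c1 c2 c3 c4 T T F F T F F F F T"
  by (intro all_boolI; simp only: S4B_eval)

lemma S4B_rep17: "\<forall>c1 c2 c3 c4. 0 \<le> S4B c1 c2 c3 c4 F F F T T T T F F T \<and>
    0 \<le> S4B c1 c2 c3 c4 F F T F T F F T T T \<and>
    0 \<le> S4B c1 c2 c3 c4 F F T F T F T T T F \<and>
    0 \<le> S4B c1 c2 c3 c4 F F T F T F T T T F \<and>
    0 \<le> S4B c1 c2 c3 c4 T T F F T F T F F T"
  by (intro all_boolI; simp only: S4B_eval)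

lemma S4B_rep18: "\<forall>c1 c2 c3 c4. 0 \<le> S4B c1 c2 c3 c4 F F F T T T T F T T \<and>
    0 \<le> S4B c1 c2 c3 c4 F F T F T F T T T T \<and>
    0 \<le> S4B c1 c2 c3 c4 F F T F T F T T T T \<and>
    0 \<le> S4B c1 c2 c3 c4 F F T F T T T T T F \<and>
    0 \<le> S4B c1 c2 c3 c4 T T F F T T T F F T"
  by (intro all_boolI; simp only: S4B_eval)

lemma S4B_rep19: "\<forall>c1 c2 c3 c4. 0 \<le> S4B c1 c2 c3 c4 F F T T F T T T T F \<and>
    0 \<le> S4B c1 c2 c3 c4 F F T T F T T T T F \<and>
    0 \<le> S4B c1 c2 c3 c4 F T T F T T F F T T \<and>
    0 \<le> S4B c1 c2 c3 c4 F T T F T T F F T T \<and>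
    0 \<le> S4B c1 c2 c3 c4 F T T F T T F F T T"
  by (intro all_boolI; simp only: S4B_eval)

lemma S4B_rep20: "\<forall>c1 c2 c3 c4. 0 \<le> S4B c1 c2 c3 c4 F F T T T F T T F F \<and>
    0 \<le> S4B c1 c2 c3 c4 F F T T T T F F T F \<and>
    0 \<le> S4B c1 c2 c3 c4 F T T F F T F T T F \<and>
    0 \<le> S4B c1 c2 c3 c4 F T T F T F F T F T \<and>
    0 \<le> S4B c1 c2 c3 c4 T F T F T F F F T T"
  by (intro all_boolI; simp only: S4B_eval)

text \<open>Here the type is a coloured triple with its edge bit, and a flag adds a fourth coloured
  vertex with three bits. Only colour patterns with False before True carry vectors, because the
  other orders arise by permuting the triple.\<close>

definition vP :: "bool \<Rightarrow> bool \<Rightarrow> bool \<Rightarrow> bool \<Rightarrow> bool \<Rightarrow> bool \<Rightarrow> bool \<Rightarrow> bool \<Rightarrow> real list" where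
  "vP a b c d e f g h = (if a then (if b then (if c then (if d then (if e then (if f then (if g then (if h then [] else [- 3244, - 1437]) else (if h then [- 3831, - 989] else [- 3587, 1892])) else (if g then (if h then [- 2193, - 2240] else [- 1142, 24]) else (if h then [- 2017, 692] else [- 2440, 1217]))) else (if f then (if g then (if h then [] else [4179, - 1429]) else (if h then [3294, - 753] else [3797, 1807])) else (if g then (if h then [5767, - 2642] else [5647, 393]) else (if h then [4984, 900] else [4281, 193])))) else (if e then (if f then (if g then (if h then [- 5873] else [- 2107]) else (if h then [- 569] else [- 2234])) else (if g then (if h then [- 6428] else [- 63]) else (if h then [- 628] else []))) else (if f then (if g then (if h then [] else [676]) else (if h then [76] else [4008])) else (if g then (if h then [2361] else [434]) else (if h then [1373] else [1488]))))) else []) else []) else (if b then (if c then (if d then (if e then (if f then (if g then [] else (if h then [4276, 1388, - 600] else [1340, - 1846, - 485])) else (if g then (if h then [4276, 1388, - 600] else [1340, - 1846, - 485]) else (if h then [10358, 566, 748] else [3652, - 3085, - 196]))) else (if f then (if g then (if h then [] else [- 3902, 3030, - 963]) else (if h then [- 1753, 2070, 620] else [- 4212, - 1544, - 10])) else (if g then (if h then [- 1753, 2070, 620] else [- 4212, - 1544, - 10]) else (if h then [] else [- 3379, - 1307, 671])))) else (if e then (if f then (if g then (if h then [4891, 5024, 133, 0] else [- 1228, - 1227, - 766, 0]) else (if h then [3423, 2663, 63, - 191] else [1343, - 743, - 993, - 562])) else (if g then (if h then [3423, 2663, 63, 191] else [1343, - 743, - 993, 562]) else (if h then [6603, - 3351,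 2346, 0] else [3346, - 1793, - 235, 0]))) else (if f then (if g then (if h then [- 5284, 2899, 383, 0] else [- 2975, 2760, - 399, 0]) else (if h then [- 2488, 1135, 2018, - 1102] else [- 3116, - 2359, 368, - 206])) else (if g then (if h then [- 2488, 1135, 2018, 1102] else [- 3116, - 2359, 368, 206]) else (if h then [- 1917, 1695, 602, 0] else [- 1798, - 1910, - 125, 0]))))) else []) else (if c then (if d then (if e then (if f then (if g then (if h then [] else [2266, 112, 663, - 570, 338]) else (if h then [2266, 112, 663, 570, - 338] else [1416, 5755, - 36, 0, 0])) else (if g then (if h then [3970, - 5426, - 637, 0, 0] else [1533, 559, - 703, - 911, - 195]) else (if h then [1533, 559, - 703, 911, 195] else [1235, 3799, - 102, 0, 0]))) else (if f then (if g then (if h then [] else [- 3118, - 830, 1336, - 1708, - 296]) else (if h then [- 3118, - 830, 1336, 1708, 296] else [- 1664, 1286, - 107, 0, 0])) else (if g then (if h then [- 3828, - 539, 512, 0, 0] else [- 3597, - 111, - 1024, - 927, 526]) else (if h then [- 3597, - 111, - 1024, 927, - 526] else [- 3477, - 129, - 1318, 0, 0])))) else (if e then (if f then (if g then (if h then [- 5787, 1374, 0, 65] else [3074, 1048, 783, 459]) else (if h then [3074, 1048, - 783, 459] else [4675, 3168, 0, - 515])) else (if g then (if h then [] else [4051, - 919, 40, - 48]) else (if h then [4051, - 919, - 40, - 48] else [5555, - 1384, 0, - 60]))) else (if f then (if g then (if h then [- 4696, 148, 0, 53] else [- 3080, - 117, - 159, - 189]) else (if h then [- 3080, - 117, 159,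 - 189] else [])) else (if g then (if h then [- 958, - 1922, 0, 259] else [- 77, - 1174, 991, - 366]) else (if h then [- 77, - 1174, - 991, - 366] else []))))) else (if d then (if e then (if f then (if g then (if h then [] else [- 2188]) else (if h then [- 2188] else [1773])) else (if g then (if h then [- 2188] else [1773]) else (if h then [1773] else []))) else []) else []))))"

text \<open>Missing triples with exactly two vertices in A count 1, edges with one or three vertices
  in A count -1. A nonnegative average therefore compares all edges meeting A with all triples that
  have exactly two vertices in A.\<close>

definition obP :: "bool \<Rightarrow> bool \<Rightarrow> bool \<Rightarrow> bool \<Rightarrow> real" where
  "obP a b c d = (if a then (if b then (if c then (if d then - 1 else 0) else (if d then 0 else 1)) else (if c then (if d then 0 else 1) else (if d then - 1 else 0))) else (if b then (if c then (if d then 0 else 1) else (if d then - 1 else 0)) else (if c then (if d then - 1 else 0) else 0)))"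

text \<open>\<open>lmP\<close>, \<open>mDP\<close> and \<open>mVP\<close> are supported on missing
  triples with two vertices in A and on edges with one or three. Complementary slackness demands
  this: in the nested construction the target is tight, whereas the multiplied inequalities are
  strict.\<close>

definition lmP :: "bool \<Rightarrow> bool \<Rightarrow> bool \<Rightarrow> bool \<Rightarrow> real" where
  "lmP a b c d = (if a then (if b then (if c then 0 else (if d then 0 else 54)) else (if c then (if d then 0 else 54) else (if d then 669 else 0))) else (if b then (if c then (if d then 0 else 54) else (if d then 669 else 0)) else (if c then (if d then 669 else 0) else 0)))"

definition mDP :: "bool \<Rightarrow> bool \<Rightarrow> bool \<Rightarrow> bool \<Rightarrow> real" where
  "mDP a b c d = (if a then (if b then (if c then (if d then 2740 else 0) else (if d then 0 else 421)) else (if c then (if d then 0 else 421) else 0)) else (if b then (if c then (if d then 0 else 1077) else 0) else 0))"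

definition mVP :: "bool \<Rightarrow> bool \<Rightarrow> bool \<Rightarrow> bool \<Rightarrow> real" where
  "mVP a b c d = (if a then (if b then (if c then (if d then 4314 else 0) else 0) else (if c then 0 else (if d then 608 else 0))) else (if b then (if c then (if d then 0 else 1107) else 0) else 0))"

definition voP :: "bool \<Rightarrow> bool \<Rightarrow> bool \<Rightarrow> bool \<Rightarrow> real" where
  "voP a b c d = (if a then (if b then (if c then (if d then - 9475 else 525) else 525) else 525) else (if b then (if c then 1950 else (if d then - 8050 else 1950)) else (if c then (if d then - 8050 else 1950) else 1950)))"

definition leP :: "bool \<Rightarrow> bool \<Rightarrow> bool \<Rightarrow> bool \<Rightarrow> bool \<Rightarrow> bool \<Rightarrow> real" where
  "leP a b c d e f = 3000000 * obP a b c d - lmP a b c d * cl e - lmP a b c d * cl f"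

text \<open>The multiplier reads a triple at the vertex a, the multiplied inequality is averaged
  over another pair in the link of the same a; given a, the two factors are independent.\<close>

definition dvP :: "bool \<Rightarrow> bool \<Rightarrow> bool \<Rightarrow> bool \<Rightarrow> bool \<Rightarrow> bool \<Rightarrow> bool \<Rightarrow> real" where
  "dvP a b c d e f g = mDP a b c d * dg g + mVP a b c d * voP a e f g"

definition lfP :: "bool \<Rightarrow> bool \<Rightarrow> bool \<Rightarrow> bool \<Rightarrow> bool \<Rightarrow> bool \<Rightarrow> bool \<Rightarrow> bool \<Rightarrow> bool \<Rightarrow> bool \<Rightarrow> bool \<Rightarrow> bool \<Rightarrow> bool \<Rightarrow> bool \<Rightarrow> bool \<Rightarrow> real" where
  "lfP c0 c1 c2 c3 c4 b012 b013 b023 b123 b014 b024 b034 b124 b134 b234 =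
    leP c0 c1 c2 b012 c3 c4 - dvP c0 c3 c4 b034 c1 c2 b012
    - dotl (vP c0 c1 c2 b012 c3 b013 b023 b123) (vP c0 c1 c2 b012 c4 b014 b024 b124)"

definition S5 :: "bool \<Rightarrow> bool \<Rightarrow> bool \<Rightarrow> bool \<Rightarrow> bool \<Rightarrow> bool \<Rightarrow> bool \<Rightarrow> bool \<Rightarrow> bool \<Rightarrow> bool \<Rightarrow> bool \<Rightarrow> bool \<Rightarrow> bool \<Rightarrow> bool \<Rightarrow> bool \<Rightarrow> real" where
  "S5 c0 c1 c2 c3 c4 b012 b013 b023 b123 b014 b024 b034 b124 b134 b234 =
    lfP c0 c1 c2 c3 c4 b012 b013 b023 b123 b014 b024 b034 b124 b134 b234 +
    lfP c0 c1 c3 c2 c4 b013 b012 b023 b123 b014 b034 b024 b134 b124 b234 +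
    lfP c0 c1 c4 c2 c3 b014 b012 b024 b124 b013 b034 b023 b134 b123 b234 +
    lfP c0 c2 c1 c3 c4 b012 b023 b013 b123 b024 b014 b034 b124 b234 b134 +
    lfP c0 c2 c3 c1 c4 b023 b012 b013 b123 b024 b034 b014 b234 b124 b134 +
    lfP c0 c2 c4 c1 c3 b024 b012 b014 b124 b023 b034 b013 b234 b123 b134 +
    lfP c0 c3 c1 c2 c4 b013 b023 b012 b123 b034 b014 b024 b134 b234 b124 +
    lfP c0 c3 c2 c1 c4 b023 b013 b012 b123 b034 b024 b014 b234 b134 b124 +
    lfP c0 c3 c4 c1 c2 b034 b013 b014 b134 b023 b024 b012 b234 b123 b124 +
    lfP c0 c4 c1 c2 c3 b014 b024 b012 b124 b034 b013 b023 b134 b234 b123 +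
    lfP c0 c4 c2 c1 c3 b024 b014 b012 b124 b034 b023 b013 b234 b134 b123 +
    lfP c0 c4 c3 c1 c2 b034 b014 b013 b134 b024 b023 b012 b234 b124 b123 +
    lfP c1 c0 c2 c3 c4 b012 b013 b123 b023 b014 b124 b134 b024 b034 b234 +
    lfP c1 c0 c3 c2 c4 b013 b012 b123 b023 b014 b134 b124 b034 b024 b234 +
    lfP c1 c0 c4 c2 c3 b014 b012 b124 b024 b013 b134 b123 b034 b023 b234 +
    lfP c1 c2 c0 c3 c4 b012 b123 b013 b023 b124 b014 b134 b024 b234 b034 +
    lfP c1 c2 c3 c0 c4 b123 b012 b013 b023 b124 b134 b014 b234 b024 b034 +
    lfP c1 c2 c4 c0 c3 b124 b012 b014 b024 b123 b134 b013 b234 b023 b034 +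
    lfP c1 c3 c0 c2 c4 b013 b123 b012 b023 b134 b014 b124 b034 b234 b024 +
    lfP c1 c3 c2 c0 c4 b123 b013 b012 b023 b134 b124 b014 b234 b034 b024 +
    lfP c1 c3 c4 c0 c2 b134 b013 b014 b034 b123 b124 b012 b234 b023 b024 +
    lfP c1 c4 c0 c2 c3 b014 b124 b012 b024 b134 b013 b123 b034 b234 b023 +
    lfP c1 c4 c2 c0 c3 b124 b014 b012 b024 b134 b123 b013 b234 b034 b023 +
    lfP c1 c4 c3 c0 c2 b134 b014 b013 b034 b124 b123 b012 b234 b024 b023 +
    lfP c2 c0 c1 c3 c4 b012 b023 b123 b013 b024 b124 b234 b014 b034 b134 +
    lfP c2 c0 c3 c1 c4 b023 b012 b123 b013 b024 b234 b124 b034 b014 b134 +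
    lfP c2 c0 c4 c1 c3 b024 b012 b124 b014 b023 b234 b123 b034 b013 b134 +
    lfP c2 c1 c0 c3 c4 b012 b123 b023 b013 b124 b024 b234 b014 b134 b034 +
    lfP c2 c1 c3 c0 c4 b123 b012 b023 b013 b124 b234 b024 b134 b014 b034 +
    lfP c2 c1 c4 c0 c3 b124 b012 b024 b014 b123 b234 b023 b134 b013 b034 +
    lfP c2 c3 c0 c1 c4 b023 b123 b012 b013 b234 b024 b124 b034 b134 b014 +
    lfP c2 c3 c1 c0 c4 b123 b023 b012 b013 b234 b124 b024 b134 b034 b014 +
    lfP c2 c3 c4 c0 c1 b234 b023 b024 b034 b123 b124 b012 b134 b013 b014 +
    lfP c2 c4 c0 c1 c3 b024 b124 b012 b014 b234 b023 b123 b034 b134 b013 +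
    lfP c2 c4 c1 c0 c3 b124 b024 b012 b014 b234 b123 b023 b134 b034 b013 +
    lfP c2 c4 c3 c0 c1 b234 b024 b023 b034 b124 b123 b012 b134 b014 b013 +
    lfP c3 c0 c1 c2 c4 b013 b023 b123 b012 b034 b134 b234 b014 b024 b124 +
    lfP c3 c0 c2 c1 c4 b023 b013 b123 b012 b034 b234 b134 b024 b014 b124 +
    lfP c3 c0 c4 c1 c2 b034 b013 b134 b014 b023 b234 b123 b024 b012 b124 +
    lfP c3 c1 c0 c2 c4 b013 b123 b023 b012 b134 b034 b234 b014 b124 b024 +
    lfP c3 c1 c2 c0 c4 b123 b013 b023 b012 b134 b234 b034 b124 b014 b024 +
    lfP c3 c1 c4 c0 c2 b134 b013 b034 b014 b123 b234 b023 b124 b012 b024 +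
    lfP c3 c2 c0 c1 c4 b023 b123 b013 b012 b234 b034 b134 b024 b124 b014 +
    lfP c3 c2 c1 c0 c4 b123 b023 b013 b012 b234 b134 b034 b124 b024 b014 +
    lfP c3 c2 c4 c0 c1 b234 b023 b034 b024 b123 b134 b013 b124 b012 b014 +
    lfP c3 c4 c0 c1 c2 b034 b134 b013 b014 b234 b023 b123 b024 b124 b012 +
    lfP c3 c4 c1 c0 c2 b134 b034 b013 b014 b234 b123 b023 b124 b024 b012 +
    lfP c3 c4 c2 c0 c1 b234 b034 b023 b024 b134 b123 b013 b124 b014 b012 +
    lfP c4 c0 c1 c2 c3 b014 b024 b124 b012 b034 b134 b234 b013 b023 b123 +
    lfP c4 c0 c2 c1 c3 b024 b014 b124 b012 b034 b234 b134 b023 b013 b123 +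
    lfP c4 c0 c3 c1 c2 b034 b014 b134 b013 b024 b234 b124 b023 b012 b123 +
    lfP c4 c1 c0 c2 c3 b014 b124 b024 b012 b134 b034 b234 b013 b123 b023 +
    lfP c4 c1 c2 c0 c3 b124 b014 b024 b012 b134 b234 b034 b123 b013 b023 +
    lfP c4 c1 c3 c0 c2 b134 b014 b034 b013 b124 b234 b024 b123 b012 b023 +
    lfP c4 c2 c0 c1 c3 b024 b124 b014 b012 b234 b034 b134 b023 b123 b013 +
    lfP c4 c2 c1 c0 c3 b124 b024 b014 b012 b234 b134 b034 b123 b023 b013 +
    lfP c4 c2 c3 c0 c1 b234 b024 b034 b023 b124 b134 b014 b123 b012 b013 +
    lfP c4 c3 c0 c1 c2 b034 b134 b014 b013 b234 b024 b124 b023 b123 b012 +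
    lfP c4 c3 c1 c0 c2 b134 b034 b014 b013 b234 b124 b024 b123 b023 b012 +
    lfP c4 c3 c2 c0 c1 b234 b034 b024 b023 b134 b124 b014 b123 b013 b012"

lemmas vP_eqs = vP_def[abs_def, THEN meta_eq_to_obj_eq, simplified fun_eq_iff all_bool if_True if_False simp_thms ]
lemmas leP_eqs = leP_def[abs_def, THEN meta_eq_to_obj_eq, simplified fun_eq_iff all_bool if_True if_False simp_thms  obP_def lmP_def cl_def arith_simps rel_simps arith_special simp_thms if_True if_False order_refl mult_zero_left mult_zero_right mult_1_left mult_1_right add_0 add_0_right minus_zero minus_minus]
lemmas dvP_eqs = dvP_def[abs_def, THEN meta_eq_to_obj_eq, simplified fun_eq_iff all_bool if_True if_False simp_thms  mDP_def mVP_def voP_def dg_def arith_simps rel_simps arith_special simp_thms if_True if_False order_refl mult_zero_left mult_zero_right mult_1_left mult_1_right add_0 add_0_right minus_zero minus_minus]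
lemmas S5_eval = S5_def lfP_def leP_eqs dvP_eqs vP_eqs dotl.simps arith_simps rel_simps arith_special simp_thms if_True if_False order_refl mult_zero_left mult_zero_right mult_1_left mult_1_right add_0 add_0_right minus_zero minus_minus
lemma S5_rep0: "\<forall>c0 c1 c2 c3 c4. 0 \<le> S5 c0 c1 c2 c3 c4 F F F F F F F F F F"
  by (intro all_boolI; simp only: S5_eval)

lemma S5_rep1: "\<forall>c0 c1 c2 c3 c4. 0 \<le> S5 c0 c1 c2 c3 c4 F F F F F F F F F T"
  by (intro all_boolI; simp only: S5_eval)

lemma S5_rep2: "\<forall>c0 c1 c2 c3 c4. 0 \<le> S5 c0 c1 c2 c3 c4 F F F F F F F F T T"
  by (intro all_boolI; simp only: S5_eval)

lemma S5_rep3: "\<forall>c0 c1 c2 c3 c4. 0 \<le> S5 c0 c1 c2 c3 c4 F F F F F F F T T T"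
  by (intro all_boolI; simp only: S5_eval)

lemma S5_rep4: "\<forall>c0 c1 c2 c3 c4. 0 \<le> S5 c0 c1 c2 c3 c4 F F F F F F T F T T"
  by (intro all_boolI; simp only: S5_eval)

lemma S5_rep5: "\<forall>c0 c1 c2 c3 c4. 0 \<le> S5 c0 c1 c2 c3 c4 F F F F F F T T F F"
  by (intro all_boolI; simp only: S5_eval)

lemma S5_rep6: "\<forall>c0 c1 c2 c3 c4. 0 \<le> S5 c0 c1 c2 c3 c4 F F F F F F T T F T"
  by (intro all_boolI; simp only: S5_eval)

lemma S5_rep7: "\<forall>c0 c1 c2 c3 c4. 0 \<le> S5 c0 c1 c2 c3 c4 F F F F F F T T T T"
  by (intro all_boolI; simp only: S5_eval)

lemma S5_rep8: "\<forall>c0 c1 c2 c3 c4. 0 \<le> S5 c0 c1 c2 c3 c4 F F F F F T T T T F"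
  by (intro all_boolI; simp only: S5_eval)

lemma S5_rep9: "\<forall>c0 c1 c2 c3 c4. 0 \<le> S5 c0 c1 c2 c3 c4 F F F F F T T T T T"
  by (intro all_boolI; simp only: S5_eval)

lemma S5_rep10: "\<forall>c0 c1 c2 c3 c4. 0 \<le> S5 c0 c1 c2 c3 c4 F F F F T T T T T T"
  by (intro all_boolI; simp only: S5_eval)

lemma S5_rep11: "\<forall>c0 c1 c2 c3 c4. 0 \<le> S5 c0 c1 c2 c3 c4 F F F T F F T T F F"
  by (intro all_boolI; simp only: S5_eval)

lemma S5_rep12: "\<forall>c0 c1 c2 c3 c4. 0 \<le> S5 c0 c1 c2 c3 c4 F F F T F F T T F T"
  by (intro all_boolI; simp only: S5_eval)

lemma S5_rep13: "\<forall>c0 c1 c2 c3 c4. 0 \<le> S5 c0 c1 c2 c3 c4 F F F T F T T F T F"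
  by (intro all_boolI; simp only: S5_eval)

lemma S5_rep14: "\<forall>c0 c1 c2 c3 c4. 0 \<le> S5 c0 c1 c2 c3 c4 F F F T F T T F T T"
  by (intro all_boolI; simp only: S5_eval)

lemma S5_rep15: "\<forall>c0 c1 c2 c3 c4. 0 \<le> S5 c0 c1 c2 c3 c4 F F F T F T T T T F"
  by (intro all_boolI; simp only: S5_eval)

lemma S5_rep16: "\<forall>c0 c1 c2 c3 c4. 0 \<le> S5 c0 c1 c2 c3 c4 F F F T T T T F F F"
  by (intro all_boolI; simp only: S5_eval)

lemma S5_rep17: "\<forall>c0 c1 c2 c3 c4. 0 \<le> S5 c0 c1 c2 c3 c4 F F F T T T T F F T"
  by (intro all_boolI; simp only: S5_eval)

lemma S5_rep18: "\<forall>c0 c1 c2 c3 c4. 0 \<le> S5 c0 c1 c2 c3 c4 F F F T T T T F T T"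
  by (intro all_boolI; simp only: S5_eval)

lemma S5_rep19: "\<forall>c0 c1 c2 c3 c4. 0 \<le> S5 c0 c1 c2 c3 c4 F F T T F T T T T F"
  by (intro all_boolI; simp only: S5_eval)

lemma S5_rep20: "\<forall>c0 c1 c2 c3 c4. 0 \<le> S5 c0 c1 c2 c3 c4 F F T T T F T T F F"
  by (intro all_boolI; simp only: S5_eval)

end

section \<open>From codes to vertices\<close>

locale k5 =
  fixes E :: "'a \<Rightarrow> 'a \<Rightarrow> 'a \<Rightarrow> bool"
  assumes E12: "E a b c = E b a c" and E23: "E a b c = E a c b"
    and K4_free: "\<not> (E a b c \<and> E a b d \<and> E a c d \<and> E b c d)"
    and C5_chord_free: "\<not> (E a b c \<and> E b c d \<and> E c d e \<and> E d e a \<and> E e a b \<and> E a b d)"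
begin

lemmas E_sym = E12 E23

text \<open>The five triples off a tight 5-cycle on five points are the rotations of abd, so
  excluding one chord position at every cycle excludes all of them.\<close>

lemma C5_chords:
  "E a b c \<and> E b c d \<and> E c d e \<and> E d e a \<and> E e a b \<longrightarrow>
    \<not> E a b d \<and> \<not> E b c e \<and> \<not> E c d a \<and> \<not> E d e b \<and> \<not> E e a c"
  using C5_chord_free[of a b c d e] C5_chord_free[of b c d e a] C5_chord_free[of c d e a b]
    C5_chord_free[of d e a b c] C5_chord_free[of e a b c d] by blast

lemma ok5_E: "ok5 (E a b c) (E a b d) (E a c d) (E b c d) (E a b e) (E a c e) (E a d e) (E b c e) (E b d e) (E c d e)"
  unfolding ok5_def
  apply (intro conjI)
  subgoal using K4_free[of a b c d] by (blast | (simp only: E_sym; blast))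
  subgoal using K4_free[of a b c e] by (blast | (simp only: E_sym; blast))
  subgoal using K4_free[of a b d e] by (blast | (simp only: E_sym; blast))
  subgoal using K4_free[of a c d e] by (blast | (simp only: E_sym; blast))
  subgoal using K4_free[of b c d e] by (blast | (simp only: E_sym; blast))
  subgoal using C5_chords[of a b c d e] by (blast | (simp only: E_sym; blast))
  subgoal using C5_chords[of a b c e d] by (blast | (simp only: E_sym; blast))
  subgoal using C5_chords[of a b d c e] by (blast | (simp only: E_sym; blast))
  subgoal using C5_chords[of a b d e c] by (blast | (simp only: E_sym; blast))
  subgoal using C5_chords[of a b e c d] by (blast | (simp only: E_sym; blast))
  subgoal using C5_chords[of a b e d c] by (blast | (simp only: E_sym; blast))
  subgoal using C5_chords[of a c b d e] by (blast | (simp only: E_sym; blast))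
  subgoal using C5_chords[of a c b e d] by (blast | (simp only: E_sym; blast))
  subgoal using C5_chords[of a c d b e] by (blast | (simp only: E_sym; blast))
  subgoal using C5_chords[of a c e b d] by (blast | (simp only: E_sym; blast))
  subgoal using C5_chords[of a d b c e] by (blast | (simp only: E_sym; blast))
  subgoal using C5_chords[of a d c b e] by (blast | (simp only: E_sym; blast))
  done

text \<open>A case principle: a property of five vertices that is invariant under permutation has to
  be checked only where the edge pattern is a representative. Vertices may coincide, as the
  exclusions in \<open>k5\<close> hold for arbitrary tuples.\<close>

lemma rep5_vertices:
  assumes s0: "\<And>a b c d e. Q b a c d e \<Longrightarrow> Q a b c d e"
    and s1: "\<And>a b c d e. Q a c b d e \<Longrightarrow> Q a b c d e"
    and s2: "\<And>a b c d e. Q a b d c e \<Longrightarrow> Q a b c d e"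
    and s3: "\<And>a b c d e. Q a b c e d \<Longrightarrow> Q a b c d e"
    and rep: "\<And>a b c d e. isrep (E a b c) (E a b d) (E a c d) (E b c d) (E a b e) (E a c e) (E a d e) (E b c e) (E b d e) (E c d e) \<Longrightarrow> Q a b c d e"
  shows "Q a b c d e"
proof -
  \<comment> \<open>Quantifying over all tuples with a given code makes Q a predicate on codes, to
    which \<open>rep5\<close> applies.\<close>
  define R where "R b0 b1 b2 b3 b4 b5 b6 b7 b8 b9 \<longleftrightarrow> (\<forall>a b c d e. E a b c = b0 \<and> E a b d = b1 \<and> E a c d = b2 \<and> E b c d = b3 \<and> E a b e = b4 \<and> E a c e = b5 \<and> E a d e = b6 \<and> E b c e = b7 \<and> E b d e = b8 \<and> E c d e = b9 \<longrightarrow> Q a b c d e)" for b0 b1 b2 b3 b4 b5 b6 b7 b8 b9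
  have r0: "R b0 b1 b2 b3 b4 b5 b6 b7 b8 b9" if h: "R b0 b1 b3 b2 b4 b7 b8 b5 b6 b9" for b0 b1 b2 b3 b4 b5 b6 b7 b8 b9
    unfolding R_def
  proof (intro allI impI)
    fix a b c d e
    assume code: "E a b c = b0 \<and> E a b d = b1 \<and> E a c d = b2 \<and> E b c d = b3 \<and> E a b e = b4 \<and> E a c e = b5 \<and> E a d e = b6 \<and> E b c e = b7 \<and> E b d e = b8 \<and> E c d e = b9"
    show "Q a b c d e"
      by (rule s0, intro h[unfolded R_def, rule_format]) (simp add: code E_sym)
  qed
  have r1: "R b0 b1 b2 b3 b4 b5 b6 b7 b8 b9" if h: "R b0 b2 b1 b3 b5 b4 b6 b7 b9 b8" for b0 b1 b2 b3 b4 b5 b6 b7 b8 b9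
    unfolding R_def
  proof (intro allI impI)
    fix a b c d e
    assume code: "E a b c = b0 \<and> E a b d = b1 \<and> E a c d = b2 \<and> E b c d = b3 \<and> E a b e = b4 \<and> E a c e = b5 \<and> E a d e = b6 \<and> E b c e = b7 \<and> E b d e = b8 \<and> E c d e = b9"
    show "Q a b c d e"
      by (rule s1, intro h[unfolded R_def, rule_format]) (simp add: code E_sym)
  qed
  have r2: "R b0 b1 b2 b3 b4 b5 b6 b7 b8 b9" if h: "R b1 b0 b2 b3 b4 b6 b5 b8 b7 b9" for b0 b1 b2 b3 b4 b5 b6 b7 b8 b9
    unfolding R_def
  proof (intro allI impI)
    fix a b c d e
    assume code: "E a b c = b0 \<and> E a b d = b1 \<and> E a c d = b2 \<and> E b c d = b3 \<and> E a b e = b4 \<and> E a c e = b5 \<and> E a d e = b6 \<and> E b c e = b7 \<and> E b d e = b8 \<and> E c d e = b9"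
    show "Q a b c d e"
      by (rule s2, intro h[unfolded R_def, rule_format]) (simp add: code E_sym)
  qed
  have r3: "R b0 b1 b2 b3 b4 b5 b6 b7 b8 b9" if h: "R b0 b4 b5 b7 b1 b2 b6 b3 b8 b9" for b0 b1 b2 b3 b4 b5 b6 b7 b8 b9
    unfolding R_def
  proof (intro allI impI)
    fix a b c d e
    assume code: "E a b c = b0 \<and> E a b d = b1 \<and> E a c d = b2 \<and> E b c d = b3 \<and> E a b e = b4 \<and> E a c e = b5 \<and> E a d e = b6 \<and> E b c e = b7 \<and> E b d e = b8 \<and> E c d e = b9"
    show "Q a b c d e"
      by (rule s3, intro h[unfolded R_def, rule_format]) (simp add: code E_sym)
  qed
  have rr: "R b0 b1 b2 b3 b4 b5 b6 b7 b8 b9" if "isrep b0 b1 b2 b3 b4 b5 b6 b7 b8 b9" for b0 b1 b2 b3 b4 b5 b6 b7 b8 b9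
    unfolding R_def using that rep by blast
  have "R (E a b c) (E a b d) (E a c d) (E b c d) (E a b e) (E a c e) (E a d e) (E b c e) (E b d e) (E c d e)"
    by (rule rep5[of R]) (fact r0 r1 r2 r3 rr ok5_E)+
  then show ?thesis unfolding R_def by blast
qed

end

locale k5w = weighted V w + k5 E
  for V :: "'a set" and w and E :: "'a \<Rightarrow> 'a \<Rightarrow> 'a \<Rightarrow> bool"

lemma hh_sym: "hh b a c = hh a b c" "hh a c b = hh a b c"
  unfolding hh_def by simp_all

text \<open>Nested equality of truth values is parity, hence independent of order and
  grouping.\<close>

lemma odd_sym: "((b::bool) = (a = c)) = (a = (b = c))" "(a = (c = b)) = (a = (b = c))"
  by blast+

lemma rt_sym:
  "rt e x1 z1 y1 x2 z2 y2 x3 z3 y3 d = rt e x1 y1 z1 x2 y2 z2 x3 y3 z3 d"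
  "rt e y1 x1 z1 y2 x2 z2 y3 x3 z3 d = rt e x1 y1 z1 x2 y2 z2 x3 y3 z3 d"
  "rt e x2 y2 z2 x1 y1 z1 x3 y3 z3 d = rt e x1 y1 z1 x2 y2 z2 x3 y3 z3 d"
  "rt e x1 y1 z1 x3 y3 z3 x2 y2 z2 d = rt e x1 y1 z1 x2 y2 z2 x3 y3 z3 d"
  unfolding rt_def by (simp_all only: odd_sym hh_sym add_ac conj_ac)

lemma S6_pos:
  "isrep b012 b013 b023 b123 b014 b024 b034 b124 b134 b234 \<Longrightarrow> ok5 b012 b013 b023 b123 b015 b025 b035 b125 b135 b235 \<Longrightarrow> okx b012 b013 b023 b123 b014 b024 b034 b124 b134 b234 b015 b025 b035 b125 b135 b235 b045 b145 b245 b345 \<Longrightarrow> 1 \<le> S6 b012 b013 b023 b123 b014 b024 b034 b124 b134 b234 b015 b025 b035 b125 b135 b235 b045 b145 b245 b345"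
  by (erule isrep.cases; hypsubst; rule S6_rep0[rule_format] S6_rep1[rule_format] S6_rep2[rule_format] S6_rep3[rule_format] S6_rep4[rule_format] S6_rep5[rule_format] S6_rep6[rule_format] S6_rep7[rule_format] S6_rep8[rule_format] S6_rep9[rule_format] S6_rep10[rule_format] S6_rep11[rule_format] S6_rep12[rule_format] S6_rep13[rule_format] S6_rep14[rule_format] S6_rep15[rule_format] S6_rep16[rule_format] S6_rep17[rule_format] S6_rep18[rule_format] S6_rep19[rule_format] S6_rep20[rule_format]; assumption)

section \<open>The six-vertex computation on vertices\<close>

context k5w
begin

definition hs :: "'a \<Rightarrow> 'a \<Rightarrow> 'a \<Rightarrow> 'a \<Rightarrow> 'a \<Rightarrow> 'a \<Rightarrow> real" where
  "hs a b c d e f = s16 (E a b c) (E a b d) (E a c d) (E b c d) (E a b e) (E a c e) (E a d e) (E b c e) (E b d e) (E c d e) (E a b f) (E a c f) (E a d f) (E b c f) (E b d f) (E c d f)"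

definition h2 :: "'a \<Rightarrow> 'a \<Rightarrow> 'a \<Rightarrow> 'a \<Rightarrow> 'a \<Rightarrow> 'a \<Rightarrow> real" where
  "h2 a b c d e f = r2 (E a b c) (E a b d) (E a c d) (E b c d) (E a b e) (E a b f) (E a e f) (E b e f)"

definition hr :: "'a \<Rightarrow> 'a \<Rightarrow> 'a \<Rightarrow> 'a \<Rightarrow> 'a \<Rightarrow> 'a \<Rightarrow> real" where
  "hr a b c d e f = rt (E a b c) (E a b d) (E a c d) (E b c d) (E a b e) (E a c e) (E b c e) (E a b f) (E a c f) (E b c f) (E d e f)"

lemma hs_sym:
  "hs b a c d e f = hs a b c d e f"
  "hs a c b d e f = hs a b c d e f"
  "hs a b d c e f = hs a b c d e f"
  "hs a b c d f e = hs a b c d e f"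
proof -
  show "hs b a c d e f = hs a b c d e f"
    unfolding hs_def by (simp only: E_sym) (rule s16_swap0)
  show "hs a c b d e f = hs a b c d e f"
    unfolding hs_def by (simp only: E_sym) (rule s16_swap1)
  show "hs a b d c e f = hs a b c d e f"
    unfolding hs_def by (simp only: E_sym) (rule s16_swap2)
  show "hs a b c d f e = hs a b c d e f"
    unfolding hs_def by (rule s16_swap3)
qed

lemma h2_sym:
  "h2 b a c d e f = h2 a b c d e f"
  "h2 a b d c e f = h2 a b c d e f"
  "h2 a b c d f e = h2 a b c d e f"
  "h2 a b e f c d = h2 a b c d e f"
proof -
  show "h2 b a c d e f = h2 a b c d e f"
    unfolding h2_def r2_def by (simp only: E_sym add.commute)
  show "h2 a b d c e f = h2 a b c d e f"
    unfolding h2_def r2_def rr_def by (simp only: E_sym conj_commute disj_commute)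
  show "h2 a b c d f e = h2 a b c d e f"
    unfolding h2_def r2_def rr_def by (simp only: E_sym conj_commute disj_commute)
  show "h2 a b e f c d = h2 a b c d e f"
    unfolding h2_def r2_def rr_def by (simp only: dotl_comm)
qed

lemma hr_sym:
  "hr b a c d e f = hr a b c d e f"
  "hr a c b d e f = hr a b c d e f"
  "hr a b c e d f = hr a b c d e f"
  "hr a b c d f e = hr a b c d e f"
proof -
  show "hr b a c d e f = hr a b c d e f"
    unfolding hr_def by (simp only: E_sym) (rule rt_sym)
  show "hr a c b d e f = hr a b c d e f"
    unfolding hr_def by (simp only: E_sym) (rule rt_sym)
  show "hr a b c e d f = hr a b c d e f"
    unfolding hr_def by (simp only: E_sym) (rule rt_sym)
  show "hr a b c d f e = hr a b c d e f"
    unfolding hr_def by (simp only: E_sym) (rule rt_sym)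
qed

text \<open>The certificate \<open>S6\<close> written with vertices instead of bits; in this form
  invariance under all permutations of the six vertices follows from the symmetries of its three
  summands.\<close>

definition SS :: "'a \<Rightarrow> 'a \<Rightarrow> 'a \<Rightarrow> 'a \<Rightarrow> 'a \<Rightarrow> 'a \<Rightarrow> real" where
  "SS a b c d e f = hr a b c d e f + hr a b d c e f + hr a b e c d f + hr a b f c d e + hr a c d b e f + hr a c e b d f + hr a c f b d e + hr a d e b c f + hr a d f b c e + hr a e f b c d + hr b c d a e f + hr b c e a d f + hr b c f a d e + hr b d e a c f + hr b d f a c e + hr b e f a c d + hr c d e a b f + hr c d f a b e + hr c e f a b d + hr d e f a b c
    - (hs c d e f a b + hs b d e f a c + hs b c e f a d + hs b c d f a e + hs b c d e a f + hs a d e f b c + hs a c e f b d + hs a c d f b e + hs a c d e b f + hs a b e f c d + hs a b d f c e + hs a b d e c f + hs a b c f d e + hs a b c e d f + hs a b c d e f)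
    - 4 * (h2 a b c d e f + h2 a b c e d f + h2 a b c f d e + h2 a c b d e f + h2 a c b e d f + h2 a c b f d e + h2 a d b c e f + h2 a d b e c f + h2 a d b f c e + h2 a e b c d f + h2 a e b d c f + h2 a e b f c d + h2 a f b c d e + h2 a f b d c e + h2 a f b e c d + h2 b c a d e f + h2 b c a e d f + h2 b c a f d e + h2 b d a c e f + h2 b d a e c f + h2 b d a f c e + h2 b e a c d f + h2 b e a d c f + h2 b e a f c d + h2 b f a c d e + h2 b f a d c e + h2 b f a e c d + h2 c d a b e f + h2 c d a e b f + h2 c d a f b e + h2 c e a b d f + h2 c e a d b f + h2 c e a f b d + h2 c f a b d e + h2 c f a d b e + h2 c f a e b d + h2 d e a b c f + h2 d e a c b f + h2 d e a f b c + h2 d f a b c e + h2 d f a c b e + h2 d f a e b c + h2 e f a b c d + h2 e f a c b d + h2 e f a d b c)"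

lemma SS_S6: "SS a b c d e f = S6 (E a b c) (E a b d) (E a c d) (E b c d) (E a b e) (E a c e) (E a d e) (E b c e) (E b d e) (E c d e) (E a b f) (E a c f) (E a d f) (E b c f) (E b d f) (E c d f) (E a e f) (E b e f) (E c e f) (E d e f)"
  unfolding SS_def S6_def hs_def h2_def hr_def by (simp only: E_sym)

lemma SS_sym:
  "SS b a c d e f = SS a b c d e f"
  "SS a c b d e f = SS a b c d e f"
  "SS a b d c e f = SS a b c d e f"
  "SS a b c e d f = SS a b c d e f"
  "SS a b c d f e = SS a b c d e f"
  unfolding SS_def by (simp_all only: hs_sym h2_sym hr_sym add_ac)

definition n5 :: "'a \<Rightarrow> 'a \<Rightarrow> 'a \<Rightarrow> 'a \<Rightarrow> 'a \<Rightarrow> nat" where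
  "n5 a b c d e = of_bool (E a b c) + of_bool (E a b d) + of_bool (E a c d) + of_bool (E b c d) + of_bool (E a b e) + of_bool (E a c e) + of_bool (E a d e) + of_bool (E b c e) + of_bool (E b d e) + of_bool (E c d e)"

lemma n5_sym:
  "n5 b a c d e = n5 a b c d e"
  "n5 a c b d e = n5 a b c d e"
  "n5 a b d c e = n5 a b c d e"
  "n5 a b c e d = n5 a b c d e"
  unfolding n5_def by (simp_all only: E_sym add_ac)

text \<open>The five vertices other than f span the most edges, which means that f has least degree
  among the six.\<close>

definition last_min :: "'a \<Rightarrow> 'a \<Rightarrow> 'a \<Rightarrow> 'a \<Rightarrow> 'a \<Rightarrow> 'a \<Rightarrow> bool" where
  "last_min a b c d e f \<longleftrightarrow> n5 b c d e f \<le> n5 a b c d e \<and> n5 a c d e f \<le> n5 a b c d e \<and> n5 a b d e f \<le> n5 a b c d e \<and> n5 a b c e f \<le> n5 a b c d e \<and> n5 a b c d f \<le> n5 a b c d e"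

lemma last_min_sym:
  "last_min b a c d e f = last_min a b c d e f"
  "last_min a c b d e f = last_min a b c d e f"
  "last_min a b d c e f = last_min a b c d e f"
  "last_min a b c e d f = last_min a b c d e f"
  unfolding last_min_def by (simp_all only: n5_sym conj_ac)

lemma last_min_okx: "last_min a b c d e f \<Longrightarrow> okx (E a b c) (E a b d) (E a c d) (E b c d) (E a b e) (E a c e) (E a d e) (E b c e) (E b d e) (E c d e) (E a b f) (E a c f) (E a d f) (E b c f) (E b d f) (E c d f) (E a e f) (E b e f) (E c e f) (E d e f)"
  unfolding okx_def last_min_def n5_def le6_def
  using ok5_E[of b c d e f] ok5_E[of a c d e f] ok5_E[of a b d e f] ok5_E[of a b c e f]
  apply (simp only: E_sym)
  apply (elim conjE, intro conjI)
  apply (rule TrueI | assumption | linarith)+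
  done

text \<open>Only the first five vertices are permuted into a representative, so f remains a vertex
  of least degree throughout the reduction.\<close>

lemma SS_pos_last_min: "last_min a b c d e f \<Longrightarrow> 1 \<le> SS a b c d e f"
proof -
  have "last_min a b c d e f \<longrightarrow> 1 \<le> SS a b c d e f"
  proof (rule rep5_vertices[where Q = "\<lambda>a b c d e. last_min a b c d e f \<longrightarrow> 1 \<le> SS a b c d e f"])
    fix a b c d e
    assume "isrep (E a b c) (E a b d) (E a c d) (E b c d) (E a b e) (E a c e) (E a d e) (E b c e) (E b d e) (E c d e)"
    then show "last_min a b c d e f \<longrightarrow> 1 \<le> SS a b c d e f"
      unfolding SS_S6 using S6_pos ok5_E[of a b c d f] last_min_okx[of a b c d e f] by blast
  qed (simp_all only: last_min_sym SS_sym)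
  then show "last_min a b c d e f \<Longrightarrow> 1 \<le> SS a b c d e f" by blast
qed

text \<open>Some vertex has least degree, and the symmetry of \<open>SS\<close> moves it to the last
  place.\<close>

lemma SS_pos: "1 \<le> SS a b c d e f"
proof -
  define g where "g = [n5 b c d e f, n5 a c d e f, n5 a b d e f, n5 a b c e f, n5 a b c d f, n5 a b c d e]"
  have "Max (set g) \<in> set g" by (rule Max_in) (simp_all add: g_def)
  moreover have "\<forall>x\<in>set g. x \<le> Max (set g)" by simp
  ultimately have "\<exists>m\<in>set g. \<forall>x\<in>set g. x \<le> m" by blast
  then have "last_min b c d e f a \<or> last_min a c d e f b \<or> last_min a b d e f c \<or> last_min a b c e f d \<or> last_min a b c d f e \<or> last_min a b c d e f"
    unfolding g_def last_min_def by (simp add: n5_sym)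
  then show ?thesis
    using SS_pos_last_min[of b c d e f a] SS_pos_last_min[of a c d e f b] SS_pos_last_min[of a b d e f c] SS_pos_last_min[of a b c e f d] SS_pos_last_min[of a b c d f e] SS_pos_last_min[of a b c d e f]
    by (auto simp only: SS_sym)
qed

end

definition lam :: real where
  "lam = 2 * sqrt 3 - 3"

lemma lam_ge: "4641 / 10000 \<le> lam"
proof -
  have "(173205 / 100000)\<^sup>2 \<le> (3 :: real)" by (simp add: power2_eq_square)
  then have "173205 / 100000 \<le> sqrt 3" by (rule real_le_rsqrt)
  then show ?thesis by (simp add: lam_def)
qed

context weighted
begin

lemma I_congV: "(\<And>v. v \<in> V \<Longrightarrow> f v = g v) \<Longrightarrow> I f = I g"
  unfolding I_def by (rule sum.cong) auto

lemma I_le_1: "(\<And>v. f v \<le> 1) \<Longrightarrow> I f \<le> 1"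
  using I_mono[of f "\<lambda>_. 1"] by (simp add: I_const)

lemma Z4_products:
  "Z4 (\<lambda>x y z t. f x y * g z t) = I (\<lambda>x. I (\<lambda>y. f x y)) * I (\<lambda>z. I (\<lambda>t. g z t))"
  "Z4 (\<lambda>x y z t. g z t * f x y) = I (\<lambda>z. I (\<lambda>t. g z t)) * I (\<lambda>x. I (\<lambda>y. f x y))"
  "Z4 (\<lambda>x y z t. f x y * k z) = I (\<lambda>x. I (\<lambda>y. f x y)) * I (\<lambda>z. k z)"
  "Z4 (\<lambda>x y z t. f x y * k t) = I (\<lambda>x. I (\<lambda>y. f x y)) * I (\<lambda>z. k z)"
  "Z4 (\<lambda>x y z t. k t * h x y z) = I (\<lambda>z. k z) * I (\<lambda>x. I (\<lambda>y. I (\<lambda>z. h x y z)))"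
  "Z4 (\<lambda>x y z t. k z * h x y t) = I (\<lambda>z. k z) * I (\<lambda>x. I (\<lambda>y. I (\<lambda>z. h x y z)))"
  "Z4 (\<lambda>x y z t. f x y) = I (\<lambda>x. I (\<lambda>y. f x y))"
  by (simp_all only: Z4_def I_cmult I_multc I_const)

end

section \<open>The optimal counterexample and a set with positive Phi\<close>

locale extremal = k5w V w E
  for V :: "'a set" and w and E :: "'a \<Rightarrow> 'a \<Rightarrow> 'a \<Rightarrow> bool" +
  fixes mu :: real
  assumes w_pos: "v \<in> V \<Longrightarrow> 0 < w v"
    and irrefl: "\<not> E a a b"
    and deg: "v \<in> V \<Longrightarrow> I (\<lambda>a. I (\<lambda>b. of_bool (E v a b))) = mu"
    and lam_less: "lam < mu"
    and sub: "\<exists>v\<in>V. \<not> B v \<Longrightarrow>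
      I (\<lambda>a. I (\<lambda>b. I (\<lambda>c. of_bool (B a \<and> B b \<and> B c \<and> E a b c)))) \<le> lam * (I (\<lambda>a. of_bool (B a))) ^ 3"
begin

lemma I3_E: "I (\<lambda>a. I (\<lambda>b. I (\<lambda>c. of_bool (E a b c)))) = mu"
proof -
  have "I (\<lambda>a. I (\<lambda>b. I (\<lambda>c. of_bool (E a b c)))) = I (\<lambda>a. mu)"
    by (rule I_congV) (rule deg)
  then show ?thesis by (simp only: I_const)
qed

lemma dg_eq: "dg e = 10000 * of_bool e - 4641"
  by (simp add: dg_def)

lemma deg_dg: "v \<in> V \<Longrightarrow> 0 \<le> I (\<lambda>a. I (\<lambda>b. dg (E v a b)))"
  using lam_less lam_ge by (simp only: dg_eq I_diff I_cmult I_const deg)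

text \<open>Edges not inside B have density at least mu - lam b^3 >= lam (1 - b^3) >= 0.4641 (1 -
  b^3), where b is the weight of B. If B covers V, the integrand vanishes on V. Allowing any
  predicate B lets sets defined from a sampled triple enter a flag computation.\<close>

lemma outside_nonneg:
  "0 \<le> I (\<lambda>a. I (\<lambda>b. I (\<lambda>c. if B a \<and> B b \<and> B c then 0 else dg (E a b c))))" (is "0 \<le> ?X")
proof (cases "\<exists>v\<in>V. \<not> B v")
  case False
  then show ?thesis by (intro I_nonneg) auto
next
  case True
  let ?b = "I (\<lambda>a. of_bool (B a))"
  let ?e = "I (\<lambda>a. I (\<lambda>b. I (\<lambda>c. of_bool (B a \<and> B b \<and> B c \<and> E a b c))))"
  have "(if B a \<and> B b \<and> B c then 0 else dg (E a b c)) = 10000 * of_bool (E a b c) - 4641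
      - 10000 * of_bool (B a \<and> B b \<and> B c \<and> E a b c) + 4641 * (of_bool (B a) * of_bool (B b) * of_bool (B c))" for a b c
    by (simp add: dg_def)
  then have X: "?X = 10000 * mu - 4641 - 10000 * ?e + 4641 * (?b * ?b * ?b)"
    by (simp only: I_add I_diff I_cmult I_multc I_const I3_E)
  have b: "0 \<le> ?b" "?b \<le> 1" by (rule I_nonneg, simp) (rule I_le_1, simp)
  then have "?b ^ 3 \<le> 1" by (rule power_le_one)
  then have "0 \<le> (10000 * lam - 4641) * (1 - ?b ^ 3)"
    using lam_ge by (intro mult_nonneg_nonneg) auto
  then have "0 \<le> 10000 * lam - 4641 - 10000 * (lam * ?b ^ 3) + 4641 * ?b ^ 3"
    by (simp add: algebra_simps)
  with sub[OF True] lam_less show ?thesis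
    unfolding X by (simp add: power3_eq_cube)
qed

definition F6 :: "'a \<Rightarrow> 'a \<Rightarrow> 'a \<Rightarrow> 'a \<Rightarrow> 'a \<Rightarrow> 'a \<Rightarrow> real" where
  "F6 a b c d e f = qq (E a b c) (E a b d) (E a c d) (E b c d) (E a b e) (E a c e) (E a d e) (E b c e) (E b d e) (E c d e) (E a b f) (E a c f) (E a d f) (E b c f) (E b d f) (E c d f)"

lemma length_u0: "length (u0 a b c d e f) \<le> 11"
  unfolding u0_def by simp

lemma length_u1: "length (u1 a b c d e f) \<le> 11"
  unfolding u1_def by simp

lemma length_u2: "length (u2 a b c d e f) \<le> 11"
  unfolding u2_def by simp

lemma length_u3: "length (u3 a b c d e f) \<le> 11"
  unfolding u3_def by simp

lemma length_u4: "length (u4 a b c d) \<le> 11"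
  unfolding u4_def by simp

lemma length_uu: "length (uu k l m n a b c d e f) \<le> 11"
  unfolding uu_def by (simp add: length_u0 length_u1 length_u2 length_u3)

lemma hs_eq: "hs a b c d e f = F6 a b c d e f + F6 a b d c e f + F6 a c b d e f + F6 a c d b e f + F6 a d b c e f + F6 a d c b e f + F6 b a c d e f + F6 b a d c e f + F6 b c a d e f + F6 b c d a e f + F6 b d a c e f + F6 b d c a e f + F6 c a b d e f + F6 c a d b e f + F6 c b a d e f + F6 c b d a e f + F6 c d a b e f + F6 c d b a e f + F6 d a b c e f + F6 d a c b e f + F6 d b a c e f + F6 d b c a e f + F6 d c a b e f + F6 d c b a e f"
  unfolding hs_def s16_def F6_def by (simp only: E_sym)

text \<open>For fixed a, b, c, d the two flag vertices e and f are independent, so their average is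
  a squared norm.\<close>

lemma Z6_hs: "0 \<le> Z6 hs"
proof -
  have "Z6 hs = 24 * Z6 F6"
    unfolding Z6_24[of F6, symmetric] hs_eq[symmetric] ..
  moreover have "0 \<le> Z6 F6"
    unfolding Z6_def F6_def qq_def
    by (rule I_nonneg, rule I_nonneg, rule I_nonneg, rule I_nonneg, rule sos_nonneg[where n = 11], rule length_uu)
  ultimately show ?thesis by simp
qed

definition G6 :: "'a \<Rightarrow> 'a \<Rightarrow> 'a \<Rightarrow> 'a \<Rightarrow> 'a \<Rightarrow> 'a \<Rightarrow> real" where
  "G6 a b c d e f = rr (E a b c) (E a b d) (E a c d) (E b c d) (E a b e) (E a b f) (E a e f) (E b e f)"

lemma Z6_h2: "0 \<le> Z6 h2"
proof -
  have "h2 a b c d e f = G6 a b c d e f + G6 b a c d e f" for a b c d e f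
    unfolding h2_def r2_def G6_def by (simp only: E_sym)
  then have "Z6 h2 = 2 * Z6 G6"
    unfolding Z6_2[of G6, symmetric] by presburger
  moreover have "0 \<le> Z6 G6"
    unfolding Z6_def G6_def rr_def
    by (rule I_nonneg, rule I_nonneg, rule sos_nonneg2[where n = 11], rule length_u4)
  ultimately show ?thesis by simp
qed

definition Phi :: "('a \<Rightarrow> bool) \<Rightarrow> real" where
  "Phi A = I (\<lambda>a. I (\<lambda>b. I (\<lambda>c. if E a b c then hh (A a) (A b) (A c) else 0)))"

text \<open>For a fixed edge abc the average over d, e, f is Phi of the set of vertices that form
  edges with both ac and bc.\<close>

definition o6 :: "'a \<Rightarrow> 'a \<Rightarrow> 'a \<Rightarrow> 'a \<Rightarrow> 'a \<Rightarrow> 'a \<Rightarrow> real" where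
  "o6 a b c d e f = (if E a b c then (if E d e f then
     hh (E a c d \<and> E b c d) (E a c e \<and> E b c e) (E a c f \<and> E b c f) else 0) else 0)"

text \<open>d forms an edge with an odd number of the pairs ab, ac, bc; if abc is an edge this means
  exactly one, three being excluded by \<open>K4_free\<close>. In the nested construction, an edge
  with two vertices in A yields precisely B as the set of such d, so \<open>outside_nonneg\<close>
  is nearly tight for it.\<close>

definition odd_cov :: "'a \<Rightarrow> 'a \<Rightarrow> 'a \<Rightarrow> 'a \<Rightarrow> bool" where
  "odd_cov a b c d \<longleftrightarrow> (E a b d = (E a c d = E b c d))"

text \<open>In the nested construction a triple inside A again recovers B, now as the set of
  vertices joined to all three of its pairs.\<close>

definition all_cov :: "'a \<Rightarrow> 'a \<Rightarrow> 'a \<Rightarrow> 'a \<Rightarrow> bool" where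
  "all_cov a b c d \<longleftrightarrow> E a b d \<and> E a c d \<and> E b c d"

definition g6 :: "'a \<Rightarrow> 'a \<Rightarrow> 'a \<Rightarrow> 'a \<Rightarrow> 'a \<Rightarrow> 'a \<Rightarrow> real" where
  "g6 a b c d e f = (if E a b c then (if odd_cov a b c d \<and> odd_cov a b c e \<and> odd_cov a b c f then 0 else dg (E d e f)) else 0)"

definition n6 :: "'a \<Rightarrow> 'a \<Rightarrow> 'a \<Rightarrow> 'a \<Rightarrow> 'a \<Rightarrow> 'a \<Rightarrow> real" where
  "n6 a b c d e f = (if E a b c then 0 else (if all_cov a b c d \<and> all_cov a b c e \<and> all_cov a b c f then 0 else dg (E d e f)))"

text \<open>Separates the objective into Phi terms, one for each vertex of abc that the two joined
  pairs can share, and two penalties whose averages are nonnegative by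
  \<open>outside_nonneg\<close>.\<close>

lemma hr_eq: "hr a b c d e f = 6000000 * (o6 b c a d e f + o6 a c b d e f + o6 a b c d e f)
    - 67500 * g6 a b c d e f - 183978 * n6 a b c d e f"
proof -
  have E: "E b c a = E a b c" "E a c b = E a b c" "E b a d = E a b d" "E c a d = E a c d" "E c b d = E b c d" for d
    by (simp_all only: E_sym)
  have k: "(if P then 0 else 361732500) = 67500 * (if P then 0 else (5359 :: real))"
    "(if P then 0 else - 313267500) = 67500 * (if P then 0 else (- 4641 :: real))"
    "(if P then 0 else 985938102) = 183978 * (if P then 0 else (5359 :: real))"
    "(if P then 0 else - 853841898) = 183978 * (if P then 0 else (- 4641 :: real))" for P
    by simp_all
  show ?thesis
    unfolding hr_def rt_def o6_def g6_def n6_def odd_cov_def all_cov_def dg_def E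
    by (cases "E a b c"; cases "E d e f"; simp only: if_True if_False simp_thms conj_assoc k add_ac add_0_right mult_zero_right diff_zero diff_0)
qed

lemma Z6_g6: "0 \<le> Z6 g6"
proof -
  have *: "0 \<le> I (\<lambda>d. I (\<lambda>e. I (\<lambda>f. g6 a b c d e f)))" for a b c
    using outside_nonneg[of "odd_cov a b c"] by (cases "E a b c") (simp_all add: g6_def I_const)
  show ?thesis unfolding Z6_def by (rule I_nonneg, rule I_nonneg, rule I_nonneg, rule *)
qed

lemma Z6_n6: "0 \<le> Z6 n6"
proof -
  have *: "0 \<le> I (\<lambda>d. I (\<lambda>e. I (\<lambda>f. n6 a b c d e f)))" for a b c
    using outside_nonneg[of "all_cov a b c"] by (cases "E a b c") (simp_all add: n6_def I_const)
  show ?thesis unfolding Z6_def by (rule I_nonneg, rule I_nonneg, rule I_nonneg, rule *)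
qed

text \<open>If Phi were never positive, every term of the averaged certificate would be at most 0,
  although its symmetrised integrand is at least 1 everywhere.\<close>

lemma ex_Phi_pos: "\<exists>A. 0 < Phi A"
proof (rule ccontr)
  assume "\<nexists>A. 0 < Phi A"
  then have np: "Phi A \<le> 0" for A by (meson not_le)
  have "I (\<lambda>d. I (\<lambda>e. I (\<lambda>f. o6 a b c d e f))) \<le> 0" for a b c
    using np[of "\<lambda>d. E a c d \<and> E b c d"] by (cases "E a b c") (simp_all add: o6_def Phi_def I_const)
  then have "Z6 o6 \<le> I (\<lambda>a. I (\<lambda>b. I (\<lambda>c. 0)))"
    unfolding Z6_def by (intro I_mono)
  then have o: "Z6 o6 \<le> 0" by (simp only: I_const)
  have hr_fun: "hr = (\<lambda>a b c d e f. 6000000 * (o6 b c a d e f + o6 a c b d e f + o6 a b c d e f)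
      - 67500 * g6 a b c d e f - 183978 * n6 a b c d e f)"
    by (intro ext) (rule hr_eq)
  have "Z6 hr = 6000000 * (3 * Z6 o6) - 67500 * Z6 g6 - 183978 * Z6 n6"
    unfolding hr_fun Z6_diff Z6_cmult Z6_3[of o6] ..
  with o Z6_g6 Z6_n6 have hr: "Z6 hr \<le> 0" by linarith
  have "Z6 SS = 20 * Z6 hr - 15 * Z6 hs - 4 * (45 * Z6 h2)"
    unfolding SS_def[abs_def] Z6_diff Z6_cmult Z6_20[of hr] Z6_15[of hs] Z6_45[of h2] ..
  with hr Z6_hs Z6_h2 have "Z6 SS \<le> 0" by linarith
  moreover have "Z6 (\<lambda>a b c d e f. 1) \<le> Z6 SS" by (rule Z6_mono) (rule SS_pos)
  ultimately show False by (simp add: Z6_const)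
qed

section \<open>Wrongly placed edges at a vertex, and the density of edges meeting A\<close>

definition LA :: "('a \<Rightarrow> bool) \<Rightarrow> 'a \<Rightarrow> 'a \<Rightarrow> 'a \<Rightarrow> 'a \<Rightarrow> 'a \<Rightarrow> real" where
  "LA A v x y z t = lfA (A x) (A y) (A z) (A t) (E v x y) (E v x z) (E v y z) (E x y z) (E v x t) (E v y t) (E v z t) (E x y t) (E x z t) (E y z t)"

definition SSA :: "('a \<Rightarrow> bool) \<Rightarrow> 'a \<Rightarrow> 'a \<Rightarrow> 'a \<Rightarrow> 'a \<Rightarrow> 'a \<Rightarrow> real" where
  "SSA A v x y z t = LA A v x y z t + LA A v x z y t + LA A v x t y z + LA A v y x z t + LA A v y z x t + LA A v y t x z + LA A v z x y t + LA A v z y x t + LA A v z t x y + LA A v t x y z + LA A v t y x z + LA A v t z x y"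

lemma ppA_sym: "ppA a b c e d f = ppA a b c d e f"
  by (cases a; cases b; cases c; cases d; cases e; cases f) (simp_all only: ppA_eqs)

lemma LA_sym: "LA A v x y t z = LA A v x y z t"
  unfolding LA_def lfA_def by (simp only: E_sym ppA_sym dotl_comm diff_right_commute)

lemma SSA_sym:
  "SSA A v y x z t = SSA A v x y z t"
  "SSA A v x z y t = SSA A v x y z t"
  "SSA A v x y t z = SSA A v x y z t"
  unfolding SSA_def by (simp_all only: LA_sym add_ac)

lemma SSA_S4: "SSA A v x y z t = S4A (A x) (A y) (A z) (A t) (E v x y) (E v x z) (E v y z) (E x y z) (E v x t) (E v y t) (E v z t) (E x y t) (E x z t) (E y z t)"
  unfolding SSA_def S4A_def LA_def by (simp only: E_sym)

lemma S4A_nonneg: "isrep b012 b013 b023 b123 b014 b024 b034 b124 b134 b234 \<Longrightarrow> \<forall>c1 c2 c3 c4. 0 \<le> S4A c1 c2 c3 c4 b012 b013 b023 b123 b014 b024 b034 b124 b134 b234 \<and> 0 \<le> S4A c1 c2 c3 c4 b012 b013 b123 b023 b014 b124 b134 b024 b034 b234 \<and> 0 \<le> S4A c1 c2 c3 c4 b012 b023 b123 b013 b024 b124 b234 b014 b034 b134 \<and> 0 \<le> S4A c1 c2 c3 c4 b013 b023 b123 b012 b034 b134 b234 b014 b024 b124 \<and> 0 \<le> S4A c1 c2 c3 c4 b014 b024 b124 b012 b034 b134 b234 b013 b023 b123"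
  by (erule isrep.cases; hypsubst; rule S4A_rep0 S4A_rep1 S4A_rep2 S4A_rep3 S4A_rep4 S4A_rep5 S4A_rep6 S4A_rep7 S4A_rep8 S4A_rep9 S4A_rep10 S4A_rep11 S4A_rep12 S4A_rep13 S4A_rep14 S4A_rep15 S4A_rep16 S4A_rep17 S4A_rep18 S4A_rep19 S4A_rep20)

lemma SSA_nonneg: "0 \<le> SSA A a b c d e"
proof -
  \<comment> \<open>Nonnegativity for one particular root is not invariant under permutations, but
    the conjunction over all five roots is, so it can be reduced to representatives.\<close>
  let ?Q = "\<lambda>a b c d e. 0 \<le> SSA A a b c d e \<and> 0 \<le> SSA A b a c d e \<and> 0 \<le> SSA A c a b d e
    \<and> 0 \<le> SSA A d a b c e \<and> 0 \<le> SSA A e a b c d"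
  have "?Q a b c d e"
  proof (rule rep5_vertices[where Q = ?Q])
    fix a b c d e
    assume "isrep (E a b c) (E a b d) (E a c d) (E b c d) (E a b e) (E a c e) (E a d e) (E b c e) (E b d e) (E c d e)"
    from S4A_nonneg[OF this] show "?Q a b c d e"
      unfolding SSA_S4 by (simp only: E_sym simp_thms)
  qed (simp_all only: SSA_sym conj_ac)
  then show ?thesis by blast
qed

lemma length_vA: "length (vA a b c d e f g) \<le> 11"
  unfolding vA_def by simp

text \<open>Weak duality: the averaged certificate is nonnegative and every subtracted term has a
  nonnegative average, so the same holds for the objective. \<open>cut\<close> records that moving v
  out of A does not increase Phi.\<close>

lemma obA_bound:
  assumes v: "v \<in> V" and cut: "0 \<le> I (\<lambda>x. I (\<lambda>y. kcA (A x) (A y) (E v x y)))"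
    and Phi: "0 \<le> Phi A" and a: "0 \<le> I (\<lambda>x. cl (A x))"
  shows "0 \<le> I (\<lambda>x. I (\<lambda>y. obA (A x) (A y) (E v x y)))"
proof -
  have L: "LA A v = (\<lambda>x y z t. 1000 * obA (A x) (A y) (E v x y)
      - mcA (A z) (A t) (E v z t) * kcA (A x) (A y) (E v x y) - mdA (A z) (A t) (E v z t) * dg (E v x y)
      - zzA (A x) (A y) (E v x y) * zzA (A z) (A t) (E v z t)
      - mlA (A x) (A y) (E v x y) * cl (A z) - mlA (A x) (A y) (E v x y) * cl (A t)
      - (mkA (A t) * (if E x y z then hh (A x) (A y) (A z) else 0) + mgA (A t) * (if A x \<or> A y \<or> A z then dg (E x y z) else 0))
      - (mkA (A z) * (if E x y t then hh (A x) (A y) (A t) else 0) + mgA (A z) * (if A x \<or> A y \<or> A t then dg (E x y t) else 0))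
      - mDA (A x) (A y) (E v x y) * dg (E x z t)
      - dotl (vA (A x) (A y) (E v x y) (A z) (E v x z) (E v y z) (E x y z))
          (vA (A x) (A y) (E v x y) (A t) (E v x t) (E v y t) (E x y t)))"
    by (intro ext) (simp only: LA_def lfA_def ppA_def llA_def kgA_def ddA_def)
  \<comment> \<open>Edges meeting A are those not inside its complement.\<close>
  have g: "0 \<le> I (\<lambda>x. I (\<lambda>y. I (\<lambda>z. if A x \<or> A y \<or> A z then dg (E x y z) else 0)))"
  proof -
    have eq: "(if A x \<or> A y \<or> A z then dg (E x y z) else 0) = (if \<not> A x \<and> \<not> A y \<and> \<not> A z then 0 else dg (E x y z))" for x y z
      by simp
    show ?thesis unfolding eq by (rule outside_nonneg)
  qed
  have "0 \<le> Z4 (\<lambda>x y z t. mcA (A z) (A t) (E v z t) * kcA (A x) (A y) (E v x y))"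
    unfolding Z4_products by (rule mult_nonneg_nonneg, rule I_nonneg, rule I_nonneg, simp add: mcA_def, rule cut)
  moreover have "0 \<le> Z4 (\<lambda>x y z t. mdA (A z) (A t) (E v z t) * dg (E v x y))"
    unfolding Z4_products by (rule mult_nonneg_nonneg, rule I_nonneg, rule I_nonneg, simp add: mdA_def, rule deg_dg[OF v])
  moreover have "0 \<le> Z4 (\<lambda>x y z t. zzA (A x) (A y) (E v x y) * zzA (A z) (A t) (E v z t))"
    unfolding Z4_def by (rule I_square_nonneg2)
  moreover have "0 \<le> Z4 (\<lambda>x y z t. mlA (A x) (A y) (E v x y) * cl (A z))"
    unfolding Z4_products I_const by (rule mult_nonneg_nonneg, rule I_nonneg, rule I_nonneg, simp add: mlA_def, rule a)
  moreover have "0 \<le> Z4 (\<lambda>x y z t. mlA (A x) (A y) (E v x y) * cl (A t))"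
    unfolding Z4_products I_const by (rule mult_nonneg_nonneg, rule I_nonneg, rule I_nonneg, simp add: mlA_def, rule a)
  moreover have "0 \<le> Z4 (\<lambda>x y z t. mkA (A t) * (if E x y z then hh (A x) (A y) (A z) else 0))"
    unfolding Z4_products by (rule mult_nonneg_nonneg, rule I_nonneg, simp add: mkA_def, rule Phi[unfolded Phi_def])
  moreover have "0 \<le> Z4 (\<lambda>x y z t. mkA (A z) * (if E x y t then hh (A x) (A y) (A t) else 0))"
    unfolding Z4_products by (rule mult_nonneg_nonneg, rule I_nonneg, simp add: mkA_def, rule Phi[unfolded Phi_def])
  moreover have "0 \<le> Z4 (\<lambda>x y z t. mgA (A t) * (if A x \<or> A y \<or> A z then dg (E x y z) else 0))"
    unfolding Z4_products by (rule mult_nonneg_nonneg, rule I_nonneg, simp add: mgA_def, rule g)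
  moreover have "0 \<le> Z4 (\<lambda>x y z t. mgA (A z) * (if A x \<or> A y \<or> A t then dg (E x y t) else 0))"
    unfolding Z4_products by (rule mult_nonneg_nonneg, rule I_nonneg, simp add: mgA_def, rule g)
  moreover have "0 \<le> Z4 (\<lambda>x y z t. mDA (A x) (A y) (E v x y) * dg (E x z t))"
    unfolding Z4_def I_cmult
    by (rule I_nonneg, rule I_nonneg, rule mult_nonneg_nonneg, simp add: mDA_def, erule deg_dg)
  moreover have "0 \<le> Z4 (\<lambda>x y z t. dotl (vA (A x) (A y) (E v x y) (A z) (E v x z) (E v y z) (E x y z))
          (vA (A x) (A y) (E v x y) (A t) (E v x t) (E v y t) (E x y t)))"
    unfolding Z4_def by (rule I_nonneg, rule I_nonneg, rule sos_nonneg[where n = 11], rule length_vA)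
  moreover have "0 \<le> Z4 (LA A v)"
  proof -
    have "12 * Z4 (LA A v) = Z4 (SSA A v)"
      unfolding SSA_def[abs_def] Z4_12[of "LA A v"] ..
    moreover have "Z4 (\<lambda>x y z t. 0) \<le> Z4 (SSA A v)" by (rule Z4_mono) (rule SSA_nonneg)
    ultimately show ?thesis by (simp add: Z4_const)
  qed
  ultimately have "0 \<le> 1000 * Z4 (\<lambda>x y z t. obA (A x) (A y) (E v x y))"
    unfolding L Z4_diff Z4_add Z4_cmult by linarith
  then show ?thesis unfolding Z4_products by simp
qed

definition LB :: "('a \<Rightarrow> bool) \<Rightarrow> 'a \<Rightarrow> 'a \<Rightarrow> 'a \<Rightarrow> 'a \<Rightarrow> 'a \<Rightarrow> real" where
  "LB A v x y z t = lfB (A x) (A y) (A z) (A t) (E v x y) (E v x z) (E v y z) (E x y z) (E v x t) (E v y t) (E v z t) (E x y t) (E x z t) (E y z t)"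

definition SSB :: "('a \<Rightarrow> bool) \<Rightarrow> 'a \<Rightarrow> 'a \<Rightarrow> 'a \<Rightarrow> 'a \<Rightarrow> 'a \<Rightarrow> real" where
  "SSB A v x y z t = LB A v x y z t + LB A v x z y t + LB A v x t y z + LB A v y x z t + LB A v y z x t + LB A v y t x z + LB A v z x y t + LB A v z y x t + LB A v z t x y + LB A v t x y z + LB A v t y x z + LB A v t z x y"

lemma ppB_sym: "ppB a b c e d f = ppB a b c d e f"
  by (cases a; cases b; cases c; cases d; cases e; cases f) (simp_all only: ppB_eqs)

lemma LB_sym: "LB A v x y t z = LB A v x y z t"
  unfolding LB_def lfB_def by (simp only: E_sym ppB_sym dotl_comm diff_right_commute)

lemma SSB_sym:
  "SSB A v y x z t = SSB A v x y z t"
  "SSB A v x z y t = SSB A v x y z t"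
  "SSB A v x y t z = SSB A v x y z t"
  unfolding SSB_def by (simp_all only: LB_sym add_ac)

lemma SSB_S4: "SSB A v x y z t = S4B (A x) (A y) (A z) (A t) (E v x y) (E v x z) (E v y z) (E x y z) (E v x t) (E v y t) (E v z t) (E x y t) (E x z t) (E y z t)"
  unfolding SSB_def S4B_def LB_def by (simp only: E_sym)

lemma S4B_nonneg: "isrep b012 b013 b023 b123 b014 b024 b034 b124 b134 b234 \<Longrightarrow> \<forall>c1 c2 c3 c4. 0 \<le> S4B c1 c2 c3 c4 b012 b013 b023 b123 b014 b024 b034 b124 b134 b234 \<and> 0 \<le> S4B c1 c2 c3 c4 b012 b013 b123 b023 b014 b124 b134 b024 b034 b234 \<and> 0 \<le> S4B c1 c2 c3 c4 b012 b023 b123 b013 b024 b124 b234 b014 b034 b134 \<and> 0 \<le> S4B c1 c2 c3 c4 b013 b023 b123 b012 b034 b134 b234 b014 b024 b124 \<and> 0 \<le> S4B c1 c2 c3 c4 b014 b024 b124 b012 b034 b134 b234 b013 b023 b123"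
  by (erule isrep.cases; hypsubst; rule S4B_rep0 S4B_rep1 S4B_rep2 S4B_rep3 S4B_rep4 S4B_rep5 S4B_rep6 S4B_rep7 S4B_rep8 S4B_rep9 S4B_rep10 S4B_rep11 S4B_rep12 S4B_rep13 S4B_rep14 S4B_rep15 S4B_rep16 S4B_rep17 S4B_rep18 S4B_rep19 S4B_rep20)

lemma SSB_nonneg: "0 \<le> SSB A a b c d e"
proof -
  let ?Q = "\<lambda>a b c d e. 0 \<le> SSB A a b c d e \<and> 0 \<le> SSB A b a c d e \<and> 0 \<le> SSB A c a b d e
    \<and> 0 \<le> SSB A d a b c e \<and> 0 \<le> SSB A e a b c d"
  have "?Q a b c d e"
  proof (rule rep5_vertices[where Q = ?Q])
    fix a b c d e
    assume "isrep (E a b c) (E a b d) (E a c d) (E b c d) (E a b e) (E a c e) (E a d e) (E b c e) (E b d e) (E c d e)"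
    from S4B_nonneg[OF this] show "?Q a b c d e"
      unfolding SSB_S4 by (simp only: E_sym simp_thms)
  qed (simp_all only: SSB_sym conj_ac)
  then show ?thesis by blast
qed

lemma length_vB: "length (vB a b c d e f g) \<le> 11"
  unfolding vB_def by simp

text \<open>The same duality argument, with \<open>cut\<close> now recording that moving v into A
  does not increase Phi.\<close>

lemma obB_bound:
  assumes v: "v \<in> V" and cut: "0 \<le> I (\<lambda>x. I (\<lambda>y. kcB (A x) (A y) (E v x y)))"
    and Phi: "0 \<le> Phi A" and a: "0 \<le> I (\<lambda>x. cl (A x))"
  shows "0 \<le> I (\<lambda>x. I (\<lambda>y. obB (A x) (A y) (E v x y)))"
proof -
  have L: "LB A v = (\<lambda>x y z t. 1000 * obB (A x) (A y) (E v x y)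
      - mcB (A z) (A t) (E v z t) * kcB (A x) (A y) (E v x y) - mdB (A z) (A t) (E v z t) * dg (E v x y)
      - zzB (A x) (A y) (E v x y) * zzB (A z) (A t) (E v z t)
      - mlB (A x) (A y) (E v x y) * cl (A z) - mlB (A x) (A y) (E v x y) * cl (A t)
      - (mkB (A t) * (if E x y z then hh (A x) (A y) (A z) else 0) + mgB (A t) * (if A x \<or> A y \<or> A z then dg (E x y z) else 0))
      - (mkB (A z) * (if E x y t then hh (A x) (A y) (A t) else 0) + mgB (A z) * (if A x \<or> A y \<or> A t then dg (E x y t) else 0))
      - mDB (A x) (A y) (E v x y) * dg (E x z t)
      - dotl (vB (A x) (A y) (E v x y) (A z) (E v x z) (E v y z) (E x y z))
          (vB (A x) (A y) (E v x y) (A t) (E v x t) (E v y t) (E x y t)))"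
    by (intro ext) (simp only: LB_def lfB_def ppB_def llB_def kgB_def ddB_def)
  have g: "0 \<le> I (\<lambda>x. I (\<lambda>y. I (\<lambda>z. if A x \<or> A y \<or> A z then dg (E x y z) else 0)))"
  proof -
    have eq: "(if A x \<or> A y \<or> A z then dg (E x y z) else 0) = (if \<not> A x \<and> \<not> A y \<and> \<not> A z then 0 else dg (E x y z))" for x y z
      by simp
    show ?thesis unfolding eq by (rule outside_nonneg)
  qed
  have "0 \<le> Z4 (\<lambda>x y z t. mcB (A z) (A t) (E v z t) * kcB (A x) (A y) (E v x y))"
    unfolding Z4_products by (rule mult_nonneg_nonneg, rule I_nonneg, rule I_nonneg, simp add: mcB_def, rule cut)
  moreover have "0 \<le> Z4 (\<lambda>x y z t. mdB (A z) (A t) (E v z t) * dg (E v x y))"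
    unfolding Z4_products by (rule mult_nonneg_nonneg, rule I_nonneg, rule I_nonneg, simp add: mdB_def, rule deg_dg[OF v])
  moreover have "0 \<le> Z4 (\<lambda>x y z t. zzB (A x) (A y) (E v x y) * zzB (A z) (A t) (E v z t))"
    unfolding Z4_def by (rule I_square_nonneg2)
  moreover have "0 \<le> Z4 (\<lambda>x y z t. mlB (A x) (A y) (E v x y) * cl (A z))"
    unfolding Z4_products I_const by (rule mult_nonneg_nonneg, rule I_nonneg, rule I_nonneg, simp add: mlB_def, rule a)
  moreover have "0 \<le> Z4 (\<lambda>x y z t. mlB (A x) (A y) (E v x y) * cl (A t))"
    unfolding Z4_products I_const by (rule mult_nonneg_nonneg, rule I_nonneg, rule I_nonneg, simp add: mlB_def, rule a)
  moreover have "0 \<le> Z4 (\<lambda>x y z t. mkB (A t) * (if E x y z then hh (A x) (A y) (A z) else 0))"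
    unfolding Z4_products by (rule mult_nonneg_nonneg, rule I_nonneg, simp add: mkB_def, rule Phi[unfolded Phi_def])
  moreover have "0 \<le> Z4 (\<lambda>x y z t. mkB (A z) * (if E x y t then hh (A x) (A y) (A t) else 0))"
    unfolding Z4_products by (rule mult_nonneg_nonneg, rule I_nonneg, simp add: mkB_def, rule Phi[unfolded Phi_def])
  moreover have "0 \<le> Z4 (\<lambda>x y z t. mgB (A t) * (if A x \<or> A y \<or> A z then dg (E x y z) else 0))"
    unfolding Z4_products by (rule mult_nonneg_nonneg, rule I_nonneg, simp add: mgB_def, rule g)
  moreover have "0 \<le> Z4 (\<lambda>x y z t. mgB (A z) * (if A x \<or> A y \<or> A t then dg (E x y t) else 0))"
    unfolding Z4_products by (rule mult_nonneg_nonneg, rule I_nonneg, simp add: mgB_def, rule g)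
  moreover have "0 \<le> Z4 (\<lambda>x y z t. mDB (A x) (A y) (E v x y) * dg (E x z t))"
    unfolding Z4_def I_cmult
    by (rule I_nonneg, rule I_nonneg, rule mult_nonneg_nonneg, simp add: mDB_def, erule deg_dg)
  moreover have "0 \<le> Z4 (\<lambda>x y z t. dotl (vB (A x) (A y) (E v x y) (A z) (E v x z) (E v y z) (E x y z))
          (vB (A x) (A y) (E v x y) (A t) (E v x t) (E v y t) (E x y t)))"
    unfolding Z4_def by (rule I_nonneg, rule I_nonneg, rule sos_nonneg[where n = 11], rule length_vB)
  moreover have "0 \<le> Z4 (LB A v)"
  proof -
    have "12 * Z4 (LB A v) = Z4 (SSB A v)"
      unfolding SSB_def[abs_def] Z4_12[of "LB A v"] ..
    moreover have "Z4 (\<lambda>x y z t. 0) \<le> Z4 (SSB A v)" by (rule Z4_mono) (rule SSB_nonneg)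
    ultimately show ?thesis by (simp add: Z4_const)
  qed
  ultimately have "0 \<le> 1000 * Z4 (\<lambda>x y z t. obB (A x) (A y) (E v x y))"
    unfolding L Z4_diff Z4_add Z4_cmult by linarith
  then show ?thesis unfolding Z4_products by simp
qed

definition LP :: "('a \<Rightarrow> bool) \<Rightarrow> 'a \<Rightarrow> 'a \<Rightarrow> 'a \<Rightarrow> 'a \<Rightarrow> 'a \<Rightarrow> real" where
  "LP A a b c d e = lfP (A a) (A b) (A c) (A d) (A e) (E a b c) (E a b d) (E a c d) (E b c d) (E a b e) (E a c e) (E a d e) (E b c e) (E b d e) (E c d e)"

definition SSP :: "('a \<Rightarrow> bool) \<Rightarrow> 'a \<Rightarrow> 'a \<Rightarrow> 'a \<Rightarrow> 'a \<Rightarrow> 'a \<Rightarrow> real" where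
  "SSP A a b c d e = LP A a b c d e + LP A a b d c e + LP A a b e c d + LP A a c b d e + LP A a c d b e + LP A a c e b d + LP A a d b c e + LP A a d c b e + LP A a d e b c + LP A a e b c d + LP A a e c b d + LP A a e d b c + LP A b a c d e + LP A b a d c e + LP A b a e c d + LP A b c a d e + LP A b c d a e + LP A b c e a d + LP A b d a c e + LP A b d c a e + LP A b d e a c + LP A b e a c d + LP A b e c a d + LP A b e d a c + LP A c a b d e + LP A c a d b e + LP A c a e b d + LP A c b a d e + LP A c b d a e + LP A c b e a d + LP A c d a b e + LP A c d b a e + LP A c d e a b + LP A c e a b d + LP A c e b a d + LP A c e d a b + LP A d a b c e + LP A d a c b e + LP A d a e b c + LP A d b a c e + LP A d b c a e + LP A d b e a c + LP A d c a b e + LP A d c b a e + LP A d c e a b + LP A d e a b c + LP A d e b a c + LP A d e c a b + LP A e a b c d + LP A e a c b d + LP A e a d b c + LP A e b a c d + LP A e b c a d + LP A e b d a c + LP A e c a b d + LP A e c b a d + LP A e c d a b + LP A e d a b c + LP A e d b a c + LP A e d c a b"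

lemma dvP_sym: "dvP a c b d e f g = dvP a b c d e f g"
  by (cases a; cases b; cases c; cases d; cases e; cases f; cases g) (simp_all only: dvP_eqs)

lemma leP_sym: "leP a b c d f e = leP a b c d e f"
  unfolding leP_def by simp

lemma LP_sym: "LP A a b c e d = LP A a b c d e"
  unfolding LP_def lfP_def by (simp only: E_sym dvP_sym leP_sym dotl_comm)

lemma SSP_sym:
  "SSP A b a c d e = SSP A a b c d e"
  "SSP A a c b d e = SSP A a b c d e"
  "SSP A a b d c e = SSP A a b c d e"
  "SSP A a b c e d = SSP A a b c d e"
  unfolding SSP_def by (simp_all only: LP_sym add_ac)

lemma SSP_S5: "SSP A a b c d e = S5 (A a) (A b) (A c) (A d) (A e) (E a b c) (E a b d) (E a c d) (E b c d) (E a b e) (E a c e) (E a d e) (E b c e) (E b d e) (E c d e)"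
  unfolding SSP_def S5_def LP_def by (simp only: E_sym)

lemma S5_nonneg: "isrep b012 b013 b023 b123 b014 b024 b034 b124 b134 b234 \<Longrightarrow> \<forall>c0 c1 c2 c3 c4. 0 \<le> S5 c0 c1 c2 c3 c4 b012 b013 b023 b123 b014 b024 b034 b124 b134 b234"
  by (erule isrep.cases; hypsubst; rule S5_rep0 S5_rep1 S5_rep2 S5_rep3 S5_rep4 S5_rep5 S5_rep6 S5_rep7 S5_rep8 S5_rep9 S5_rep10 S5_rep11 S5_rep12 S5_rep13 S5_rep14 S5_rep15 S5_rep16 S5_rep17 S5_rep18 S5_rep19 S5_rep20)

lemma SSP_nonneg: "0 \<le> SSP A a b c d e"
proof (rule rep5_vertices[where Q = "\<lambda>a b c d e. 0 \<le> SSP A a b c d e"])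
  fix a b c d e
  assume "isrep (E a b c) (E a b d) (E a c d) (E b c d) (E a b e) (E a c e) (E a d e) (E b c e) (E b d e) (E c d e)"
  from S5_nonneg[OF this] show "0 \<le> SSP A a b c d e"
    unfolding SSP_S5 by blast
qed (simp_all only: SSP_sym)

lemma length_vP: "length (vP a b c d e f g h) \<le> 11"
  unfolding vP_def by simp

text \<open>\<open>voP\<close> is \<open>obA\<close> or \<open>obB\<close> according to the colour
  of its vertex, so the hypothesis \<open>v\<close> carries both rooted bounds. Their multipliers
  are averaged over a separate pair at the same vertex.\<close>

lemma obP_bound:
  assumes a: "0 \<le> I (\<lambda>x. cl (A x))"
    and v: "\<And>v. v \<in> V \<Longrightarrow> 0 \<le> I (\<lambda>x. I (\<lambda>y. voP (A v) (A x) (A y) (E v x y)))"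
  shows "0 \<le> I (\<lambda>x. I (\<lambda>y. I (\<lambda>z. obP (A x) (A y) (A z) (E x y z))))"
proof -
  have L: "LP A = (\<lambda>a b c d e. 3000000 * obP (A a) (A b) (A c) (E a b c)
      - lmP (A a) (A b) (A c) (E a b c) * cl (A d) - lmP (A a) (A b) (A c) (E a b c) * cl (A e)
      - (mDP (A a) (A d) (A e) (E a d e) * dg (E a b c) + mVP (A a) (A d) (A e) (E a d e) * voP (A a) (A b) (A c) (E a b c))
      - dotl (vP (A a) (A b) (A c) (E a b c) (A d) (E a b d) (E a c d) (E b c d))
          (vP (A a) (A b) (A c) (E a b c) (A e) (E a b e) (E a c e) (E b c e)))"
    by (intro ext) (simp only: LP_def lfP_def leP_def dvP_def)
  have "0 \<le> Z5 (\<lambda>a b c d e. lmP (A a) (A b) (A c) (E a b c) * cl (A d))"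
    unfolding Z5_def I_const I_cmult
    by (rule I_nonneg, rule I_nonneg, rule I_nonneg, rule mult_nonneg_nonneg, simp add: lmP_def, rule a)
  moreover have "0 \<le> Z5 (\<lambda>a b c d e. lmP (A a) (A b) (A c) (E a b c) * cl (A e))"
    unfolding Z5_def I_const I_cmult
    by (rule I_nonneg, rule I_nonneg, rule I_nonneg, rule mult_nonneg_nonneg, simp add: lmP_def, rule a)
  moreover have "0 \<le> Z5 (\<lambda>a b c d e. mDP (A a) (A d) (A e) (E a d e) * dg (E a b c))"
    unfolding Z5_def I_cmult I_multc
    by (rule I_nonneg, rule mult_nonneg_nonneg, rule I_nonneg, rule I_nonneg, simp add: mDP_def, erule deg_dg)
  moreover have "0 \<le> Z5 (\<lambda>a b c d e. mVP (A a) (A d) (A e) (E a d e) * voP (A a) (A b) (A c) (E a b c))"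
    unfolding Z5_def I_cmult I_multc
    by (rule I_nonneg, rule mult_nonneg_nonneg, rule I_nonneg, rule I_nonneg, simp add: mVP_def, erule v)
  moreover have "0 \<le> Z5 (\<lambda>a b c d e. dotl (vP (A a) (A b) (A c) (E a b c) (A d) (E a b d) (E a c d) (E b c d))
          (vP (A a) (A b) (A c) (E a b c) (A e) (E a b e) (E a c e) (E b c e)))"
    unfolding Z5_def by (rule I_nonneg, rule I_nonneg, rule I_nonneg, rule sos_nonneg[where n = 11], rule length_vP)
  moreover have "0 \<le> Z5 (LP A)"
  proof -
    have "60 * Z5 (LP A) = Z5 (SSP A)"
      unfolding SSP_def[abs_def] Z5_60[of "LP A"] ..
    moreover have "Z5 (\<lambda>a b c d e. 0) \<le> Z5 (SSP A)" by (rule Z5_mono) (rule SSP_nonneg)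
    ultimately show ?thesis by (simp add: Z5_const)
  qed
  ultimately have "0 \<le> 3000000 * Z5 (\<lambda>a b c d e. obP (A a) (A b) (A c) (E a b c))"
    unfolding L Z5_diff Z5_add Z5_cmult by linarith
  then show ?thesis unfolding Z5_def I_const by simp
qed

section \<open>A set maximising Phi, and the final contradiction\<close>

lemma Phi_cong: "(\<And>x. x \<in> V \<Longrightarrow> A x = B x) \<Longrightarrow> Phi A = Phi B"
  unfolding Phi_def by (intro I_congV) simp

text \<open>Phi sees A only on the finite set V, so finitely many values compete.\<close>

lemma ex_Phi_max: "\<exists>A. 0 < Phi A \<and> (\<forall>B. Phi B \<le> Phi A)"
proof -
  define S where "S = (\<lambda>X. Phi (\<lambda>x. x \<in> X)) ` Pow V"
  have S: "finite S" "S \<noteq> {}" unfolding S_def using finV by auto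
  have le: "Phi B \<le> Max S" for B
  proof -
    have "Phi B = Phi (\<lambda>x. x \<in> {x \<in> V. B x})" by (rule Phi_cong) simp
    then have "Phi B \<in> S" unfolding S_def by blast
    with S show ?thesis by simp
  qed
  from Max_in[OF S] obtain X where "Max S = Phi (\<lambda>x. x \<in> X)" unfolding S_def by blast
  with le ex_Phi_pos show ?thesis by (metis order_less_le_trans)
qed

lemma I_delta: "v \<in> V \<Longrightarrow> I (\<lambda>x. of_bool (x = v) * f x) = w v * f v"
proof -
  assume v: "v \<in> V"
  have "I (\<lambda>x. of_bool (x = v) * f x) = (\<Sum>x\<in>V. if x = v then w v * f v else 0)"
    unfolding I_def by (rule sum.cong) auto
  with v finV show ?thesis by simp
qed

text \<open>No edge contains v twice, so the change of Phi is exactly linear in the weight of v,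
  without second-order terms; the factor 3 counts the positions of v in an ordered triple.\<close>

lemma Phi_flip:
  assumes v: "v \<in> V"
  shows "Phi (A(v := b)) - Phi A = 3 * (w v *
    I (\<lambda>x. I (\<lambda>y. if E v x y then hh b (A x) (A y) - hh (A v) (A x) (A y) else 0)))"
proof -
  define A' where "A' = A(v := b)"
  define D where "D x y z = (if E x y z then hh (A' x) (A' y) (A' z) else 0)
    - (if E x y z then hh (A x) (A y) (A z) else 0)" for x y z
  have irr: "\<not> E a a b" "\<not> E a b a" "\<not> E a b b" for a b
    using irrefl E_sym by metis+
  have D: "D x y z = of_bool (x = v) * D v y z + of_bool (y = v) * D x v z + of_bool (z = v) * D x y v" for x y z
    by (cases "x = v"; cases "y = v"; cases "z = v") (simp_all add: D_def A'_def irr)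
  have D2: "D x v z = D v x z" "D x y v = D v x y" for x y z
  proof -
    have hh3: "hh a b c = hh c a b" for a b c by (simp only: hh_sym)
    have e: "E x v z = E v x z" "E x y v = E v x y" by (metis E_sym)+
    show "D x v z = D v x z" unfolding D_def e by (simp only: hh_sym)
    show "D x y v = D v x y" unfolding D_def e hh3[of _ _ "A v"] hh3[of _ _ "A' v"] ..
  qed
  have D3: "D v y z = (if E v y z then hh b (A y) (A z) - hh (A v) (A y) (A z) else 0)" for y z
    using irr by (auto simp: D_def A'_def)
  have "Phi A' - Phi A = I (\<lambda>x. I (\<lambda>y. I (\<lambda>z. D x y z)))"
    unfolding Phi_def D_def I_diff ..
  also have "\<dots> = I (\<lambda>x. I (\<lambda>y. I (\<lambda>z. of_bool (x = v) * D v y z + of_bool (y = v) * D x v z + of_bool (z = v) * D x y v)))"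
    by (subst D) (rule refl)
  also have "\<dots> = w v * I (\<lambda>y. I (\<lambda>z. D v y z)) + I (\<lambda>x. w v * I (\<lambda>z. D x v z)) + I (\<lambda>x. I (\<lambda>y. w v * D x y v))"
    by (simp only: I_add I_cmult I_delta[OF v])
  also have "\<dots> = 3 * (w v * I (\<lambda>y. I (\<lambda>z. D v y z)))"
    by (simp add: I_cmult D2)
  finally show ?thesis unfolding A'_def D3 .
qed

text \<open>Positivity of the weights enters here: the change of Phi is divided by the weight of
  v.\<close>

lemma flip_le:
  assumes "v \<in> V" "Phi (A(v := b)) \<le> Phi A"
  shows "I (\<lambda>x. I (\<lambda>y. if E v x y then hh b (A x) (A y) - hh (A v) (A x) (A y) else 0)) \<le> 0"
proof -
  have aux: "x \<le> 0" if "d = 3 * (c * x)" "d \<le> 0" "0 < c" for d c x :: real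
    using that by (simp add: mult_le_0_iff)
  show ?thesis
    by (rule aux[OF Phi_flip[OF assms(1)] _ w_pos[OF assms(1)]]) (simp add: assms(2))
qed

lemma kc_cut:
  assumes v: "v \<in> V" and max: "\<And>B. Phi B \<le> Phi A"
  shows "A v \<Longrightarrow> 0 \<le> I (\<lambda>x. I (\<lambda>y. kcA (A x) (A y) (E v x y)))"
    and "\<not> A v \<Longrightarrow> 0 \<le> I (\<lambda>x. I (\<lambda>y. kcB (A x) (A y) (E v x y)))"
proof -
  have kA: "kcA a b c = - 1 * (if c then hh False a b - hh True a b else 0)" for a b c
    by (cases a; cases b; cases c) (simp_all add: kcA_def hh_def)
  have kB: "kcB a b c = - 1 * (if c then hh True a b - hh False a b else 0)" for a b c
    by (cases a; cases b; cases c) (simp_all add: kcB_def hh_def)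
  show "0 \<le> I (\<lambda>x. I (\<lambda>y. kcA (A x) (A y) (E v x y)))" if "A v"
  proof -
    have t: "A v = True" using that by simp
    show ?thesis using flip_le[OF v max, of False] unfolding kA I_cmult t by simp
  qed
  show "0 \<le> I (\<lambda>x. I (\<lambda>y. kcB (A x) (A y) (E v x y)))" if "\<not> A v"
  proof -
    have f: "A v = False" using that by simp
    show ?thesis using flip_le[OF v max, of True] unfolding kB I_cmult f by simp
  qed
qed

definition k1 :: "bool \<Rightarrow> bool \<Rightarrow> bool \<Rightarrow> bool" where
  "k1 x y z \<longleftrightarrow> (x \<and> \<not> y \<and> \<not> z) \<or> (\<not> x \<and> y \<and> \<not> z) \<or> (\<not> x \<and> \<not> y \<and> z)"

definition k2 :: "bool \<Rightarrow> bool \<Rightarrow> bool \<Rightarrow> bool" where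
  "k2 x y z \<longleftrightarrow> (x \<and> y \<and> \<not> z) \<or> (x \<and> \<not> y \<and> z) \<or> (\<not> x \<and> y \<and> z)"

lemma I3_rotate:
  "I (\<lambda>a. I (\<lambda>b. I (\<lambda>c. f b * of_bool (E a b c)))) = I (\<lambda>a. I (\<lambda>b. I (\<lambda>c. f a * of_bool (E a b c))))"
  "I (\<lambda>a. I (\<lambda>b. I (\<lambda>c. f c * of_bool (E a b c)))) = I (\<lambda>a. I (\<lambda>b. I (\<lambda>c. f a * of_bool (E a b c))))"
proof -
  show 1: "I (\<lambda>a. I (\<lambda>b. I (\<lambda>c. f b * of_bool (E a b c)))) = I (\<lambda>a. I (\<lambda>b. I (\<lambda>c. f a * of_bool (E a b c))))"
  proof -
    have "I (\<lambda>a. I (\<lambda>b. I (\<lambda>c. f b * of_bool (E a b c)))) = I (\<lambda>a. I (\<lambda>b. I (\<lambda>c. f a * of_bool (E b a c))))"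
      by (rule I_swap)
    also have "\<dots> = I (\<lambda>a. I (\<lambda>b. I (\<lambda>c. f a * of_bool (E a b c))))"
      by (rule I_cong, rule I_cong, rule I_cong, rule arg_cong2[where f = "(*)", OF refl], rule arg_cong[where f = of_bool, OF E12])
    finally show ?thesis .
  qed
  have 2: "I (\<lambda>b. I (\<lambda>c. f c * of_bool (E a b c))) = I (\<lambda>b. I (\<lambda>c. f b * of_bool (E a b c)))" for a
  proof -
    have "I (\<lambda>b. I (\<lambda>c. f c * of_bool (E a b c))) = I (\<lambda>b. I (\<lambda>c. f b * of_bool (E a c b)))"
      by (rule I_swap)
    also have "\<dots> = I (\<lambda>b. I (\<lambda>c. f b * of_bool (E a b c)))"
      by (rule I_cong, rule I_cong, rule arg_cong2[where f = "(*)", OF refl], rule arg_cong[where f = of_bool, OF E23])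
    finally show ?thesis .
  qed
  show "I (\<lambda>a. I (\<lambda>b. I (\<lambda>c. f c * of_bool (E a b c)))) = I (\<lambda>a. I (\<lambda>b. I (\<lambda>c. f a * of_bool (E a b c))))"
    unfolding 2 by (rule 1)
qed

lemma contradiction: False
proof -
  from ex_Phi_max obtain A where pos: "0 < Phi A" and max: "\<And>B. Phi B \<le> Phi A" by blast
  define a where "a = I (\<lambda>x. of_bool (A x))"
  define e0 where "e0 = I (\<lambda>x. I (\<lambda>y. I (\<lambda>z. of_bool (\<not> A x \<and> \<not> A y \<and> \<not> A z \<and> E x y z))))"
  define e1 where "e1 = I (\<lambda>x. I (\<lambda>y. I (\<lambda>z. of_bool (E x y z \<and> k1 (A x) (A y) (A z)))))"
  define e2 where "e2 = I (\<lambda>x. I (\<lambda>y. I (\<lambda>z. of_bool (E x y z \<and> k2 (A x) (A y) (A z)))))"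
  define e3 where "e3 = I (\<lambda>x. I (\<lambda>y. I (\<lambda>z. of_bool (E x y z \<and> A x \<and> A y \<and> A z))))"
  have nn: "0 \<le> e1" "0 \<le> e2" "0 \<le> e3"
    unfolding e1_def e2_def e3_def by (intro I_nonneg; simp)+
  \<comment> \<open>Since Phi of the empty set is 0, A meets V. Hence its weight is positive and its
    complement is a proper part of V, to which \<open>sub\<close> applies.\<close>
  have "\<exists>v\<in>V. A v"
  proof (rule ccontr)
    assume "\<not> (\<exists>v\<in>V. A v)"
    then have "Phi A = Phi (\<lambda>_. False)" by (intro Phi_cong) simp
    also have "\<dots> = 0"
    proof -
      have "hh False False False = 0" by (simp add: hh_def)
      then show ?thesis by (simp only: Phi_def if_cancel I_const)
    qed
    finally show False using pos by simp
  qed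
  then obtain v0 where v0: "v0 \<in> V" "A v0" by blast
  have a_pos: "0 < a"
  proof -
    have "w v0 * of_bool (A v0) \<le> (\<Sum>v\<in>V. w v * of_bool (A v))"
      using v0 finV w_nonneg by (intro member_le_sum) auto
    with v0 w_pos[of v0] show ?thesis unfolding a_def I_def by simp
  qed
  have a_le: "a \<le> 1" unfolding a_def by (rule I_le_1) simp
  have Phi: "Phi A = e2 - 19 * e1 - 38 * e3"
  proof -
    have "(if E x y z then hh (A x) (A y) (A z) else 0) = of_bool (E x y z \<and> k2 (A x) (A y) (A z))
      - 19 * of_bool (E x y z \<and> k1 (A x) (A y) (A z)) - 38 * of_bool (E x y z \<and> A x \<and> A y \<and> A z)" for x y z
      by (cases "A x"; cases "A y"; cases "A z"; cases "E x y z") (simp_all add: hh_def k1_def k2_def)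
    then show ?thesis unfolding Phi_def e1_def e2_def e3_def by (simp only: I_diff I_cmult)
  qed
  have total: "e0 + e1 + e2 + e3 = mu"
  proof -
    have "of_bool (E x y z) = (of_bool (\<not> A x \<and> \<not> A y \<and> \<not> A z \<and> E x y z) + of_bool (E x y z \<and> k1 (A x) (A y) (A z))
      + of_bool (E x y z \<and> k2 (A x) (A y) (A z)) + of_bool (E x y z \<and> A x \<and> A y \<and> A z) :: real)" for x y z
      by (cases "A x"; cases "A y"; cases "A z"; cases "E x y z") (simp_all add: k1_def k2_def)
    then show ?thesis using I3_E unfolding e0_def e1_def e2_def e3_def by (simp only: I_add)
  qed
  \<comment> \<open>Counting edges with multiplicity by their vertices in A amounts to adding the
    degrees, all equal to mu, over A; the factor 3 comes from the three positions.\<close>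
  have degs: "e1 + 2 * e2 + 3 * e3 = 3 * (a * mu)"
  proof -
    let ?l = "\<lambda>x y z. of_bool (E x y z \<and> k1 (A x) (A y) (A z)) + 2 * of_bool (E x y z \<and> k2 (A x) (A y) (A z))
        + 3 * of_bool (E x y z \<and> A x \<and> A y \<and> A z) :: real"
    let ?r = "\<lambda>x y z. of_bool (A x) * of_bool (E x y z) + of_bool (A y) * of_bool (E x y z)
        + of_bool (A z) * of_bool (E x y z) :: real"
    have pw: "?l x y z = ?r x y z" for x y z
      by (cases "A x"; cases "A y"; cases "A z"; cases "E x y z") (simp_all add: k1_def k2_def)
    have eq: "I (\<lambda>x. I (\<lambda>y. I (\<lambda>z. ?l x y z))) = I (\<lambda>x. I (\<lambda>y. I (\<lambda>z. ?r x y z)))"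
      by (rule I_cong, rule I_cong, rule I_cong, rule pw)
    have "e1 + 2 * e2 + 3 * e3 = I (\<lambda>x. I (\<lambda>y. I (\<lambda>z. ?l x y z)))"
      unfolding e1_def e2_def e3_def by (simp only: I_add I_cmult)
    also note eq
    also have "I (\<lambda>x. I (\<lambda>y. I (\<lambda>z. ?r x y z))) = 3 * I (\<lambda>x. I (\<lambda>y. I (\<lambda>z. of_bool (A x) * of_bool (E x y z))))"
      by (simp only: I_add I3_rotate[of "\<lambda>x. of_bool (A x)"])
    also have "I (\<lambda>x. I (\<lambda>y. I (\<lambda>z. of_bool (A x) * of_bool (E x y z)))) = I (\<lambda>x. of_bool (A x) * mu)"
      unfolding I_cmult by (rule I_congV) (simp add: deg)
    finally show ?thesis unfolding a_def I_multc .
  qed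
  have e0_le: "e0 \<le> lam * (1 - a) ^ 3"
  proof -
    have "of_bool (\<not> A x) = (1 - of_bool (A x) :: real)" for x by simp
    then have "I (\<lambda>x. of_bool (\<not> A x)) = 1 - a" unfolding a_def by (simp only: I_diff I_const)
    with sub[of "\<lambda>x. \<not> A x"] v0 show ?thesis unfolding e0_def by auto
  qed
  have lam0: "0 < lam" using lam_ge by simp
  have cube: "lam * (1 - a) ^ 3 \<le> mu * (1 - a) ^ 3"
    using lam_less a_le by (intro mult_right_mono) auto
  \<comment> \<open>The argument below gives a^2 - 3 a + 19/13 <= 0, whose smaller root is about
    0.61204; the constant is a rational just below it.\<close>
  have "6119 / 10000 \<le> a"
  proof (rule ccontr)
    assume "\<not> 6119 / 10000 \<le> a"
    then have lt: "a < 6119 / 10000" by simp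
    define s where "s = e1 + e2 + e3"
    have s: "mu * (1 - (1 - a) ^ 3) \<le> s"
      using total e0_le cube unfolding s_def by (simp add: algebra_simps)
    \<comment> \<open>Phi > 0 reads 19 e1 + 38 e3 < e2. Hence edges meeting A have at least 39/20
      vertices in A on average, while their total number of vertices in A is fixed by
      \<open>degs\<close>.\<close>
    have "20 * e1 \<le> s" using pos Phi nn unfolding s_def by linarith
    then have "39 * s \<le> 20 * (e1 + 2 * e2 + 3 * e3)" using nn unfolding s_def by (simp add: algebra_simps)
    then have "39 * s \<le> 60 * (a * mu)" unfolding degs by simp
    with s have "39 * (mu * (1 - (1 - a) ^ 3)) \<le> 60 * (a * mu)" by linarith
    moreover have "mu * (1 - (1 - a) ^ 3) = a * mu * (3 - 3 * a + a * a)"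
      by (simp add: algebra_simps power3_eq_cube)
    ultimately have "a * mu * (39 * (3 - 3 * a + a * a)) \<le> a * mu * 60"
      by (simp add: algebra_simps)
    moreover have "0 < a * mu" using a_pos lam0 lam_less by simp
    ultimately have le: "39 * (3 - 3 * a + a * a) \<le> 60" using mult_le_cancel_left_pos by blast
    \<comment> \<open>The second root 23881/10000 is 3 minus the first, so the product has the same
      linear term as the quadratic in question.\<close>
    have "0 < (6119 / 10000 - a) * (23881 / 10000 - a)"
      using lt by (intro mult_pos_pos) auto
    also have "\<dots> = a * a - 3 * a + 146127839 / 100000000" by (simp add: field_simps)
    finally have "0 < a * a - 3 * a + 146127839 / 100000000" .
    moreover have "57 + 39 * (a * a) \<le> 117 * a" using le by (simp add: algebra_simps)
    ultimately show False by linarith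
  qed
  moreover have "cl c = 10000 * of_bool c - 6119" for c by (simp add: cl_def)
  ultimately have cl: "0 \<le> I (\<lambda>x. cl (A x))"
    unfolding a_def by (simp only: I_diff I_cmult I_const)
  have vo: "0 \<le> I (\<lambda>x. I (\<lambda>y. voP (A v) (A x) (A y) (E v x y)))" if v: "v \<in> V" for v
  proof (cases "A v")
    case True
    have "voP True x y e = obA x y e" for x y e
      by (cases x; cases y; cases e) (simp_all add: voP_def obA_def)
    with True obA_bound[OF v kc_cut(1)[OF v max] less_imp_le[OF pos] cl] show ?thesis by simp
  next
    case False
    have "voP False x y e = obB x y e" for x y e
      by (cases x; cases y; cases e) (simp_all add: voP_def obB_def)
    with False obB_bound[OF v kc_cut(2)[OF v max] less_imp_le[OF pos] cl] show ?thesis by simp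
  qed
  \<comment> \<open>The indicator of exactly two vertices in A is expanded into products of single
    indicators, whose averages are powers of a.\<close>
  have "obP x y z e = of_bool x * of_bool y - of_bool x * of_bool y * of_bool z
      + (of_bool x * of_bool z - of_bool x * of_bool y * of_bool z)
      + (of_bool y * of_bool z - of_bool x * of_bool y * of_bool z)
      - of_bool (e \<and> k1 x y z) - of_bool (e \<and> k2 x y z) - of_bool (e \<and> x \<and> y \<and> z)" for x y z e
    by (cases x; cases y; cases z; cases e) (simp_all add: obP_def k1_def k2_def)
  with obP_bound[OF cl vo] have bound: "e1 + e2 + e3 \<le> 3 * (a * a - a * a * a)"
    unfolding e1_def e2_def e3_def a_def by (simp only: I_add I_diff I_cmult I_multc I_const) simp
  \<comment> \<open>r is the weight of B in the nested construction. As a function of b = 1 - a the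
    bound lam b^3 + 3 a^2 b touches \<open>lam\<close> at b = r, hence the square in the identity
    below.\<close>
  define r where "r = (sqrt 3 - 1) / 2"
  have r: "2 * r * r + 2 * r = 1" and lam: "lam = 4 * r - 1"
    unfolding r_def lam_def by (simp_all add: field_simps)
  have r0: "0 \<le> r" unfolding r_def by simp
  from bound total e0_le have "mu \<le> lam * (1 - a) ^ 3 + 3 * (a * a - a * a * a)" by linarith
  also have "\<dots> = lam - a * ((4 * r + 2) * ((1 - a) - r)\<^sup>2)"
    using r lam by algebra
  also have "\<dots> \<le> lam" using a_pos r0 by simp
  finally show False using lam_less by simp
qed

end

section \<open>Optimal weights on a minimal vertex set\<close>

definition T3 :: "'a set \<Rightarrow> ('a \<Rightarrow> 'a \<Rightarrow> 'a \<Rightarrow> bool) \<Rightarrow> ('a \<Rightarrow> real) \<Rightarrow> ('a \<Rightarrow> real) \<Rightarrow> ('a \<Rightarrow> real) \<Rightarrow> real" where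
  "T3 V E f g h = (\<Sum>a\<in>V. \<Sum>b\<in>V. \<Sum>c\<in>V. f a * g b * h c * of_bool (E a b c))"

abbreviation dens :: "'a set \<Rightarrow> ('a \<Rightarrow> 'a \<Rightarrow> 'a \<Rightarrow> bool) \<Rightarrow> ('a \<Rightarrow> real) \<Rightarrow> real" where
  "dens V E w \<equiv> T3 V E w w w"

text \<open>Trilinearity in the form that expands the density along a line u + t D.\<close>

lemma T3_add1: "T3 V E (\<lambda>v. f v + t * f' v) g h = T3 V E f g h + t * T3 V E f' g h"
  unfolding T3_def sum_distrib_left sum.distrib[symmetric] by (simp add: algebra_simps)

lemma T3_add2: "T3 V E f (\<lambda>v. g v + t * g' v) h = T3 V E f g h + t * T3 V E f g' h"
  unfolding T3_def sum_distrib_left sum.distrib[symmetric] by (simp add: algebra_simps)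

lemma T3_add3: "T3 V E f g (\<lambda>v. h v + t * h' v) = T3 V E f g h + t * T3 V E f g h'"
  unfolding T3_def sum_distrib_left sum.distrib[symmetric] by (simp add: algebra_simps)

lemma T3_cong: "(\<And>v. v \<in> V \<Longrightarrow> f v = f' v) \<Longrightarrow> dens V E f = dens V E f'"
  unfolding T3_def by simp

lemma T3_scale: "dens V E (\<lambda>v. k * w v) = k ^ 3 * dens V E w"
  unfolding T3_def sum_distrib_left by (simp add: power3_eq_cube mult_ac)

lemma (in weighted) dens_I: "dens V E w = I (\<lambda>a. I (\<lambda>b. I (\<lambda>c. of_bool (E a b c))))"
  unfolding T3_def I_def sum_distrib_left by (simp add: mult_ac)

lemma sum_delta_mult:
  assumes "finite V" "x \<in> V"
  shows "(\<Sum>a\<in>V. of_bool (a = x) * F a) = (F x :: real)"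
proof -
  have "(\<Sum>a\<in>V. of_bool (a = x) * F a) = (\<Sum>a\<in>V. if a = x then F x else 0)"
    by (rule sum.cong) auto
  with assms show ?thesis by simp
qed

lemma continuous_coordinate: "continuous_on UNIV (\<lambda>w :: 'a \<Rightarrow> real. w v)"
  by (rule continuous_on_product_coordinates)

text \<open>Weights are functions on the whole type and are therefore pinned to 0 off V. The simplex
  then is a closed part of a product of compact sets, so Tychonoff's theorem applies even if the
  type is infinite.\<close>

lemma compact_simplex:
  fixes V :: "'a set"
  assumes "finite V"
  shows "compact {w :: 'a \<Rightarrow> real. (\<forall>v\<in>V. 0 \<le> w v \<and> w v \<le> 1) \<and> (\<forall>v. v \<notin> V \<longrightarrow> w v = 0) \<and> sum w V = 1}"
proof -
  let ?S = "PiE UNIV (\<lambda>v. if v \<in> V then {0..1} else {0 :: real})"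
  have "compactin (product_topology (\<lambda>_. euclidean) UNIV) ?S"
    unfolding compactin_PiE by simp
  then have "compact ?S" unfolding euclidean_product_topology by simp
  moreover have "closed {w :: 'a \<Rightarrow> real. sum w V = 1}"
    by (rule closed_Collect_eq, rule continuous_on_sum, rule continuous_coordinate, rule continuous_on_const)
  ultimately have "compact (?S \<inter> {w. sum w V = 1})" by (rule compact_Int_closed)
  moreover have "w \<in> ?S \<longleftrightarrow> (\<forall>v\<in>V. 0 \<le> w v \<and> w v \<le> 1) \<and> (\<forall>v. v \<notin> V \<longrightarrow> w v = 0)" (is "_ \<longleftrightarrow> ?R") for w
  proof
    assume "w \<in> ?S"
    then have "w v \<in> (if v \<in> V then {0..1} else {0})" for v by (rule PiE_mem) simp
    then show ?R by (metis atLeastAtMost_iff singletonD)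
  next
    assume ?R
    then show "w \<in> ?S" by (intro PiE_I) auto
  qed
  then have "?S \<inter> {w. sum w V = 1} = {w. (\<forall>v\<in>V. 0 \<le> w v \<and> w v \<le> 1) \<and> (\<forall>v. v \<notin> V \<longrightarrow> w v = 0) \<and> sum w V = 1}"
    by blast
  ultimately show ?thesis by simp
qed

lemma ex_max_weight:
  fixes V :: "'a set" and w0 :: "'a \<Rightarrow> real"
  assumes V: "finite V" and w0: "\<And>v. v \<in> V \<Longrightarrow> 0 \<le> w0 v" "sum w0 V = 1"
  obtains u where "\<And>v. v \<in> V \<Longrightarrow> 0 \<le> u v" "sum u V = 1"
    "\<And>w. (\<And>v. v \<in> V \<Longrightarrow> 0 \<le> w v) \<Longrightarrow> sum w V = 1 \<Longrightarrow> dens V E w \<le> dens V E u"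
proof -
  let ?D = "{w :: 'a \<Rightarrow> real. (\<forall>v\<in>V. 0 \<le> w v \<and> w v \<le> 1) \<and> (\<forall>v. v \<notin> V \<longrightarrow> w v = 0) \<and> sum w V = 1}"
  \<comment> \<open>Setting a weight to 0 off V changes neither its sum nor its density and places
    it in the compact set.\<close>
  have inD: "(\<lambda>v. if v \<in> V then w v else 0) \<in> ?D" if w: "\<And>v. v \<in> V \<Longrightarrow> 0 \<le> w v" "sum w V = 1" for w
  proof -
    have le: "w v \<le> 1" if "v \<in> V" for v
      using member_le_sum[OF that _ V, of w] w(1) unfolding w(2) by blast
    have "sum (\<lambda>v. if v \<in> V then w v else 0) V = sum w V" by (rule sum.cong) auto
    then show ?thesis using le w(1) unfolding w(2) by auto
  qed
  have "continuous_on UNIV (\<lambda>w. dens V E w)"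
    unfolding T3_def by (intro continuous_on_sum continuous_on_mult continuous_on_const continuous_coordinate)
  then have cont: "continuous_on ?D (\<lambda>w. dens V E w)" by (rule continuous_on_subset) simp
  have ne: "?D \<noteq> {}" using inD[OF w0] by (metis empty_iff)
  from continuous_attains_sup[OF compact_simplex[OF V] ne cont]
  obtain u where u: "u \<in> ?D" and max: "\<forall>w\<in>?D. dens V E w \<le> dens V E u" by (elim bexE)
  show ?thesis
  proof (rule that[of u])
    fix w :: "'a \<Rightarrow> real" assume w: "\<And>v. v \<in> V \<Longrightarrow> 0 \<le> w v" "sum w V = 1"
    have "dens V E w = dens V E (\<lambda>v. if v \<in> V then w v else 0)" by (rule T3_cong) simp
    with bspec[OF max inD[OF w]] show "dens V E w \<le> dens V E u" by simp
  qed (use u in auto)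
qed

text \<open>For small t the linear term beats the other two. The cap c will keep the perturbed
  weights nonnegative.\<close>

lemma cubic_pos:
  fixes d q r c :: real
  assumes "0 < d" "0 < c"
  obtains t where "0 < t" "t \<le> c" "0 < t * d + t\<^sup>2 * q + t ^ 3 * r"
proof -
  define K where "K = \<bar>q\<bar> + \<bar>r\<bar> + 1"
  define t where "t = min c (min 1 (d / (2 * K)))"
  have K: "K > 0" unfolding K_def by linarith
  have t: "0 < t" "t \<le> c" "t \<le> 1" "t \<le> d / (2 * K)" using assms K unfolding t_def by auto
  have "t * K \<le> d / 2" using t(4) K by (simp add: field_simps)
  moreover have "- (t * K) \<le> t * q + t\<^sup>2 * r"
  proof -
    have "t\<^sup>2 \<le> t" using t by (simp add: power2_eq_square mult_left_le)
    then have "t\<^sup>2 * \<bar>r\<bar> \<le> t * \<bar>r\<bar>" by (rule mult_right_mono) simp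
    moreover have "- (t\<^sup>2 * \<bar>r\<bar>) \<le> t\<^sup>2 * r"
      using mult_left_mono[of "- \<bar>r\<bar>" r "t\<^sup>2"] by simp
    moreover have "- (t * \<bar>q\<bar>) \<le> t * q"
      using mult_left_mono[of "- \<bar>q\<bar>" q t] t(1) by simp
    ultimately show ?thesis using t(1) unfolding K_def by (simp add: algebra_simps)
  qed
  ultimately have "0 < d + t * q + t\<^sup>2 * r" using assms by linarith
  then have "0 < t * (d + t * q + t\<^sup>2 * r)" using t(1) by (rule mult_pos_pos[rotated])
  moreover have "t * (d + t * q + t\<^sup>2 * r) = t * d + t\<^sup>2 * q + t ^ 3 * r"
    by (simp add: algebra_simps power2_eq_square power3_eq_cube)
  ultimately show ?thesis using t that by simp
qed

text \<open>The inequality is homogeneous, so a counterexample with the fewest vertices can be taken to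
  maximise the density over the simplex of weights; maximality makes all degrees equal, and
  minimality bounds the density of every proper subset.\<close>

theorem dens_le:
  fixes V :: "'a set"
  assumes k5: "k5 E" and irr: "\<And>a b. \<not> E a a b" and V: "finite V" and w: "\<And>v. v \<in> V \<Longrightarrow> 0 \<le> w v"
  shows "dens V E w \<le> lam * (sum w V) ^ 3"
  using V w
proof (induction V arbitrary: w rule: finite_psubset_induct)
  case (psubset V)
  interpret k: k5 E by (rule k5)
  show ?case
  proof (rule ccontr)
    assume neg: "\<not> ?case"
    define s where "s = sum w V"
    have s: "s > 0"
    proof (rule ccontr)
      assume "\<not> s > 0"
      then have "s = 0" using sum_nonneg[of V w] psubset.prems unfolding s_def by force
      then have "\<forall>v\<in>V. w v = 0" unfolding s_def using psubset.hyps psubset.prems by (simp add: sum_nonneg_eq_0_iff)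
      then have "dens V E w = dens V E (\<lambda>_. 0)" by (intro T3_cong) auto
      also have "\<dots> = 0" by (simp add: T3_def)
      finally show False using neg \<open>s = 0\<close> unfolding s_def by simp
    qed
    define w0 where "w0 = (\<lambda>v. 1 / s * w v)"
    have w0: "\<And>v. v \<in> V \<Longrightarrow> 0 \<le> w0 v" "sum w0 V = 1"
      using psubset.prems s unfolding w0_def sum_distrib_left[symmetric] s_def[symmetric] by simp_all
    obtain u where u: "\<And>v. v \<in> V \<Longrightarrow> 0 \<le> u v" "sum u V = 1"
      and max: "\<And>w. (\<And>v. v \<in> V \<Longrightarrow> 0 \<le> w v) \<Longrightarrow> sum w V = 1 \<Longrightarrow> dens V E w \<le> dens V E u"
      using ex_max_weight[OF psubset.hyps w0] by metis
    define M where "M = dens V E u"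
    have "dens V E w0 = (1 / s) ^ 3 * dens V E w" unfolding w0_def by (rule T3_scale)
    moreover have "(1 / s) ^ 3 * dens V E w > (1 / s) ^ 3 * (lam * s ^ 3)"
      using neg s unfolding s_def[symmetric] by (intro mult_strict_left_mono) auto
    moreover have "(1 / s) ^ 3 * (lam * s ^ 3) = lam" using s by (simp add: power_divide)
    ultimately have M: "lam < M" using max[OF w0] unfolding M_def by linarith
    \<comment> \<open>A vertex of weight 0 could be deleted without changing density or total
      weight, and the smaller set obeys the induction hypothesis.\<close>
    have pos: "0 < u v" if v: "v \<in> V" for v
    proof (rule ccontr)
      assume "\<not> 0 < u v"
      then have u0: "u v = 0" using u(1)[OF v] by simp
      have ss: "sum F V = sum F (V - {v})" if "F v = 0" for F :: "'a \<Rightarrow> real"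
        using sum.remove[OF psubset.hyps(1) v, of F] that by simp
      have "M = dens (V - {v}) E u"
        unfolding M_def T3_def by (subst ss; simp add: u0 ss)
      also have "\<dots> \<le> lam * (sum u (V - {v})) ^ 3"
        using v u(1) by (intro psubset.IH) auto
      also have "sum u (V - {v}) = 1" using u(2) ss[of u] u0 by simp
      finally show False using M by simp
    qed
    interpret weighted V u using psubset.hyps u by unfold_locales auto
    let ?d = "\<lambda>x. I (\<lambda>b. I (\<lambda>c. of_bool (E x b c)))"
    have T_delta: "T3 V E (\<lambda>v. of_bool (v = x)) u u = ?d x" if "x \<in> V" for x
    proof -
      have "T3 V E (\<lambda>v. of_bool (v = x)) u u = (\<Sum>a\<in>V. of_bool (a = x) * I (\<lambda>b. I (\<lambda>c. of_bool (E a b c))))"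
        unfolding T3_def I_def sum_distrib_left by (simp add: mult_ac)
      also have "\<dots> = ?d x" by (rule sum_delta_mult[OF psubset.hyps(1) that])
      finally show ?thesis .
    qed
    have sym1: "T3 V E f g h = T3 V E g f h" for f g h
    proof -
      have pt: "f a * g b * h c * of_bool (E a b c) = g b * f a * h c * of_bool (E b a c)" for a b c
        using k.E12[of a b c] by simp
      have "T3 V E f g h = (\<Sum>a\<in>V. \<Sum>b\<in>V. \<Sum>c\<in>V. g b * f a * h c * of_bool (E b a c))"
        unfolding T3_def by (intro sum.cong refl pt)
      also have "\<dots> = T3 V E g f h" unfolding T3_def by (rule sum.swap)
      finally show ?thesis .
    qed
    have sym2: "T3 V E f g h = T3 V E f h g" for f g h
    proof -
      have pt: "f a * g b * h c * of_bool (E a b c) = f a * h c * g b * of_bool (E a c b)" for a b c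
        using k.E23[of a b c] by simp
      have "T3 V E f g h = (\<Sum>a\<in>V. \<Sum>b\<in>V. \<Sum>c\<in>V. f a * h c * g b * of_bool (E a c b))"
        unfolding T3_def by (intro sum.cong refl pt)
      also have "\<dots> = T3 V E f h g" unfolding T3_def by (rule sum.cong[OF refl], rule sum.swap)
      finally show ?thesis .
    qed
    \<comment> \<open>Otherwise shifting a little weight from y to x would raise the density,
      because its derivative along D is three times the difference of the two degrees.\<close>
    have le: "?d x \<le> ?d y" if x: "x \<in> V" and y: "y \<in> V" for x y
    proof (rule ccontr)
      assume "\<not> ?d x \<le> ?d y"
      then have d: "0 < 3 * (?d x - ?d y)" by simp
      define D where "D = (\<lambda>v. of_bool (v = x) + (- 1) * of_bool (v = y) :: real)"
      obtain t where t: "0 < t" "t \<le> u y" "0 < t * (3 * (?d x - ?d y)) + t\<^sup>2 * (3 * T3 V E D D u) + t ^ 3 * T3 V E D D D"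
        using cubic_pos[OF d pos[OF y]] by blast
      have DT: "T3 V E D u u = ?d x - ?d y"
        unfolding D_def T3_add1 T_delta[OF x] T_delta[OF y] by simp
      have "dens V E (\<lambda>v. u v + t * D v) = M + t * (3 * (?d x - ?d y)) + t\<^sup>2 * (3 * T3 V E D D u) + t ^ 3 * T3 V E D D D"
      proof -
        have "T3 V E u D u = T3 V E D u u" "T3 V E u u D = T3 V E D u u"
          "T3 V E D u D = T3 V E D D u" "T3 V E u D D = T3 V E D D u"
          using sym1 sym2 by metis+
        then show ?thesis
          unfolding T3_add1 T3_add2 T3_add3 M_def DT[symmetric]
          by (simp add: algebra_simps power2_eq_square power3_eq_cube)
      qed
      with t(3) have "M < dens V E (\<lambda>v. u v + t * D v)" by simp
      moreover have "dens V E (\<lambda>v. u v + t * D v) \<le> M"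
        unfolding M_def
      proof (rule max)
        show "0 \<le> u v + t * D v" if "v \<in> V" for v
          using u(1)[OF that] t(1,2) unfolding D_def by auto
        have "sum (\<lambda>v. u v + t * D v) V = sum u V + t * ((\<Sum>v\<in>V. of_bool (v = x)) - (\<Sum>v\<in>V. of_bool (v = y)))"
          unfolding D_def by (simp add: sum.distrib sum_distrib_left sum_subtractf algebra_simps)
        also have "(\<Sum>v\<in>V. of_bool (v = z)) = (1 :: real)" if "z \<in> V" for z
          using sum_delta_mult[OF psubset.hyps(1) that, of "\<lambda>_. 1"] by simp
        from this[OF x] this[OF y] have "sum u V + t * ((\<Sum>v\<in>V. of_bool (v = x)) - (\<Sum>v\<in>V. of_bool (v = y))) = 1"
          using u(2) by simp
        finally show "sum (\<lambda>v. u v + t * D v) V = 1" .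
      qed
      ultimately show False by simp
    qed
    have deg: "?d v = M" if v: "v \<in> V" for v
    proof -
      have "M = I ?d" unfolding M_def dens_I ..
      also have "\<dots> = I (\<lambda>_. ?d v)"
        by (rule I_congV) (rule antisym; rule le; (assumption | rule v))
      also have "\<dots> = ?d v" by (rule I_const)
      finally show ?thesis by (rule sym)
    qed
    \<comment> \<open>The assumption \<open>sub\<close> is the induction hypothesis for the part of
      V cut out by B, in its homogeneous form with unnormalised weights.\<close>
    interpret extremal V u E M
    proof (unfold_locales)
      fix B :: "'a \<Rightarrow> bool"
      assume "\<exists>v\<in>V. \<not> B v"
      then have ps: "{v \<in> V. B v} \<subset> V" by blast
      have flt: "(\<Sum>v\<in>{v \<in> V. B v}. F v) = (\<Sum>v\<in>V. of_bool (B v) * F v)" for F :: "'a \<Rightarrow> real"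
        unfolding sum.inter_filter[OF psubset.hyps(1)] by (rule sum.cong) auto
      have "I (\<lambda>a. I (\<lambda>b. I (\<lambda>c. of_bool (B a \<and> B b \<and> B c \<and> E a b c)))) = dens {v \<in> V. B v} E u"
        unfolding T3_def flt I_def sum_distrib_left by (simp add: of_bool_conj mult_ac)
      moreover have "I (\<lambda>a. of_bool (B a)) = sum u {v \<in> V. B v}"
        unfolding flt I_def by (simp add: mult_ac)
      moreover have "dens {v \<in> V. B v} E u \<le> lam * (sum u {v \<in> V. B v}) ^ 3"
        using u(1) by (intro psubset.IH ps) auto
      ultimately show "I (\<lambda>a. I (\<lambda>b. I (\<lambda>c. of_bool (B a \<and> B b \<and> B c \<and> E a b c)))) \<le> lam * (I (\<lambda>a. of_bool (B a))) ^ 3"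
        by simp
    qed (use pos irr deg M in auto)
    show False by (rule contradiction)
  qed
qed

section \<open>Random samples from a large 3-graph\<close>

definition iv :: "'a set \<Rightarrow> ('a \<Rightarrow> real) \<Rightarrow> real" where
  "iv V f = (\<Sum>x\<in>V. f x) / real (card V)"

definition av :: "nat \<Rightarrow> 'a set \<Rightarrow> ((nat \<Rightarrow> 'a) \<Rightarrow> real) \<Rightarrow> real" where
  "av m V F = (\<Sum>s\<in>{..<m} \<rightarrow>\<^sub>E V. F s) / real (card V) ^ m"

locale sample =
  fixes V :: "'a set"
  assumes finV: "finite V" and neV: "V \<noteq> {}"
begin

lemma card_pos: "0 < real (card V)"
  using finV neV by (simp add: card_gt_0_iff)

lemma finU: "finite ({..<m::nat} \<rightarrow>\<^sub>E V)"
  using finV by (intro finite_PiE) auto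

lemma cardU: "real (card ({..<m::nat} \<rightarrow>\<^sub>E V)) = real (card V) ^ m"
  by (simp add: card_PiE)

lemma av_const: "av m V (\<lambda>_. k) = k"
  using card_pos by (simp add: av_def cardU)

lemma av_sum: "av m V (\<lambda>s. \<Sum>i\<in>J. F i s) = (\<Sum>i\<in>J. av m V (F i))"
  unfolding av_def sum_divide_distrib[symmetric] by (subst sum.swap) simp

lemma av_add: "av m V (\<lambda>s. F s + G s) = av m V F + av m V G"
  unfolding av_def by (simp add: sum.distrib add_divide_distrib)

lemma av_cmult: "av m V (\<lambda>s. k * F s) = k * av m V F"
  unfolding av_def by (simp add: sum_distrib_left)

lemma av_mono: "(\<And>s. s \<in> {..<m} \<rightarrow>\<^sub>E V \<Longrightarrow> F s \<le> G s) \<Longrightarrow> av m V F \<le> av m V G"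
  unfolding av_def using card_pos by (intro divide_right_mono sum_mono) auto

lemma iv_nonneg: "(\<And>x. 0 \<le> f x) \<Longrightarrow> 0 \<le> iv V f"
  unfolding iv_def by (intro divide_nonneg_nonneg sum_nonneg) auto

lemma iv_le_1: "(\<And>x. f x \<le> 1) \<Longrightarrow> iv V f \<le> 1"
  using sum_bounded_above[of V f 1] card_pos unfolding iv_def by (simp add: divide_le_eq)

text \<open>Exchanging coordinate i of s with the extra point x is an involution on the pairs (x,
  s), so it preserves the uniform average.\<close>

lemma resample: "i < m \<Longrightarrow> av m V F = iv V (\<lambda>x. av m V (\<lambda>s. F (s(i := x))))"
proof -
  assume i: "i < m"
  let ?U = "{..<m} \<rightarrow>\<^sub>E V"
  let ?j = "\<lambda>(x, s). (s i, s(i := x))"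
  have "(\<Sum>p\<in>V \<times> ?U. case p of (x, s) \<Rightarrow> F (s(i := x))) = (\<Sum>p\<in>V \<times> ?U. case p of (x, s) \<Rightarrow> F s)"
  proof (rule sum.reindex_bij_witness[of _ ?j ?j])
    fix p assume "p \<in> V \<times> ?U"
    then obtain x s where p: "p = (x, s)" "x \<in> V" "s \<in> ?U" by (rule SigmaE)
    have "s i \<in> V" using PiE_mem[OF p(3), of i] i by simp
    moreover have "insert i {..<m} = {..<m}" using i by auto
    then have "s(i := x) \<in> ?U" using PiE_fun_upd[of x "\<lambda>_. V" i s "{..<m}"] p(2,3) by simp
    ultimately show "?j p \<in> V \<times> ?U" unfolding p(1) by simp
    then show "?j p \<in> V \<times> ?U" .
    show "?j (?j p) = p" unfolding p(1) by simp
    then show "?j (?j p) = p" .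
    show "(case ?j p of (x, s) \<Rightarrow> F s) = (case p of (x, s) \<Rightarrow> F (s(i := x)))" unfolding p(1) by simp
  qed
  then have eq: "(\<Sum>x\<in>V. \<Sum>s\<in>?U. F (s(i := x))) = real (card V) * (\<Sum>s\<in>?U. F s)"
    by (simp add: sum.cartesian_product[symmetric])
  show ?thesis
    unfolding iv_def av_def sum_divide_distrib[symmetric] eq using card_pos by simp
qed

text \<open>Distinct coordinates of a random map are independent and uniform: each is resampled in
  turn, after which the integrand no longer depends on s.\<close>

lemma av2: "i < m \<Longrightarrow> j < m \<Longrightarrow> i \<noteq> j \<Longrightarrow>
  av m V (\<lambda>s. g (s i) (s j)) = iv V (\<lambda>x. iv V (\<lambda>y. g x y))"
  by (subst resample[of i], assumption, subst resample[of j], assumption) (simp add: av_const)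

lemma av3: "i < m \<Longrightarrow> j < m \<Longrightarrow> k < m \<Longrightarrow> distinct [i, j, k] \<Longrightarrow>
  av m V (\<lambda>s. g (s i) (s j) (s k)) = iv V (\<lambda>x. iv V (\<lambda>y. iv V (\<lambda>z. g x y z)))"
  by (subst resample[of i], assumption, subst resample[of j], assumption, subst resample[of k], assumption)
    (simp add: av_const)

lemma av4: "i < m \<Longrightarrow> j < m \<Longrightarrow> k < m \<Longrightarrow> l < m \<Longrightarrow> distinct [i, j, k, l] \<Longrightarrow>
  av m V (\<lambda>s. g (s i) (s j) (s k) (s l)) = iv V (\<lambda>x. iv V (\<lambda>y. iv V (\<lambda>z. iv V (\<lambda>t. g x y z t))))"
  by (subst resample[of i], assumption, subst resample[of j], assumption, subst resample[of k], assumption,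
      subst resample[of l], assumption) (simp add: av_const)

lemma av5: "i < m \<Longrightarrow> j < m \<Longrightarrow> k < m \<Longrightarrow> l < m \<Longrightarrow> n < m \<Longrightarrow> distinct [i, j, k, l, n] \<Longrightarrow>
  av m V (\<lambda>s. g (s i) (s j) (s k) (s l) (s n)) =
    iv V (\<lambda>x. iv V (\<lambda>y. iv V (\<lambda>z. iv V (\<lambda>t. iv V (\<lambda>u. g x y z t u)))))"
  by (subst resample[of i], assumption, subst resample[of j], assumption, subst resample[of k], assumption,
      subst resample[of l], assumption, subst resample[of n], assumption) (auto simp: av_const)

end

definition K4 :: "('a \<Rightarrow> 'a \<Rightarrow> 'a \<Rightarrow> bool) \<Rightarrow> 'a \<Rightarrow> 'a \<Rightarrow> 'a \<Rightarrow> 'a \<Rightarrow> bool" where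
  "K4 E a b c d \<longleftrightarrow> E a b c \<and> E a b d \<and> E a c d \<and> E b c d"

text \<open>One chord position is enough, since a rotation of the cycle carries any chord to
  abd.\<close>

definition C5p :: "('a \<Rightarrow> 'a \<Rightarrow> 'a \<Rightarrow> bool) \<Rightarrow> 'a \<Rightarrow> 'a \<Rightarrow> 'a \<Rightarrow> 'a \<Rightarrow> 'a \<Rightarrow> bool" where
  "C5p E a b c d e \<longleftrightarrow> E a b c \<and> E b c d \<and> E c d e \<and> E d e a \<and> E e a b \<and> E a b d"

locale threegraph =
  fixes E :: "'a \<Rightarrow> 'a \<Rightarrow> 'a \<Rightarrow> bool"
  assumes sym12: "E a b c \<Longrightarrow> E b a c" and sym23: "E a b c \<Longrightarrow> E a c b" and irrefl: "\<not> E a a b"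
begin

lemma irr: "\<not> E a a b" "\<not> E a b a" "\<not> E a b b"
  using irrefl sym12 sym23 by blast+

lemma K4_distinct: "K4 E a b c d \<Longrightarrow> distinct [a, b, c, d]"
  unfolding K4_def using irr by auto

lemma C5p_distinct: "C5p E a b c d e \<Longrightarrow> distinct [a, b, c, d, e]"
  unfolding C5p_def using irr by auto

text \<open>\<open>dens_le\<close> with all weights 1. E is first cut down to V, because
  \<open>k5\<close> demands its exclusions on the whole type while they are known only inside
  V.\<close>

lemma count_le:
  assumes "finite V" "\<And>a b c d. a \<in> V \<Longrightarrow> b \<in> V \<Longrightarrow> c \<in> V \<Longrightarrow> d \<in> V \<Longrightarrow> \<not> K4 E a b c d"
    "\<And>a b c d e. a \<in> V \<Longrightarrow> b \<in> V \<Longrightarrow> c \<in> V \<Longrightarrow> d \<in> V \<Longrightarrow> e \<in> V \<Longrightarrow> \<not> C5p E a b c d e"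
  shows "(\<Sum>a\<in>V. \<Sum>b\<in>V. \<Sum>c\<in>V. of_bool (E a b c)) \<le> lam * real (card V) ^ 3"
proof -
  define E' where "E' a b c \<longleftrightarrow> a \<in> V \<and> b \<in> V \<and> c \<in> V \<and> E a b c" for a b c
  have "k5 E'"
  proof
    fix a b c d e
    show "E' a b c = E' b a c" "E' a b c = E' a c b" unfolding E'_def using sym12 sym23 by blast+
    show "\<not> (E' a b c \<and> E' a b d \<and> E' a c d \<and> E' b c d)"
      using assms(2)[of a b c d] unfolding E'_def K4_def by blast
    show "\<not> (E' a b c \<and> E' b c d \<and> E' c d e \<and> E' d e a \<and> E' e a b \<and> E' a b d)"
      using assms(3)[of a b c d e] unfolding E'_def C5p_def by blast
  qed
  moreover have "\<not> E' a a b" for a b unfolding E'_def using irr by blast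
  ultimately have "dens V E' (\<lambda>_. 1) \<le> lam * (sum (\<lambda>_. 1) V) ^ 3"
    using assms(1) by (intro dens_le) auto
  moreover have "dens V E' (\<lambda>_. 1) = (\<Sum>a\<in>V. \<Sum>b\<in>V. \<Sum>c\<in>V. of_bool (E a b c))"
    unfolding T3_def by (intro sum.cong refl) (simp add: E'_def)
  ultimately show ?thesis by simp
qed

end

lemma lam_nonneg: "0 \<le> lam"
  using lam_ge by simp

text \<open>A random map from \<open>m\<close> points into \<open>V\<close> pulls \<open>E\<close> back to a relation that obeys
  \<open>count_le\<close> unless it meets one of the two forbidden patterns.\<close>

lemma sampling_bound:
  fixes V :: "'a set"
  assumes "threegraph E" "finite V" "V \<noteq> {}" and m: "m > 0"
  shows "iv V (\<lambda>a. iv V (\<lambda>b. iv V (\<lambda>c. of_bool (E a b c)))) \<le> lam + 3 / real m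
    + real m ^ 4 * iv V (\<lambda>a. iv V (\<lambda>b. iv V (\<lambda>c. iv V (\<lambda>d. of_bool (K4 E a b c d)))))
    + real m ^ 5 * iv V (\<lambda>a. iv V (\<lambda>b. iv V (\<lambda>c. iv V (\<lambda>d. iv V (\<lambda>e. of_bool (C5p E a b c d e))))))"
    (is "?e \<le> lam + _ + real m ^ 4 * ?k4 + real m ^ 5 * ?k5")
proof -
  interpret threegraph E by fact
  interpret sample V using assms by unfold_locales
  let ?M = "{..<m}"
  define N where "N s = (\<Sum>i\<in>?M. \<Sum>j\<in>?M. \<Sum>k\<in>?M. of_bool (E (s i) (s j) (s k)) :: real)" for s
  define N4 where "N4 s = (\<Sum>i\<in>?M. \<Sum>j\<in>?M. \<Sum>k\<in>?M. \<Sum>l\<in>?M. of_bool (K4 E (s i) (s j) (s k) (s l)) :: real)" for s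
  define N5 where "N5 s = (\<Sum>i\<in>?M. \<Sum>j\<in>?M. \<Sum>k\<in>?M. \<Sum>l\<in>?M. \<Sum>n\<in>?M. of_bool (C5p E (s i) (s j) (s k) (s l) (s n)) :: real)" for s
  have NN: "0 \<le> N4 s" "0 \<le> N5 s" for s unfolding N4_def N5_def by (intro sum_nonneg; simp)+
  have pw: "N s \<le> lam * real m ^ 3 + real m ^ 3 * (N4 s + N5 s)" for s
  proof (cases "N4 s = 0 \<and> N5 s = 0")
    case True
    interpret p: threegraph "\<lambda>i j k. E (s i) (s j) (s k)"
      by unfold_locales (use sym12 sym23 irr in blast)+
    have K: "\<not> K4 E (s i) (s j) (s k) (s l)" if "i \<in> ?M" "j \<in> ?M" "k \<in> ?M" "l \<in> ?M" for i j k l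
      using True that unfolding N4_def by (simp add: sum_nonneg_eq_0_iff sum_nonneg) blast
    have C: "\<not> C5p E (s i) (s j) (s k) (s l) (s n)" if "i \<in> ?M" "j \<in> ?M" "k \<in> ?M" "l \<in> ?M" "n \<in> ?M" for i j k l n
      using True that unfolding N5_def by (simp add: sum_nonneg_eq_0_iff sum_nonneg) blast
    have "N s \<le> lam * real (card ?M) ^ 3"
      unfolding N_def
    proof (rule p.count_le)
      show "finite ?M" by simp
      show "\<not> K4 (\<lambda>i j k. E (s i) (s j) (s k)) a b c d" if "a \<in> ?M" "b \<in> ?M" "c \<in> ?M" "d \<in> ?M" for a b c d
        using K[OF that] unfolding K4_def .
      show "\<not> C5p (\<lambda>i j k. E (s i) (s j) (s k)) a b c d e"
        if "a \<in> ?M" "b \<in> ?M" "c \<in> ?M" "d \<in> ?M" "e \<in> ?M" for a b c d e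
        using C[OF that] unfolding C5p_def .
    qed
    with True show ?thesis by simp
  next
    case False
    \<comment> \<open>Being counts, N4 and N5 add up to at least 1 as soon as one of them is
      nonzero; then the trivial bound m^3 for N suffices.\<close>
    have "N4 s = real (\<Sum>i\<in>?M. \<Sum>j\<in>?M. \<Sum>k\<in>?M. \<Sum>l\<in>?M. of_bool (K4 E (s i) (s j) (s k) (s l)))"
      unfolding N4_def by simp
    moreover have "N5 s = real (\<Sum>i\<in>?M. \<Sum>j\<in>?M. \<Sum>k\<in>?M. \<Sum>l\<in>?M. \<Sum>n\<in>?M. of_bool (C5p E (s i) (s j) (s k) (s l) (s n)))"
      unfolding N5_def by simp
    ultimately obtain a b where "N4 s = real a" "N5 s = real b" by blast
    with False have "1 \<le> N4 s + N5 s" by (cases a; cases b) auto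
    then have "real m ^ 3 * 1 \<le> real m ^ 3 * (N4 s + N5 s)" by (intro mult_left_mono) auto
    moreover have "N s \<le> (\<Sum>i\<in>?M. \<Sum>j\<in>?M. \<Sum>k\<in>?M. 1)"
      unfolding N_def by (intro sum_mono) simp
    moreover have "(\<Sum>i\<in>?M. \<Sum>j\<in>?M. \<Sum>k\<in>?M. 1) = real m ^ 3" by (simp add: power3_eq_cube)
    moreover have "0 \<le> lam * real m ^ 3" using lam_nonneg by simp
    ultimately show ?thesis by linarith
  qed
  have e1: "?e \<le> 1" by (intro iv_le_1) simp
  have k0: "0 \<le> ?k4" "0 \<le> ?k5" by (intro iv_nonneg; simp)+
  \<comment> \<open>At most 3 m^2 index triples have a repetition, and each of them costs at most ?e
    <= 1. After division by m^3 this is the term 3 / m.\<close>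
  have "real m ^ 3 * ?e - 3 * real m ^ 2 \<le> av m V N"
  proof -
    have "?e - of_bool (i = j) - of_bool (i = k) - of_bool (j = k) \<le> av m V (\<lambda>s. of_bool (E (s i) (s j) (s k)))"
      if "i \<in> ?M" "j \<in> ?M" "k \<in> ?M" for i j k
    proof (cases "distinct [i, j, k]")
      case True
      with that av3[of i m j k "\<lambda>a b c. of_bool (E a b c)"] show ?thesis by simp
    next
      case False
      have "0 \<le> av m V (\<lambda>s. of_bool (E (s i) (s j) (s k)))"
        using av_mono[of m "\<lambda>_. 0"] by (simp add: av_const)
      with False e1 show ?thesis by (auto simp: of_bool_def)
    qed
    then have "(\<Sum>i\<in>?M. \<Sum>j\<in>?M. \<Sum>k\<in>?M. ?e - of_bool (i = j) - of_bool (i = k) - of_bool (j = k)) \<le> av m V N"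
      unfolding N_def av_sum by (intro sum_mono) auto
    moreover have "(\<Sum>i\<in>?M. \<Sum>j\<in>?M. \<Sum>k\<in>?M. ?e - of_bool (i = j) - of_bool (i = k) - of_bool (j = k))
      = real m ^ 3 * ?e - 3 * real m ^ 2"
    proof -
      have d: "(\<Sum>j\<in>?M. of_bool (i = j)) = (1 :: real)" if "i \<in> ?M" for i
        using that sum_delta_mult[of ?M i "\<lambda>_. 1"] by (simp add: eq_commute)
      have "(\<Sum>i\<in>?M. \<Sum>j\<in>?M. \<Sum>k\<in>?M. ?e - of_bool (i = j) - of_bool (i = k) - of_bool (j = k))
        = (\<Sum>i\<in>?M. \<Sum>j\<in>?M. real m * ?e - real m * of_bool (i = j) - 1 - 1)"
        by (intro sum.cong refl) (simp add: sum_subtractf d right_diff_distrib)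
      also have "\<dots> = (\<Sum>i\<in>?M. real m * (real m * ?e) - real m - real m - real m)"
        by (intro sum.cong refl) (simp add: sum_subtractf sum_distrib_left[symmetric] d)
      also have "\<dots> = real m ^ 3 * ?e - 3 * real m ^ 2"
        by (simp add: algebra_simps power2_eq_square power3_eq_cube)
      finally show ?thesis .
    qed
    ultimately show ?thesis by simp
  qed
  also have "av m V N \<le> av m V (\<lambda>s. lam * real m ^ 3 + real m ^ 3 * (N4 s + N5 s))"
    by (rule av_mono) (rule pw)
  also have "\<dots> = lam * real m ^ 3 + real m ^ 3 * (av m V N4 + av m V N5)"
    by (simp only: av_add av_cmult av_const)
  \<comment> \<open>A union bound over the m^4 index tuples; tuples with a repeated index contribute
    nothing, since \<open>K4\<close> forces distinct vertices.\<close>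
  also have "av m V N4 \<le> real m ^ 4 * ?k4"
  proof -
    have "av m V (\<lambda>s. of_bool (K4 E (s i) (s j) (s k) (s l))) \<le> ?k4"
      if "i \<in> ?M" "j \<in> ?M" "k \<in> ?M" "l \<in> ?M" for i j k l
    proof (cases "distinct [i, j, k, l]")
      case True
      with that av4[of i m j k l "\<lambda>a b c d. of_bool (K4 E a b c d)"] show ?thesis by simp
    next
      case False
      then have "\<not> K4 E (s i) (s j) (s k) (s l)" for s :: "nat \<Rightarrow> 'a" using K4_distinct by fastforce
      with k0 show ?thesis by (simp add: av_const)
    qed
    then have "av m V N4 \<le> (\<Sum>i\<in>?M. \<Sum>j\<in>?M. \<Sum>k\<in>?M. \<Sum>l\<in>?M. ?k4)"
      unfolding N4_def av_sum by (intro sum_mono) auto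
    then show ?thesis by (simp add: power4_eq_xxxx mult_ac)
  qed
  also have "av m V N5 \<le> real m ^ 5 * ?k5"
  proof -
    have "av m V (\<lambda>s. of_bool (C5p E (s i) (s j) (s k) (s l) (s n))) \<le> ?k5"
      if "i \<in> ?M" "j \<in> ?M" "k \<in> ?M" "l \<in> ?M" "n \<in> ?M" for i j k l n
    proof (cases "distinct [i, j, k, l, n]")
      case True
      with that av5[of i m j k l n "\<lambda>a b c d e. of_bool (C5p E a b c d e)"] show ?thesis by simp
    next
      case False
      then have "\<not> C5p E (s i) (s j) (s k) (s l) (s n)" for s :: "nat \<Rightarrow> 'a" using C5p_distinct by fastforce
      with k0 show ?thesis by (simp add: av_const)
    qed
    then have "av m V N5 \<le> (\<Sum>i\<in>?M. \<Sum>j\<in>?M. \<Sum>k\<in>?M. \<Sum>l\<in>?M. \<Sum>n\<in>?M. ?k5)"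
      unfolding N5_def av_sum by (intro sum_mono) auto
    then show ?thesis by (simp add: eval_nat_numeral mult_ac)
  qed
  finally have "real m ^ 3 * ?e - 3 * real m ^ 2 \<le> lam * real m ^ 3 + real m ^ 3 * (real m ^ 4 * ?k4 + real m ^ 5 * ?k5)"
    by (simp add: mult_left_mono)
  moreover have "3 * real m ^ 2 = real m ^ 3 * (3 / real m)" using m by (simp add: power2_eq_square power3_eq_cube)
  ultimately have "real m ^ 3 * ?e \<le> real m ^ 3 * (lam + 3 / real m + real m ^ 4 * ?k4 + real m ^ 5 * ?k5)"
    by (simp add: algebra_simps)
  then show ?thesis using m by simp
qed

section \<open>Blow-ups of patterns that occur with positive density\<close>

definition ds :: "nat \<Rightarrow> real \<Rightarrow> real" where
  "ds t d = (d / 2) ^ (t + 1) / 2"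

lemma ds_pos: "0 < d \<Longrightarrow> 0 < ds t d"
  unfolding ds_def by simp

lemma card_filter: "finite A \<Longrightarrow> real (card {x \<in> A. P x}) = (\<Sum>x\<in>A. of_bool (P x))"
  using sum.inter_filter[of A "\<lambda>_. 1 :: real" P] by (simp add: of_bool_def)

lemma sum_Times: "sum h (A \<times> B) = (\<Sum>a\<in>A. \<Sum>b\<in>B. h (a, b))"
  by (simp add: sum.cartesian_product split_def)

text \<open>Choosing \<open>T\<close> at random, a point \<open>y\<close> of large degree survives with probability bounded
  below, while \<open>T\<close> fails to be injective with probability at most \<open>t\<^sup>2 / card V\<close>.\<close>

lemma dup:
  fixes V :: "'a set" and A :: "'b set"
  assumes d: "0 < d" and V: "finite V" and A: "finite A" "A \<noteq> {}" and S: "S \<subseteq> A \<times> V"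
    and large: "real t ^ 2 / ds t d < real (card V)" "0 < card V"
    and dense: "d * real (card V) * real (card A) \<le> real (card S)"
  shows "\<exists>T. inj_on T {..<t} \<and> T ` {..<t} \<subseteq> V \<and>
    ds t d * real (card A) \<le> real (card {y \<in> A. \<forall>p<t. (y, T p) \<in> S})"
proof (rule ccontr)
  assume neg: "\<not> ?thesis"
  interpret sample V using V large by unfold_locales auto
  let ?U = "{..<t} \<rightarrow>\<^sub>E V"
  define n where "n = real (card V)"
  define N where "N = real (card A)"
  have n: "0 < n" and N: "0 < N" unfolding n_def N_def using large A by (auto simp: card_gt_0_iff)
  define g where "g T = real (card {y \<in> A. \<forall>p<t. (y, T p) \<in> S})" for T
  define deg where "deg y = real (card {x \<in> V. (y, x) \<in> S})" for y
  have deg_le: "deg y \<le> n" for y unfolding deg_def n_def using V by (simp add: card_mono)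
  have deg0: "0 \<le> deg y" for y unfolding deg_def by simp
  have cS: "real (card S) = (\<Sum>y\<in>A. deg y)"
  proof -
    have "S = Sigma A (\<lambda>y. {x \<in> V. (y, x) \<in> S})" using S by auto
    then have "card S = card (Sigma A (\<lambda>y. {x \<in> V. (y, x) \<in> S}))" by (rule arg_cong)
    also have "\<dots> = (\<Sum>y\<in>A. card {x \<in> V. (y, x) \<in> S})"
      using A V by (intro card_SigmaI) auto
    finally have "card S = (\<Sum>y\<in>A. card {x \<in> V. (y, x) \<in> S})" .
    then show ?thesis unfolding deg_def by simp
  qed
  have sum_g: "(\<Sum>T\<in>?U. g T) = (\<Sum>y\<in>A. deg y ^ t)"
  proof -
    have "(\<Sum>T\<in>?U. g T) = (\<Sum>T\<in>?U. \<Sum>y\<in>A. of_bool (\<forall>p<t. (y, T p) \<in> S))"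
      unfolding g_def card_filter[OF A(1)] ..
    also have "\<dots> = (\<Sum>y\<in>A. \<Sum>T\<in>?U. of_bool (\<forall>p<t. (y, T p) \<in> S))" by (rule sum.swap)
    also have "\<dots> = (\<Sum>y\<in>A. deg y ^ t)"
    proof (rule sum.cong[OF refl])
      fix y
      have "{T \<in> ?U. \<forall>p<t. (y, T p) \<in> S} = {..<t} \<rightarrow>\<^sub>E {x \<in> V. (y, x) \<in> S}"
        by (rule set_eqI) (simp add: PiE_iff, blast)
      then have "card {T \<in> ?U. \<forall>p<t. (y, T p) \<in> S} = card {x \<in> V. (y, x) \<in> S} ^ t"
        by (simp add: card_PiE)
      then show "(\<Sum>T\<in>?U. of_bool (\<forall>p<t. (y, T p) \<in> S)) = deg y ^ t"
        unfolding card_filter[OF finU, symmetric] deg_def by simp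
    qed
    finally show ?thesis .
  qed
  \<comment> \<open>At least a fraction d/2 of A has degree at least (d/2) n, and each such point
    survives t random choices with probability at least (d/2)^t. The expected surviving fraction is
    thus at least (d/2)^(t+1), which is 2 \<open>ds t d\<close>.\<close>
  define B where "B = (\<Sum>y\<in>A. of_bool (d / 2 * n \<le> deg y) :: real)"
  have "deg y \<le> n * of_bool (d / 2 * n \<le> deg y) + d / 2 * n" for y
    using deg_le[of y] mult_pos_pos[OF d n] by (cases "d / 2 * n \<le> deg y") auto
  then have "(\<Sum>y\<in>A. deg y) \<le> (\<Sum>y\<in>A. n * of_bool (d / 2 * n \<le> deg y) + d / 2 * n)"
    by (rule sum_mono)
  also have "\<dots> = n * B + d / 2 * n * N"
    unfolding B_def N_def by (simp add: sum.distrib sum_distrib_left)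
  finally have "d * n * N \<le> n * B + d / 2 * n * N"
    using dense cS unfolding n_def N_def by linarith
  then have "n * (d / 2 * N) \<le> n * B" by (simp add: field_simps)
  then have B: "d / 2 * N \<le> B" using n by simp
  have "B * (d / 2 * n) ^ t \<le> (\<Sum>y\<in>A. deg y ^ t)"
    unfolding B_def sum_distrib_right
  proof (rule sum_mono)
    fix y
    show "of_bool (d / 2 * n \<le> deg y) * (d / 2 * n) ^ t \<le> deg y ^ t"
      using d n deg0[of y] by (cases "d / 2 * n \<le> deg y") (auto intro!: power_mono)
  qed
  moreover have "(d / 2 * N) * (d / 2 * n) ^ t \<le> B * (d / 2 * n) ^ t"
    using B d n by (intro mult_right_mono) auto
  moreover have "(d / 2 * N) * (d / 2 * n) ^ t = 2 * ds t d * N * n ^ t"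
    unfolding ds_def by (simp add: power_mult_distrib power_divide)
  ultimately have "2 * ds t d * N * n ^ t \<le> (\<Sum>T\<in>?U. g T)" unfolding sum_g by linarith
  then have lower: "2 * ds t d * N \<le> av t V g"
    unfolding av_def n_def[symmetric] using n by (simp add: field_simps)
  \<comment> \<open>Under the negated claim an injective T leaves fewer than \<open>ds t d\<close> N
    survivors; any other T is charged N for each colliding pair of indices.\<close>
  have pw: "g T \<le> ds t d * N + N * (\<Sum>p<t. \<Sum>q<t. of_bool (p \<noteq> q \<and> T p = T q))" if T: "T \<in> ?U" for T
  proof (cases "inj_on T {..<t}")
    case True
    have "T ` {..<t} \<subseteq> V" using T by auto
    with neg True have "g T < ds t d * N" unfolding g_def N_def by (meson not_le)
    moreover have "0 \<le> N * (\<Sum>p<t. \<Sum>q<t. of_bool (p \<noteq> q \<and> T p = T q) :: real)"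
      using N by (intro mult_nonneg_nonneg sum_nonneg) auto
    ultimately show ?thesis by linarith
  next
    case False
    then obtain p q where pq: "p < t" "q < t" "p \<noteq> q" "T p = T q" unfolding inj_on_def by auto
    have "of_bool (p \<noteq> q \<and> T p = T q) \<le> (\<Sum>q<t. of_bool (p \<noteq> q \<and> T p = T q) :: real)"
      using pq by (intro member_le_sum[of q "{..<t}" "\<lambda>q. of_bool (p \<noteq> q \<and> T p = T q)"]) auto
    also have "\<dots> \<le> (\<Sum>p<t. \<Sum>q<t. of_bool (p \<noteq> q \<and> T p = T q))"
      using pq by (intro member_le_sum[of p "{..<t}" "\<lambda>p. \<Sum>q<t. of_bool (p \<noteq> q \<and> T p = T q)"]) (auto intro: sum_nonneg)
    finally have "1 \<le> (\<Sum>p<t. \<Sum>q<t. of_bool (p \<noteq> q \<and> T p = T q) :: real)" using pq by simp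
    then have "N * 1 \<le> N * (\<Sum>p<t. \<Sum>q<t. of_bool (p \<noteq> q \<and> T p = T q))"
      using N by (intro mult_left_mono) auto
    moreover have "g T \<le> N" unfolding g_def N_def using A by (simp add: card_mono)
    moreover have "0 \<le> ds t d * N" using N ds_pos[OF d, of t] by simp
    ultimately show ?thesis by linarith
  qed
  have coll: "av t V (\<lambda>T. of_bool (p \<noteq> q \<and> T p = T q)) \<le> 1 / n" if "p < t" "q < t" for p q
  proof (cases "p = q")
    case True
    then show ?thesis using n by (simp add: av_const)
  next
    case False
    have one: "(\<Sum>y\<in>V. of_bool (x = y)) = (1 :: real)" if "x \<in> V" for x
    proof -
      have "(\<Sum>y\<in>V. of_bool (x = y)) = (\<Sum>y\<in>V. of_bool (y = x) * (1 :: real))"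
        by (intro sum.cong refl) auto
      then show ?thesis unfolding sum_delta_mult[OF V that] .
    qed
    have "iv V (\<lambda>x. iv V (\<lambda>y. of_bool (x = y))) = (\<Sum>x\<in>V. 1 / n) / n"
      unfolding iv_def n_def[symmetric]
      by (intro arg_cong2[where f = "(/)"] sum.cong refl) (simp add: one)
    also have "\<dots> = 1 / n" using n by (simp add: n_def[symmetric])
    finally have "iv V (\<lambda>x. iv V (\<lambda>y. of_bool (x = y))) = 1 / n" .
    with False that av2[of p t q "\<lambda>x y. of_bool (x = y)"] show ?thesis by simp
  qed
  have "av t V g \<le> av t V (\<lambda>T. ds t d * N + N * (\<Sum>p<t. \<Sum>q<t. of_bool (p \<noteq> q \<and> T p = T q)))"
    by (rule av_mono) (rule pw)
  also have "\<dots> = ds t d * N + N * (\<Sum>p<t. \<Sum>q<t. av t V (\<lambda>T. of_bool (p \<noteq> q \<and> T p = T q)))"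
    by (simp only: av_add av_cmult av_const av_sum)
  also have "(\<Sum>p<t. \<Sum>q<t. av t V (\<lambda>T. of_bool (p \<noteq> q \<and> T p = T q))) \<le> (\<Sum>p<t. \<Sum>q<t. 1 / n)"
    using coll by (intro sum_mono) auto
  also have "(\<Sum>p<t. \<Sum>q<t. 1 / n) = real t ^ 2 / n" by (simp add: power2_eq_square)
  finally have "av t V g \<le> N * (ds t d + real t ^ 2 / n)"
    using N by (simp add: algebra_simps)
  with lower have "N * (2 * ds t d) \<le> N * (ds t d + real t ^ 2 / n)" by (simp add: mult_ac)
  then have "ds t d \<le> real t ^ 2 / n" using N by simp
  moreover have "real t ^ 2 / n < ds t d"
    using large(1) n ds_pos[OF d, of t] unfolding n_def[symmetric] by (simp add: field_simps)
  ultimately show False by linarith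
qed

text \<open>\<open>dup\<close> is applied to the last coordinate five times over. Each round fixes t
  values of one coordinate that work with all surviving prefixes and replaces the density d by
  \<open>ds t d\<close>; the iterates in \<open>large\<close> are the size conditions of the five
  rounds.\<close>

lemma blowup5:
  fixes V :: "'a set"
  assumes d: "0 < d" and V: "finite V" "V \<noteq> {}"
    and large: "\<And>i. i < 5 \<Longrightarrow> real t ^ 2 / ((ds t) ^^ Suc i) d < real (card V)"
    and dense: "d \<le> iv V (\<lambda>a. iv V (\<lambda>b. iv V (\<lambda>c. iv V (\<lambda>d. iv V (\<lambda>e. of_bool (f a b c d e))))))"
  shows "\<exists>T :: nat \<Rightarrow> nat \<Rightarrow> 'a. (\<forall>i<5. inj_on (T i) {..<t} \<and> T i ` {..<t} \<subseteq> V) \<and>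
    (\<forall>p q r s u. p < t \<and> q < t \<and> r < t \<and> s < t \<and> u < t \<longrightarrow> f (T 0 p) (T 1 q) (T 2 r) (T 3 s) (T 4 u))"
proof -
  define n where "n = real (card V)"
  have n: "0 < n" "0 < card V" unfolding n_def using V by (auto simp: card_gt_0_iff)
  define d1 d2 d3 d4 where "d1 = ds t d" "d2 = ds t d1" "d3 = ds t d2" "d4 = ds t d3"
  note dd = this
  have dp: "0 < d1" "0 < d2" "0 < d3" "0 < d4" unfolding dd using d by (auto intro!: ds_pos)
  have lg: "real t ^ 2 / ds t d < real (card V)" "real t ^ 2 / ds t d1 < real (card V)"
    "real t ^ 2 / ds t d2 < real (card V)" "real t ^ 2 / ds t d3 < real (card V)" "real t ^ 2 / ds t d4 < real (card V)"
    using large[of 0] large[of 1] large[of 2] large[of 3] large[of 4]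
    unfolding dd by (simp_all add: eval_nat_numeral)
  let ?A4 = "((V \<times> V) \<times> V) \<times> V"
  let ?A3 = "(V \<times> V) \<times> V"
  define S5 where "S5 = {y \<in> ?A4 \<times> V. case y of ((((a, b), c), d), e) \<Rightarrow> f a b c d e}"
  have finS5: "finite (?A4)" and neS5: "?A4 \<noteq> {}" using V by simp_all
  have subS5: "S5 \<subseteq> ?A4 \<times> V" unfolding S5_def by blast
  have "real (card S5) = (\<Sum>a\<in>V. \<Sum>b\<in>V. \<Sum>c\<in>V. \<Sum>d\<in>V. \<Sum>e\<in>V. of_bool (f a b c d e))"
  proof -
    have "finite (?A4 \<times> V)" using V by simp
    from card_filter[OF this] show ?thesis unfolding S5_def sum_Times by simp
  qed
  also have "\<dots> = n ^ 5 * iv V (\<lambda>a. iv V (\<lambda>b. iv V (\<lambda>c. iv V (\<lambda>d. iv V (\<lambda>e. of_bool (f a b c d e))))))"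
    unfolding iv_def n_def[symmetric] sum_divide_distrib[symmetric] using n by (simp add: eval_nat_numeral)
  finally have "n ^ 5 * d \<le> real (card S5)" using dense n by simp
  then have "d * real (card V) * real (card ?A4) \<le> real (card S5)"
    unfolding n_def by (simp add: card_cartesian_product eval_nat_numeral mult_ac)
  from dup[OF d V(1) finS5 neS5 subS5 lg(1) n(2) this] obtain T4 where T4: "inj_on T4 {..<t}" "T4 ` {..<t} \<subseteq> V"
    "d1 * real (card ?A4) \<le> real (card {y \<in> ?A4. \<forall>p<t. (y, T4 p) \<in> S5})"
    unfolding dd(1)[symmetric] by blast
  define S4 where "S4 = {y \<in> ?A4. \<forall>p<t. (y, T4 p) \<in> S5}"
  have finS4: "finite (?A3)" and neS4: "?A3 \<noteq> {}" using V by simp_all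
  have subS4: "S4 \<subseteq> ?A3 \<times> V" unfolding S4_def by blast
  have "d1 * real (card V) * real (card ?A3) \<le> real (card S4)"
    using T4(3) unfolding S4_def by (simp add: card_cartesian_product mult_ac)
  from dup[OF dp(1) V(1) finS4 neS4 subS4 lg(2) n(2) this] obtain T3 where T3: "inj_on T3 {..<t}" "T3 ` {..<t} \<subseteq> V"
    "d2 * real (card ?A3) \<le> real (card {y \<in> ?A3. \<forall>p<t. (y, T3 p) \<in> S4})"
    unfolding dd(2)[symmetric] by blast
  define S3 where "S3 = {y \<in> ?A3. \<forall>p<t. (y, T3 p) \<in> S4}"
  have finS3: "finite ((V \<times> V))" and neS3: "(V \<times> V) \<noteq> {}" using V by simp_all
  have subS3: "S3 \<subseteq> (V \<times> V) \<times> V" unfolding S3_def by blast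
  have "d2 * real (card V) * real (card (V \<times> V)) \<le> real (card S3)"
    using T3(3) unfolding S3_def by (simp add: card_cartesian_product mult_ac)
  from dup[OF dp(2) V(1) finS3 neS3 subS3 lg(3) n(2) this] obtain T2 where T2: "inj_on T2 {..<t}" "T2 ` {..<t} \<subseteq> V"
    "d3 * real (card (V \<times> V)) \<le> real (card {y \<in> V \<times> V. \<forall>p<t. (y, T2 p) \<in> S3})"
    unfolding dd(3)[symmetric] by blast
  define S2 where "S2 = {y \<in> V \<times> V. \<forall>p<t. (y, T2 p) \<in> S3}"
  have finS2: "finite (V)" and neS2: "V \<noteq> {}" using V by simp_all
  have subS2: "S2 \<subseteq> V \<times> V" unfolding S2_def by blast
  have "d3 * real (card V) * real (card V) \<le> real (card S2)"
    using T2(3) unfolding S2_def by (simp add: card_cartesian_product mult_ac)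
  from dup[OF dp(3) V(1) finS2 neS2 subS2 lg(4) n(2) this] obtain T1 where T1: "inj_on T1 {..<t}" "T1 ` {..<t} \<subseteq> V"
    "d4 * real (card V) \<le> real (card {y \<in> V. \<forall>p<t. (y, T1 p) \<in> S2})"
    unfolding dd(4)[symmetric] by blast
  \<comment> \<open>For the first coordinate no prefix is left; a one-point set takes its place so
    that \<open>dup\<close> applies once more.\<close>
  define S1 where "S1 = {()} \<times> {y \<in> V. \<forall>p<t. (y, T1 p) \<in> S2}"
  have "d4 * real (card V) * real (card {()}) \<le> real (card S1)"
    using T1(3) unfolding S1_def by (simp add: card_cartesian_product)
  moreover have "S1 \<subseteq> {()} \<times> V" unfolding S1_def by auto
  ultimately obtain T0 where T0: "inj_on T0 {..<t}" "T0 ` {..<t} \<subseteq> V"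
    "ds t d4 * real (card {()}) \<le> real (card {y \<in> {()}. \<forall>p<t. (y, T0 p) \<in> S1})"
    using dup[OF dp(4) V(1), of "{()}" S1 t, OF _ _ _ lg(5) n(2)] by blast
  have "0 < real (card {y \<in> {()}. \<forall>p<t. (y, T0 p) \<in> S1})"
    using T0(3) ds_pos[OF dp(4), of t] by simp
  then have "{y \<in> {()}. \<forall>p<t. (y, T0 p) \<in> S1} \<noteq> {}" by (metis card.empty of_nat_0 less_irrefl)
  then obtain y where "\<forall>p<t. (y, T0 p) \<in> S1" by blast
  then have t0: "((), T0 p) \<in> S1" if "p < t" for p
    using that by (cases y) simp
  have f: "f (T0 p) (T1 q) (T2 r) (T3 s) (T4 u)" if "p < t" "q < t" "r < t" "s < t" "u < t" for p q r s u
  proof -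
    have "(T0 p, T1 q) \<in> S2" using t0[OF that(1)] that(2) unfolding S1_def by blast
    then have "((T0 p, T1 q), T2 r) \<in> S3" using that(3) unfolding S2_def by blast
    then have "(((T0 p, T1 q), T2 r), T3 s) \<in> S4" using that(4) unfolding S3_def by blast
    then have "((((T0 p, T1 q), T2 r), T3 s), T4 u) \<in> S5" using that(5) unfolding S4_def by blast
    then show ?thesis unfolding S5_def by simp
  qed
  define T where "T i = (if i = 0 then T0 else if i = 1 then T1 else if i = 2 then T2 else if i = 3 then T3 else T4)" for i :: nat
  have "inj_on (T i) {..<t} \<and> T i ` {..<t} \<subseteq> V" for i
    using T0(1,2) T1(1,2) T2(1,2) T3(1,2) T4(1,2) unfolding T_def by presburger
  moreover have "T 0 = T0" "T 1 = T1" "T 2 = T2" "T 3 = T3" "T 4 = T4" unfolding T_def by simp_all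
  ultimately show ?thesis using f by (intro exI[of _ T]) simp
qed

section \<open>Closed tight walks\<close>

fun tw :: "(nat \<Rightarrow> nat \<Rightarrow> nat \<Rightarrow> bool) \<Rightarrow> nat list \<Rightarrow> bool" where
  "tw H (x # y # z # r) = (H x y z \<and> tw H (y # z # r))"
| "tw H _ = True"

lemma tw_nth: "tw H xs \<Longrightarrow> i + 2 < length xs \<Longrightarrow> H (xs ! i) (xs ! (i + 1)) (xs ! (i + 2))"
proof (induction H xs arbitrary: i rule: tw.induct)
  case (1 H x y z r)
  then show ?case by (cases i) auto
qed auto

lemma Suc_mod: "1 < l \<Longrightarrow> (l + 1) mod l = (1 :: nat)"
  by (metis mod_add_self1 mod_less)

text \<open>A homomorphism to H from the tight cycle on 0,...,l-1.\<close>

definition walk :: "(nat \<Rightarrow> nat \<Rightarrow> nat \<Rightarrow> bool) \<Rightarrow> nat \<Rightarrow> (nat \<Rightarrow> nat) \<Rightarrow> bool" where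
  "walk H l \<phi> \<longleftrightarrow> (\<forall>i<l. H (\<phi> i) (\<phi> ((i + 1) mod l)) (\<phi> ((i + 2) mod l)))"

text \<open>A closed tight walk is prolonged by three steps by running once more around its first edge.\<close>

lemma tw_extend:
  assumes rot: "\<And>a b c. H a b c \<Longrightarrow> H b c a" and base: "tw H (a # b # c # r @ [a, b])"
  shows "\<exists>r'. length r' = length r + 3 * k \<and> tw H (a # b # c # r' @ [a, b])"
proof (induction k)
  case 0
  then show ?case using base by auto
next
  case (Suc k)
  then obtain r' where r': "length r' = length r + 3 * k" "tw H (a # b # c # r' @ [a, b])" by blast
  have h: "H a b c" using r'(2) by simp
  then have "H b c a" "H c a b" using rot by blast+
  with h r' have "tw H (a # b # c # (a # b # c # r') @ [a, b])" by simp
  moreover have "length (a # b # c # r') = length r + 3 * Suc k" using r'(1) by simp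
  ultimately show ?case by blast
qed

text \<open>The list a, b, c, r is read cyclically; repeating a, b at its end records the two
  triples that wrap around. Each unit of k inserts one more turn through a, b, c.\<close>

lemma walk_exists:
  assumes rot: "\<And>a b c. H a b c \<Longrightarrow> H b c a" and base: "tw H (a # b # c # r @ [a, b])"
    and l: "l = length r + 3 + 3 * k"
  shows "\<exists>\<phi>. walk H l \<phi>"
proof -
  obtain r' where r': "length r' = length r + 3 * k" "tw H (a # b # c # r' @ [a, b])"
    using tw_extend[of H a b c r k] rot base by blast
  define xs where "xs = a # b # c # r'"
  have len: "length xs = l" using r'(1) l unfolding xs_def by simp
  have nth: "(xs @ [a, b]) ! j = xs ! (j mod l)" if j: "j < l + 2" for j
  proof -
    have "j < l \<or> j = l \<or> j = l + 1" using j by linarith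
    then consider "j < l" | "j = l" | "j = l + 1" by blast
    then show ?thesis
    proof cases
      case 1
      then show ?thesis using len by (simp add: nth_append)
    next
      case 2
      then show ?thesis using len by (simp add: nth_append) (simp add: xs_def)
    next
      case 3
      have "(l + 1) mod l = 1" using l by (intro Suc_mod) simp
      then show ?thesis using 3 len by (simp add: nth_append) (simp add: xs_def)
    qed
  qed
  have "tw H (xs @ [a, b])" using r'(2) unfolding xs_def by simp
  then have "H (xs ! (i mod l)) (xs ! ((i + 1) mod l)) (xs ! ((i + 2) mod l))" if "i < l" for i
    using tw_nth[of H "xs @ [a, b]" i] that len nth[of i] nth[of "i + 1"] nth[of "i + 2"] by simp
  then show ?thesis unfolding walk_def by (intro exI[of _ "\<lambda>i. xs ! i"]) auto
qed

definition H4 :: "nat \<Rightarrow> nat \<Rightarrow> nat \<Rightarrow> bool" where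
  "H4 i j k \<longleftrightarrow> i < 4 \<and> j < 4 \<and> k < 4 \<and> i \<noteq> j \<and> j \<noteq> k \<and> i \<noteq> k"

text \<open>The triples of \<open>{0,\<dots>,4}\<close> that are edges of the tight 5-cycle with the chord \<open>013\<close>,
  each coded by the bit mask of the triple.\<close>

definition H5 :: "nat \<Rightarrow> nat \<Rightarrow> nat \<Rightarrow> bool" where
  "H5 i j k \<longleftrightarrow> i < 5 \<and> j < 5 \<and> k < 5 \<and> 2 ^ i + 2 ^ j + 2 ^ k \<in> {7, 14, 28, 25, 19, 11 :: nat}"

text \<open>Running through 0, 1, 2, 3 once or twice gives closed walks of lengths 4 and 8. Residue
  2 cannot start at length 5: any two points of a tight 5-cycle share an edge, so five distinct
  images would be required.\<close>

lemma walk_H4: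
  assumes "7 \<le> l" "l mod 3 \<noteq> 0"
  shows "\<exists>\<phi>. walk H4 l \<phi>"
proof (cases "l mod 3 = 1")
  case True
  then have "l = length [3::nat] + 3 + 3 * ((l - 4) div 3)" using assms by simp presburger
  then show ?thesis by (rule walk_exists[where H = H4 and a = 0 and b = 1 and c = 2, rotated 2]) (auto simp: H4_def)
next
  case False
  then have "l = length [3::nat, 0, 1, 2, 3] + 3 + 3 * ((l - 8) div 3)" using assms by simp presburger
  then show ?thesis by (rule walk_exists[where H = H4 and a = 0 and b = 1 and c = 2, rotated 2]) (auto simp: H4_def)
qed

text \<open>The cycle itself has length 5. For residue 1 the walk 0, 1, 4, 0, 3, 1, 2 of length 7
  uses the chord 013; a closed walk of length 4 would require a K4.\<close>

lemma walk_H5: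
  assumes "7 \<le> l" "l mod 3 \<noteq> 0"
  shows "\<exists>\<phi>. walk H5 l \<phi>"
proof (cases "l mod 3 = 1")
  case True
  then have "l = length [0::nat, 3, 1, 2] + 3 + 3 * ((l - 7) div 3)" using assms by simp presburger
  then show ?thesis
    by (rule walk_exists[where H = H5 and a = 0 and b = 1 and c = 4, rotated 2]) (auto simp: H5_def add_ac)
next
  case False
  then have "l = length [3::nat, 4] + 3 + 3 * ((l - 5) div 3)" using assms by simp presburger
  then show ?thesis
    by (rule walk_exists[where H = H5 and a = 0 and b = 1 and c = 2, rotated 2]) (auto simp: H5_def add_ac)
qed

section \<open>Embedding tight cycles into 3-graphs given by edge sets\<close>

definition Er :: "'a set set \<Rightarrow> 'a \<Rightarrow> 'a \<Rightarrow> 'a \<Rightarrow> bool" where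
  "Er Es a b c \<longleftrightarrow> a \<noteq> b \<and> a \<noteq> c \<and> b \<noteq> c \<and> {a, b, c} \<in> Es"

text \<open>The distinctness clauses in \<open>Er\<close> give irreflexivity for an arbitrary set of
  sets.\<close>

lemma threegraph_Er: "threegraph (Er Es)"
  by unfold_locales (auto simp: Er_def insert_commute)

text \<open>The cycle has vertices 1,...,l while g is indexed from 0, hence the shift by one. The
  two edges that wrap around come from the indices l - 2 and l - 1.\<close>

lemma embed:
  assumes l: "3 \<le> l" and inj: "inj_on g {..<l}" and V: "g ` {..<l} \<subseteq> V"
    and E: "\<And>i. i < l \<Longrightarrow> Er Es (g i) (g ((i + 1) mod l)) (g ((i + 2) mod l))"
  shows "contains_subgraph (V, Es) (tight_cycle l)"
proof -
  define f where "f v = g (v - 1)" for v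
  have lt: "v - 1 < l" "1 \<le> v" if "v \<in> {1..l}" for v using that by auto
  have "inj_on f {1..l}"
  proof (rule inj_onI)
    fix x y assume xy: "x \<in> {1..l}" "y \<in> {1..l}" "f x = f y"
    then have "x - 1 = y - 1" using inj_onD[OF inj, of "x - 1" "y - 1"] lt[OF xy(1)] lt[OF xy(2)] unfolding f_def by simp
    then show "x = y" using lt[OF xy(1)] lt[OF xy(2)] by linarith
  qed
  moreover have "f ` {1..l} \<subseteq> V"
  proof (rule image_subsetI)
    fix v assume "v \<in> {1..l}"
    then show "f v \<in> V" using V lt(1)[of v] unfolding f_def by blast
  qed
  moreover have "f ` e \<in> Es" if "e \<in> edges (tight_cycle l)" for e
  proof -
    from that consider i where "1 \<le> i" "i + 2 \<le> l" "e = {i, i + 1, i + 2}" | "e = {l - 1, l, 1}" | "e = {l, 1, 2}"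
      unfolding tight_cycle_def by auto
    then show ?thesis
    proof cases
      case 1
      have "(i - 1 + 1) mod l = i" "(i - 1 + 2) mod l = i + 1" using 1 by simp_all
      then show ?thesis using E[of "i - 1"] 1 unfolding Er_def f_def by simp
    next
      case 2
      have e: "l - 2 + 1 = l - 1" "l - 2 + 2 = l" using l by simp_all
      have "(l - 2 + 1) mod l = l - 1" "(l - 2 + 2) mod l = 0" "l - 1 - 1 = l - 2" unfolding e using l by simp_all
      then show ?thesis using E[of "l - 2"] 2 l unfolding Er_def f_def by simp
    next
      case 3
      have e: "l - 1 + 1 = l" "l - 1 + 2 = l + 1" using l by simp_all
      have "(l - 1 + 1) mod l = 0" unfolding e by simp
      moreover have "(l - 1 + 2) mod l = 1" unfolding e using l by (intro Suc_mod) simp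
      ultimately show ?thesis using E[of "l - 1"] 3 l unfolding Er_def f_def by simp
    qed
  qed
  ultimately show ?thesis unfolding contains_subgraph_def
    by (intro exI[of _ f]) (auto simp: tight_cycle_def)
qed

text \<open>Position i of the cycle goes to copy number i in the class of its image under the walk.
  Within a class injectivity comes from T; across classes \<open>cover\<close> puts the two vertices
  into a common edge, so they differ.\<close>

lemma embed_blowup:
  assumes l: "3 \<le> l" and walk: "walk H l \<phi>"
    and T: "\<And>i. i < c \<Longrightarrow> inj_on (T i) {..<l} \<and> T i ` {..<l} \<subseteq> V"
    and H: "\<And>i j k. H i j k \<Longrightarrow> i < c" and cover: "\<And>i j. i < c \<Longrightarrow> j < c \<Longrightarrow> i \<noteq> j \<Longrightarrow> \<exists>k. H i j k"
    and E: "\<And>i j k p q r. H i j k \<Longrightarrow> p < l \<Longrightarrow> q < l \<Longrightarrow> r < l \<Longrightarrow> Er Es (T i p) (T j q) (T k r)"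
  shows "contains_subgraph (V, Es) (tight_cycle l)"
proof (rule embed[where g = "\<lambda>i. T (\<phi> i) i"])
  have c: "\<phi> i < c" if "i < l" for i using walk that H unfolding walk_def by blast
  show "inj_on (\<lambda>i. T (\<phi> i) i) {..<l}"
  proof (rule inj_onI)
    fix i j assume ij: "i \<in> {..<l}" "j \<in> {..<l}" "T (\<phi> i) i = T (\<phi> j) j"
    show "i = j"
    proof (cases "\<phi> i = \<phi> j")
      case True
      with ij T[OF c[of i]] show ?thesis by (auto simp: inj_on_def)
    next
      case False
      with c[of i] c[of j] ij obtain k where "H (\<phi> i) (\<phi> j) k" using cover by blast
      with E[of "\<phi> i" "\<phi> j" k i j i] ij show ?thesis unfolding Er_def by auto
    qed
  qed
  show "(\<lambda>i. T (\<phi> i) i) ` {..<l} \<subseteq> V" using T c by fastforce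
  show "Er Es (T (\<phi> i) i) (T (\<phi> ((i + 1) mod l)) ((i + 1) mod l)) (T (\<phi> ((i + 2) mod l)) ((i + 2) mod l))" if "i < l" for i
    using walk that l unfolding walk_def by (intro E) auto
qed (rule l)

lemma nat_less_5: "(i :: nat) < 5 \<longleftrightarrow> i = 0 \<or> i = 1 \<or> i = 2 \<or> i = 3 \<or> i = 4"
  by auto

lemma nat_less_4: "(i :: nat) < 4 \<longleftrightarrow> i = 0 \<or> i = 1 \<or> i = 2 \<or> i = 3"
  by auto

lemma blowup_K4_contains:
  assumes l: "7 \<le> l" "l mod 3 \<noteq> 0" and T: "\<And>i. i < 5 \<Longrightarrow> inj_on (T i) {..<l} \<and> T i ` {..<l} \<subseteq> V"
    and f: "\<And>p q r s. p < l \<Longrightarrow> q < l \<Longrightarrow> r < l \<Longrightarrow> s < l \<Longrightarrow> K4 (Er Es) (T 0 p) (T 1 q) (T 2 r) (T (3::nat) s)"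
  shows "contains_subgraph (V, Es) (tight_cycle l)"
proof -
  interpret threegraph "Er Es" by (rule threegraph_Er)
  obtain \<phi> where w: "walk H4 l \<phi>" using walk_H4[OF l] by blast
  show ?thesis
  proof (rule embed_blowup[OF _ w, where c = 4 and T = T])
    show "\<exists>k. H4 i j k" if "i < 4" "j < 4" "i \<noteq> j" for i j
    proof -
      have "H4 i j 0 \<or> H4 i j 1 \<or> H4 i j 2"
        using that unfolding H4_def nat_less_4 by (elim disjE; simp)
      then show ?thesis by blast
    qed
    show "Er Es (T i p) (T j q) (T k r)" if "H4 i j k" "p < l" "q < l" "r < l" for i j k p q r
    proof -
      \<comment> \<open>A triple involves three classes; the remaining coordinate of the pattern is
        filled with an index already at hand.\<close>
      have e: "Er Es (T 0 p) (T 1 q) (T 2 r)" "Er Es (T 0 p) (T 1 q) (T 3 r)" "Er Es (T 0 p) (T 2 q) (T 3 r)"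
        "Er Es (T 1 p) (T 2 q) (T 3 r)" if "p < l" "q < l" "r < l" for p q r
        using f[of p q r r] f[of p q q r] f[of p p q r] that unfolding K4_def by blast+
      have s: "Er Es a b c" if "Er Es a b c \<or> Er Es a c b \<or> Er Es b a c \<or> Er Es b c a \<or> Er Es c a b \<or> Er Es c b a" for a b c
        using that sym12 sym23 by blast
      show ?thesis
        using that e unfolding H4_def nat_less_4 by (intro s) (elim conjE disjE; simp)
    qed
  qed (use l T in \<open>auto simp: H4_def\<close>)
qed

lemma blowup_C5p_contains:
  assumes l: "7 \<le> l" "l mod 3 \<noteq> 0" and T: "\<And>i. i < 5 \<Longrightarrow> inj_on (T i) {..<l} \<and> T i ` {..<l} \<subseteq> V"
    and f: "\<And>p q r s u. p < l \<Longrightarrow> q < l \<Longrightarrow> r < l \<Longrightarrow> s < l \<Longrightarrow> u < l \<Longrightarrow>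
      C5p (Er Es) (T 0 p) (T 1 q) (T 2 r) (T 3 s) (T (4::nat) u)"
  shows "contains_subgraph (V, Es) (tight_cycle l)"
proof -
  interpret threegraph "Er Es" by (rule threegraph_Er)
  obtain \<phi> where w: "walk H5 l \<phi>" using walk_H5[OF l] by blast
  show ?thesis
  proof (rule embed_blowup[OF _ w, where c = 5 and T = T])
    show "\<exists>k. H5 i j k" if "i < 5" "j < 5" "i \<noteq> j" for i j
    proof -
      have "H5 i j 0 \<or> H5 i j 1 \<or> H5 i j 2 \<or> H5 i j 3 \<or> H5 i j 4"
        using that unfolding H5_def nat_less_5 by (elim disjE; simp)
      then show ?thesis by blast
    qed
    show "Er Es (T i p) (T j q) (T k r)" if "H5 i j k" "p < l" "q < l" "r < l" for i j k p q r
    proof -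
      have e: "Er Es (T 0 p) (T 1 q) (T 2 r)" "Er Es (T 1 p) (T 2 q) (T 3 r)" "Er Es (T 2 p) (T 3 q) (T 4 r)"
        "Er Es (T 3 p) (T 4 q) (T 0 r)" "Er Es (T 4 p) (T 0 q) (T 1 r)" "Er Es (T 0 p) (T 1 q) (T 3 r)"
        if "p < l" "q < l" "r < l" for p q r
        using f[of p q r r r] f[of p p q r r] f[of p p p q r] f[of r p p p q] f[of q r p p p] f[of p q r r p] that
        unfolding C5p_def by blast+
      have s: "Er Es a b c" if "Er Es a b c \<or> Er Es a c b \<or> Er Es b a c \<or> Er Es b c a \<or> Er Es c a b \<or> Er Es c b a" for a b c
        using that sym12 sym23 by blast
      show ?thesis
        using that e unfolding H5_def nat_less_5 by (intro s) (elim conjE disjE; simp)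
    qed
  qed (use l T in \<open>auto simp: H5_def\<close>)
qed

lemma ordered_edges:
  assumes "three_graph (V, Es)"
  shows "6 * real (card Es) \<le> (\<Sum>a\<in>V. \<Sum>b\<in>V. \<Sum>c\<in>V. of_bool (Er Es a b c))"
proof -
  have V: "finite V" and E: "\<And>e. e \<in> Es \<Longrightarrow> e \<subseteq> V \<and> card e = 3"
    using assms by (auto simp: three_graph_def)
  have finE: "finite Es" using V E by (auto intro: finite_subset[of _ "Pow V"])
  define P where "P = {y \<in> V \<times> V \<times> V. case y of (a, b, c) \<Rightarrow> Er Es a b c}"
  have finP: "finite P" unfolding P_def using V by simp
  define tri where "tri = (\<lambda>(a, b, c). {a, b, c} :: 'a set)"
  have "(\<Sum>e\<in>Es. 6) \<le> (\<Sum>e\<in>Es. \<Sum>y\<in>{y \<in> P. tri y = e}. 1 :: nat)"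
  proof (rule sum_mono)
    fix e assume e: "e \<in> Es"
    then obtain x y z where xyz: "e = {x, y, z}" "x \<noteq> y" "y \<noteq> z" "x \<noteq> z"
      using E[OF e] by (auto simp: card_3_iff)
    have "{(x, y, z), (x, z, y), (y, x, z), (y, z, x), (z, x, y), (z, y, x)} \<subseteq> {y \<in> P. tri y = e}"
      using xyz e E[OF e] unfolding P_def tri_def Er_def by (auto simp: insert_commute)
    then have "card {(x, y, z), (x, z, y), (y, x, z), (y, z, x), (z, x, y), (z, y, x)} \<le> card {y \<in> P. tri y = e}"
      using finP by (intro card_mono) auto
    then show "(6 :: nat) \<le> (\<Sum>y\<in>{y \<in> P. tri y = e}. 1)" using xyz by simp
  qed
  also have "\<dots> = (\<Sum>y\<in>P. 1)"
    using finP finE by (intro sum.group) (auto simp: P_def tri_def Er_def)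
  finally have "6 * real (card Es) \<le> real (card P)" by (simp flip: of_nat_mult)
  also have "real (card P) = (\<Sum>a\<in>V. \<Sum>b\<in>V. \<Sum>c\<in>V. of_bool (Er Es a b c))"
  proof -
    have "finite (V \<times> V \<times> V)" using V by simp
    from card_filter[OF this] show ?thesis unfolding P_def sum_Times by simp
  qed
  finally show ?thesis .
qed

text \<open>The tight 4-cycle consists of all four triples of its vertices, so it is K4; a tight
  5-cycle with a chord contains the plain one. Thus \<open>Er\<close> is good on V and
  \<open>count_le\<close> applies without error term.\<close>

lemma pair_bound:
  assumes G: "three_graph (V, Es)" and free: "family_free {tight_cycle 4, tight_cycle 5} (V, Es)"
  shows "6 * real (card Es) \<le> lam * real (card V) ^ 3"
proof -
  interpret threegraph "Er Es" by (rule threegraph_Er)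
  have V: "finite V" and E: "\<And>e. e \<in> Es \<Longrightarrow> e \<subseteq> V" using G by (auto simp: three_graph_def)
  have K: "\<not> K4 (Er Es) a b c d" if abcd: "a \<in> V" "b \<in> V" "c \<in> V" "d \<in> V" for a b c d
  proof
    assume k: "K4 (Er Es) a b c d"
    have "contains_subgraph (V, Es) (tight_cycle 4)"
    proof (rule embed[where g = "\<lambda>i. [a, b, c, d] ! i"])
      have "distinct [a, b, c, d]" by (rule K4_distinct[OF k])
      then show "inj_on (\<lambda>i. [a, b, c, d] ! i) {..<4}" by (intro inj_on_nth) auto
      show "(\<lambda>i. [a, b, c, d] ! i) ` {..<4} \<subseteq> V" using abcd by (auto simp: nat_less_4)
      show "Er Es ([a, b, c, d] ! i) ([a, b, c, d] ! ((i + 1) mod 4)) ([a, b, c, d] ! ((i + 2) mod 4))" if "i < 4" for i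
        using that k unfolding nat_less_4 K4_def by (elim disjE; simp; blast intro: sym12 sym23)
    qed simp
    then show False using free unfolding family_free_def by blast
  qed
  have C: "\<not> C5p (Er Es) a b c d e" if abcd: "a \<in> V" "b \<in> V" "c \<in> V" "d \<in> V" "e \<in> V" for a b c d e
  proof
    assume k: "C5p (Er Es) a b c d e"
    have "contains_subgraph (V, Es) (tight_cycle 5)"
    proof (rule embed[where g = "\<lambda>i. [a, b, c, d, e] ! i"])
      have "distinct [a, b, c, d, e]" by (rule C5p_distinct[OF k])
      then show "inj_on (\<lambda>i. [a, b, c, d, e] ! i) {..<5}" by (intro inj_on_nth) auto
      show "(\<lambda>i. [a, b, c, d, e] ! i) ` {..<5} \<subseteq> V" using abcd by (auto simp: nat_less_5)
      show "Er Es ([a, b, c, d, e] ! i) ([a, b, c, d, e] ! ((i + 1) mod 5)) ([a, b, c, d, e] ! ((i + 2) mod 5))" if "i < 5" for i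
        using that k unfolding nat_less_5 C5p_def by (elim disjE; simp)
    qed simp
    then show False using free unfolding family_free_def by blast
  qed
  from ordered_edges[OF G] count_le[OF V K C] show ?thesis by linarith
qed

lemma cycle_bound:
  assumes l: "7 \<le> l" "l mod 3 \<noteq> 0" and eps: "0 < \<epsilon>"
  shows "\<exists>n0. \<forall>V :: nat set. \<forall>Es. three_graph (V, Es) \<and> family_free {tight_cycle l} (V, Es) \<and> n0 \<le> card V
    \<longrightarrow> 6 * real (card Es) \<le> (lam + \<epsilon>) * real (card V) ^ 3"
proof -
  \<comment> \<open>m makes the collision term 3 / m at most half of the allowed error, and d makes
    each of the two pattern terms at most a quarter of it, using m^4 <= m^5.\<close>
  define m where "m = nat \<lceil>6 / \<epsilon>\<rceil> + 1"
  have m0: "0 < real m" unfolding m_def by simp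
  have "6 / \<epsilon> \<le> real m" unfolding m_def by linarith
  then have m: "m > 0" "3 / real m \<le> \<epsilon> / 2" using eps m0 by (simp_all add: field_simps)
  define d where "d = \<epsilon> / (4 * real m ^ 5)"
  have d: "0 < d" unfolding d_def using eps m by simp
  define q where "q i = real l ^ 2 / ((ds l) ^^ Suc i) d" for i
  have it: "0 < ((ds l) ^^ i) d" for i by (induction i) (auto simp: d ds_pos)
  have q0: "0 \<le> q i" for i unfolding q_def using it[of "Suc i"] by (intro divide_nonneg_pos) auto
  \<comment> \<open>Exceeding the sum of the five size thresholds of \<open>blowup5\<close> exceeds
    each of them.\<close>
  define n0 where "n0 = nat \<lceil>\<Sum>i<5. q i\<rceil> + 1"
  show ?thesis
  proof (intro exI[of _ n0] allI impI)
    fix V :: "nat set" and Es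
    assume "three_graph (V, Es) \<and> family_free {tight_cycle l} (V, Es) \<and> n0 \<le> card V"
    then have G: "three_graph (V, Es)" and free: "\<not> contains_subgraph (V, Es) (tight_cycle l)" and n0: "n0 \<le> card V"
      by (auto simp: family_free_def)
    have V: "finite V" "V \<noteq> {}" using G n0 by (auto simp: three_graph_def n0_def)
    have large: "real l ^ 2 / ((ds l) ^^ Suc i) d < real (card V)" if "i < 5" for i
    proof -
      have "q i \<le> (\<Sum>i<5. q i)" using that q0 by (intro member_le_sum) auto
      also have "\<dots> < real n0" unfolding n0_def by linarith
      also have "\<dots> \<le> real (card V)" using n0 by simp
      finally show ?thesis unfolding q_def .
    qed
    interpret sample V using V by unfold_locales
    let ?e = "iv V (\<lambda>a. iv V (\<lambda>b. iv V (\<lambda>c. of_bool (Er Es a b c))))"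
    let ?k4 = "iv V (\<lambda>a. iv V (\<lambda>b. iv V (\<lambda>c. iv V (\<lambda>d. of_bool (K4 (Er Es) a b c d)))))"
    let ?k5 = "iv V (\<lambda>a. iv V (\<lambda>b. iv V (\<lambda>c. iv V (\<lambda>d. iv V (\<lambda>e. of_bool (C5p (Er Es) a b c d e))))))"
    have "?k4 < d"
    proof (rule ccontr)
      assume "\<not> ?k4 < d"
      \<comment> \<open>An idle fifth coordinate is added to the K4 density, so that the same
        blow-up lemma serves both patterns.\<close>
      moreover have "iv V (\<lambda>e :: nat. k) = k" for k using card_pos by (simp add: iv_def)
      ultimately have "d \<le> iv V (\<lambda>a. iv V (\<lambda>b. iv V (\<lambda>c. iv V (\<lambda>d. iv V (\<lambda>e. of_bool (K4 (Er Es) a b c d))))))"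
        by simp
      from blowup5[OF d V large this] obtain T :: "nat \<Rightarrow> nat \<Rightarrow> nat"
        where T: "\<forall>i<5. inj_on (T i) {..<l} \<and> T i ` {..<l} \<subseteq> V"
          "\<forall>p q r s u. p < l \<and> q < l \<and> r < l \<and> s < l \<and> u < l \<longrightarrow> K4 (Er Es) (T 0 p) (T 1 q) (T 2 r) (T 3 s)" by blast
      have "contains_subgraph (V, Es) (tight_cycle l)"
        by (rule blowup_K4_contains[OF l, where T = T]) (use T in blast)+
      with free show False by blast
    qed
    moreover have "?k5 < d"
    proof (rule ccontr)
      assume "\<not> ?k5 < d"
      then have "d \<le> ?k5" by simp
      from blowup5[OF d V large this] obtain T :: "nat \<Rightarrow> nat \<Rightarrow> nat"
        where T: "\<forall>i<5. inj_on (T i) {..<l} \<and> T i ` {..<l} \<subseteq> V"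
          "\<forall>p q r s u. p < l \<and> q < l \<and> r < l \<and> s < l \<and> u < l \<longrightarrow> C5p (Er Es) (T 0 p) (T 1 q) (T 2 r) (T 3 s) (T 4 u)" by blast
      have "contains_subgraph (V, Es) (tight_cycle l)"
        by (rule blowup_C5p_contains[OF l, where T = T]) (use T in blast)+
      with free show False by blast
    qed
    moreover have "?e \<le> lam + 3 / real m + real m ^ 4 * ?k4 + real m ^ 5 * ?k5"
      by (rule sampling_bound[OF threegraph_Er V m(1)])
    moreover have "real m ^ 4 * ?k4 \<le> real m ^ 5 * d"
    proof -
      have "real m ^ 4 \<le> real m ^ 5" using m(1) by (intro power_increasing) auto
      moreover have "0 \<le> ?k4" by (intro iv_nonneg) simp
      ultimately show ?thesis using \<open>?k4 < d\<close> by (intro mult_mono) auto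
    qed
    moreover have "real m ^ 5 * ?k5 \<le> real m ^ 5 * d" using \<open>?k5 < d\<close> by (intro mult_left_mono) auto
    moreover have "real m ^ 5 * d = \<epsilon> / 4" unfolding d_def using m by simp
    ultimately have "?e \<le> lam + \<epsilon>" using m(2) by linarith
    moreover have "(\<Sum>a\<in>V. \<Sum>b\<in>V. \<Sum>c\<in>V. of_bool (Er Es a b c)) = ?e * real (card V) ^ 3"
      unfolding iv_def sum_divide_distrib[symmetric] using card_pos by (simp add: power3_eq_cube)
    ultimately show "6 * real (card Es) \<le> (lam + \<epsilon>) * real (card V) ^ 3"
      using ordered_edges[OF G] mult_right_mono[of ?e "lam + \<epsilon>" "real (card V) ^ 3"] by simp
  qed
qed

section \<open>The passage to the Turan density\<close>

lemma turan_density_le: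
  fixes \<F> :: "nat hypergraph set"
  assumes F: "\<And>H. H \<in> \<F> \<Longrightarrow> edges H \<noteq> {}"
    and bound: "\<And>\<epsilon>. 0 < \<epsilon> \<Longrightarrow> \<exists>n0. \<forall>V :: nat set. \<forall>Es. three_graph (V, Es) \<and> family_free \<F> (V, Es) \<and> n0 \<le> card V
      \<longrightarrow> 6 * real (card Es) \<le> (lam + \<epsilon>) * real (card V) ^ 3"
  shows "turan_density \<F> \<le> lam"
proof (rule field_le_epsilon)
  fix \<epsilon> :: real assume eps: "0 < \<epsilon>"
  from bound[OF eps] obtain n0 where n0: "\<And>V Es. three_graph (V :: nat set, Es) \<Longrightarrow> family_free \<F> (V, Es) \<Longrightarrow> n0 \<le> card V
      \<Longrightarrow> 6 * real (card Es) \<le> (lam + \<epsilon>) * real (card V) ^ 3" by blast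
  have ex: "6 * real (ex_number n \<F>) \<le> (lam + \<epsilon>) * real n ^ 3" if "n0 \<le> n" for n
  proof -
    let ?S = "{card (edges G) | G :: nat hypergraph. three_graph G \<and> card (verts G) = n \<and> family_free \<F> G}"
    have "finite ?S" "?S \<noteq> {}" using ex_number_set[of \<F> n] F by blast+
    then have "ex_number n \<F> \<in> ?S" unfolding ex_number_def by (rule Max_in)
    then obtain V Es where "three_graph (V :: nat set, Es)" "card V = n" "family_free \<F> (V, Es)" "ex_number n \<F> = card Es"
      by auto
    with n0[of V Es] that show ?thesis by simp
  qed
  \<comment> \<open>The factor is the ratio of n^3 to n (n - 1) (n - 2), which tends to 1 and
    accounts for counting ordered triples with repetition.\<close>
  define r where "r n = (lam + \<epsilon>) * (1 / ((1 - 1 / real n) * (1 - 2 / real n)))" for n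
  have "r \<longlonglongrightarrow> (lam + \<epsilon>) * (1 / ((1 - 0) * (1 - 0)))"
    unfolding r_def by (intro tendsto_intros lim_const_over_n) simp
  then have lim: "r \<longlonglongrightarrow> lam + \<epsilon>" by simp
  have "real (ex_number n \<F>) / real (n choose 3) \<le> r n" if n: "max n0 3 \<le> n" for n
  proof -
    have ch: "real (n choose 3) = real n * (real n - 1) * (real n - 2) / 6"
      by (simp add: binomial_gbinomial gbinomial_prod_rev numeral_3_eq_3 prod.atLeast0_lessThan_Suc fact_numeral)
    have pos: "0 < real n * (real n - 1) * (real n - 2)" using n by (intro mult_pos_pos) auto
    have "real (ex_number n \<F>) / real (n choose 3) = 6 * real (ex_number n \<F>) / (real n * (real n - 1) * (real n - 2))"
      unfolding ch by simp
    also have "\<dots> \<le> (lam + \<epsilon>) * real n ^ 3 / (real n * (real n - 1) * (real n - 2))"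
      using ex[of n] n pos by (intro divide_right_mono) auto
    also have "\<dots> = r n"
    proof -
      have "(1 - 1 / real n) * (1 - 2 / real n) = (real n * (real n - 1) * (real n - 2)) / real n ^ 3"
        using n by (simp add: field_simps power3_eq_cube)
      then show ?thesis unfolding r_def by simp
    qed
    finally show ?thesis .
  qed
  then show "turan_density \<F> \<le> lam + \<epsilon>"
    by (intro LIMSEQ_le[OF turan_density_limit[OF F] lim]) blast+
qed

theorem theorem1p1:
  fixes \<F> :: "nat hypergraph set"
  assumes "\<F> = {tight_cycle 4, tight_cycle 5} \<or>
    (\<exists>l::nat. l \<ge> 7 \<and> l mod 3 \<noteq> 0 \<and> \<F> = {tight_cycle l})"
  shows "turan_density \<F> \<le> 2 * sqrt 3 - 3"
proof -
  have "turan_density \<F> \<le> lam"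
  proof (rule turan_density_le)
    show "edges H \<noteq> {}" if "H \<in> \<F>" for H using that assms edges_tight_cycle_nonempty by blast
    fix \<epsilon> :: real assume eps: "0 < \<epsilon>"
    show "\<exists>n0. \<forall>V :: nat set. \<forall>Es. three_graph (V, Es) \<and> family_free \<F> (V, Es) \<and> n0 \<le> card V
      \<longrightarrow> 6 * real (card Es) \<le> (lam + \<epsilon>) * real (card V) ^ 3"
      using assms
    proof (elim disjE exE conjE)
      assume F: "\<F> = {tight_cycle 4, tight_cycle 5}"
      show ?thesis
      proof (intro exI[of _ 0] allI impI)
        fix V :: "nat set" and Es
        assume "three_graph (V, Es) \<and> family_free \<F> (V, Es) \<and> 0 \<le> card V"
        then have "6 * real (card Es) \<le> lam * real (card V) ^ 3" using pair_bound F by blast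
        also have "\<dots> \<le> (lam + \<epsilon>) * real (card V) ^ 3" using eps by (intro mult_right_mono) auto
        finally show "6 * real (card Es) \<le> (lam + \<epsilon>) * real (card V) ^ 3" .
      qed
    next
      fix l assume "7 \<le> l" "l mod 3 \<noteq> 0" "\<F> = {tight_cycle l}"
      then show ?thesis using cycle_bound[OF _ _ eps] by blast
    qed
  qed
  then show ?thesis unfolding lam_def .
qed

end
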